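(* The strict 2-category $\mathbf{NM}$ of small natural models admits the construction of coalgebras over $\mathbf{Cat}$ (with respect to the forgetful strict 2-functor $\mathbf{NM}\to\mathbf{Cat}$ taking the underlying category).
   Context: **Display categories.** A display category $\mathbf{C}$ is a category (also denoted $\mathbf{C}$) with a class $\mathcal{D}_{\mathbf{C}}$ of morphisms, called displays, such that every display $p:E\to B$ has, along every $f:A\to B$, a pullback $f^*p:f^*E\to A$ that is a display, and $\mathcal{D}_{\mathbf{C}}$ is closed under composition with isomorphisms. A choice of such pullbacks is fixed. $\mathcal{D}_{\mathbf{C}}$ also denotes the $\mathbf{C}$-indexed category (pseudofunctor $\mathbf{C}^{\mathrm{op}}\to\mathbf{Cat}$) whose value at $A$ is the full subcategory of $\mathbf{C}/A$ on displays, with reindexing by the chosen pullbacks. A display functor is a functor taking displays to displays and pullbacks of displays to pullbacks of displays. **Natural models.** A small pre-natural model $\mathbf{C}$ is a small display category $\mathbf{C}$ with small strict $\mathbf{C}$-indexed categories $\mathbf{Tp}_{\mathbf{C}},\mathbf{Tm}_{\mathbf{C}}:\mathbf{C}^{\mathrm{op}}\to\mathbf{Cat}$ (strict functors) and a strictly natural $p_{\mathbf{C}}:\mathbf{Tm}_{\mathbf{C}}\to\mathbf{Tp}_{\mathbf{C}}$, each component of which is a discrete opfibration, that is representable: for all $\Gamma\in\mathbf{C}$ and $A\in\mathbf{Tp}_{\mathbf{C}}(\Gamma)$, the presheaf $\Delta\mapsto\{(u:\Delta\to\Gamma,\ t\in\mathbf{Tm}_{\mathbf{C}}(\Delta)) :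 p_{\mathbf{C}}(t)=A[u]\}$ over $\Gamma$ is represented by a (chosen) display $p_A:\Gamma.A\to\Gamma$, with universal element $v_A\in\mathbf{Tm}_{\mathbf{C}}(\Gamma.A)$. Here $A[u]$ denotes $\mathbf{Tp}_{\mathbf{C}}(u)(A)$, and similarly for morphisms and terms. The $\mathbf{C}$-indexed functor $\mathrm{comp}_{\mathbf{C}}:\mathbf{Tp}_{\mathbf{C}}\to\mathcal{D}_{\mathbf{C}}$ sends $A$ to $p_A$ and $f:A\to B$ to the map $\Gamma.f:\Gamma.A\to\Gamma.B$ over $\Gamma$ with $v_B[\Gamma.f]$ equal to the codomain of the unique lift of $f[p_A]$ with domain $v_A$. A small natural model is a small pre-natural model for which $\mathrm{comp}_{\mathbf{C}}$ is a $\mathbf{C}$-indexed equivalence (each component is an equivalence of categories). **Morphisms.** A morphism $F:\mathbf{C}\to\mathbf{D}$ of small pre-natural models is a display functor $F$ with strictly natural $\mathbf{Tp}_F:\mathbf{Tp}_{\mathbf{C}}\to F^*\mathbf{Tp}_{\mathbf{D}}$ and $\mathbf{Tm}_F:\mathbf{Tm}_{\mathbf{C}}\to F^*\mathbf{Tm}_{\mathbf{D}}$ commuting with $p_{\mathbf{C}},F^*p_{\mathbf{D}}$; one writes $FA,Ft$ for their values. It is a morphism of small natural models (between small natural models) if, for each $A\in\mathbf{Tp}_{\mathbf{C}}(\Gamma)$, the canonical map $(\tau_F)_A:F(\Gamma.A)\to F\Gamma.FA$ over $F\Gamma$ (with $v_{FA}[(\tau_F)_A]=Fv_A$) is an isomorphism.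 A 2-morphism $\alpha:F\Rightarrow G$ is a natural transformation $\alpha$ with $\mathbf{C}$-indexed natural transformations $\mathbf{Tp}_\alpha:\mathbf{Tp}_F\Rightarrow\alpha^*\mathbf{Tp}_{\mathbf{D}}\circ\mathbf{Tp}_G$ and $\mathbf{Tm}_\alpha:\mathbf{Tm}_F\Rightarrow\alpha^*\mathbf{Tm}_{\mathbf{D}}\circ\mathbf{Tm}_G$, with components $\alpha_A:FA\to(GA)[\alpha_\Gamma]$ and $\alpha_t:Ft\to(Gt)[\alpha_\Gamma]$, such that $p_{\mathbf{D}}(\alpha_t)=\alpha_{p_{\mathbf{C}}(t)}$. $\mathbf{NM}$ is the strict 2-category of small natural models, morphisms and 2-morphisms. **Construction of coalgebras.** For a strict 2-category $\mathbf{K}$, $\mathbf{Comon}(\mathbf{K})$ is the strict 2-category of comonads $\Box:C\to C$ in $\mathbf{K}$; a morphism $\Box_1\to\Box_2$ is a morphism $f:C_1\to C_2$ with a 2-morphism $\tau:f\Box_1\Rightarrow\Box_2f$ compatible with counits and comultiplications; a 2-morphism is a 2-morphism of $\mathbf{K}$ compatible with the $\tau$s. An object of coalgebras for $\Box:C\to C$ is an object $C^\Box$ with $\mathrm{Hom}_{\mathbf{K}}(D,C^\Box)\cong\mathrm{Hom}_{\mathbf{Comon}(\mathbf{K})}(\mathrm{id}_D,\Box)$ naturally in $D$; it yields a forgetful–cofree adjunction $U\dashv F:C\to C^\Box$. $\mathbf{K}$ admits the construction of coalgebras if every comonad in $\mathbf{K}$ has an object of coalgebras. A strict 2-functor $\Phi:\mathbf{K}\to\mathbf{L}$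 between such 2-categories preserves the construction of coalgebras on the nose if for every comonad $\Box:C\to C$ in $\mathbf{K}$ the adjunction $\Phi U\dashv\Phi F:\Phi C\to\Phi(C^\Box)$ is comonadic on the nose, i.e. the comparison morphism $\Phi(C^\Box)\to(\Phi C)^{\Phi\Box}$ is an identity (objects of coalgebras in $\mathbf{K}$, $\mathbf{L}$ being understood as chosen; in $\mathbf{Cat}$ they are the usual categories of coalgebras). $\mathbf{K}$ admits the construction of coalgebras over $\mathbf{L}$ (via $\Phi$) if $\mathbf{K}$ and $\mathbf{L}$ admit the construction of coalgebras and $\Phi$ preserves it on the nose. $\mathbf{Cat}$ is the strict 2-category of small categories. *)

theory Defs
  imports Main "HOL-Library.FuncSet"
begin

section \<open>Categories, functors, natural transformations\<close>

text \<open>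
  All operations are required to be undefined outside their domains. Hence two structures are equal
  as records iff they are equal mathematically, which gives ``on the nose'' its intended meaning.
\<close>

record ('o, 'a) cat =
  Obj :: "'o set"
  Arr :: "'a set"
  Dom :: "'a \<Rightarrow> 'o"
  Cod :: "'a \<Rightarrow> 'o"
  Idn :: "'o \<Rightarrow> 'a"
  Cmp :: "'a \<Rightarrow> 'a \<Rightarrow> 'a"  (infixr "\<cdot>\<index>" 70)

locale category =
  fixes C :: "('o, 'a) cat" (structure)
  assumes dom_closed: "f \<in> Arr C \<Longrightarrow> Dom C f \<in> Obj C"
    and cod_closed: "f \<in> Arr C \<Longrightarrow> Cod C f \<in> Obj C"
    and idn_arr: "A \<in> Obj C \<Longrightarrow> Idn C A \<in> Arr C"
    and idn_dom: "A \<in> Obj C \<Longrightarrow> Dom C (Idn C A) = A"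
    and idn_cod: "A \<in> Obj C \<Longrightarrow> Cod C (Idn C A) = A"
    and cmp_arr: "f \<in> Arr C \<Longrightarrow> g \<in> Arr C \<Longrightarrow> Dom C g = Cod C f \<Longrightarrow> g \<cdot> f \<in> Arr C"
    and cmp_dom: "f \<in> Arr C \<Longrightarrow> g \<in> Arr C \<Longrightarrow> Dom C g = Cod C f \<Longrightarrow> Dom C (g \<cdot> f) = Dom C f"
    and cmp_cod: "f \<in> Arr C \<Longrightarrow> g \<in> Arr C \<Longrightarrow> Dom C g = Cod C f \<Longrightarrow> Cod C (g \<cdot> f) = Cod C g"
    and idn_left: "f \<in> Arr C \<Longrightarrow> Idn C (Cod C f) \<cdot> f = f"
    and idn_right: "f \<in> Arr C \<Longrightarrow> f \<cdot> Idn C (Dom C f) = f"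
    and assoc: "f \<in> Arr C \<Longrightarrow> g \<in> Arr C \<Longrightarrow> h \<in> Arr C \<Longrightarrow>
      Dom C g = Cod C f \<Longrightarrow> Dom C h = Cod C g \<Longrightarrow> (h \<cdot> g) \<cdot> f = h \<cdot> (g \<cdot> f)"
    and dom_ext: "Dom C \<in> extensional (Arr C)"
    and cod_ext: "Cod C \<in> extensional (Arr C)"
    and idn_ext: "Idn C \<in> extensional (Obj C)"
    and cmp_ext: "\<not> (g \<in> Arr C \<and> f \<in> Arr C \<and> Dom C g = Cod C f) \<Longrightarrow> g \<cdot> f = undefined"

definition partial_comp ::
    "'a set \<Rightarrow> ('a \<Rightarrow> 'o) \<Rightarrow> ('a \<Rightarrow> 'o) \<Rightarrow> ('a \<Rightarrow> 'a \<Rightarrow> 'a) \<Rightarrow> 'a \<Rightarrow> 'a \<Rightarrow> 'a" where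
  "partial_comp A d c m = (\<lambda>g f. if g \<in> A \<and> f \<in> A \<and> d g = c f then m g f else undefined)"

definition mkcat ::
    "'o set \<Rightarrow> 'a set \<Rightarrow> ('a \<Rightarrow> 'o) \<Rightarrow> ('a \<Rightarrow> 'o) \<Rightarrow> ('o \<Rightarrow> 'a) \<Rightarrow> ('a \<Rightarrow> 'a \<Rightarrow> 'a) \<Rightarrow> ('o, 'a) cat" where
  "mkcat X A d c i m = \<lparr>Obj = X, Arr = A, Dom = restrict d A, Cod = restrict c A,
     Idn = restrict i X, Cmp = partial_comp A d c m\<rparr>"

definition hom :: "('o, 'a) cat \<Rightarrow> 'o \<Rightarrow> 'o \<Rightarrow> 'a set" where
  "hom C A B = {f \<in> Arr C. Dom C f = A \<and> Cod C f = B}"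

definition iso :: "('o, 'a) cat \<Rightarrow> 'a \<Rightarrow> bool" where
  "iso C f \<longleftrightarrow> f \<in> Arr C \<and> (\<exists>g \<in> hom C (Cod C f) (Dom C f).
     g \<cdot>\<^bsub>C\<^esub> f = Idn C (Dom C f) \<and> f \<cdot>\<^bsub>C\<^esub> g = Idn C (Cod C f))"

definition opcat :: "('o, 'a) cat \<Rightarrow> ('o, 'a) cat" where
  "opcat C = C\<lparr>Dom := Cod C, Cod := Dom C, Cmp := (\<lambda>g f. f \<cdot>\<^bsub>C\<^esub> g)\<rparr>"

definition full_subcat :: "('o, 'a) cat \<Rightarrow> 'o set \<Rightarrow> ('o, 'a) cat" where
  "full_subcat C S = mkcat (Obj C \<inter> S) {f \<in> Arr C. Dom C f \<in> S \<and> Cod C f \<in> S}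
     (Dom C) (Cod C) (Idn C) (Cmp C)"

definition slice :: "('o, 'a) cat \<Rightarrow> 'o \<Rightarrow> ('a, 'a \<times> 'a \<times> 'a) cat" where
  "slice C B = mkcat {p \<in> Arr C. Cod C p = B}
     {(p, q, h). p \<in> Arr C \<and> Cod C p = B \<and> q \<in> Arr C \<and> Cod C q = B \<and>
        h \<in> hom C (Dom C p) (Dom C q) \<and> q \<cdot>\<^bsub>C\<^esub> h = p}
     fst (fst \<circ> snd) (\<lambda>p. (p, p, Idn C (Dom C p)))
     (\<lambda>(q', r, k) (p, q, h). (p, r, k \<cdot>\<^bsub>C\<^esub> h))"

record ('o, 'a, 'p, 'b) fct =
  Src :: "('o, 'a) cat"
  Tgt :: "('p, 'b) cat"
  Fob :: "'o \<Rightarrow> 'p"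
  Far :: "'a \<Rightarrow> 'b"

locale fctr =
  fixes F :: "('o, 'a, 'p, 'b) fct"
  assumes src_cat: "category (Src F)"
    and tgt_cat: "category (Tgt F)"
    and fob: "A \<in> Obj (Src F) \<Longrightarrow> Fob F A \<in> Obj (Tgt F)"
    and far: "f \<in> Arr (Src F) \<Longrightarrow>
      Far F f \<in> hom (Tgt F) (Fob F (Dom (Src F) f)) (Fob F (Cod (Src F) f))"
    and pres_idn: "A \<in> Obj (Src F) \<Longrightarrow> Far F (Idn (Src F) A) = Idn (Tgt F) (Fob F A)"
    and pres_cmp: "f \<in> Arr (Src F) \<Longrightarrow> g \<in> Arr (Src F) \<Longrightarrow> Dom (Src F) g = Cod (Src F) f \<Longrightarrow>
      Far F (g \<cdot>\<^bsub>Src F\<^esub> f) = Far F g \<cdot>\<^bsub>Tgt F\<^esub> Far F f"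
    and fob_ext: "Fob F \<in> extensional (Obj (Src F))"
    and far_ext: "Far F \<in> extensional (Arr (Src F))"

definition fct_id :: "('o, 'a) cat \<Rightarrow> ('o, 'a, 'o, 'a) fct" where
  "fct_id C = \<lparr>Src = C, Tgt = C, Fob = (\<lambda>A\<in>Obj C. A), Far = (\<lambda>f\<in>Arr C. f)\<rparr>"

definition fct_comp :: "('p, 'b, 'q, 'c) fct \<Rightarrow> ('o, 'a, 'p, 'b) fct \<Rightarrow> ('o, 'a, 'q, 'c) fct" where
  "fct_comp G F = \<lparr>Src = Src F, Tgt = Tgt G,
     Fob = compose (Obj (Src F)) (Fob G) (Fob F), Far = compose (Arr (Src F)) (Far G) (Far F)\<rparr>"

definition fct_op :: "('o, 'a, 'p, 'b) fct \<Rightarrow> ('o, 'a, 'p, 'b) fct" where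
  "fct_op F = F\<lparr>Src := opcat (Src F), Tgt := opcat (Tgt F)\<rparr>"

record ('o, 'a, 'p, 'b) ntr =
  NSrc :: "('o, 'a, 'p, 'b) fct"
  NTgt :: "('o, 'a, 'p, 'b) fct"
  At :: "'o \<Rightarrow> 'b"

locale ntrans =
  fixes \<alpha> :: "('o, 'a, 'p, 'b) ntr"
  assumes nsrc: "fctr (NSrc \<alpha>)"
    and ntgt: "fctr (NTgt \<alpha>)"
    and same_src: "Src (NTgt \<alpha>) = Src (NSrc \<alpha>)"
    and same_tgt: "Tgt (NTgt \<alpha>) = Tgt (NSrc \<alpha>)"
    and component: "A \<in> Obj (Src (NSrc \<alpha>)) \<Longrightarrow>
      At \<alpha> A \<in> hom (Tgt (NSrc \<alpha>)) (Fob (NSrc \<alpha>) A) (Fob (NTgt \<alpha>) A)"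
    and natural: "f \<in> Arr (Src (NSrc \<alpha>)) \<Longrightarrow>
      At \<alpha> (Cod (Src (NSrc \<alpha>)) f) \<cdot>\<^bsub>Tgt (NSrc \<alpha>)\<^esub> Far (NSrc \<alpha>) f
      = Far (NTgt \<alpha>) f \<cdot>\<^bsub>Tgt (NSrc \<alpha>)\<^esub> At \<alpha> (Dom (Src (NSrc \<alpha>)) f)"
    and at_ext: "At \<alpha> \<in> extensional (Obj (Src (NSrc \<alpha>)))"

definition ntid :: "('o, 'a, 'p, 'b) fct \<Rightarrow> ('o, 'a, 'p, 'b) ntr" where
  "ntid F = \<lparr>NSrc = F, NTgt = F, At = (\<lambda>A\<in>Obj (Src F). Idn (Tgt F) (Fob F A))\<rparr>"

definition ntvcomp :: "('o, 'a, 'p, 'b) ntr \<Rightarrow> ('o, 'a, 'p, 'b) ntr \<Rightarrow> ('o, 'a, 'p, 'b) ntr" where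
  "ntvcomp \<beta> \<alpha> = \<lparr>NSrc = NSrc \<alpha>, NTgt = NTgt \<beta>,
     At = (\<lambda>A\<in>Obj (Src (NSrc \<alpha>)). At \<beta> A \<cdot>\<^bsub>Tgt (NSrc \<alpha>)\<^esub> At \<alpha> A)\<rparr>"

definition nthcomp :: "('p, 'b, 'q, 'c) ntr \<Rightarrow> ('o, 'a, 'p, 'b) ntr \<Rightarrow> ('o, 'a, 'q, 'c) ntr" where
  "nthcomp \<beta> \<alpha> = \<lparr>NSrc = fct_comp (NSrc \<beta>) (NSrc \<alpha>), NTgt = fct_comp (NTgt \<beta>) (NTgt \<alpha>),
     At = (\<lambda>A\<in>Obj (Src (NSrc \<alpha>)).
       At \<beta> (Fob (NTgt \<alpha>) A) \<cdot>\<^bsub>Tgt (NSrc \<beta>)\<^esub> Far (NSrc \<beta>) (At \<alpha> A))\<rparr>"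

definition cat_isomorphism :: "('o, 'a, 'p, 'b) fct \<Rightarrow> bool" where
  "cat_isomorphism F \<longleftrightarrow> fctr F \<and>
     (\<exists>G. fctr G \<and> Src G = Tgt F \<and> Tgt G = Src F \<and>
        fct_comp G F = fct_id (Src F) \<and> fct_comp F G = fct_id (Tgt F))"

definition nat_iso :: "('o, 'a, 'p, 'b) fct \<Rightarrow> ('o, 'a, 'p, 'b) fct \<Rightarrow> ('o, 'a, 'p, 'b) ntr \<Rightarrow> bool" where
  "nat_iso F G \<alpha> \<longleftrightarrow> ntrans \<alpha> \<and> NSrc \<alpha> = F \<and> NTgt \<alpha> = G \<and> (\<forall>A\<in>Obj (Src F). iso (Tgt F) (At \<alpha> A))"

definition cat_equivalence :: "('o, 'a, 'p, 'b) fct \<Rightarrow> bool" where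
  "cat_equivalence F \<longleftrightarrow> fctr F \<and>
     (\<exists>G \<eta> \<epsilon>. fctr G \<and> Src G = Tgt F \<and> Tgt G = Src F \<and>
        nat_iso (fct_id (Src F)) (fct_comp G F) \<eta> \<and> nat_iso (fct_comp F G) (fct_id (Tgt F)) \<epsilon>)"

definition discrete_opfibration :: "('o, 'a, 'p, 'b) fct \<Rightarrow> bool" where
  "discrete_opfibration P \<longleftrightarrow> fctr P \<and>
     (\<forall>e\<in>Obj (Src P). \<forall>f\<in>Arr (Tgt P). Dom (Tgt P) f = Fob P e \<longrightarrow>
        (\<exists>!g. g \<in> Arr (Src P) \<and> Dom (Src P) g = e \<and> Far P g = f))"

definition oplift :: "('o, 'a, 'p, 'b) fct \<Rightarrow> 'o \<Rightarrow> 'b \<Rightarrow> 'a" where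
  "oplift P e f = (THE g. g \<in> Arr (Src P) \<and> Dom (Src P) g = e \<and> Far P g = f)"


section \<open>Strict 2-categories\<close>

text \<open>
  A strict 2-category consists of the category of objects and 1-cells, the category of 1-cells and
  2-cells under vertical composition, and a horizontal composition making objects and 2-cells
  into a category as well.
\<close>

record ('o, 'f, 't) two_cat =
  One :: "('o, 'f) cat"
  Two :: "('f, 't) cat"
  HCmp :: "'t \<Rightarrow> 't \<Rightarrow> 't"  (infixr "\<star>\<index>" 75)

definition horizontal :: "('o, 'f, 't) two_cat \<Rightarrow> ('o, 't) cat" where
  "horizontal K = \<lparr>Obj = Obj (One K), Arr = Arr (Two K),
     Dom = (\<lambda>\<alpha>\<in>Arr (Two K). Dom (One K) (Dom (Two K) \<alpha>)),
     Cod = (\<lambda>\<alpha>\<in>Arr (Two K). Cod (One K) (Dom (Two K) \<alpha>)),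
     Idn = (\<lambda>A\<in>Obj (One K). Idn (Two K) (Idn (One K) A)),
     Cmp = HCmp K\<rparr>"

locale strict_2_category =
  fixes K :: "('o, 'f, 't) two_cat" (structure)
  assumes one: "category (One K)"
    and two: "category (Two K)"
    and obj_two: "Obj (Two K) = Arr (One K)"
    and globular_dom: "\<alpha> \<in> Arr (Two K) \<Longrightarrow> Dom (One K) (Cod (Two K) \<alpha>) = Dom (One K) (Dom (Two K) \<alpha>)"
    and globular_cod: "\<alpha> \<in> Arr (Two K) \<Longrightarrow> Cod (One K) (Cod (Two K) \<alpha>) = Cod (One K) (Dom (Two K) \<alpha>)"
    and hor: "category (horizontal K)"
    and hcmp_dom: "\<alpha> \<in> Arr (Two K) \<Longrightarrow> \<beta> \<in> Arr (Two K) \<Longrightarrow>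
      Dom (horizontal K) \<beta> = Cod (horizontal K) \<alpha> \<Longrightarrow>
      Dom (Two K) (\<beta> \<star> \<alpha>) = Dom (Two K) \<beta> \<cdot>\<^bsub>One K\<^esub> Dom (Two K) \<alpha>"
    and hcmp_cod: "\<alpha> \<in> Arr (Two K) \<Longrightarrow> \<beta> \<in> Arr (Two K) \<Longrightarrow>
      Dom (horizontal K) \<beta> = Cod (horizontal K) \<alpha> \<Longrightarrow>
      Cod (Two K) (\<beta> \<star> \<alpha>) = Cod (Two K) \<beta> \<cdot>\<^bsub>One K\<^esub> Cod (Two K) \<alpha>"
    and hcmp_idn: "f \<in> Arr (One K) \<Longrightarrow> g \<in> Arr (One K) \<Longrightarrow> Dom (One K) g = Cod (One K) f \<Longrightarrow>
      Idn (Two K) g \<star> Idn (Two K) f = Idn (Two K) (g \<cdot>\<^bsub>One K\<^esub> f)"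
    and interchange: "\<alpha> \<in> Arr (Two K) \<Longrightarrow> \<alpha>' \<in> Arr (Two K) \<Longrightarrow>
      \<beta> \<in> Arr (Two K) \<Longrightarrow> \<beta>' \<in> Arr (Two K) \<Longrightarrow>
      Dom (Two K) \<alpha>' = Cod (Two K) \<alpha> \<Longrightarrow> Dom (Two K) \<beta>' = Cod (Two K) \<beta> \<Longrightarrow>
      Dom (horizontal K) \<beta> = Cod (horizontal K) \<alpha> \<Longrightarrow>
      (\<beta>' \<cdot>\<^bsub>Two K\<^esub> \<beta>) \<star> (\<alpha>' \<cdot>\<^bsub>Two K\<^esub> \<alpha>) = (\<beta>' \<star> \<alpha>') \<cdot>\<^bsub>Two K\<^esub> (\<beta> \<star> \<alpha>)"

definition homcat :: "('o, 'f, 't) two_cat \<Rightarrow> 'o \<Rightarrow> 'o \<Rightarrow> ('f, 't) cat" where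
  "homcat K A B = full_subcat (Two K) (hom (One K) A B)"

definition lwhisker :: "('o, 'f, 't) two_cat \<Rightarrow> 'f \<Rightarrow> 't \<Rightarrow> 't" where
  "lwhisker K g \<alpha> = Idn (Two K) g \<star>\<^bsub>K\<^esub> \<alpha>"

definition rwhisker :: "('o, 'f, 't) two_cat \<Rightarrow> 't \<Rightarrow> 'f \<Rightarrow> 't" where
  "rwhisker K \<alpha> f = \<alpha> \<star>\<^bsub>K\<^esub> Idn (Two K) f"

record ('o, 'f, 't, 'p, 'g, 's) two_fct =
  F0 :: "'o \<Rightarrow> 'p"
  F1 :: "'f \<Rightarrow> 'g"
  F2 :: "'t \<Rightarrow> 's"

locale strict_2_functor =
  fixes K :: "('o, 'f, 't) two_cat" and L :: "('p, 'g, 's) two_cat"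
    and \<Phi> :: "('o, 'f, 't, 'p, 'g, 's) two_fct"
  assumes f0: "A \<in> Obj (One K) \<Longrightarrow> F0 \<Phi> A \<in> Obj (One L)"
    and f1: "f \<in> Arr (One K) \<Longrightarrow>
      F1 \<Phi> f \<in> hom (One L) (F0 \<Phi> (Dom (One K) f)) (F0 \<Phi> (Cod (One K) f))"
    and f1_idn: "A \<in> Obj (One K) \<Longrightarrow> F1 \<Phi> (Idn (One K) A) = Idn (One L) (F0 \<Phi> A)"
    and f1_cmp: "f \<in> Arr (One K) \<Longrightarrow> g \<in> Arr (One K) \<Longrightarrow> Dom (One K) g = Cod (One K) f \<Longrightarrow>
      F1 \<Phi> (g \<cdot>\<^bsub>One K\<^esub> f) = F1 \<Phi> g \<cdot>\<^bsub>One L\<^esub> F1 \<Phi> f"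
    and f2: "\<alpha> \<in> Arr (Two K) \<Longrightarrow>
      F2 \<Phi> \<alpha> \<in> hom (Two L) (F1 \<Phi> (Dom (Two K) \<alpha>)) (F1 \<Phi> (Cod (Two K) \<alpha>))"
    and f2_idn: "f \<in> Arr (One K) \<Longrightarrow> F2 \<Phi> (Idn (Two K) f) = Idn (Two L) (F1 \<Phi> f)"
    and f2_cmp: "\<alpha> \<in> Arr (Two K) \<Longrightarrow> \<beta> \<in> Arr (Two K) \<Longrightarrow> Dom (Two K) \<beta> = Cod (Two K) \<alpha> \<Longrightarrow>
      F2 \<Phi> (\<beta> \<cdot>\<^bsub>Two K\<^esub> \<alpha>) = F2 \<Phi> \<beta> \<cdot>\<^bsub>Two L\<^esub> F2 \<Phi> \<alpha>"
    and f2_hcmp: "\<alpha> \<in> Arr (Two K) \<Longrightarrow> \<beta> \<in> Arr (Two K) \<Longrightarrow>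
      Dom (horizontal K) \<beta> = Cod (horizontal K) \<alpha> \<Longrightarrow>
      F2 \<Phi> (\<beta> \<star>\<^bsub>K\<^esub> \<alpha>) = F2 \<Phi> \<beta> \<star>\<^bsub>L\<^esub> F2 \<Phi> \<alpha>"


section \<open>Comonads in a strict 2-category\<close>

record ('o, 'f, 't) cmnd =
  Base :: 'o
  Endo :: 'f
  Counit :: 't
  Comult :: 't

locale comonad =
  fixes K :: "('o, 'f, 't) two_cat" and W :: "('o, 'f, 't) cmnd"
  assumes base: "Base W \<in> Obj (One K)"
    and endo: "Endo W \<in> hom (One K) (Base W) (Base W)"
    and counit: "Counit W \<in> hom (Two K) (Endo W) (Idn (One K) (Base W))"
    and comult: "Comult W \<in> hom (Two K) (Endo W) (Endo W \<cdot>\<^bsub>One K\<^esub> Endo W)"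
    and counit_left: "rwhisker K (Counit W) (Endo W) \<cdot>\<^bsub>Two K\<^esub> Comult W = Idn (Two K) (Endo W)"
    and counit_right: "lwhisker K (Endo W) (Counit W) \<cdot>\<^bsub>Two K\<^esub> Comult W = Idn (Two K) (Endo W)"
    and coassoc: "rwhisker K (Comult W) (Endo W) \<cdot>\<^bsub>Two K\<^esub> Comult W
      = lwhisker K (Endo W) (Comult W) \<cdot>\<^bsub>Two K\<^esub> Comult W"

record ('o, 'f, 't) cmor =
  CSrc :: "('o, 'f, 't) cmnd"
  CTgt :: "('o, 'f, 't) cmnd"
  CMap :: 'f
  CCell :: 't

locale comonad_mor =
  fixes K :: "('o, 'f, 't) two_cat" and m :: "('o, 'f, 't) cmor"
  assumes csrc: "comonad K (CSrc m)"
    and ctgt: "comonad K (CTgt m)"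
    and cmap: "CMap m \<in> hom (One K) (Base (CSrc m)) (Base (CTgt m))"
    and ccell: "CCell m \<in>
      hom (Two K) (CMap m \<cdot>\<^bsub>One K\<^esub> Endo (CSrc m)) (Endo (CTgt m) \<cdot>\<^bsub>One K\<^esub> CMap m)"
    and counit_compat: "rwhisker K (Counit (CTgt m)) (CMap m) \<cdot>\<^bsub>Two K\<^esub> CCell m
      = lwhisker K (CMap m) (Counit (CSrc m))"
    and comult_compat: "rwhisker K (Comult (CTgt m)) (CMap m) \<cdot>\<^bsub>Two K\<^esub> CCell m
      = lwhisker K (Endo (CTgt m)) (CCell m) \<cdot>\<^bsub>Two K\<^esub>
        (rwhisker K (CCell m) (Endo (CSrc m)) \<cdot>\<^bsub>Two K\<^esub> lwhisker K (CMap m) (Comult (CSrc m)))"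

record ('o, 'f, 't) cmor2 =
  C2Src :: "('o, 'f, 't) cmor"
  C2Tgt :: "('o, 'f, 't) cmor"
  C2Cell :: 't

locale comonad_mor2 =
  fixes K :: "('o, 'f, 't) two_cat" and \<theta> :: "('o, 'f, 't) cmor2"
  assumes c2src: "comonad_mor K (C2Src \<theta>)"
    and c2tgt: "comonad_mor K (C2Tgt \<theta>)"
    and c2same_src: "CSrc (C2Tgt \<theta>) = CSrc (C2Src \<theta>)"
    and c2same_tgt: "CTgt (C2Tgt \<theta>) = CTgt (C2Src \<theta>)"
    and c2cell: "C2Cell \<theta> \<in> hom (Two K) (CMap (C2Src \<theta>)) (CMap (C2Tgt \<theta>))"
    and c2compat: "lwhisker K (Endo (CTgt (C2Src \<theta>))) (C2Cell \<theta>) \<cdot>\<^bsub>Two K\<^esub> CCell (C2Src \<theta>)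
      = CCell (C2Tgt \<theta>) \<cdot>\<^bsub>Two K\<^esub> rwhisker K (C2Cell \<theta>) (Endo (CSrc (C2Src \<theta>)))"

definition cmor_id :: "('o, 'f, 't) two_cat \<Rightarrow> ('o, 'f, 't) cmnd \<Rightarrow> ('o, 'f, 't) cmor" where
  "cmor_id K W = \<lparr>CSrc = W, CTgt = W, CMap = Idn (One K) (Base W), CCell = Idn (Two K) (Endo W)\<rparr>"

definition cmor_comp ::
    "('o, 'f, 't) two_cat \<Rightarrow> ('o, 'f, 't) cmor \<Rightarrow> ('o, 'f, 't) cmor \<Rightarrow> ('o, 'f, 't) cmor" where
  "cmor_comp K n m = \<lparr>CSrc = CSrc m, CTgt = CTgt n, CMap = CMap n \<cdot>\<^bsub>One K\<^esub> CMap m,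
     CCell = rwhisker K (CCell n) (CMap m) \<cdot>\<^bsub>Two K\<^esub> lwhisker K (CMap n) (CCell m)\<rparr>"

definition Comon ::
    "('o, 'f, 't) two_cat \<Rightarrow> (('o, 'f, 't) cmnd, ('o, 'f, 't) cmor, ('o, 'f, 't) cmor2) two_cat" where
  "Comon K =
    \<lparr>One = mkcat {W. comonad K W} {m. comonad_mor K m} CSrc CTgt (cmor_id K) (cmor_comp K),
     Two = mkcat {m. comonad_mor K m} {\<theta>. comonad_mor2 K \<theta>} C2Src C2Tgt
       (\<lambda>m. \<lparr>C2Src = m, C2Tgt = m, C2Cell = Idn (Two K) (CMap m)\<rparr>)
       (\<lambda>\<phi> \<theta>. \<lparr>C2Src = C2Src \<theta>, C2Tgt = C2Tgt \<phi>, C2Cell = C2Cell \<phi> \<cdot>\<^bsub>Two K\<^esub> C2Cell \<theta>\<rparr>),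
     HCmp = partial_comp {\<theta>. comonad_mor2 K \<theta>} (CSrc \<circ> C2Src) (CTgt \<circ> C2Src)
       (\<lambda>\<phi> \<theta>. \<lparr>C2Src = cmor_comp K (C2Src \<phi>) (C2Src \<theta>), C2Tgt = cmor_comp K (C2Tgt \<phi>) (C2Tgt \<theta>),
                C2Cell = C2Cell \<phi> \<star>\<^bsub>K\<^esub> C2Cell \<theta>\<rparr>)\<rparr>"

definition id_comonad :: "('o, 'f, 't) two_cat \<Rightarrow> 'o \<Rightarrow> ('o, 'f, 't) cmnd" where
  "id_comonad K D = \<lparr>Base = D, Endo = Idn (One K) D,
     Counit = Idn (Two K) (Idn (One K) D), Comult = Idn (Two K) (Idn (One K) D)\<rparr>"

definition id_comonad1 :: "('o, 'f, 't) two_cat \<Rightarrow> 'f \<Rightarrow> ('o, 'f, 't) cmor" where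
  "id_comonad1 K h = \<lparr>CSrc = id_comonad K (Dom (One K) h), CTgt = id_comonad K (Cod (One K) h),
     CMap = h, CCell = Idn (Two K) h\<rparr>"

definition id_comonad2 :: "('o, 'f, 't) two_cat \<Rightarrow> 't \<Rightarrow> ('o, 'f, 't) cmor2" where
  "id_comonad2 K \<theta> = \<lparr>C2Src = id_comonad1 K (Dom (Two K) \<theta>), C2Tgt = id_comonad1 K (Cod (Two K) \<theta>),
     C2Cell = \<theta>\<rparr>"


section \<open>The construction of coalgebras\<close>

record ('o, 'f, 't) coalg_obj =
  Carrier :: 'o
  Iso :: "'o \<Rightarrow> ('f, 't, ('o, 'f, 't) cmor, ('o, 'f, 't) cmor2) fct"

text \<open>
  The last two assumptions say that the isomorphisms are (strictly) 2-natural in \<open>D\<close>, where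
  \<open>D\<close> is sent to \<open>id_comonad K D\<close> by the 2-functor with action \<open>id_comonad1\<close>, \<open>id_comonad2\<close>.
\<close>

locale object_of_coalgebras =
  fixes K :: "('o, 'f, 't) two_cat" and W :: "('o, 'f, 't) cmnd" and X :: "('o, 'f, 't) coalg_obj"
  assumes carrier: "Carrier X \<in> Obj (One K)"
    and iso: "D \<in> Obj (One K) \<Longrightarrow> cat_isomorphism (Iso X D)"
    and iso_src: "D \<in> Obj (One K) \<Longrightarrow> Src (Iso X D) = homcat K D (Carrier X)"
    and iso_tgt: "D \<in> Obj (One K) \<Longrightarrow> Tgt (Iso X D) = homcat (Comon K) (id_comonad K D) W"
    and iso_natural1: "g \<in> Arr (One K) \<Longrightarrow> Cod (One K) g = Carrier X \<Longrightarrow>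
      h \<in> Arr (One K) \<Longrightarrow> Cod (One K) h = Dom (One K) g \<Longrightarrow>
      Fob (Iso X (Dom (One K) h)) (g \<cdot>\<^bsub>One K\<^esub> h)
      = Fob (Iso X (Dom (One K) g)) g \<cdot>\<^bsub>One (Comon K)\<^esub> id_comonad1 K h"
    and iso_natural2: "\<phi> \<in> Arr (Two K) \<Longrightarrow> Cod (horizontal K) \<phi> = Carrier X \<Longrightarrow>
      \<theta> \<in> Arr (Two K) \<Longrightarrow> Cod (horizontal K) \<theta> = Dom (horizontal K) \<phi> \<Longrightarrow>
      Far (Iso X (Dom (horizontal K) \<theta>)) (\<phi> \<star>\<^bsub>K\<^esub> \<theta>)
      = Far (Iso X (Dom (horizontal K) \<phi>)) \<phi> \<star>\<^bsub>Comon K\<^esub> id_comonad2 K \<theta>"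

type_synonym ('o, 'f, 't) coalg_choice = "('o, 'f, 't) cmnd \<Rightarrow> ('o, 'f, 't) coalg_obj"

definition chosen_coalgebras :: "('o, 'f, 't) two_cat \<Rightarrow> ('o, 'f, 't) coalg_choice \<Rightarrow> bool" where
  "chosen_coalgebras K c \<longleftrightarrow> (\<forall>W. comonad K W \<longrightarrow> object_of_coalgebras K W (c W))"

definition admits_coalgebras :: "('o, 'f, 't) two_cat \<Rightarrow> bool" where
  "admits_coalgebras K \<longleftrightarrow> strict_2_category K \<and> (\<forall>W. comonad K W \<longrightarrow> (\<exists>X. object_of_coalgebras K W X))"

record ('f, 't) adj =
  LAdj :: 'f
  RAdj :: 'f
  AUnit :: 't
  ACounit :: 't

locale adjunction =
  fixes K :: "('o, 'f, 't) two_cat" and J :: "('f, 't) adj"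
  assumes ladj: "LAdj J \<in> Arr (One K)"
    and radj: "RAdj J \<in> hom (One K) (Cod (One K) (LAdj J)) (Dom (One K) (LAdj J))"
    and aunit: "AUnit J \<in>
      hom (Two K) (Idn (One K) (Dom (One K) (LAdj J))) (RAdj J \<cdot>\<^bsub>One K\<^esub> LAdj J)"
    and acounit: "ACounit J \<in>
      hom (Two K) (LAdj J \<cdot>\<^bsub>One K\<^esub> RAdj J) (Idn (One K) (Cod (One K) (LAdj J)))"
    and triangle_left:
      "rwhisker K (ACounit J) (LAdj J) \<cdot>\<^bsub>Two K\<^esub> lwhisker K (LAdj J) (AUnit J) = Idn (Two K) (LAdj J)"
    and triangle_right:
      "lwhisker K (RAdj J) (ACounit J) \<cdot>\<^bsub>Two K\<^esub> rwhisker K (AUnit J) (RAdj J) = Idn (Two K) (RAdj J)"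

definition adj_comonad :: "('o, 'f, 't) two_cat \<Rightarrow> ('f, 't) adj \<Rightarrow> ('o, 'f, 't) cmnd" where
  "adj_comonad K J = \<lparr>Base = Cod (One K) (LAdj J), Endo = LAdj J \<cdot>\<^bsub>One K\<^esub> RAdj J,
     Counit = ACounit J, Comult = lwhisker K (LAdj J) (rwhisker K (AUnit J) (RAdj J))\<rparr>"

text \<open>
  The forgetful--cofree adjunction: the forgetful 1-cell is the 1-cell underlying the image of the
  identity; the cofree 1-cell corresponds to the comonad together with its comultiplication; the
  unit corresponds to the universal coaction; the counit is that of the comonad.
\<close>

definition coalg_forget :: "('o, 'f, 't) two_cat \<Rightarrow> ('o, 'f, 't) coalg_obj \<Rightarrow> 'f" where
  "coalg_forget K X = CMap (Fob (Iso X (Carrier X)) (Idn (One K) (Carrier X)))"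

definition coalg_cofree ::
    "('o, 'f, 't) two_cat \<Rightarrow> ('o, 'f, 't) cmnd \<Rightarrow> ('o, 'f, 't) coalg_obj \<Rightarrow> 'f" where
  "coalg_cofree K W X = (THE F. F \<in> hom (One K) (Base W) (Carrier X) \<and>
     Fob (Iso X (Base W)) F
     = \<lparr>CSrc = id_comonad K (Base W), CTgt = W, CMap = Endo W, CCell = Comult W\<rparr>)"

definition coalg_unit ::
    "('o, 'f, 't) two_cat \<Rightarrow> ('o, 'f, 't) cmnd \<Rightarrow> ('o, 'f, 't) coalg_obj \<Rightarrow> 't" where
  "coalg_unit K W X = (THE \<eta>.
     \<eta> \<in> hom (Two K) (Idn (One K) (Carrier X)) (coalg_cofree K W X \<cdot>\<^bsub>One K\<^esub> coalg_forget K X) \<and>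
     C2Cell (Far (Iso X (Carrier X)) \<eta>) = CCell (Fob (Iso X (Carrier X)) (Idn (One K) (Carrier X))))"

definition coalg_adj ::
    "('o, 'f, 't) two_cat \<Rightarrow> ('o, 'f, 't) cmnd \<Rightarrow> ('o, 'f, 't) coalg_obj \<Rightarrow> ('f, 't) adj" where
  "coalg_adj K W X = \<lparr>LAdj = coalg_forget K X, RAdj = coalg_cofree K W X,
     AUnit = coalg_unit K W X, ACounit = Counit W\<rparr>"

text \<open>The comparison 1-cell of an adjunction, for an object of coalgebras \<open>X\<close> of its comonad.\<close>

definition comparison ::
    "('o, 'f, 't) two_cat \<Rightarrow> ('o, 'f, 't) coalg_obj \<Rightarrow> ('f, 't) adj \<Rightarrow> 'f" where
  "comparison K X J = (THE h. h \<in> hom (One K) (Dom (One K) (LAdj J)) (Carrier X) \<and>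
     Fob (Iso X (Dom (One K) (LAdj J))) h
     = \<lparr>CSrc = id_comonad K (Dom (One K) (LAdj J)), CTgt = adj_comonad K J,
        CMap = LAdj J, CCell = lwhisker K (LAdj J) (AUnit J)\<rparr>)"

definition comonadic_on_the_nose ::
    "('o, 'f, 't) two_cat \<Rightarrow> ('o, 'f, 't) coalg_choice \<Rightarrow> ('f, 't) adj \<Rightarrow> bool" where
  "comonadic_on_the_nose K c J \<longleftrightarrow> adjunction K J \<and>
     Carrier (c (adj_comonad K J)) = Dom (One K) (LAdj J) \<and>
     comparison K (c (adj_comonad K J)) J = Idn (One K) (Dom (One K) (LAdj J))"

definition map_comonad ::
    "('o, 'f, 't, 'p, 'g, 's) two_fct \<Rightarrow> ('o, 'f, 't) cmnd \<Rightarrow> ('p, 'g, 's) cmnd" where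
  "map_comonad \<Phi> W = \<lparr>Base = F0 \<Phi> (Base W), Endo = F1 \<Phi> (Endo W),
     Counit = F2 \<Phi> (Counit W), Comult = F2 \<Phi> (Comult W)\<rparr>"

definition map_adj :: "('o, 'f, 't, 'p, 'g, 's) two_fct \<Rightarrow> ('f, 't) adj \<Rightarrow> ('g, 's) adj" where
  "map_adj \<Phi> J = \<lparr>LAdj = F1 \<Phi> (LAdj J), RAdj = F1 \<Phi> (RAdj J),
     AUnit = F2 \<Phi> (AUnit J), ACounit = F2 \<Phi> (ACounit J)\<rparr>"

definition preserves_coalgebras_on_the_nose ::
    "('o, 'f, 't) two_cat \<Rightarrow> ('o, 'f, 't) coalg_choice \<Rightarrow>
     ('p, 'g, 's) two_cat \<Rightarrow> ('p, 'g, 's) coalg_choice \<Rightarrow>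
     ('o, 'f, 't, 'p, 'g, 's) two_fct \<Rightarrow> bool" where
  "preserves_coalgebras_on_the_nose K cK L cL \<Phi> \<longleftrightarrow>
     (\<forall>W. comonad K W \<longrightarrow>
        adj_comonad L (map_adj \<Phi> (coalg_adj K W (cK W))) = map_comonad \<Phi> W \<and>
        comonadic_on_the_nose L cL (map_adj \<Phi> (coalg_adj K W (cK W))))"

text \<open>
  The choice \<open>cL\<close> of objects of coalgebras in \<open>L\<close> is a parameter, as \<open>L\<close> will come with a
  standard one; in \<open>K\<close> some choice has to exist.
\<close>

definition admits_coalgebras_over ::
    "('o, 'f, 't) two_cat \<Rightarrow> ('p, 'g, 's) two_cat \<Rightarrow> ('p, 'g, 's) coalg_choice \<Rightarrow>
     ('o, 'f, 't, 'p, 'g, 's) two_fct \<Rightarrow> bool" where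
  "admits_coalgebras_over K L cL \<Phi> \<longleftrightarrow>
     admits_coalgebras K \<and> admits_coalgebras L \<and> strict_2_functor K L \<Phi> \<and> chosen_coalgebras L cL \<and>
     (\<exists>cK. chosen_coalgebras K cK \<and> preserves_coalgebras_on_the_nose K cK L cL \<Phi>)"


section \<open>The 2-category of small categories and its categories of coalgebras\<close>

text \<open>Small categories are those whose objects and arrows form subsets of the type \<open>'u\<close>.\<close>

type_synonym 'u scat = "('u, 'u) cat"
type_synonym 'u sfct = "('u, 'u, 'u, 'u) fct"
type_synonym 'u sntr = "('u, 'u, 'u, 'u) ntr"

definition CAT :: "('u scat, 'u sfct, 'u sntr) two_cat" where
  "CAT =
    \<lparr>One = mkcat {C. category C} {F. fctr F} Src Tgt fct_id fct_comp,
     Two = mkcat {F. fctr F} {\<alpha>. ntrans \<alpha>} NSrc NTgt ntid ntvcomp,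
     HCmp = partial_comp {\<alpha>. ntrans \<alpha>} (Src \<circ> NSrc) (Tgt \<circ> NSrc) nthcomp\<rparr>"

text \<open>
  The construction of coalgebras needs the universe to be closed under pairing; this is the closure
  of \<open>'a\<close> under pairing. A coalgebra is the pair of its carrier and its structure map; the arrows
  are tagged with their domain and codomain.
\<close>

datatype 'a univ = Atom 'a | Tup (tfst: "'a univ") (tsnd: "'a univ")

definition coalgebras ::
    "('a univ scat, 'a univ sfct, 'a univ sntr) cmnd \<Rightarrow> 'a univ set" where
  "coalgebras W = {Tup A a | A a. A \<in> Obj (Base W) \<and> a \<in> hom (Base W) A (Fob (Endo W) A) \<and>
     At (Counit W) A \<cdot>\<^bsub>Base W\<^esub> a = Idn (Base W) A \<and>
     At (Comult W) A \<cdot>\<^bsub>Base W\<^esub> a = Far (Endo W) a \<cdot>\<^bsub>Base W\<^esub> a}"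

definition EM :: "('a univ scat, 'a univ sfct, 'a univ sntr) cmnd \<Rightarrow> 'a univ scat" where
  "EM W = mkcat (coalgebras W)
     {Tup X (Tup Y f) | X Y f. X \<in> coalgebras W \<and> Y \<in> coalgebras W \<and>
        f \<in> hom (Base W) (tfst X) (tfst Y) \<and>
        Far (Endo W) f \<cdot>\<^bsub>Base W\<^esub> tsnd X = tsnd Y \<cdot>\<^bsub>Base W\<^esub> f}
     tfst (tfst \<circ> tsnd) (\<lambda>X. Tup X (Tup X (Idn (Base W) (tfst X))))
     (\<lambda>n m. Tup (tfst m) (Tup (tfst (tsnd n)) (tsnd (tsnd n) \<cdot>\<^bsub>Base W\<^esub> tsnd (tsnd m))))"

definition EM_forget :: "('a univ scat, 'a univ sfct, 'a univ sntr) cmnd \<Rightarrow> 'a univ sfct" where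
  "EM_forget W = \<lparr>Src = EM W, Tgt = Base W,
     Fob = restrict tfst (Obj (EM W)), Far = restrict (tsnd \<circ> tsnd) (Arr (EM W))\<rparr>"

definition EM_coaction ::
    "('a univ scat, 'a univ sfct, 'a univ sntr) cmnd \<Rightarrow>
     ('a univ scat, 'a univ sfct, 'a univ sntr) cmor" where
  "EM_coaction W = \<lparr>CSrc = id_comonad CAT (EM W), CTgt = W, CMap = EM_forget W,
     CCell = \<lparr>NSrc = EM_forget W, NTgt = fct_comp (Endo W) (EM_forget W),
              At = restrict tsnd (Obj (EM W))\<rparr>\<rparr>"

definition EM_choice :: "('a univ scat, 'a univ sfct, 'a univ sntr) coalg_choice" where
  "EM_choice W = \<lparr>Carrier = EM W,
     Iso = (\<lambda>D. \<lparr>Src = homcat CAT D (EM W), Tgt = homcat (Comon CAT) (id_comonad CAT D) W,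
       Fob = (\<lambda>G\<in>Obj (homcat CAT D (EM W)). EM_coaction W \<cdot>\<^bsub>One (Comon CAT)\<^esub> id_comonad1 CAT G),
       Far = (\<lambda>\<theta>\<in>Arr (homcat CAT D (EM W)).
         lwhisker (Comon CAT) (EM_coaction W) (id_comonad2 CAT \<theta>))\<rparr>)\<rparr>"


section \<open>Display categories\<close>

definition pullback :: "('o, 'a) cat \<Rightarrow> 'a \<Rightarrow> 'a \<Rightarrow> 'a \<Rightarrow> 'a \<Rightarrow> bool" where
  "pullback C p f p' q \<longleftrightarrow>
     p \<in> Arr C \<and> f \<in> Arr C \<and> p' \<in> Arr C \<and> q \<in> Arr C \<and> Cod C p = Cod C f \<and>
     Cod C p' = Dom C f \<and> Cod C q = Dom C p \<and> Dom C p' = Dom C q \<and>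
     p \<cdot>\<^bsub>C\<^esub> q = f \<cdot>\<^bsub>C\<^esub> p' \<and>
     (\<forall>a\<in>Arr C. \<forall>b\<in>Arr C. Cod C a = Dom C f \<longrightarrow> Cod C b = Dom C p \<longrightarrow> Dom C a = Dom C b \<longrightarrow>
        p \<cdot>\<^bsub>C\<^esub> b = f \<cdot>\<^bsub>C\<^esub> a \<longrightarrow>
        (\<exists>!w. w \<in> hom C (Dom C a) (Dom C p') \<and> p' \<cdot>\<^bsub>C\<^esub> w = a \<and> q \<cdot>\<^bsub>C\<^esub> w = b))"

text \<open>\<open>Pb p f\<close> consists of the two legs of the chosen pullback of \<open>p\<close> along \<open>f\<close>.\<close>

record 'u dcat =
  UCat :: "'u scat"
  Disp :: "'u set"
  Pb :: "'u \<Rightarrow> 'u \<Rightarrow> 'u \<times> 'u"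

locale display_category =
  fixes D :: "('u, 'z) dcat_scheme"
  assumes ucat: "category (UCat D)"
    and disp_arr: "Disp D \<subseteq> Arr (UCat D)"
    and pb_disp: "p \<in> Disp D \<Longrightarrow> f \<in> Arr (UCat D) \<Longrightarrow> Cod (UCat D) f = Cod (UCat D) p \<Longrightarrow>
      fst (Pb D p f) \<in> Disp D"
    and pb: "p \<in> Disp D \<Longrightarrow> f \<in> Arr (UCat D) \<Longrightarrow> Cod (UCat D) f = Cod (UCat D) p \<Longrightarrow>
      pullback (UCat D) p f (fst (Pb D p f)) (snd (Pb D p f))"
    and iso_disp: "p \<in> Disp D \<Longrightarrow> iso (UCat D) i \<Longrightarrow> Dom (UCat D) i = Cod (UCat D) p \<Longrightarrow>
      i \<cdot>\<^bsub>UCat D\<^esub> p \<in> Disp D"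
    and disp_iso: "p \<in> Disp D \<Longrightarrow> iso (UCat D) i \<Longrightarrow> Cod (UCat D) i = Dom (UCat D) p \<Longrightarrow>
      p \<cdot>\<^bsub>UCat D\<^esub> i \<in> Disp D"
    and pb_ext: "\<not> (p \<in> Disp D \<and> f \<in> Arr (UCat D) \<and> Cod (UCat D) f = Cod (UCat D) p) \<Longrightarrow>
      Pb D p f = undefined"

definition disp_over :: "('u, 'z) dcat_scheme \<Rightarrow> 'u \<Rightarrow> ('u, 'u \<times> 'u \<times> 'u) cat" where
  "disp_over D \<Gamma> = full_subcat (slice (UCat D) \<Gamma>) (Disp D)"

definition display_functor ::
    "('u, 'z) dcat_scheme \<Rightarrow> ('u, 'z) dcat_scheme \<Rightarrow> 'u sfct \<Rightarrow> bool" where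
  "display_functor D E F \<longleftrightarrow> fctr F \<and> Src F = UCat D \<and> Tgt F = UCat E \<and>
     Far F ` Disp D \<subseteq> Disp E \<and>
     (\<forall>p\<in>Disp D. \<forall>f p' q. pullback (UCat D) p f p' q \<longrightarrow>
        pullback (UCat E) (Far F p) (Far F f) (Far F p') (Far F q))"


section \<open>Natural models\<close>

text \<open>
  Indexed categories are functors from the opposite category to the category \<open>One CAT\<close> of small
  categories. \<open>Pj \<Gamma> A\<close> is the display \<open>p\<^sub>A\<close>, whose domain is \<open>\<Gamma>.A\<close>, and \<open>Vr \<Gamma> A\<close> is \<open>v\<^sub>A\<close>.
\<close>

type_synonym 'u icat = "('u, 'u, 'u scat, 'u sfct) fct"
type_synonym 'u ifct = "('u, 'u, 'u scat, 'u sfct) ntr"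

record 'u nm = "'u dcat" +
  Tp :: "'u icat"
  Tm :: "'u icat"
  Pr :: "'u ifct"
  Pj :: "'u \<Rightarrow> 'u \<Rightarrow> 'u"
  Vr :: "'u \<Rightarrow> 'u \<Rightarrow> 'u"

abbreviation obj_sub :: "'u icat \<Rightarrow> 'u \<Rightarrow> 'u \<Rightarrow> 'u" where
  "obj_sub T A u \<equiv> Fob (Far T u) A"

abbreviation arr_sub :: "'u icat \<Rightarrow> 'u \<Rightarrow> 'u \<Rightarrow> 'u" where
  "arr_sub T f u \<equiv> Far (Far T u) f"

definition ctx_ext :: "'u nm \<Rightarrow> 'u \<Rightarrow> 'u \<Rightarrow> 'u" where
  "ctx_ext M \<Gamma> A = Dom (UCat M) (Pj M \<Gamma> A)"

locale pre_natural_model =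
  fixes M :: "'u nm"
  assumes dcat: "display_category M"
    and tp: "fctr (Tp M)" "Src (Tp M) = opcat (UCat M)" "Tgt (Tp M) = One CAT"
    and tm: "fctr (Tm M)" "Src (Tm M) = opcat (UCat M)" "Tgt (Tm M) = One CAT"
    and pr: "ntrans (Pr M)" "NSrc (Pr M) = Tm M" "NTgt (Pr M) = Tp M"
    and pr_opfib: "\<Gamma> \<in> Obj (UCat M) \<Longrightarrow> discrete_opfibration (At (Pr M) \<Gamma>)"
    and pj: "\<Gamma> \<in> Obj (UCat M) \<Longrightarrow> A \<in> Obj (Fob (Tp M) \<Gamma>) \<Longrightarrow>
      Pj M \<Gamma> A \<in> Disp M \<and> Cod (UCat M) (Pj M \<Gamma> A) = \<Gamma>"
    and vr: "\<Gamma> \<in> Obj (UCat M) \<Longrightarrow> A \<in> Obj (Fob (Tp M) \<Gamma>) \<Longrightarrow>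
      Vr M \<Gamma> A \<in> Obj (Fob (Tm M) (ctx_ext M \<Gamma> A)) \<and>
      Fob (At (Pr M) (ctx_ext M \<Gamma> A)) (Vr M \<Gamma> A) = obj_sub (Tp M) A (Pj M \<Gamma> A)"
    and representable: "\<Gamma> \<in> Obj (UCat M) \<Longrightarrow> A \<in> Obj (Fob (Tp M) \<Gamma>) \<Longrightarrow>
      u \<in> hom (UCat M) \<Delta> \<Gamma> \<Longrightarrow> t \<in> Obj (Fob (Tm M) \<Delta>) \<Longrightarrow>
      Fob (At (Pr M) \<Delta>) t = obj_sub (Tp M) A u \<Longrightarrow>
      \<exists>!w. w \<in> hom (UCat M) \<Delta> (ctx_ext M \<Gamma> A) \<and>
        Pj M \<Gamma> A \<cdot>\<^bsub>UCat M\<^esub> w = u \<and> obj_sub (Tm M) (Vr M \<Gamma> A) w = t"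
    and pj_vr_ext: "\<not> (\<Gamma> \<in> Obj (UCat M) \<and> A \<in> Obj (Fob (Tp M) \<Gamma>)) \<Longrightarrow>
      Pj M \<Gamma> A = undefined \<and> Vr M \<Gamma> A = undefined"

definition ext_map :: "'u nm \<Rightarrow> 'u \<Rightarrow> 'u \<Rightarrow> 'u" where
  "ext_map M \<Gamma> f = (let A = Dom (Fob (Tp M) \<Gamma>) f; B = Cod (Fob (Tp M) \<Gamma>) f in
     THE h. h \<in> hom (UCat M) (ctx_ext M \<Gamma> A) (ctx_ext M \<Gamma> B) \<and> Pj M \<Gamma> B \<cdot>\<^bsub>UCat M\<^esub> h = Pj M \<Gamma> A \<and>
       obj_sub (Tm M) (Vr M \<Gamma> B) h
       = Cod (Fob (Tm M) (ctx_ext M \<Gamma> A))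
           (oplift (At (Pr M) (ctx_ext M \<Gamma> A)) (Vr M \<Gamma> A) (arr_sub (Tp M) f (Pj M \<Gamma> A))))"

definition comprehension :: "'u nm \<Rightarrow> 'u \<Rightarrow> ('u, 'u, 'u, 'u \<times> 'u \<times> 'u) fct" where
  "comprehension M \<Gamma> = \<lparr>Src = Fob (Tp M) \<Gamma>, Tgt = disp_over M \<Gamma>,
     Fob = (\<lambda>A\<in>Obj (Fob (Tp M) \<Gamma>). Pj M \<Gamma> A),
     Far = (\<lambda>f\<in>Arr (Fob (Tp M) \<Gamma>). (Pj M \<Gamma> (Dom (Fob (Tp M) \<Gamma>) f), Pj M \<Gamma> (Cod (Fob (Tp M) \<Gamma>) f),
       ext_map M \<Gamma> f))\<rparr>"

locale natural_model = pre_natural_model M for M :: "'u nm" +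
  assumes comprehension_equiv: "\<Gamma> \<in> Obj (UCat M) \<Longrightarrow> cat_equivalence (comprehension M \<Gamma>)"

record 'u nmor =
  MSrc :: "'u nm"
  MTgt :: "'u nm"
  MFun :: "'u sfct"
  MTp :: "'u ifct"
  MTm :: "'u ifct"

locale pre_nm_mor =
  fixes m :: "'u nmor"
  assumes msrc: "pre_natural_model (MSrc m)"
    and mtgt: "pre_natural_model (MTgt m)"
    and mfun: "display_functor (MSrc m) (MTgt m) (MFun m)"
    and mtp: "ntrans (MTp m)" "NSrc (MTp m) = Tp (MSrc m)"
      "NTgt (MTp m) = fct_comp (Tp (MTgt m)) (fct_op (MFun m))"
    and mtm: "ntrans (MTm m)" "NSrc (MTm m) = Tm (MSrc m)"
      "NTgt (MTm m) = fct_comp (Tm (MTgt m)) (fct_op (MFun m))"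
    and commutes: "\<Gamma> \<in> Obj (UCat (MSrc m)) \<Longrightarrow>
      fct_comp (At (Pr (MTgt m)) (Fob (MFun m) \<Gamma>)) (At (MTm m) \<Gamma>)
      = fct_comp (At (MTp m) \<Gamma>) (At (Pr (MSrc m)) \<Gamma>)"

definition canonical_map :: "'u nmor \<Rightarrow> 'u \<Rightarrow> 'u \<Rightarrow> 'u" where
  "canonical_map m \<Gamma> A =
     (let F = MFun m; N = MTgt m; \<Gamma>A = ctx_ext (MSrc m) \<Gamma> A; F\<Gamma> = Fob F \<Gamma>; FA = Fob (At (MTp m) \<Gamma>) A in
      THE h. h \<in> hom (UCat N) (Fob F \<Gamma>A) (ctx_ext N F\<Gamma> FA) \<and>
        Pj N F\<Gamma> FA \<cdot>\<^bsub>UCat N\<^esub> h = Far F (Pj (MSrc m) \<Gamma> A) \<and>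
        obj_sub (Tm N) (Vr N F\<Gamma> FA) h = Fob (At (MTm m) \<Gamma>A) (Vr (MSrc m) \<Gamma> A))"

locale nm_mor = pre_nm_mor m for m :: "'u nmor" +
  assumes nm_src: "natural_model (MSrc m)"
    and nm_tgt: "natural_model (MTgt m)"
    and canonical_iso: "\<Gamma> \<in> Obj (UCat (MSrc m)) \<Longrightarrow> A \<in> Obj (Fob (Tp (MSrc m)) \<Gamma>) \<Longrightarrow>
      iso (UCat (MTgt m)) (canonical_map m \<Gamma> A)"

definition nmor_id :: "'u nm \<Rightarrow> 'u nmor" where
  "nmor_id M = \<lparr>MSrc = M, MTgt = M, MFun = fct_id (UCat M), MTp = ntid (Tp M), MTm = ntid (Tm M)\<rparr>"

definition nmor_comp :: "'u nmor \<Rightarrow> 'u nmor \<Rightarrow> 'u nmor" where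
  "nmor_comp n m = \<lparr>MSrc = MSrc m, MTgt = MTgt n, MFun = fct_comp (MFun n) (MFun m),
     MTp = \<lparr>NSrc = Tp (MSrc m), NTgt = fct_comp (Tp (MTgt n)) (fct_op (fct_comp (MFun n) (MFun m))),
       At = (\<lambda>\<Gamma>\<in>Obj (UCat (MSrc m)). fct_comp (At (MTp n) (Fob (MFun m) \<Gamma>)) (At (MTp m) \<Gamma>))\<rparr>,
     MTm = \<lparr>NSrc = Tm (MSrc m), NTgt = fct_comp (Tm (MTgt n)) (fct_op (fct_comp (MFun n) (MFun m))),
       At = (\<lambda>\<Gamma>\<in>Obj (UCat (MSrc m)). fct_comp (At (MTm n) (Fob (MFun m) \<Gamma>)) (At (MTm m) \<Gamma>))\<rparr>\<rparr>"

record 'u nmor2 =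
  M2Src :: "'u nmor"
  M2Tgt :: "'u nmor"
  M2Nt :: "'u sntr"
  M2Tp :: "'u \<Rightarrow> 'u sntr"
  M2Tm :: "'u \<Rightarrow> 'u sntr"

text \<open>
  For indexed functors \<open>a : S \<rightarrow> T F\<^sup>o\<^sup>p\<close>, \<open>b : S \<rightarrow> T G\<^sup>o\<^sup>p\<close> and \<open>\<alpha> : F \<Rightarrow> G\<close>: \<open>\<tau>\<close> is an indexed natural
  transformation from \<open>a\<close> to the composite of \<open>b\<close> with reindexing along \<open>\<alpha>\<close>.
\<close>

locale indexed_ntrans =
  fixes S T :: "'u icat" and \<alpha> :: "'u sntr" and a b :: "'u ifct" and \<tau> :: "'u \<Rightarrow> 'u sntr"
  assumes components: "\<Gamma> \<in> Obj (Src (NSrc \<alpha>)) \<Longrightarrow> ntrans (\<tau> \<Gamma>) \<and>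
      NSrc (\<tau> \<Gamma>) = At a \<Gamma> \<and> NTgt (\<tau> \<Gamma>) = fct_comp (Far T (At \<alpha> \<Gamma>)) (At b \<Gamma>)"
    and indexed: "u \<in> Arr (Src (NSrc \<alpha>)) \<Longrightarrow> A \<in> Obj (Fob S (Cod (Src (NSrc \<alpha>)) u)) \<Longrightarrow>
      At (\<tau> (Dom (Src (NSrc \<alpha>)) u)) (obj_sub S A u)
      = arr_sub T (At (\<tau> (Cod (Src (NSrc \<alpha>)) u)) A) (Far (NSrc \<alpha>) u)"
    and tau_ext: "\<tau> \<in> extensional (Obj (Src (NSrc \<alpha>)))"

locale nm_mor2 =
  fixes \<theta> :: "'u nmor2"
  assumes m2src: "nm_mor (M2Src \<theta>)"
    and m2tgt: "nm_mor (M2Tgt \<theta>)"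
    and m2same: "MSrc (M2Tgt \<theta>) = MSrc (M2Src \<theta>)" "MTgt (M2Tgt \<theta>) = MTgt (M2Src \<theta>)"
    and m2nt: "ntrans (M2Nt \<theta>)" "NSrc (M2Nt \<theta>) = MFun (M2Src \<theta>)" "NTgt (M2Nt \<theta>) = MFun (M2Tgt \<theta>)"
    and m2tp: "indexed_ntrans (Tp (MSrc (M2Src \<theta>))) (Tp (MTgt (M2Src \<theta>))) (M2Nt \<theta>)
      (MTp (M2Src \<theta>)) (MTp (M2Tgt \<theta>)) (M2Tp \<theta>)"
    and m2tm: "indexed_ntrans (Tm (MSrc (M2Src \<theta>))) (Tm (MTgt (M2Src \<theta>))) (M2Nt \<theta>)
      (MTm (M2Src \<theta>)) (MTm (M2Tgt \<theta>)) (M2Tm \<theta>)"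
    and m2compat: "\<Gamma> \<in> Obj (UCat (MSrc (M2Src \<theta>))) \<Longrightarrow> t \<in> Obj (Fob (Tm (MSrc (M2Src \<theta>))) \<Gamma>) \<Longrightarrow>
      Far (At (Pr (MTgt (M2Src \<theta>))) (Fob (MFun (M2Src \<theta>)) \<Gamma>)) (At (M2Tm \<theta> \<Gamma>) t)
      = At (M2Tp \<theta> \<Gamma>) (Fob (At (Pr (MSrc (M2Src \<theta>))) \<Gamma>) t)"

definition nmor2_id :: "'u nmor \<Rightarrow> 'u nmor2" where
  "nmor2_id m = \<lparr>M2Src = m, M2Tgt = m, M2Nt = ntid (MFun m),
     M2Tp = (\<lambda>\<Gamma>\<in>Obj (UCat (MSrc m)). ntid (At (MTp m) \<Gamma>)),
     M2Tm = (\<lambda>\<Gamma>\<in>Obj (UCat (MSrc m)). ntid (At (MTm m) \<Gamma>))\<rparr>"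

text \<open>
  On types, the vertical composite of \<open>\<theta> : F \<Rightarrow> G\<close> and \<open>\<phi> : G \<Rightarrow> H\<close> has components
  \<open>\<phi>\<^sub>A[\<theta>\<^sub>\<Gamma>] \<circ> \<theta>\<^sub>A\<close>, and the horizontal composite of \<open>\<theta> : F \<Rightarrow> G\<close> and \<open>\<phi> : H \<Rightarrow> L\<close> has components
  \<open>\<phi>\<^sub>G\<^sub>A[H \<theta>\<^sub>\<Gamma>] \<circ> H \<theta>\<^sub>A\<close>; likewise on terms. The selectors \<open>T\<close>, \<open>mT\<close>, \<open>m2T\<close> are those for either types
  or terms.
\<close>

definition indexed_vcomp ::
    "('u nm \<Rightarrow> 'u icat) \<Rightarrow> ('u nmor \<Rightarrow> 'u ifct) \<Rightarrow> ('u nmor2 \<Rightarrow> 'u \<Rightarrow> 'u sntr) \<Rightarrow>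
     'u nmor2 \<Rightarrow> 'u nmor2 \<Rightarrow> 'u \<Rightarrow> 'u sntr" where
  "indexed_vcomp T mT m2T \<phi> \<theta> =
     (let F = M2Src \<theta>; H = M2Tgt \<phi>; M = MSrc F; N = MTgt F in
      (\<lambda>\<Gamma>\<in>Obj (UCat M).
        \<lparr>NSrc = At (mT F) \<Gamma>,
         NTgt = fct_comp (Far (T N) (At (ntvcomp (M2Nt \<phi>) (M2Nt \<theta>)) \<Gamma>)) (At (mT H) \<Gamma>),
         At = (\<lambda>A\<in>Obj (Fob (T M) \<Gamma>).
           arr_sub (T N) (At (m2T \<phi> \<Gamma>) A) (At (M2Nt \<theta>) \<Gamma>)
           \<cdot>\<^bsub>Fob (T N) (Fob (MFun F) \<Gamma>)\<^esub> At (m2T \<theta> \<Gamma>) A)\<rparr>))"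

definition indexed_hcomp ::
    "('u nm \<Rightarrow> 'u icat) \<Rightarrow> ('u nmor \<Rightarrow> 'u ifct) \<Rightarrow> ('u nmor2 \<Rightarrow> 'u \<Rightarrow> 'u sntr) \<Rightarrow>
     'u nmor2 \<Rightarrow> 'u nmor2 \<Rightarrow> 'u \<Rightarrow> 'u sntr" where
  "indexed_hcomp T mT m2T \<phi> \<theta> =
     (let F = M2Src \<theta>; G = M2Tgt \<theta>; H = M2Src \<phi>; L = M2Tgt \<phi>; M = MSrc F; N = MTgt H in
      (\<lambda>\<Gamma>\<in>Obj (UCat M).
        \<lparr>NSrc = fct_comp (At (mT H) (Fob (MFun F) \<Gamma>)) (At (mT F) \<Gamma>),
         NTgt = fct_comp (Far (T N) (At (nthcomp (M2Nt \<phi>) (M2Nt \<theta>)) \<Gamma>))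
           (fct_comp (At (mT L) (Fob (MFun G) \<Gamma>)) (At (mT G) \<Gamma>)),
         At = (\<lambda>A\<in>Obj (Fob (T M) \<Gamma>).
           arr_sub (T N) (At (m2T \<phi> (Fob (MFun G) \<Gamma>)) (Fob (At (mT G) \<Gamma>) A))
             (Far (MFun H) (At (M2Nt \<theta>) \<Gamma>))
           \<cdot>\<^bsub>Fob (T N) (Fob (MFun H) (Fob (MFun F) \<Gamma>))\<^esub>
           Far (At (mT H) (Fob (MFun F) \<Gamma>)) (At (m2T \<theta> \<Gamma>) A))\<rparr>))"

definition nmor2_vcomp :: "'u nmor2 \<Rightarrow> 'u nmor2 \<Rightarrow> 'u nmor2" where
  "nmor2_vcomp \<phi> \<theta> = \<lparr>M2Src = M2Src \<theta>, M2Tgt = M2Tgt \<phi>, M2Nt = ntvcomp (M2Nt \<phi>) (M2Nt \<theta>),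
     M2Tp = indexed_vcomp Tp MTp M2Tp \<phi> \<theta>, M2Tm = indexed_vcomp Tm MTm M2Tm \<phi> \<theta>\<rparr>"

definition nmor2_hcomp :: "'u nmor2 \<Rightarrow> 'u nmor2 \<Rightarrow> 'u nmor2" where
  "nmor2_hcomp \<phi> \<theta> = \<lparr>M2Src = nmor_comp (M2Src \<phi>) (M2Src \<theta>), M2Tgt = nmor_comp (M2Tgt \<phi>) (M2Tgt \<theta>),
     M2Nt = nthcomp (M2Nt \<phi>) (M2Nt \<theta>),
     M2Tp = indexed_hcomp Tp MTp M2Tp \<phi> \<theta>, M2Tm = indexed_hcomp Tm MTm M2Tm \<phi> \<theta>\<rparr>"

definition NM :: "('u nm, 'u nmor, 'u nmor2) two_cat" where
  "NM =
    \<lparr>One = mkcat {M. natural_model M} {m. nm_mor m} MSrc MTgt nmor_id nmor_comp,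
     Two = mkcat {m. nm_mor m} {\<theta>. nm_mor2 \<theta>} M2Src M2Tgt nmor2_id nmor2_vcomp,
     HCmp = partial_comp {\<theta>. nm_mor2 \<theta>} (MSrc \<circ> M2Src) (MTgt \<circ> M2Src) nmor2_hcomp\<rparr>"

definition NM_forget :: "('u nm, 'u nmor, 'u nmor2, 'u scat, 'u sfct, 'u sntr) two_fct" where
  "NM_forget = \<lparr>F0 = UCat, F1 = MFun, F2 = M2Nt\<rparr>"

end

theory Submission imports Defs begin

text \<open>A comonad \<open>\<box>\<close> on a natural model induces, for every coalgebra \<open>(\<Gamma>, \<gamma>)\<close> of the base
  comonad, comonads \<open>A \<mapsto> (\<box>A)[\<gamma>]\<close> on the types and the terms over \<open>\<Gamma>\<close>, and substitution along a
  coalgebra map is a strict map of these comonads. The types and terms over \<open>(\<Gamma>, \<gamma>)\<close> in the natural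
  model of coalgebras are the coalgebras of the fibrewise comonads. Since \<open>\<box>\<close> preserves context
  extensions and pullbacks of displays up to isomorphism, both lift uniquely to coalgebras: the coaction
  on \<open>\<Gamma>.A\<close> classifies the pushforward of \<open>\<box>v\<^bsub>A\<^esub>\<close> along the structure map of \<open>A\<close>. Discreteness of
  \<open>p\<close> makes the lifted terms coalgebras automatically. The universal property is then that of the
  categories of coalgebras in each fibre. In any 2-category an object of coalgebras, its adjunction and
  its preservation on the nose are determined by a universal coaction, which reduces the theorem to that
  property.\<close>

section \<open>Categories, functors and the 2-category of categories\<close>

text \<open>The fibrewise comonads exist because a coaction \<gamma> undoes the indexing: the counit
  has components \<box>A -> A[\<epsilon>], and substituting \<gamma> gives (\<box>A)[\<gamma>] -> A
  since \<epsilon>\<gamma> = id; the comultiplication is treated likewise, by \<delta>\<gamma> =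
  (\<box>\<gamma>)\<gamma>. That comprehension is an equivalence leads back from displays to types:
  a display of coalgebras is in M the extension by some type A, and full faithfulness recovers the
  structure map of A from the coaction on the total object. The obstacle is that morphisms preserve
  extensions only up to isomorphism, whereas the universal property and the comparison are
  equalities. Chosen extensions are therefore replaced by the choice-free predicate
  \<open>is_ext\<close>; morphisms see the choices of extensions and pullbacks only up to
  isomorphism, so those of coalgebras may be arbitrary. Category, forgetful functor and coaction
  underlying the model of coalgebras are literally those in \<open>CAT\<close>, so the forgetful
  2-functor sends one universal coaction to the other and no comparison isomorphism has to be
  corrected.\<close>

lemma mkcat_simps [simp]:
  "Obj (mkcat X A d c i m) = X" "Arr (mkcat X A d c i m) = A"
  "Dom (mkcat X A d c i m) = restrict d A" "Cod (mkcat X A d c i m) = restrict c A"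
  "Idn (mkcat X A d c i m) = restrict i X" "Cmp (mkcat X A d c i m) = partial_comp A d c m"
  by (simp_all add: mkcat_def)

text \<open>Extensionality holds by construction, because \<open>mkcat\<close> restricts every
  operation to its domain. What remains are the laws for the raw operations on genuine
  arrows.\<close>

lemma category_mkcat:
  assumes "\<And>f. f \<in> A \<Longrightarrow> d f \<in> X" "\<And>f. f \<in> A \<Longrightarrow> c f \<in> X"
    "\<And>x. x \<in> X \<Longrightarrow> i x \<in> A" "\<And>x. x \<in> X \<Longrightarrow> d (i x) = x" "\<And>x. x \<in> X \<Longrightarrow> c (i x) = x"
    "\<And>f g. f \<in> A \<Longrightarrow> g \<in> A \<Longrightarrow> d g = c f \<Longrightarrow> m g f \<in> A"
    "\<And>f g. f \<in> A \<Longrightarrow> g \<in> A \<Longrightarrow> d g = c f \<Longrightarrow> d (m g f) = d f"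
    "\<And>f g. f \<in> A \<Longrightarrow> g \<in> A \<Longrightarrow> d g = c f \<Longrightarrow> c (m g f) = c g"
    "\<And>f. f \<in> A \<Longrightarrow> m (i (c f)) f = f" "\<And>f. f \<in> A \<Longrightarrow> m f (i (d f)) = f"
    "\<And>f g h. f \<in> A \<Longrightarrow> g \<in> A \<Longrightarrow> h \<in> A \<Longrightarrow> d g = c f \<Longrightarrow> d h = c g \<Longrightarrow>
      m (m h g) f = m h (m g f)"
  shows "category (mkcat X A d c i m)"
  by unfold_locales (auto simp add: assms partial_comp_def)

declare category.dom_closed [simp] category.cod_closed [simp] category.idn_arr [simp]
  category.idn_dom [simp] category.idn_cod [simp] category.cmp_arr [simp] category.cmp_dom [simp]
  category.cmp_cod [simp] category.assoc [simp]

lemma idn_left' [simp]: "category C \<Longrightarrow> f \<in> Arr C \<Longrightarrow> Cod C f = A \<Longrightarrow> Idn C A \<cdot>\<^bsub>C\<^esub> f = f"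
  by (drule (1) category.idn_left) simp

lemma idn_right' [simp]: "category C \<Longrightarrow> f \<in> Arr C \<Longrightarrow> Dom C f = A \<Longrightarrow> f \<cdot>\<^bsub>C\<^esub> Idn C A = f"
  by (drule (1) category.idn_right) simp

lemma homD: "f \<in> hom C A B \<Longrightarrow> f \<in> Arr C" "f \<in> hom C A B \<Longrightarrow> Dom C f = A" "f \<in> hom C A B \<Longrightarrow> Cod C f = B"
  by (auto simp: hom_def)

lemma category_opcat [simp]: "category C \<Longrightarrow> category (opcat C)"
  by (intro category.intro) (auto simp: opcat_def category.cmp_ext category.dom_ext category.cod_ext category.idn_ext)

lemma opcat_simps [simp]:
  "Obj (opcat C) = Obj C" "Arr (opcat C) = Arr C" "Dom (opcat C) = Cod C" "Cod (opcat C) = Dom C"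
  "Idn (opcat C) = Idn C" "Cmp (opcat C) g f = Cmp C f g"
  by (simp_all add: opcat_def)

declare fctr.src_cat [simp] fctr.tgt_cat [simp]

lemma fct_simps [simp]:
  "fctr F \<Longrightarrow> Tgt F = D \<Longrightarrow> A \<in> Obj (Src F) \<Longrightarrow> Fob F A \<in> Obj D"
  "fctr F \<Longrightarrow> Tgt F = D \<Longrightarrow> f \<in> Arr (Src F) \<Longrightarrow> Far F f \<in> Arr D"
  "fctr F \<Longrightarrow> Tgt F = D \<Longrightarrow> f \<in> Arr (Src F) \<Longrightarrow> Dom D (Far F f) = Fob F (Dom (Src F) f)"
  "fctr F \<Longrightarrow> Tgt F = D \<Longrightarrow> f \<in> Arr (Src F) \<Longrightarrow> Cod D (Far F f) = Fob F (Cod (Src F) f)"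
  "fctr F \<Longrightarrow> Src F = C \<Longrightarrow> A \<in> Obj C \<Longrightarrow> Far F (Idn C A) = Idn (Tgt F) (Fob F A)"
  "fctr F \<Longrightarrow> Src F = C \<Longrightarrow> f \<in> Arr C \<Longrightarrow> g \<in> Arr C \<Longrightarrow> Dom C g = Cod C f \<Longrightarrow>
    Far F (g \<cdot>\<^bsub>C\<^esub> f) = Far F g \<cdot>\<^bsub>Tgt F\<^esub> Far F f"
  using fctr.fob fctr.far[of F f] fctr.pres_idn fctr.pres_cmp by (auto simp: hom_def)

lemma fctrI:
  assumes "category C" "category D" "\<And>A. A \<in> Obj C \<Longrightarrow> fo A \<in> Obj D"
    "\<And>f. f \<in> Arr C \<Longrightarrow> fa f \<in> Arr D"
    "\<And>f. f \<in> Arr C \<Longrightarrow> Dom D (fa f) = fo (Dom C f)"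
    "\<And>f. f \<in> Arr C \<Longrightarrow> Cod D (fa f) = fo (Cod C f)"
    "\<And>A. A \<in> Obj C \<Longrightarrow> fa (Idn C A) = Idn D (fo A)"
    "\<And>f g. f \<in> Arr C \<Longrightarrow> g \<in> Arr C \<Longrightarrow> Dom C g = Cod C f \<Longrightarrow> fa (g \<cdot>\<^bsub>C\<^esub> f) = fa g \<cdot>\<^bsub>D\<^esub> fa f"
  shows "fctr \<lparr>Src = C, Tgt = D, Fob = restrict fo (Obj C), Far = restrict fa (Arr C)\<rparr>"
  by (intro fctr.intro) (simp_all add: assms hom_def)

lemma fct_eqI:
  fixes F G :: "('o,'a,'p,'b) fct"
  assumes "fctr F" "fctr G" "Src F = Src G" "Tgt F = Tgt G"
    "\<And>A. A \<in> Obj (Src G) \<Longrightarrow> Fob F A = Fob G A" "\<And>f. f \<in> Arr (Src G) \<Longrightarrow> Far F f = Far G f"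
  shows "F = G"
proof -
  have "Fob F = Fob G"
    using fctr.fob_ext[OF assms(1)] fctr.fob_ext[OF assms(2)] assms(3,5) by (intro extensionalityI) auto
  moreover have "Far F = Far G"
    using fctr.far_ext[OF assms(1)] fctr.far_ext[OF assms(2)] assms(3,6) by (intro extensionalityI) auto
  ultimately show ?thesis using assms by simp
qed

lemma fct_id_simps [simp]:
  "Src (fct_id C) = C" "Tgt (fct_id C) = C" "A \<in> Obj C \<Longrightarrow> Fob (fct_id C) A = A"
  "f \<in> Arr C \<Longrightarrow> Far (fct_id C) f = f"
  by (simp_all add: fct_id_def)

lemma fctr_id [simp]: "category C \<Longrightarrow> fctr (fct_id C)"
  unfolding fct_id_def by (rule fctrI) auto

lemma fct_comp_simps [simp]:
  "Src (fct_comp G F) = Src F" "Tgt (fct_comp G F) = Tgt G"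
  "A \<in> Obj (Src F) \<Longrightarrow> Fob (fct_comp G F) A = Fob G (Fob F A)"
  "f \<in> Arr (Src F) \<Longrightarrow> Far (fct_comp G F) f = Far G (Far F f)"
  by (simp_all add: fct_comp_def compose_def)

lemma fctr_comp [simp]: "fctr F \<Longrightarrow> fctr G \<Longrightarrow> Src G = Tgt F \<Longrightarrow> fctr (fct_comp G F)"
  unfolding fct_comp_def compose_def by (rule fctrI) auto

lemma fct_op_simps [simp]:
  "Src (fct_op F) = opcat (Src F)" "Tgt (fct_op F) = opcat (Tgt F)" "Fob (fct_op F) = Fob F" "Far (fct_op F) = Far F"
  by (simp_all add: fct_op_def)

lemma fctr_op [simp]: "fctr F \<Longrightarrow> fctr (fct_op F)"
  by (intro fctr.intro) (auto simp: hom_def fctr.fob_ext fctr.far_ext)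

lemma fct_comp_id_left [simp]: "fctr F \<Longrightarrow> Tgt F = C \<Longrightarrow> fct_comp (fct_id C) F = F"
  by (rule fct_eqI) auto

lemma fct_comp_id_right [simp]: "fctr F \<Longrightarrow> Src F = C \<Longrightarrow> fct_comp F (fct_id C) = F"
  by (rule fct_eqI) auto

lemma fct_comp_assoc [simp]:
  "fctr F \<Longrightarrow> fctr G \<Longrightarrow> fctr H \<Longrightarrow> Src G = Tgt F \<Longrightarrow> Src H = Tgt G \<Longrightarrow>
    fct_comp (fct_comp H G) F = fct_comp H (fct_comp G F)"
  by (rule fct_eqI) auto

lemma fct_op_id [simp]: "category C \<Longrightarrow> fct_op (fct_id C) = fct_id (opcat C)"
  by (rule fct_eqI) auto

lemma fct_op_comp [simp]: "fctr F \<Longrightarrow> fctr G \<Longrightarrow> Src G = Tgt F \<Longrightarrow> fct_op (fct_comp G F) = fct_comp (fct_op G) (fct_op F)"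
  by (rule fct_eqI) auto

declare ntrans.nsrc [simp] ntrans.ntgt [simp]

lemma ntr_simps [simp]:
  "ntrans \<alpha> \<Longrightarrow> Src (NTgt \<alpha>) = Src (NSrc \<alpha>)"
  "ntrans \<alpha> \<Longrightarrow> Tgt (NTgt \<alpha>) = Tgt (NSrc \<alpha>)"
  "ntrans \<alpha> \<Longrightarrow> Tgt (NSrc \<alpha>) = D \<Longrightarrow> A \<in> Obj (Src (NSrc \<alpha>)) \<Longrightarrow> At \<alpha> A \<in> Arr D"
  "ntrans \<alpha> \<Longrightarrow> Tgt (NSrc \<alpha>) = D \<Longrightarrow> A \<in> Obj (Src (NSrc \<alpha>)) \<Longrightarrow> Dom D (At \<alpha> A) = Fob (NSrc \<alpha>) A"
  "ntrans \<alpha> \<Longrightarrow> Tgt (NSrc \<alpha>) = D \<Longrightarrow> A \<in> Obj (Src (NSrc \<alpha>)) \<Longrightarrow> Cod D (At \<alpha> A) = Fob (NTgt \<alpha>) A"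
  using ntrans.same_src ntrans.same_tgt ntrans.component[of \<alpha> A] by (auto simp: hom_def)

lemma ntransI:
  assumes "fctr F" "fctr G" "Src G = Src F" "Tgt G = Tgt F"
    "\<And>A. A \<in> Obj (Src F) \<Longrightarrow> a A \<in> Arr (Tgt F)"
    "\<And>A. A \<in> Obj (Src F) \<Longrightarrow> Dom (Tgt F) (a A) = Fob F A"
    "\<And>A. A \<in> Obj (Src F) \<Longrightarrow> Cod (Tgt F) (a A) = Fob G A"
    "\<And>f. f \<in> Arr (Src F) \<Longrightarrow>
      a (Cod (Src F) f) \<cdot>\<^bsub>Tgt F\<^esub> Far F f = Far G f \<cdot>\<^bsub>Tgt F\<^esub> a (Dom (Src F) f)"
    "X = Obj (Src F)"
  shows "ntrans \<lparr>NSrc = F, NTgt = G, At = restrict a X\<rparr>"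
  by (intro ntrans.intro) (simp_all add: assms hom_def)

lemma ntr_eqI:
  fixes \<alpha> \<beta> :: "('o,'a,'p,'b) ntr"
  assumes "ntrans \<alpha>" "ntrans \<beta>" "NSrc \<alpha> = NSrc \<beta>" "NTgt \<alpha> = NTgt \<beta>"
    "\<And>A. A \<in> Obj (Src (NSrc \<beta>)) \<Longrightarrow> At \<alpha> A = At \<beta> A"
  shows "\<alpha> = \<beta>"
proof -
  have "At \<alpha> = At \<beta>"
    using ntrans.at_ext[OF assms(1)] ntrans.at_ext[OF assms(2)] assms(3,5) by (intro extensionalityI) auto
  then show ?thesis using assms by simp
qed

lemma naturality:
  "ntrans \<alpha> \<Longrightarrow> Tgt (NSrc \<alpha>) = D \<Longrightarrow> Src (NSrc \<alpha>) = C \<Longrightarrow> f \<in> Arr C \<Longrightarrow> Dom C f = A \<Longrightarrow> Cod C f = B \<Longrightarrow>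
    Far (NTgt \<alpha>) f \<cdot>\<^bsub>D\<^esub> At \<alpha> A = At \<alpha> B \<cdot>\<^bsub>D\<^esub> Far (NSrc \<alpha>) f"
  using ntrans.natural by fastforce

lemma ntid_simps [simp]:
  "NSrc (ntid F) = F" "NTgt (ntid F) = F" "A \<in> Obj (Src F) \<Longrightarrow> At (ntid F) A = Idn (Tgt F) (Fob F A)"
  by (simp_all add: ntid_def)

lemma ntrans_id [simp]: "fctr F \<Longrightarrow> ntrans (ntid F)"
  unfolding ntid_def by (rule ntransI) auto

lemma ntvcomp_simps [simp]:
  "NSrc (ntvcomp \<beta> \<alpha>) = NSrc \<alpha>" "NTgt (ntvcomp \<beta> \<alpha>) = NTgt \<beta>"
  "A \<in> Obj (Src (NSrc \<alpha>)) \<Longrightarrow> At (ntvcomp \<beta> \<alpha>) A = At \<beta> A \<cdot>\<^bsub>Tgt (NSrc \<alpha>)\<^esub> At \<alpha> A"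
  by (simp_all add: ntvcomp_def)

text \<open>Composites are normalised to the right by \<open>assoc\<close>, so a commuting square no
  longer matches once a further arrow \<open>x\<close> follows it. This is the form in which squares
  are applied inside longer composites.\<close>

lemma cmp_cong_left:
  "category C \<Longrightarrow> a \<cdot>\<^bsub>C\<^esub> b = c \<cdot>\<^bsub>C\<^esub> d \<Longrightarrow> a \<in> Arr C \<Longrightarrow> b \<in> Arr C \<Longrightarrow> c \<in> Arr C \<Longrightarrow> d \<in> Arr C \<Longrightarrow> x \<in> Arr C \<Longrightarrow>
    Dom C a = Cod C b \<Longrightarrow> Dom C c = Cod C d \<Longrightarrow> Dom C b = Cod C x \<Longrightarrow> Dom C d = Cod C x \<Longrightarrow>
    a \<cdot>\<^bsub>C\<^esub> (b \<cdot>\<^bsub>C\<^esub> x) = c \<cdot>\<^bsub>C\<^esub> (d \<cdot>\<^bsub>C\<^esub> x)"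
  by (metis category.assoc)

lemma naturality2:
  assumes "ntrans \<alpha>" "Tgt (NSrc \<alpha>) = D" "Src (NSrc \<alpha>) = C" "f \<in> Arr C" "Dom C f = A" "Cod C f = B"
    "x \<in> Arr D" "Cod D x = Fob (NSrc \<alpha>) A"
  shows "Far (NTgt \<alpha>) f \<cdot>\<^bsub>D\<^esub> (At \<alpha> A \<cdot>\<^bsub>D\<^esub> x) = At \<alpha> B \<cdot>\<^bsub>D\<^esub> (Far (NSrc \<alpha>) f \<cdot>\<^bsub>D\<^esub> x)"
  using assms by (intro cmp_cong_left naturality) auto

lemma ntrans_vcomp [simp]:
  assumes "ntrans \<alpha>" "ntrans \<beta>" "NSrc \<beta> = NTgt \<alpha>" shows "ntrans (ntvcomp \<beta> \<alpha>)"
  unfolding ntvcomp_def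
proof (rule ntransI)
  fix f assume f: "f \<in> Arr (Src (NSrc \<alpha>))"
  let ?D = "Tgt (NSrc \<alpha>)"
  show "(At \<beta> (Cod (Src (NSrc \<alpha>)) f) \<cdot>\<^bsub>?D\<^esub> At \<alpha> (Cod (Src (NSrc \<alpha>)) f)) \<cdot>\<^bsub>?D\<^esub> Far (NSrc \<alpha>) f
     = Far (NTgt \<beta>) f \<cdot>\<^bsub>?D\<^esub> (At \<beta> (Dom (Src (NSrc \<alpha>)) f) \<cdot>\<^bsub>?D\<^esub> At \<alpha> (Dom (Src (NSrc \<alpha>)) f))"
    using f assms naturality[of \<alpha> ?D _ f] naturality2[of \<beta> ?D _ f] by simp
qed (use assms ntr_simps(1,2)[of \<beta>] in simp_all)

lemma nthcomp_simps [simp]: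
  "NSrc (nthcomp \<beta> \<alpha>) = fct_comp (NSrc \<beta>) (NSrc \<alpha>)" "NTgt (nthcomp \<beta> \<alpha>) = fct_comp (NTgt \<beta>) (NTgt \<alpha>)"
  "A \<in> Obj (Src (NSrc \<alpha>)) \<Longrightarrow> At (nthcomp \<beta> \<alpha>) A = At \<beta> (Fob (NTgt \<alpha>) A) \<cdot>\<^bsub>Tgt (NSrc \<beta>)\<^esub> Far (NSrc \<beta>) (At \<alpha> A)"
  by (simp_all add: nthcomp_def)

lemma ntrans_hcomp [simp]:
  assumes "ntrans \<alpha>" "ntrans \<beta>" "Src (NSrc \<beta>) = Tgt (NSrc \<alpha>)" shows "ntrans (nthcomp \<beta> \<alpha>)"
  unfolding nthcomp_def
proof (rule ntransI)
  fix f assume "f \<in> Arr (Src (fct_comp (NSrc \<beta>) (NSrc \<alpha>)))"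
  then have f: "f \<in> Arr (Src (NSrc \<alpha>))" by simp
  let ?C = "Src (NSrc \<alpha>)" let ?D = "Tgt (NSrc \<beta>)" let ?E = "Tgt (NSrc \<alpha>)"
  have "Far (NSrc \<beta>) (At \<alpha> (Cod ?C f)) \<cdot>\<^bsub>?D\<^esub> Far (NSrc \<beta>) (Far (NSrc \<alpha>) f)
      = Far (NSrc \<beta>) (Far (NTgt \<alpha>) f) \<cdot>\<^bsub>?D\<^esub> Far (NSrc \<beta>) (At \<alpha> (Dom ?C f))"
    using naturality[of \<alpha> ?E _ f] f assms by (simp flip: fct_simps(6))
  then show "(At \<beta> (Fob (NTgt \<alpha>) (Cod (Src (fct_comp (NSrc \<beta>) (NSrc \<alpha>))) f)) \<cdot>\<^bsub>?D\<^esub> 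
      Far (NSrc \<beta>) (At \<alpha> (Cod (Src (fct_comp (NSrc \<beta>) (NSrc \<alpha>))) f))) \<cdot>\<^bsub>Tgt (fct_comp (NSrc \<beta>) (NSrc \<alpha>))\<^esub>
     Far (fct_comp (NSrc \<beta>) (NSrc \<alpha>)) f
     = Far (fct_comp (NTgt \<beta>) (NTgt \<alpha>)) f \<cdot>\<^bsub>Tgt (fct_comp (NSrc \<beta>) (NSrc \<alpha>))\<^esub> 
      (At \<beta> (Fob (NTgt \<alpha>) (Dom (Src (fct_comp (NSrc \<beta>) (NSrc \<alpha>))) f)) \<cdot>\<^bsub>?D\<^esub> 
        Far (NSrc \<beta>) (At \<alpha> (Dom (Src (fct_comp (NSrc \<beta>) (NSrc \<alpha>))) f)))"
    using f assms by (simp add: naturality2)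
qed (use assms in simp_all)

lemma nt_eqs [simp]:
  "ntrans \<alpha> \<Longrightarrow> NTgt \<alpha> = F \<Longrightarrow> ntvcomp (ntid F) \<alpha> = \<alpha>"
  "ntrans \<alpha> \<Longrightarrow> NSrc \<alpha> = F \<Longrightarrow> ntvcomp \<alpha> (ntid F) = \<alpha>"
  "ntrans \<alpha> \<Longrightarrow> ntrans \<beta> \<Longrightarrow> ntrans \<gamma> \<Longrightarrow> NSrc \<beta> = NTgt \<alpha> \<Longrightarrow> NSrc \<gamma> = NTgt \<beta> \<Longrightarrow>
    ntvcomp (ntvcomp \<gamma> \<beta>) \<alpha> = ntvcomp \<gamma> (ntvcomp \<beta> \<alpha>)"
  using ntr_simps(1,2)[of \<beta>] by (auto intro!: ntr_eqI)

lemma nth_eqs [simp]: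
  "ntrans \<alpha> \<Longrightarrow> Tgt (NSrc \<alpha>) = C \<Longrightarrow> nthcomp (ntid (fct_id C)) \<alpha> = \<alpha>"
  "ntrans \<alpha> \<Longrightarrow> Src (NSrc \<alpha>) = C \<Longrightarrow> nthcomp \<alpha> (ntid (fct_id C)) = \<alpha>"
  "ntrans \<alpha> \<Longrightarrow> ntrans \<beta> \<Longrightarrow> ntrans \<gamma> \<Longrightarrow> Src (NSrc \<beta>) = Tgt (NSrc \<alpha>) \<Longrightarrow> Src (NSrc \<gamma>) = Tgt (NSrc \<beta>) \<Longrightarrow>
    nthcomp (nthcomp \<gamma> \<beta>) \<alpha> = nthcomp \<gamma> (nthcomp \<beta> \<alpha>)"
  by (auto intro!: ntr_eqI)

lemma nth_id [simp]: "fctr F \<Longrightarrow> fctr G \<Longrightarrow> Src G = Tgt F \<Longrightarrow> nthcomp (ntid G) (ntid F) = ntid (fct_comp G F)"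
  by (auto intro!: ntr_eqI)

text \<open>After unfolding at an object, the two sides differ only in the order of a component of
  \<open>\<beta>\<close> and the image of a component of \<open>\<alpha>'\<close>; naturality of
  \<open>\<beta>\<close> at that component exchanges them.\<close>

lemma nt_interchange:
  assumes "ntrans \<alpha>" "ntrans \<beta>" "ntrans \<alpha>'" "ntrans \<beta>'" "NSrc \<alpha>' = NTgt \<alpha>" "NSrc \<beta>' = NTgt \<beta>"
    "Src (NSrc \<beta>) = Tgt (NSrc \<alpha>)"
  shows "nthcomp (ntvcomp \<beta>' \<beta>) (ntvcomp \<alpha>' \<alpha>) = ntvcomp (nthcomp \<beta>' \<alpha>') (nthcomp \<beta> \<alpha>)"
proof -
  have [simp]: "Src (NTgt \<alpha>') = Src (NSrc \<alpha>)" "Tgt (NTgt \<alpha>') = Tgt (NSrc \<alpha>)"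
    "Src (NTgt \<beta>') = Src (NSrc \<beta>)" "Tgt (NTgt \<beta>') = Tgt (NSrc \<beta>)"
    using assms ntr_simps(1,2)[of \<alpha>'] ntr_simps(1,2)[of \<beta>'] by auto
  show ?thesis
  proof (rule ntr_eqI)
    fix A assume "A \<in> Obj (Src (NSrc (ntvcomp (nthcomp \<beta>' \<alpha>') (nthcomp \<beta> \<alpha>))))"
    then have A: "A \<in> Obj (Src (NSrc \<alpha>))" by simp
    then show "At (nthcomp (ntvcomp \<beta>' \<beta>) (ntvcomp \<alpha>' \<alpha>)) A
        = At (ntvcomp (nthcomp \<beta>' \<alpha>') (nthcomp \<beta> \<alpha>)) A"
      using assms naturality2[of \<beta> "Tgt (NSrc \<beta>)" "Tgt (NSrc \<alpha>)" "At \<alpha>' A"] by simp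
  qed (use assms in simp_all)
qed

section \<open>The strict 2-category of categories\<close>

lemma CAT_simps [simp]:
  "Obj (One CAT) = {C. category C}" "Arr (One CAT) = {F. fctr F}"
  "fctr F \<Longrightarrow> Dom (One CAT) F = Src F" "fctr F \<Longrightarrow> Cod (One CAT) F = Tgt F"
  "category C \<Longrightarrow> Idn (One CAT) C = fct_id C"
  "fctr F \<Longrightarrow> fctr G \<Longrightarrow> Src G = Tgt F \<Longrightarrow> G \<cdot>\<^bsub>One CAT\<^esub> F = fct_comp G F"
  "Obj (Two CAT) = {F. fctr F}" "Arr (Two CAT) = {\<alpha>. ntrans \<alpha>}"
  "ntrans \<alpha> \<Longrightarrow> Dom (Two CAT) \<alpha> = NSrc \<alpha>" "ntrans \<alpha> \<Longrightarrow> Cod (Two CAT) \<alpha> = NTgt \<alpha>"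
  "fctr F \<Longrightarrow> Idn (Two CAT) F = ntid F"
  "ntrans \<alpha> \<Longrightarrow> ntrans \<beta> \<Longrightarrow> NSrc \<beta> = NTgt \<alpha> \<Longrightarrow> \<beta> \<cdot>\<^bsub>Two CAT\<^esub> \<alpha> = ntvcomp \<beta> \<alpha>"
  "ntrans \<alpha> \<Longrightarrow> ntrans \<beta> \<Longrightarrow> Src (NSrc \<beta>) = Tgt (NSrc \<alpha>) \<Longrightarrow> \<beta> \<star>\<^bsub>CAT\<^esub> \<alpha> = nthcomp \<beta> \<alpha>"
  by (simp_all add: CAT_def partial_comp_def)

lemma category_one_CAT [simp]: "category (One CAT)"
  unfolding CAT_def by simp (rule category_mkcat; simp)

lemma category_two_CAT [simp]: "category (Two CAT)"
  unfolding CAT_def by simp (rule category_mkcat; simp add: ntr_simps(1,2))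

lemma horizontal_simps [simp]:
  "Obj (horizontal K) = Obj (One K)" "Arr (horizontal K) = Arr (Two K)"
  "\<alpha> \<in> Arr (Two K) \<Longrightarrow> Dom (horizontal K) \<alpha> = Dom (One K) (Dom (Two K) \<alpha>)"
  "\<alpha> \<in> Arr (Two K) \<Longrightarrow> Cod (horizontal K) \<alpha> = Cod (One K) (Dom (Two K) \<alpha>)"
  "A \<in> Obj (One K) \<Longrightarrow> Idn (horizontal K) A = Idn (Two K) (Idn (One K) A)"
  "Cmp (horizontal K) = HCmp K"
  by (simp_all add: horizontal_def)

text \<open>\<open>horizontal\<close> is defined for an arbitrary 2-category; brought into the form
  of \<open>mkcat\<close>, it falls under \<open>category_mkcat\<close>.\<close>

lemma horizontal_CAT: "horizontal CAT = mkcat {C. category C} {\<alpha>. ntrans \<alpha>} (Src \<circ> NSrc) (Tgt \<circ> NSrc)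
    (\<lambda>C. ntid (fct_id C)) nthcomp"
  by (auto simp: horizontal_def mkcat_def CAT_def fun_eq_iff partial_comp_def restrict_def)

lemma category_hor_CAT: "category (horizontal CAT)"
  unfolding horizontal_CAT by (rule category_mkcat) simp_all

lemma strict_2_category_CAT: "strict_2_category CAT"
  by (intro strict_2_category.intro)
    (auto simp: category_hor_CAT nt_interchange)

section \<open>Objects of coalgebras from a universal coaction\<close>

lemma full_subcat_simps [simp]:
  "Obj (full_subcat C S) = Obj C \<inter> S"
  "Arr (full_subcat C S) = {f \<in> Arr C. Dom C f \<in> S \<and> Cod C f \<in> S}"
  "f \<in> Arr C \<Longrightarrow> Dom C f \<in> S \<Longrightarrow> Cod C f \<in> S \<Longrightarrow> Dom (full_subcat C S) f = Dom C f"
  "f \<in> Arr C \<Longrightarrow> Dom C f \<in> S \<Longrightarrow> Cod C f \<in> S \<Longrightarrow> Cod (full_subcat C S) f = Cod C f"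
  "A \<in> Obj C \<Longrightarrow> A \<in> S \<Longrightarrow> Idn (full_subcat C S) A = Idn C A"
  "f \<in> Arr C \<Longrightarrow> Dom C f \<in> S \<Longrightarrow> Cod C f \<in> S \<Longrightarrow> g \<in> Arr C \<Longrightarrow> Dom C g = Cod C f \<Longrightarrow> Cod C g \<in> S \<Longrightarrow>
    g \<cdot>\<^bsub>full_subcat C S\<^esub> f = g \<cdot>\<^bsub>C\<^esub> f"
  by (simp_all add: full_subcat_def partial_comp_def)

lemma category_full_subcat [simp]: "category C \<Longrightarrow> category (full_subcat C S)"
  unfolding full_subcat_def by (rule category_mkcat) auto

text \<open>The inverse takes unique preimages of objects and arrows. It is a functor because both
  sides of each functor law have the same image under \<open>F\<close>, and \<open>F\<close> is
  injective.\<close>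

lemma cat_isomorphismI:
  fixes F :: "('o,'a,'p,'b) fct"
  assumes F: "fctr F" "Src F = C" "Tgt F = D"
    and o: "\<And>B. B \<in> Obj D \<Longrightarrow> \<exists>!A. A \<in> Obj C \<and> Fob F A = B"
    and a: "\<And>g. g \<in> Arr D \<Longrightarrow> \<exists>!f. f \<in> Arr C \<and> Far F f = g"
  shows "cat_isomorphism F"
proof -
  define o' where "o' = (\<lambda>B. THE A. A \<in> Obj C \<and> Fob F A = B)"
  define a' where "a' = (\<lambda>g. THE f. f \<in> Arr C \<and> Far F f = g)"
  have o': "o' B \<in> Obj C" "Fob F (o' B) = B" if "B \<in> Obj D" for B
    using theI'[OF o[OF that]] by (auto simp: o'_def)
  have a': "a' g \<in> Arr C" "Far F (a' g) = g" if "g \<in> Arr D" for g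
    using theI'[OF a[OF that]] by (auto simp: a'_def)
  have oi: "A = B" if "A \<in> Obj C" "B \<in> Obj C" "Fob F A = Fob F B" for A B
    using o[of "Fob F A"] that F by auto
  have ai: "f = g" if "f \<in> Arr C" "g \<in> Arr C" "Far F f = Far F g" for f g
    using a[of "Far F f"] that F by auto
  have [simp]: "category C" "category D" using F by auto
  have c: "Fob F (Dom C (a' g)) = Dom D g" "Fob F (Cod C (a' g)) = Cod D g" if "g \<in> Arr D" for g
    using fct_simps(3,4)[OF F(1,3), of "a' g"] a'[OF that] F by simp_all
  have dc: "Dom C (a' g) = o' (Dom D g)" "Cod C (a' g) = o' (Cod D g)" if "g \<in> Arr D" for g
    using that a' o' c by (auto intro!: oi)
  let ?G = "\<lparr>Src = D, Tgt = C, Fob = restrict o' (Obj D), Far = restrict a' (Arr D)\<rparr>"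
  have G: "fctr ?G"
  proof (rule fctrI)
    fix f g assume fg: "f \<in> Arr D" "g \<in> Arr D" "Dom D g = Cod D f"
    have "Far F (a' g \<cdot>\<^bsub>C\<^esub> a' f) = g \<cdot>\<^bsub>D\<^esub> f"
      using F fg a' dc by simp
    then show "a' (g \<cdot>\<^bsub>D\<^esub> f) = a' g \<cdot>\<^bsub>C\<^esub> a' f"
      using fg a' dc by (intro ai) auto
  next
    fix A assume A: "A \<in> Obj D"
    have "Far F (Idn C (o' A)) = Idn D A" using A F o' by simp
    then show "a' (Idn D A) = Idn C (o' A)" using A a' o' by (intro ai) auto
  qed (use o' a' dc in auto)
  have "fct_comp ?G F = fct_id C" using F G o' a' by (intro fct_eqI) (auto intro: oi ai)
  moreover have "fct_comp F ?G = fct_id D" using F G o' a' by (intro fct_eqI) auto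
  ultimately show ?thesis
    unfolding cat_isomorphism_def using F G by (intro conjI exI[of _ ?G]) auto
qed

section \<open>2-cell calculus and coactions in a strict 2-category\<close>

context strict_2_category
begin

abbreviation cmp1 (infixr "\<odot>" 75) where "g \<odot> f \<equiv> Cmp (One K) g f"
abbreviation cmp2 (infixr "\<bullet>" 70) where "\<beta> \<bullet> \<alpha> \<equiv> Cmp (Two K) \<beta> \<alpha>"
abbreviation "D1 \<equiv> Dom (One K)"
abbreviation "C1 \<equiv> Cod (One K)"
abbreviation "D2 \<equiv> Dom (Two K)"
abbreviation "C2 \<equiv> Cod (Two K)"
abbreviation "I1 \<equiv> Idn (One K)"
abbreviation "I2 \<equiv> Idn (Two K)"

lemmas [simp] = one two hor globular_dom globular_cod

lemma two_arr [simp]: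
  "\<alpha> \<in> Arr (Two K) \<Longrightarrow> D2 \<alpha> \<in> Arr (One K)" "\<alpha> \<in> Arr (Two K) \<Longrightarrow> C2 \<alpha> \<in> Arr (One K)"
  "f \<in> Arr (One K) \<Longrightarrow> I2 f \<in> Arr (Two K)" "f \<in> Arr (One K) \<Longrightarrow> D2 (I2 f) = f"
  "f \<in> Arr (One K) \<Longrightarrow> C2 (I2 f) = f"
  using category.dom_closed[OF two] category.cod_closed[OF two] category.idn_arr[OF two]
    category.idn_dom[OF two] category.idn_cod[OF two] by (auto simp: obj_two)

lemma hcmp_simps [simp]:
  assumes "\<alpha> \<in> Arr (Two K)" "\<beta> \<in> Arr (Two K)" "D1 (D2 \<beta>) = C1 (D2 \<alpha>)"
  shows "\<beta> \<star> \<alpha> \<in> Arr (Two K)" "D2 (\<beta> \<star> \<alpha>) = D2 \<beta> \<odot> D2 \<alpha>" "C2 (\<beta> \<star> \<alpha>) = C2 \<beta> \<odot> C2 \<alpha>"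
  using assms category.cmp_arr[OF hor, of \<alpha> \<beta>] hcmp_dom[of \<alpha> \<beta>] hcmp_cod[of \<alpha> \<beta>] by simp_all

lemma hcmp_assoc [simp]:
  assumes "\<alpha> \<in> Arr (Two K)" "\<beta> \<in> Arr (Two K)" "\<gamma> \<in> Arr (Two K)"
    "D1 (D2 \<beta>) = C1 (D2 \<alpha>)" "D1 (D2 \<gamma>) = C1 (D2 \<beta>)"
  shows "(\<gamma> \<star> \<beta>) \<star> \<alpha> = \<gamma> \<star> (\<beta> \<star> \<alpha>)"
  using assms category.assoc[OF hor, of \<alpha> \<beta> \<gamma>] by simp

lemma hcmp_id [simp]:
  "\<alpha> \<in> Arr (Two K) \<Longrightarrow> C1 (D2 \<alpha>) = A \<Longrightarrow> I2 (I1 A) \<star> \<alpha> = \<alpha>"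
  "\<alpha> \<in> Arr (Two K) \<Longrightarrow> D1 (D2 \<alpha>) = A \<Longrightarrow> \<alpha> \<star> I2 (I1 A) = \<alpha>"
  using category.idn_left[OF hor, of \<alpha>] category.idn_right[OF hor, of \<alpha>]
  by auto

lemma hcmp_I2 [simp]:
  "f \<in> Arr (One K) \<Longrightarrow> g \<in> Arr (One K) \<Longrightarrow> D1 g = C1 f \<Longrightarrow> I2 g \<star> I2 f = I2 (g \<odot> f)"
  by (rule hcmp_idn)

lemma whisker_left:
  assumes "\<alpha> \<in> Arr (Two K)" "\<beta> \<in> Arr (Two K)" "D2 \<beta> = C2 \<alpha>" "g \<in> Arr (One K)" "D1 g = C1 (D2 \<alpha>)"
  shows "I2 g \<star> (\<beta> \<bullet> \<alpha>) = (I2 g \<star> \<beta>) \<bullet> (I2 g \<star> \<alpha>)"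
  using interchange[of \<alpha> \<beta> "I2 g" "I2 g"] assms by simp

lemma whisker_right:
  assumes "\<alpha> \<in> Arr (Two K)" "\<beta> \<in> Arr (Two K)" "D2 \<beta> = C2 \<alpha>" "g \<in> Arr (One K)" "D1 (D2 \<alpha>) = C1 g"
  shows "(\<beta> \<bullet> \<alpha>) \<star> I2 g = (\<beta> \<star> I2 g) \<bullet> (\<alpha> \<star> I2 g)"
  using interchange[of "I2 g" "I2 g" \<alpha> \<beta>] assms by simp

text \<open>Interchange against identities: a horizontal composite may be carried out in either
  order. Used in both directions, the two equations slide one 2-cell past another.\<close>

lemma hcmp_split:
  assumes "\<alpha> \<in> Arr (Two K)" "\<beta> \<in> Arr (Two K)" "D1 (D2 \<beta>) = C1 (D2 \<alpha>)"
    "D2 \<alpha> = f" "C2 \<alpha> = f'" "D2 \<beta> = g" "C2 \<beta> = g'"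
  shows "(\<beta> \<star> I2 f') \<bullet> (I2 g \<star> \<alpha>) = \<beta> \<star> \<alpha>" "(I2 g' \<star> \<alpha>) \<bullet> (\<beta> \<star> I2 f) = \<beta> \<star> \<alpha>"
  using interchange[of \<alpha> "I2 f'" "I2 g" \<beta>] interchange[of "I2 f" \<alpha> \<beta> "I2 g'"] assms by auto

text \<open>A coalgebra for \<open>W\<close> at stage \<open>D\<close>: for the one-arrow category
  \<open>D\<close> in \<open>CAT\<close> it is a coalgebra in the usual sense. In general it is a
  comonad morphism into \<open>W\<close> from the identity comonad on \<open>D\<close>, freed of
  whiskerings by identities.\<close>

definition coaction :: "('o,'f,'t) cmnd \<Rightarrow> 'o \<Rightarrow> 'f \<Rightarrow> 't \<Rightarrow> bool" where
  "coaction W D G \<tau> \<longleftrightarrow> G \<in> hom (One K) D (Base W) \<and> \<tau> \<in> hom (Two K) G (Endo W \<odot> G) \<and>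
     (Counit W \<star> I2 G) \<bullet> \<tau> = I2 G \<and> (Comult W \<star> I2 G) \<bullet> \<tau> = (I2 (Endo W) \<star> \<tau>) \<bullet> \<tau>"

definition coalg_map :: "('o,'f,'t) cmnd \<Rightarrow> 't \<Rightarrow> 't \<Rightarrow> 't \<Rightarrow> bool" where
  "coalg_map W \<tau> \<tau>' \<theta> \<longleftrightarrow> (I2 (Endo W) \<star> \<theta>) \<bullet> \<tau> = \<tau>' \<bullet> \<theta>"

lemma comonad_id [simp]: "D \<in> Obj (One K) \<Longrightarrow> comonad K (id_comonad K D)"
  by (intro comonad.intro) (simp_all add: id_comonad_def hom_def rwhisker_def lwhisker_def)

lemma id_comonad_simps [simp]:
  "Base (id_comonad K D) = D" "Endo (id_comonad K D) = I1 D"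
  "Counit (id_comonad K D) = I2 (I1 D)" "Comult (id_comonad K D) = I2 (I1 D)"
  by (simp_all add: id_comonad_def)

lemma comonad_simps:
  assumes "comonad K W"
  shows "Base W \<in> Obj (One K)" "Endo W \<in> Arr (One K)" "D1 (Endo W) = Base W" "C1 (Endo W) = Base W"
    "Counit W \<in> Arr (Two K)" "Comult W \<in> Arr (Two K)"
    "D2 (Counit W) = Endo W" "C2 (Counit W) = I1 (Base W)"
    "D2 (Comult W) = Endo W" "C2 (Comult W) = Endo W \<odot> Endo W"
  using assms by (auto simp: comonad_def hom_def)

text \<open>All whiskerings that involve the source comonad are whiskerings by identities or of
  identities, so they cancel, and the two compatibility conditions turn into the counit and
  coassociativity laws.\<close>

lemma comonad_mor_iff:
  assumes W: "comonad K W" and D: "D \<in> Obj (One K)"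
  shows "comonad_mor K \<lparr>CSrc = id_comonad K D, CTgt = W, CMap = G, CCell = \<tau>\<rparr> \<longleftrightarrow> coaction W D G \<tau>"
proof -
  note [simp] = comonad_simps[OF W]
  show ?thesis
  proof (cases "G \<in> hom (One K) D (Base W) \<and> \<tau> \<in> hom (Two K) G (Endo W \<odot> G)")
    case True
    then have [simp]: "G \<in> Arr (One K)" "D1 G = D" "C1 G = Base W" "\<tau> \<in> Arr (Two K)" "D2 \<tau> = G"
      "C2 \<tau> = Endo W \<odot> G" by (auto simp: hom_def)
    show ?thesis using W D by (simp add: comonad_mor_def coaction_def rwhisker_def lwhisker_def hom_def)
  next
    case False
    then show ?thesis using W D
      by (auto simp add: comonad_mor_def coaction_def rwhisker_def lwhisker_def hom_def)
  qed
qed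

lemma comonad_mor_id1 [simp]: "h \<in> Arr (One K) \<Longrightarrow> comonad_mor K (id_comonad1 K h)"
  by (intro comonad_mor.intro) (simp_all add: id_comonad1_def rwhisker_def lwhisker_def hom_def)

lemma id1_simps [simp]: "CSrc (id_comonad1 K h) = id_comonad K (D1 h)" "CTgt (id_comonad1 K h) = id_comonad K (C1 h)"
   "CMap (id_comonad1 K h) = h" "CCell (id_comonad1 K h) = I2 h"
  by (simp_all add: id_comonad1_def)

lemma id2_simps [simp]: "C2Src (id_comonad2 K \<theta>) = id_comonad1 K (D2 \<theta>)"
   "C2Tgt (id_comonad2 K \<theta>) = id_comonad1 K (C2 \<theta>)" "C2Cell (id_comonad2 K \<theta>) = \<theta>"
  by (simp_all add: id_comonad2_def)

lemma comonad_mor2_id2 [simp]: "\<theta> \<in> Arr (Two K) \<Longrightarrow> comonad_mor2 K (id_comonad2 K \<theta>)"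
  by (intro comonad_mor2.intro)
    (simp_all add: rwhisker_def lwhisker_def hom_def)

text \<open>The hom-categories of \<open>Comon K\<close> are full subcategories of this one, and
  they are the targets of the isomorphisms in \<open>object_of_coalgebras\<close>. The point with
  content is that compatibility squares can be pasted vertically.\<close>

lemma category_two_Comon: "category (Two (Comon K))"
proof -
  have *: "C2Cell \<theta> \<in> Arr (Two K)" "D2 (C2Cell \<theta>) = CMap (C2Src \<theta>)" "C2 (C2Cell \<theta>) = CMap (C2Tgt \<theta>)"
    "comonad_mor K (C2Src \<theta>)" "comonad_mor K (C2Tgt \<theta>)"
    "CSrc (C2Tgt \<theta>) = CSrc (C2Src \<theta>)" "CTgt (C2Tgt \<theta>) = CTgt (C2Src \<theta>)"
    if "comonad_mor2 K \<theta>" for \<theta>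
    using that by (auto simp: comonad_mor2_def hom_def)
  have m: "CMap m \<in> Arr (One K)" "D1 (CMap m) = Base (CSrc m)" "C1 (CMap m) = Base (CTgt m)"
     "CCell m \<in> Arr (Two K)" "D2 (CCell m) = CMap m \<odot> Endo (CSrc m)" "C2 (CCell m) = Endo (CTgt m) \<odot> CMap m"
     "comonad K (CSrc m)" "comonad K (CTgt m)"
     if "comonad_mor K m" for m using that by (auto simp: comonad_mor_def hom_def)
  show ?thesis
    unfolding Comon_def two_cat.simps
  proof (rule category_mkcat; (unfold mem_Collect_eq)?)
    fix m assume "comonad_mor K m"
    note [simp] = m[OF this] comonad_simps[OF m(7)[OF this]] comonad_simps[OF m(8)[OF this]] this
    show "comonad_mor2 K \<lparr>C2Src = m, C2Tgt = m, C2Cell = I2 (CMap m)\<rparr>"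
      by (intro comonad_mor2.intro) (simp_all add: rwhisker_def lwhisker_def hom_def)
  next
    fix \<theta> \<phi> assume t: "comonad_mor2 K \<theta>" "comonad_mor2 K \<phi>" "C2Src \<phi> = C2Tgt \<theta>"
    note [simp] = *[OF t(1)] *[OF t(2)] m[OF *(4)[OF t(1)]] m[OF *(5)[OF t(1)]] m[OF *(5)[OF t(2)]]
      t comonad_simps[OF m(7)[OF *(4)[OF t(1)]]] comonad_simps[OF m(8)[OF *(4)[OF t(1)]]]
    let ?V = "CSrc (C2Src \<theta>)" and ?W = "CTgt (C2Src \<theta>)"
    have 1: "(I2 (Endo ?W) \<star> C2Cell \<theta>) \<bullet> CCell (C2Src \<theta>) = CCell (C2Tgt \<theta>) \<bullet> (C2Cell \<theta> \<star> I2 (Endo ?V))"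
      using comonad_mor2.c2compat[OF t(1)] by (simp add: rwhisker_def lwhisker_def)
    have 2: "(I2 (Endo ?W) \<star> C2Cell \<phi>) \<bullet> CCell (C2Tgt \<theta>) = CCell (C2Tgt \<phi>) \<bullet> (C2Cell \<phi> \<star> I2 (Endo ?V))"
      using comonad_mor2.c2compat[OF t(2)] by (simp add: rwhisker_def lwhisker_def)
    have "(I2 (Endo ?W) \<star> (C2Cell \<phi> \<bullet> C2Cell \<theta>)) \<bullet> CCell (C2Src \<theta>)
        = (I2 (Endo ?W) \<star> C2Cell \<phi>) \<bullet> (I2 (Endo ?W) \<star> C2Cell \<theta>) \<bullet> CCell (C2Src \<theta>)"
      by (simp add: whisker_left)
    also have "\<dots> = (I2 (Endo ?W) \<star> C2Cell \<phi>) \<bullet> CCell (C2Tgt \<theta>) \<bullet> (C2Cell \<theta> \<star> I2 (Endo ?V))"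
      by (simp add: 1)
    also have "\<dots> = CCell (C2Tgt \<phi>) \<bullet> (C2Cell \<phi> \<star> I2 (Endo ?V)) \<bullet> (C2Cell \<theta> \<star> I2 (Endo ?V))"
      by (rule cmp_cong_left[OF _ 2]) simp_all
    also have "\<dots> = CCell (C2Tgt \<phi>) \<bullet> ((C2Cell \<phi> \<bullet> C2Cell \<theta>) \<star> I2 (Endo ?V))"
      by (simp add: whisker_right)
    finally show "comonad_mor2 K \<lparr>C2Src = C2Src \<theta>, C2Tgt = C2Tgt \<phi>, C2Cell = C2Cell \<phi> \<bullet> C2Cell \<theta>\<rparr>"
      by (intro comonad_mor2.intro) (simp_all add: rwhisker_def lwhisker_def hom_def)
  qed (use * m in simp_all)
qed

lemma Comon_simps [simp]:
  "comonad_mor K m \<Longrightarrow> comonad_mor K n \<Longrightarrow> CSrc n = CTgt m \<Longrightarrow> n \<cdot>\<^bsub>One (Comon K)\<^esub> m = cmor_comp K n m"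
  "Obj (Two (Comon K)) = {m. comonad_mor K m}" "Arr (Two (Comon K)) = {\<theta>. comonad_mor2 K \<theta>}"
  "comonad_mor2 K \<theta> \<Longrightarrow> Dom (Two (Comon K)) \<theta> = C2Src \<theta>"
  "comonad_mor2 K \<theta> \<Longrightarrow> Cod (Two (Comon K)) \<theta> = C2Tgt \<theta>"
  "comonad_mor K m \<Longrightarrow> Idn (Two (Comon K)) m = \<lparr>C2Src = m, C2Tgt = m, C2Cell = Idn (Two K) (CMap m)\<rparr>"
  "comonad_mor2 K \<theta> \<Longrightarrow> comonad_mor2 K \<phi> \<Longrightarrow> C2Src \<phi> = C2Tgt \<theta> \<Longrightarrow>
    \<phi> \<cdot>\<^bsub>Two (Comon K)\<^esub> \<theta> = \<lparr>C2Src = C2Src \<theta>, C2Tgt = C2Tgt \<phi>, C2Cell = C2Cell \<phi> \<cdot>\<^bsub>Two K\<^esub> C2Cell \<theta>\<rparr>"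
  "comonad_mor2 K \<theta> \<Longrightarrow> comonad_mor2 K \<phi> \<Longrightarrow> CSrc (C2Src \<phi>) = CTgt (C2Src \<theta>) \<Longrightarrow>
    \<phi> \<star>\<^bsub>Comon K\<^esub> \<theta> = \<lparr>C2Src = cmor_comp K (C2Src \<phi>) (C2Src \<theta>),
      C2Tgt = cmor_comp K (C2Tgt \<phi>) (C2Tgt \<theta>), C2Cell = C2Cell \<phi> \<star> C2Cell \<theta>\<rparr>"
  by (simp_all add: Comon_def partial_comp_def)

end

text \<open>The Yoneda argument: a 2-natural \<open>Iso\<close> is determined by the image
  \<open>k\<close> of the identity 1-cell and acts on everything else by composition with
  \<open>k\<close>. The shape follows \<open>EM_choice\<close>, which thereby becomes an
  instance.\<close>

definition coalg_obj_of ::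
  "('o,'f,'t) two_cat \<Rightarrow> ('o,'f,'t) cmnd \<Rightarrow> 'o \<Rightarrow> 'f \<Rightarrow> 't \<Rightarrow> ('o,'f,'t) coalg_obj" where
  "coalg_obj_of K W X U c = (let k = \<lparr>CSrc = id_comonad K X, CTgt = W, CMap = U, CCell = c\<rparr> in
     \<lparr>Carrier = X,
      Iso = (\<lambda>D. \<lparr>Src = homcat K D X, Tgt = homcat (Comon K) (id_comonad K D) W,
       Fob = (\<lambda>G\<in>Obj (homcat K D X). k \<cdot>\<^bsub>One (Comon K)\<^esub> id_comonad1 K G),
       Far = (\<lambda>\<theta>\<in>Arr (homcat K D X). lwhisker (Comon K) k (id_comonad2 K \<theta>))\<rparr>)\<rparr>)"

text \<open>The universal property stripped of \<open>Comon\<close>: every coaction is uniquely the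
  universal one whiskered by a 1-cell \<open>H\<close>, and every coalgebra map between two such
  coactions is uniquely a whiskering by \<open>U\<close>. Preservation by a 2-functor compares two
  instances of this locale, one in each 2-category.\<close>

locale universal_coaction = strict_2_category +
  fixes W :: "('a, 'b, 'c) cmnd" and X :: 'a and U :: 'b and c :: 'c
  assumes W: "comonad K W" and X: "X \<in> Obj (One K)"
    and coact: "coaction W X U c"
    and ex1_lift: "coaction W D G \<tau> \<Longrightarrow> D \<in> Obj (One K) \<Longrightarrow>
      \<exists>!H. H \<in> hom (One K) D X \<and> U \<odot> H = G \<and> c \<star> I2 H = \<tau>"
    and ex1_lift2: "H \<in> hom (One K) D X \<Longrightarrow> H' \<in> hom (One K) D X \<Longrightarrow>
      \<theta> \<in> hom (Two K) (U \<odot> H) (U \<odot> H') \<Longrightarrow> coalg_map W (c \<star> I2 H) (c \<star> I2 H') \<theta> \<Longrightarrow>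
      \<exists>!\<phi>. \<phi> \<in> hom (Two K) H H' \<and> I2 U \<star> \<phi> = \<theta>"
begin

lemmas [simp] = W X comonad_simps[OF W]

lemma U [simp]: "U \<in> Arr (One K)" "D1 U = X" "C1 U = Base W"
  and c [simp]: "c \<in> Arr (Two K)" "D2 c = U" "C2 c = Endo W \<odot> U"
  and c_counit: "(Counit W \<star> I2 U) \<bullet> c = I2 U"
  and c_comult: "(Comult W \<star> I2 U) \<bullet> c = (I2 (Endo W) \<star> c) \<bullet> c"
  using coact by (auto simp: coaction_def hom_def)

definition k where "k = \<lparr>CSrc = id_comonad K X, CTgt = W, CMap = U, CCell = c\<rparr>"

lemma k_simps [simp]: "comonad_mor K k" "CSrc k = id_comonad K X" "CTgt k = W" "CMap k = U" "CCell k = c"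
  using comonad_mor_iff[OF W X] coact by (auto simp: k_def)

definition pb where "pb H = \<lparr>CSrc = id_comonad K (D1 H), CTgt = W, CMap = U \<odot> H, CCell = c \<star> I2 H\<rparr>"

lemma k_cmp [simp]: "H \<in> Arr (One K) \<Longrightarrow> C1 H = X \<Longrightarrow> cmor_comp K k (id_comonad1 K H) = pb H"
  by (simp add: cmor_comp_def pb_def id_comonad1_def rwhisker_def lwhisker_def)

lemma pb_simps [simp]: "CSrc (pb H) = id_comonad K (D1 H)" "CTgt (pb H) = W" "CMap (pb H) = U \<odot> H" "CCell (pb H) = c \<star> I2 H"
  by (simp_all add: pb_def)

lemma pb_coaction:
  assumes H: "H \<in> Arr (One K)" "C1 H = X"
  shows "coaction W (D1 H) (U \<odot> H) (c \<star> I2 H)"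
proof -
  have "(Counit W \<star> I2 (U \<odot> H)) \<bullet> (c \<star> I2 H) = ((Counit W \<star> I2 U) \<star> I2 H) \<bullet> (c \<star> I2 H)"
    using H by simp
  also have "\<dots> = ((Counit W \<star> I2 U) \<bullet> c) \<star> I2 H" using H by (subst whisker_right) simp_all
  also have "\<dots> = I2 (U \<odot> H)" using H by (simp add: c_counit)
  finally have 1: "(Counit W \<star> I2 (U \<odot> H)) \<bullet> (c \<star> I2 H) = I2 (U \<odot> H)" .
  have "(Comult W \<star> I2 (U \<odot> H)) \<bullet> (c \<star> I2 H) = ((Comult W \<star> I2 U) \<star> I2 H) \<bullet> (c \<star> I2 H)"
    using H by simp
  also have "\<dots> = ((I2 (Endo W) \<star> c) \<bullet> c) \<star> I2 H"
    using H by (subst whisker_right[symmetric]) (simp_all add: c_comult)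
  also have "\<dots> = (I2 (Endo W) \<star> c \<star> I2 H) \<bullet> (c \<star> I2 H)" using H by (simp add: whisker_right)
  finally show ?thesis using 1 H by (simp add: coaction_def hom_def)
qed

lemma pb_mor [simp]:
  assumes "H \<in> Arr (One K)" "C1 H = X" shows "comonad_mor K (pb H)"
  using pb_coaction[OF assms] assms comonad_mor_iff[OF W, of "D1 H"] by (simp add: pb_def)

definition pb2 where "pb2 \<theta> = \<lparr>C2Src = pb (D2 \<theta>), C2Tgt = pb (C2 \<theta>), C2Cell = I2 U \<star> \<theta>\<rparr>"

lemma pb2_simps [simp]: "C2Src (pb2 \<theta>) = pb (D2 \<theta>)" "C2Tgt (pb2 \<theta>) = pb (C2 \<theta>)" "C2Cell (pb2 \<theta>) = I2 U \<star> \<theta>"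
  by (simp_all add: pb2_def)

text \<open>Both sides of the compatibility condition are the horizontal composite
  \<open>c \<star> \<theta>\<close>, carried out in the two possible orders.\<close>

lemma pb2_mor [simp]:
  assumes t: "\<theta> \<in> Arr (Two K)" "C1 (D2 \<theta>) = X" shows "comonad_mor2 K (pb2 \<theta>)"
proof (intro comonad_mor2.intro)
  have "(I2 (Endo W) \<star> (I2 U \<star> \<theta>)) \<bullet> (c \<star> I2 (D2 \<theta>)) = ((I2 (Endo W) \<star> I2 U) \<star> \<theta>) \<bullet> (c \<star> I2 (D2 \<theta>))"
    by (subst hcmp_assoc) (use t in simp_all)
  also have "\<dots> = c \<star> \<theta>" using t by (simp add: hcmp_split)
  also have "\<dots> = (c \<star> I2 (C2 \<theta>)) \<bullet> (I2 U \<star> \<theta>)" using t by (simp add: hcmp_split)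
  finally show "lwhisker K (Endo (CTgt (C2Src (pb2 \<theta>)))) (C2Cell (pb2 \<theta>)) \<bullet> CCell (C2Src (pb2 \<theta>)) =
    CCell (C2Tgt (pb2 \<theta>)) \<bullet> rwhisker K (C2Cell (pb2 \<theta>)) (Endo (CSrc (C2Src (pb2 \<theta>))))"
    using t by (simp add: lwhisker_def rwhisker_def)
qed (use t in \<open>simp_all add: hom_def\<close>)

lemma pb2_I2 [simp]: "H \<in> Arr (One K) \<Longrightarrow> C1 H = X \<Longrightarrow>
  pb2 (I2 H) = \<lparr>C2Src = pb H, C2Tgt = pb H, C2Cell = I2 (U \<odot> H)\<rparr>"
  by (simp add: pb2_def)

lemma k_id2 [simp]:
  "\<theta> \<in> Arr (Two K) \<Longrightarrow> C1 (D2 \<theta>) = X \<Longrightarrow> lwhisker (Comon K) k (id_comonad2 K \<theta>) = pb2 \<theta>"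
  using category.idn_arr[OF category_two_Comon, of k] by (simp add: lwhisker_def pb2_def)

abbreviation "coalg \<equiv> coalg_obj_of K W X U c"

lemma coalg_simps:
  "Carrier coalg = X"
  "Iso coalg D = \<lparr>Src = homcat K D X, Tgt = homcat (Comon K) (id_comonad K D) W,
       Fob = (\<lambda>G\<in>Obj (homcat K D X). pb G), Far = (\<lambda>\<theta>\<in>Arr (homcat K D X). pb2 \<theta>)\<rparr>"
  by (auto simp: coalg_obj_of_def Let_def homcat_def hom_def obj_two fun_eq_iff restrict_def simp flip: k_def)

lemma Iso_simps [simp]:
  "H \<in> Arr (One K) \<Longrightarrow> C1 H = X \<Longrightarrow> D1 H = D \<Longrightarrow> Fob (Iso coalg D) H = pb H"
  "\<theta> \<in> Arr (Two K) \<Longrightarrow> C1 (D2 \<theta>) = X \<Longrightarrow> D1 (D2 \<theta>) = D \<Longrightarrow> Far (Iso coalg D) \<theta> = pb2 \<theta>"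
  by (simp_all add: coalg_simps homcat_def hom_def obj_two)

lemma homcat_simps:
  "Obj (homcat K D X) = hom (One K) D X"
  "\<theta> \<in> Arr (homcat K D X) \<longleftrightarrow> \<theta> \<in> Arr (Two K) \<and> D1 (D2 \<theta>) = D \<and> C1 (D2 \<theta>) = X"
  by (auto simp: homcat_def hom_def obj_two)

lemma One_Comon [simp]: "Arr (One (Comon K)) = {m. comonad_mor K m}"
  "comonad_mor K m \<Longrightarrow> Dom (One (Comon K)) m = CSrc m" "comonad_mor K m \<Longrightarrow> Cod (One (Comon K)) m = CTgt m"
  by (simp_all add: Comon_def)

text \<open>\<open>Iso\<close> is bijective on objects by \<open>ex1_lift\<close> and on arrows by
  \<open>ex1_lift2\<close>. Its 2-naturality is associativity, since it acts by composition with
  \<open>k\<close>.\<close>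

theorem object_of_coalgebras_coalg: "object_of_coalgebras K W coalg"
proof
  fix D assume D: "D \<in> Obj (One K)"
  let ?C = "homcat K D X" and ?D = "homcat (Comon K) (id_comonad K D) W"
  have D_iff: "Obj ?D = {m. comonad_mor K m \<and> CSrc m = id_comonad K D \<and> CTgt m = W}"
    by (auto simp: homcat_def hom_def)
  have D_iff2: "m \<in> Arr ?D \<longleftrightarrow> comonad_mor2 K m \<and> CSrc (C2Src m) = id_comonad K D \<and> CTgt (C2Src m) = W" for m
    by (auto simp: homcat_def hom_def comonad_mor2_def)
  have cats: "category ?C" "category ?D" by (simp_all add: homcat_def category_two_Comon)
  have H: "\<exists>!H. H \<in> hom (One K) D X \<and> pb H = m"
    if m: "comonad_mor K m" "CSrc m = id_comonad K D" "CTgt m = W" for m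
  proof -
    have eq: "\<lparr>CSrc = id_comonad K D, CTgt = W, CMap = CMap m, CCell = CCell m\<rparr> = m"
      using m by (intro cmor.equality) simp_all
    have "coaction W D (CMap m) (CCell m)" using m(1) by (simp add: eq flip: comonad_mor_iff[OF W D])
    from ex1_lift[OF this D] obtain H where H: "H \<in> hom (One K) D X" "U \<odot> H = CMap m" "c \<star> I2 H = CCell m"
      and un: "\<And>H'. H' \<in> hom (One K) D X \<Longrightarrow> U \<odot> H' = CMap m \<Longrightarrow> c \<star> I2 H' = CCell m \<Longrightarrow> H' = H" by blast
    show ?thesis
    proof (rule ex1I[of _ H])
      show "H \<in> hom (One K) D X \<and> pb H = m" using H eq by (simp add: hom_def pb_def)
      fix H' assume "H' \<in> hom (One K) D X \<and> pb H' = m"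
      then show "H' = H" using pb_simps(3,4)[of H'] by (intro un) auto
    qed
  qed
  show "cat_isomorphism (Iso coalg D)"
  proof (rule cat_isomorphismI)
    show "fctr (Iso coalg D)"
      unfolding coalg_simps
    proof (rule fctrI)
      fix \<theta> \<phi> assume tp: "\<theta> \<in> Arr ?C" "\<phi> \<in> Arr ?C" "Dom ?C \<phi> = Cod ?C \<theta>"
      then have tp': "\<theta> \<in> Arr (Two K)" "\<phi> \<in> Arr (Two K)" "D2 \<phi> = C2 \<theta>" "D1 (D2 \<theta>) = D" "C1 (D2 \<theta>) = X"
        by (auto simp: homcat_def hom_def)
      have "\<phi> \<cdot>\<^bsub>?C\<^esub> \<theta> = \<phi> \<bullet> \<theta>" using tp by (auto simp: homcat_def)
      moreover have "pb2 \<phi> \<cdot>\<^bsub>?D\<^esub> pb2 \<theta> = pb2 \<phi> \<cdot>\<^bsub>Two (Comon K)\<^esub> pb2 \<theta>"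
        using tp' unfolding homcat_def by (intro full_subcat_simps) (auto simp: hom_def)
      ultimately show "pb2 (\<phi> \<cdot>\<^bsub>?C\<^esub> \<theta>) = pb2 \<phi> \<cdot>\<^bsub>?D\<^esub> pb2 \<theta>"
        using tp' by (simp add: pb2_def[of "\<phi> \<bullet> \<theta>"] whisker_left)
    qed (use cats in \<open>auto simp: homcat_def hom_def obj_two D category_two_Comon\<close>)
    fix B assume "B \<in> Obj ?D"
    then have B: "comonad_mor K B" "CSrc B = id_comonad K D" "CTgt B = W" by (simp_all add: D_iff)
    have "Fob (Iso coalg D) A = pb A" if "A \<in> hom (One K) D X" for A
      using that by (simp add: hom_def)
    then show "\<exists>!A. A \<in> Obj ?C \<and> Fob (Iso coalg D) A = B"
      unfolding homcat_simps using H[OF B] by metis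
  next
    fix \<theta> assume "\<theta> \<in> Arr ?D"
    then have t: "comonad_mor2 K \<theta>" "CSrc (C2Src \<theta>) = id_comonad K D" "CTgt (C2Src \<theta>) = W"
      by (auto simp: D_iff2)
    \<comment> \<open>\<open>ex1_lift2\<close> lifts a 2-cell only between given 1-cells, so the
      source and the target of \<open>\<theta>\<close> are classified first.\<close>
    from H[of "C2Src \<theta>"] obtain H1 where H1: "H1 \<in> hom (One K) D X" "pb H1 = C2Src \<theta>"
      using t unfolding comonad_mor2_def by blast
    from H[of "C2Tgt \<theta>"] obtain H2 where H2: "H2 \<in> hom (One K) D X" "pb H2 = C2Tgt \<theta>"
      using t unfolding comonad_mor2_def by metis
    have h: "H1 \<in> Arr (One K)" "D1 H1 = D" "C1 H1 = X" "H2 \<in> Arr (One K)" "D1 H2 = D" "C1 H2 = X"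
      using H1 H2 by (auto simp: hom_def)
    have cell: "C2Cell \<theta> \<in> hom (Two K) (U \<odot> H1) (U \<odot> H2)"
      using comonad_mor2.c2cell[OF t(1)] by (simp flip: H1(2) H2(2))
    have "coalg_map W (c \<star> I2 H1) (c \<star> I2 H2) (C2Cell \<theta>)"
      using comonad_mor2.c2compat[OF t(1)] cell h
      by (simp add: coalg_map_def lwhisker_def rwhisker_def hom_def flip: H1(2) H2(2))
    from ex1_lift2[OF H1(1) H2(1) cell this] obtain \<phi> where
      p: "\<phi> \<in> hom (Two K) H1 H2" "I2 U \<star> \<phi> = C2Cell \<theta>"
      and un: "\<And>\<psi>. \<psi> \<in> hom (Two K) H1 H2 \<Longrightarrow> I2 U \<star> \<psi> = C2Cell \<theta> \<Longrightarrow> \<psi> = \<phi>" by blast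
    \<comment> \<open>A competing preimage of \<open>\<theta>\<close> is not known to run from
      \<open>H1\<close> to \<open>H2\<close>; injectivity of \<open>pb\<close> fixes its ends, after
      which the uniqueness of \<open>\<phi>\<close> applies.\<close>
    have inj: "J = H" if "J \<in> hom (One K) D X" "H \<in> hom (One K) D X" "pb J = pb H" for J H
      using H[of "pb H"] that by (auto simp: hom_def)
    have pe: "pb2 \<phi> = \<theta>" using p H1 H2 by (simp add: pb2_def hom_def)
    show "\<exists>!f. f \<in> Arr ?C \<and> Far (Iso coalg D) f = \<theta>"
    proof (rule ex1I[of _ \<phi>])
      show "\<phi> \<in> Arr ?C \<and> Far (Iso coalg D) \<phi> = \<theta>"
        using p h pe by (auto simp: homcat_simps hom_def)
    next
      fix f assume f: "f \<in> Arr ?C \<and> Far (Iso coalg D) f = \<theta>"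
      then have f'': "f \<in> Arr (Two K)" "D1 (D2 f) = D" "C1 (D2 f) = X" by (simp_all add: homcat_simps)
      then have f': "f \<in> Arr (Two K)" "D1 (D2 f) = D" "C1 (D2 f) = X" "pb2 f = \<theta>" using f by simp_all
      have "D2 f = H1" using f' H1 by (intro inj) (auto simp: hom_def)
      moreover have "C2 f = H2" using f' H2 by (intro inj) (auto simp: hom_def)
      ultimately show "f = \<phi>" using f' by (intro un) (auto simp: hom_def)
    qed
  qed (simp_all add: coalg_simps)
next
  fix g h assume gh: "g \<in> Arr (One K)" "C1 g = Carrier coalg" "h \<in> Arr (One K)" "C1 h = D1 g"
  then have "pb (g \<odot> h) = cmor_comp K (pb g) (id_comonad1 K h)"
    by (simp add: coalg_simps cmor_comp_def pb_def id_comonad1_def rwhisker_def lwhisker_def)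
  then show "Fob (Iso coalg (D1 h)) (g \<odot> h)
      = Fob (Iso coalg (D1 g)) g \<cdot>\<^bsub>One (Comon K)\<^esub> id_comonad1 K h"
    using gh by (simp add: coalg_simps(1))
next
  fix \<phi> \<theta> assume gh: "\<phi> \<in> Arr (Two K)" "Cod (horizontal K) \<phi> = Carrier coalg" "\<theta> \<in> Arr (Two K)"
    "Cod (horizontal K) \<theta> = Dom (horizontal K) \<phi>"
  have *: "pb (g \<odot> h) = cmor_comp K (pb g) (id_comonad1 K h)"
    if "g \<in> Arr (One K)" "C1 g = X" "h \<in> Arr (One K)" "C1 h = D1 g" for g h
    using that by (simp add: coalg_simps cmor_comp_def pb_def id_comonad1_def rwhisker_def lwhisker_def)
  have "pb2 (\<phi> \<star> \<theta>) = pb2 \<phi> \<star>\<^bsub>Comon K\<^esub> id_comonad2 K \<theta>"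
    using gh by (simp add: coalg_simps(1) pb2_def[of "\<phi> \<star> \<theta>"] *)
  then show "Far (Iso coalg (Dom (horizontal K) \<theta>)) (\<phi> \<star> \<theta>) =
           Far (Iso coalg (Dom (horizontal K) \<phi>)) \<phi> \<star>\<^bsub>Comon K\<^esub> id_comonad2 K \<theta>"
    using gh by (simp add: coalg_simps(1))
qed (simp_all add: coalg_simps)

section \<open>The forgetful-cofree adjunction of a universal coaction\<close>

definition cofree where "cofree = (THE F. F \<in> hom (One K) (Base W) X \<and> U \<odot> F = Endo W \<and> c \<star> I2 F = Comult W)"

lemma cofree: "cofree \<in> Arr (One K)" "D1 cofree = Base W" "C1 cofree = X" "U \<odot> cofree = Endo W"
    "c \<star> I2 cofree = Comult W"
  and cofree_unique: "F \<in> hom (One K) (Base W) X \<Longrightarrow> U \<odot> F = Endo W \<Longrightarrow> c \<star> I2 F = Comult W \<Longrightarrow> F = cofree"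
proof -
  \<comment> \<open>The comonad coacts on its own endo-1-cell, at stage \<open>Base W\<close>; this
    coaction is what the cofree 1-cell classifies.\<close>
  have co: "coaction W (Base W) (Endo W) (Comult W)"
    using W by (simp add: coaction_def hom_def comonad_def rwhisker_def lwhisker_def)
  have "\<exists>!F. F \<in> hom (One K) (Base W) X \<and> U \<odot> F = Endo W \<and> c \<star> I2 F = Comult W"
    using ex1_lift[OF co] by simp
  note t = theI'[OF this, folded cofree_def]
  then show "cofree \<in> Arr (One K)" "D1 cofree = Base W" "C1 cofree = X" "U \<odot> cofree = Endo W"
    "c \<star> I2 cofree = Comult W" by (auto simp: hom_def)
  show "F \<in> hom (One K) (Base W) X \<Longrightarrow> U \<odot> F = Endo W \<Longrightarrow> c \<star> I2 F = Comult W \<Longrightarrow> F = cofree"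
    using ex1_lift[OF co] t by auto
qed

lemmas [simp] = cofree(1-3)

definition unit where "unit = (THE \<eta>. \<eta> \<in> hom (Two K) (I1 X) (cofree \<odot> U) \<and> I2 U \<star> \<eta> = c)"

text \<open>Coassociativity of \<open>c\<close> says precisely that \<open>c\<close> is a coalgebra
  map from the universal coalgebra to the cofree coalgebra on \<open>U\<close>, so it lifts along
  \<open>U\<close>.\<close>

lemma unit_ex: "\<exists>!\<eta>. \<eta> \<in> hom (Two K) (I1 X) (cofree \<odot> U) \<and> I2 U \<star> \<eta> = c"
proof -
  have [simp]: "U \<odot> (cofree \<odot> U) = Endo W \<odot> U" by (simp add: cofree(4) flip: category.assoc[OF one])
  have "c \<star> I2 (cofree \<odot> U) = (c \<star> I2 cofree) \<star> I2 U" by simp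
  then have *: "c \<star> I2 (cofree \<odot> U) = Comult W \<star> I2 U" by (simp only: cofree(5))
  show ?thesis by (rule ex1_lift2) (simp_all add: hom_def coalg_map_def * c_comult)
qed

lemma unit: "unit \<in> Arr (Two K)" "D2 unit = I1 X" "C2 unit = cofree \<odot> U" "I2 U \<star> unit = c"
  using theI'[OF unit_ex, folded unit_def] by (auto simp: hom_def)

lemma unit_unique: "\<eta> \<in> hom (Two K) (I1 X) (cofree \<odot> U) \<Longrightarrow> I2 U \<star> \<eta> = c \<Longrightarrow> \<eta> = unit"
  using unit_ex theI'[OF unit_ex, folded unit_def] by blast

lemmas [simp] = unit(1-3)

lemma coalg_forget_eq: "coalg_forget K coalg = U"
  by (simp add: coalg_forget_def coalg_simps(1))

lemma coalg_cofree_eq: "coalg_cofree K W coalg = cofree"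
  unfolding coalg_cofree_def coalg_simps(1)
proof (rule the_equality)
  show "cofree \<in> hom (One K) (Base W) X \<and> Fob (Iso coalg (Base W)) cofree =
    \<lparr>CSrc = id_comonad K (Base W), CTgt = W, CMap = Endo W, CCell = Comult W\<rparr>"
    by (simp add: hom_def pb_def cofree(4,5))
next
  fix F assume "F \<in> hom (One K) (Base W) X \<and> Fob (Iso coalg (Base W)) F =
    \<lparr>CSrc = id_comonad K (Base W), CTgt = W, CMap = Endo W, CCell = Comult W\<rparr>"
  note a = conjunct1[OF this, THEN homD(1)] conjunct1[OF this, THEN homD(2)] conjunct1[OF this, THEN homD(3)] conjunct2[OF this]
  show "F = cofree" using a(4) by (intro cofree_unique) (simp_all add: a(1-3) hom_def pb_def)
qed

lemma coalg_unit_eq: "coalg_unit K W coalg = unit"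
  unfolding coalg_unit_def coalg_simps(1) coalg_cofree_eq coalg_forget_eq
proof (rule the_equality)
  show "unit \<in> hom (Two K) (I1 X) (cofree \<odot> U) \<and> C2Cell (Far (Iso coalg X) unit) = CCell (Fob (Iso coalg X) (I1 X))"
    by (simp add: hom_def unit(4))
next
  fix F assume "F \<in> hom (Two K) (I1 X) (cofree \<odot> U) \<and> C2Cell (Far (Iso coalg X) F) = CCell (Fob (Iso coalg X) (I1 X))"
  note a = conjunct1[OF this, THEN homD(1)] conjunct1[OF this, THEN homD(2)] conjunct1[OF this, THEN homD(3)] conjunct2[OF this]
  show "F = unit" using a(4) by (intro unit_unique) (simp_all add: a(1-3) hom_def)
qed

lemma coalg_adj_eq: "coalg_adj K W coalg = \<lparr>LAdj = U, RAdj = cofree, AUnit = unit, ACounit = Counit W\<rparr>"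
  by (simp add: coalg_adj_def coalg_forget_eq coalg_cofree_eq coalg_unit_eq)

lemma comult_unit: "I2 U \<star> unit \<star> I2 cofree = Comult W"
proof -
  have "I2 U \<star> unit \<star> I2 cofree = (I2 U \<star> unit) \<star> I2 cofree" by simp
  then show ?thesis unfolding unit(4) by (simp add: cofree(5))
qed

text \<open>One triangle identity is the counit law of \<open>c\<close>. The other is an equation of
  2-cells into \<open>X\<close>: after whiskering with \<open>U\<close> it becomes a counit law of
  the comonad, and \<open>ex1_lift2\<close> makes whiskering with \<open>U\<close> injective on such
  lifts.\<close>

lemma coalg_adjunction: "adjunction K (coalg_adj K W coalg)"
  unfolding coalg_adj_eq
proof
  let ?F = cofree
  let ?J = "\<lparr>LAdj = U, RAdj = cofree, AUnit = unit, ACounit = Counit W\<rparr>"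
  note [simp] = cofree(4)
  have e: "U \<odot> (cofree \<odot> f) = Endo W \<odot> f" if "f \<in> Arr (One K)" "C1 f = Base W" for f
    using that by (simp flip: category.assoc[OF one])
  have ue: "I2 U \<star> (I2 ?F \<star> Counit W) = I2 (Endo W) \<star> Counit W"
    by (simp flip: hcmp_assoc)
  have A: "I2 ?F \<star> Counit W \<in> Arr (Two K)" "unit \<star> I2 ?F \<in> Arr (Two K)" by simp_all
  have "I2 U \<star> ((I2 ?F \<star> Counit W) \<bullet> (unit \<star> I2 ?F)) = (I2 (Endo W) \<star> Counit W) \<bullet> Comult W"
    using ue comult_unit by (subst whisker_left) simp_all
  also have "\<dots> = I2 U \<star> I2 ?F"
    using comonad.counit_right[OF W] by (simp add: lwhisker_def)
  finally have *: "I2 U \<star> ((I2 ?F \<star> Counit W) \<bullet> (unit \<star> I2 ?F)) = I2 U \<star> I2 ?F" .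
  have ex: "\<exists>!\<phi>. \<phi> \<in> hom (Two K) ?F ?F \<and> I2 U \<star> \<phi> = I2 (Endo W)"
    by (rule ex1_lift2) (simp_all add: hom_def coalg_map_def cofree(5))
  let ?\<phi> = "(I2 ?F \<star> Counit W) \<bullet> (unit \<star> I2 ?F)"
  have "?\<phi> \<in> hom (Two K) ?F ?F \<and> I2 U \<star> ?\<phi> = I2 (Endo W)" using * by (simp add: hom_def)
  moreover have "I2 ?F \<in> hom (Two K) ?F ?F \<and> I2 U \<star> I2 ?F = I2 (Endo W)" by (simp add: hom_def)
  ultimately have "?\<phi> = I2 ?F" using ex by blast
  then show "lwhisker K (RAdj ?J) (ACounit ?J) \<bullet> rwhisker K (AUnit ?J) (RAdj ?J) = I2 (RAdj ?J)"
    by (simp add: lwhisker_def rwhisker_def)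
qed (simp_all add: hom_def lwhisker_def rwhisker_def unit(4) c_counit cofree(4))

lemma adj_comonad_eq: "adj_comonad K (coalg_adj K W coalg) = W"
  unfolding coalg_adj_eq by (simp add: adj_comonad_def lwhisker_def rwhisker_def comult_unit cofree(4))

text \<open>The adjunction induces \<open>W\<close> itself, and the coaction it puts on
  \<open>U\<close> is \<open>I2 U \<star> unit = c\<close>. The comparison thus classifies the
  universal coaction, which the identity does as well.\<close>

lemma comparison_eq: "comparison K coalg (coalg_adj K W coalg) = I1 X"
  unfolding comparison_def adj_comonad_eq coalg_simps(1) unfolding coalg_adj_eq cmor.simps adj.simps
proof (rule the_equality)
  show "I1 X \<in> hom (One K) (D1 U) X \<and> Fob (Iso coalg (D1 U)) (I1 X) =
      \<lparr>CSrc = id_comonad K (D1 U), CTgt = W, CMap = U, CCell = lwhisker K U unit\<rparr>"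
    by (simp add: hom_def pb_def lwhisker_def unit(4))
next
  fix H assume "H \<in> hom (One K) (D1 U) X \<and> Fob (Iso coalg (D1 U)) H =
      \<lparr>CSrc = id_comonad K (D1 U), CTgt = W, CMap = U, CCell = lwhisker K U unit\<rparr>"
  note a = conjunct1[OF this, THEN homD(1)] conjunct1[OF this, THEN homD(2)] conjunct1[OF this, THEN homD(3)] conjunct2[OF this]
  have "H \<in> hom (One K) X X \<and> U \<odot> H = U \<and> c \<star> I2 H = c" using a(4) by (simp add: a(1-3)[simplified] hom_def pb_def lwhisker_def unit(4))
  moreover have "I1 X \<in> hom (One K) X X \<and> U \<odot> I1 X = U \<and> c \<star> I2 (I1 X) = c" by (simp add: hom_def)
  ultimately show "H = I1 X" using ex1_lift[OF coact X] by blast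
qed

end

text \<open>The right adjoint and the unit are characterised by equations over \<open>U\<close> and
  \<open>c\<close>. A strict 2-functor preserves these equations, so uniqueness in \<open>L\<close>
  identifies the images; that the image of the universal coaction is again universal is what turns
  this into an equality.\<close>

theorem preserves_coalgebras:
  assumes K: "universal_coaction K W X U c" and \<Phi>: "strict_2_functor K L \<Phi>"
    and L: "universal_coaction L (map_comonad \<Phi> W) (F0 \<Phi> X) (F1 \<Phi> U) (F2 \<Phi> c)"
  shows "map_adj \<Phi> (coalg_adj K W (coalg_obj_of K W X U c)) =
    coalg_adj L (map_comonad \<Phi> W) (coalg_obj_of L (map_comonad \<Phi> W) (F0 \<Phi> X) (F1 \<Phi> U) (F2 \<Phi> c))"
proof -
  interpret K: universal_coaction K W X U c by fact
  interpret L: universal_coaction L "map_comonad \<Phi> W" "F0 \<Phi> X" "F1 \<Phi> U" "F2 \<Phi> c" by fact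
  interpret F: strict_2_functor K L \<Phi> by fact
  have 1: "F1 \<Phi> K.cofree = L.cofree"
  proof (rule L.cofree_unique)
    show "F1 \<Phi> K.cofree \<in> hom (One L) (Base (map_comonad \<Phi> W)) (F0 \<Phi> X)"
      using F.f1[of K.cofree] by (simp add: map_comonad_def)
    show "F1 \<Phi> U \<cdot>\<^bsub>One L\<^esub> F1 \<Phi> K.cofree = Endo (map_comonad \<Phi> W)"
      using F.f1_cmp[of K.cofree U] by (simp add: map_comonad_def K.cofree(4))
    show "F2 \<Phi> c \<star>\<^bsub>L\<^esub> Idn (Two L) (F1 \<Phi> K.cofree) = Comult (map_comonad \<Phi> W)"
      using F.f2_hcmp[of "K.I2 K.cofree" c] F.f2_idn[of K.cofree] by (simp add: map_comonad_def K.cofree(5))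
  qed
  have 2: "F2 \<Phi> K.unit = L.unit"
  proof (rule L.unit_unique)
    show "F2 \<Phi> K.unit \<in> hom (Two L) (Idn (One L) (F0 \<Phi> X)) (L.cofree \<cdot>\<^bsub>One L\<^esub> F1 \<Phi> U)"
      using F.f2[of K.unit] F.f1_idn[OF K.X] F.f1_cmp[of U K.cofree] by (simp add: 1)
    show "Idn (Two L) (F1 \<Phi> U) \<star>\<^bsub>L\<^esub> F2 \<Phi> K.unit = F2 \<Phi> c"
      using F.f2_hcmp[of K.unit "K.I2 U"] F.f2_idn[of U] by (simp add: K.unit(4))
  qed
  show ?thesis unfolding K.coalg_adj_eq L.coalg_adj_eq
    by (simp add: map_adj_def 1 2) (simp add: map_comonad_def)
qed

section \<open>Categories of coalgebras\<close>

interpretation CAT: strict_2_category CAT by (rule strict_2_category_CAT)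

lemma comonad_CAT_simps [simp]:
  assumes "comonad CAT W"
  shows "category (Base W)" "fctr (Endo W)" "Src (Endo W) = Base W" "Tgt (Endo W) = Base W"
    "ntrans (Counit W)" "NSrc (Counit W) = Endo W" "NTgt (Counit W) = fct_id (Base W)"
    "ntrans (Comult W)" "NSrc (Comult W) = Endo W" "NTgt (Comult W) = fct_comp (Endo W) (Endo W)"
  using CAT.comonad_simps[OF assms] by auto

lemma comonad_CAT_I:
  assumes F: "fctr F" "Src F = B" "Tgt F = B"
    and e: "ntrans e" "NSrc e = F" "NTgt e = fct_id B"
    and d: "ntrans d" "NSrc d = F" "NTgt d = fct_comp F F"
    and laws: "\<And>A. A \<in> Obj B \<Longrightarrow> At e (Fob F A) \<cdot>\<^bsub>B\<^esub> At d A = Idn B (Fob F A)"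
    "\<And>A. A \<in> Obj B \<Longrightarrow> Far F (At e A) \<cdot>\<^bsub>B\<^esub> At d A = Idn B (Fob F A)"
    "\<And>A. A \<in> Obj B \<Longrightarrow> At d (Fob F A) \<cdot>\<^bsub>B\<^esub> At d A = Far F (At d A) \<cdot>\<^bsub>B\<^esub> At d A"
  shows "comonad CAT \<lparr>Base = B, Endo = F, Counit = e, Comult = d\<rparr>"
proof -
  have [simp]: "category B" using F by auto
  have 1: "ntvcomp (nthcomp e (ntid F)) d = ntid F" "ntvcomp (nthcomp (ntid F) e) d = ntid F"
    "ntvcomp (nthcomp d (ntid F)) d = ntvcomp (nthcomp (ntid F) d) d"
    using F e d laws by (auto intro!: ntr_eqI)
  show ?thesis
    using F e d 1 by (intro comonad.intro) (simp_all add: hom_def rwhisker_def lwhisker_def)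
qed

abbreviation EM_co where "EM_co W \<equiv> CCell (EM_coaction W)"

lemma coalgebras_iff: "X \<in> coalgebras W \<longleftrightarrow> X = Tup (tfst X) (tsnd X) \<and> tfst X \<in> Obj (Base W) \<and>
    tsnd X \<in> hom (Base W) (tfst X) (Fob (Endo W) (tfst X)) \<and>
     At (Counit W) (tfst X) \<cdot>\<^bsub>Base W\<^esub> tsnd X = Idn (Base W) (tfst X) \<and>
     At (Comult W) (tfst X) \<cdot>\<^bsub>Base W\<^esub> tsnd X = Far (Endo W) (tsnd X) \<cdot>\<^bsub>Base W\<^esub> tsnd X"
  by (cases X) (auto simp: coalgebras_def)

lemma category_EM [simp]:
  assumes W: "comonad CAT W" shows "category (EM W)"
proof -
  have c: "tfst X \<in> Obj (Base W)" "tsnd X \<in> Arr (Base W)" "Dom (Base W) (tsnd X) = tfst X"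
    "Cod (Base W) (tsnd X) = Fob (Endo W) (tfst X)" if "X \<in> coalgebras W" for X
    using that by (auto simp: coalgebras_iff hom_def)
  show ?thesis unfolding EM_def
  proof (rule category_mkcat)
    fix f g assume *: "f \<in> {Tup X (Tup Y f) | X Y f. X \<in> coalgebras W \<and> Y \<in> coalgebras W \<and>
        f \<in> hom (Base W) (tfst X) (tfst Y) \<and> Far (Endo W) f \<cdot>\<^bsub>Base W\<^esub> tsnd X = tsnd Y \<cdot>\<^bsub>Base W\<^esub> f}"
      "g \<in> {Tup X (Tup Y f) | X Y f. X \<in> coalgebras W \<and> Y \<in> coalgebras W \<and>
        f \<in> hom (Base W) (tfst X) (tfst Y) \<and> Far (Endo W) f \<cdot>\<^bsub>Base W\<^esub> tsnd X = tsnd Y \<cdot>\<^bsub>Base W\<^esub> f}"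
      "tfst g = (tfst \<circ> tsnd) f"
    then obtain X Y Z f' g' where [simp]: "f = Tup X (Tup Y f')" "g = Tup Y (Tup Z g')"
      and h: "X \<in> coalgebras W" "Y \<in> coalgebras W" "Z \<in> coalgebras W"
        "f' \<in> Arr (Base W)" "Dom (Base W) f' = tfst X" "Cod (Base W) f' = tfst Y"
        "g' \<in> Arr (Base W)" "Dom (Base W) g' = tfst Y" "Cod (Base W) g' = tfst Z"
        and eq: "Far (Endo W) f' \<cdot>\<^bsub>Base W\<^esub> tsnd X = tsnd Y \<cdot>\<^bsub>Base W\<^esub> f'"
          "Far (Endo W) g' \<cdot>\<^bsub>Base W\<^esub> tsnd Y = tsnd Z \<cdot>\<^bsub>Base W\<^esub> g'" by (auto simp: hom_def)
    note [simp] = h c[OF h(1)] c[OF h(2)] c[OF h(3)]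
    have "Far (Endo W) (g' \<cdot>\<^bsub>Base W\<^esub> f') \<cdot>\<^bsub>Base W\<^esub> tsnd X = Far (Endo W) g' \<cdot>\<^bsub>Base W\<^esub> (tsnd Y \<cdot>\<^bsub>Base W\<^esub> f')"
      using W by (simp flip: eq)
    also have "\<dots> = tsnd Z \<cdot>\<^bsub>Base W\<^esub> (g' \<cdot>\<^bsub>Base W\<^esub> f')"
      using W by (intro cmp_cong_left[OF _ eq(2)]) simp_all
    finally show "Tup (tfst f) (Tup (tfst (tsnd g)) (tsnd (tsnd g) \<cdot>\<^bsub>Base W\<^esub> tsnd (tsnd f))) \<in> {Tup X (Tup Y f) | X Y f. X \<in> coalgebras W \<and> Y \<in> coalgebras W \<and>
        f \<in> hom (Base W) (tfst X) (tfst Y) \<and> Far (Endo W) f \<cdot>\<^bsub>Base W\<^esub> tsnd X = tsnd Y \<cdot>\<^bsub>Base W\<^esub> f}"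
      using W by (simp add: hom_def)
  qed (use W c in \<open>auto simp: hom_def\<close>)
qed

lemma EM_forget_simps [simp]:
  "Src (EM_forget W) = EM W" "Tgt (EM_forget W) = Base W"
  by (simp_all add: EM_forget_def)

text \<open>The \<open>raw\<close> facts read the tagged encoding directly. They serve to build the
  forgetful functor, the coaction and the introduction and equality rules, through which coalgebras
  are handled afterwards.\<close>

lemma EM_raw_obj:
  assumes "X \<in> Obj (EM W)"
  shows "tfst X \<in> Obj (Base W)" "tsnd X \<in> Arr (Base W)" "Dom (Base W) (tsnd X) = tfst X"
    "Cod (Base W) (tsnd X) = Fob (Endo W) (tfst X)"
  using assms by (auto simp: EM_def coalgebras_iff hom_def)

lemma EM_raw_arr:
  assumes "k \<in> Arr (EM W)"
  shows "Dom (EM W) k = tfst k" "Cod (EM W) k = tfst (tsnd k)" "tfst k \<in> Obj (EM W)" "tfst (tsnd k) \<in> Obj (EM W)"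
    "tsnd (tsnd k) \<in> Arr (Base W)" "Dom (Base W) (tsnd (tsnd k)) = tfst (tfst k)"
    "Cod (Base W) (tsnd (tsnd k)) = tfst (tfst (tsnd k))"
    "Far (Endo W) (tsnd (tsnd k)) \<cdot>\<^bsub>Base W\<^esub> tsnd (tfst k) = tsnd (tfst (tsnd k)) \<cdot>\<^bsub>Base W\<^esub> tsnd (tsnd k)"
proof -
  show "Dom (EM W) k = tfst k" "Cod (EM W) k = tfst (tsnd k)" using assms by (simp_all add: EM_def)
  from assms obtain X Y f where "k = Tup X (Tup Y f)" "X \<in> Obj (EM W)" "Y \<in> Obj (EM W)" "f \<in> hom (Base W) (tfst X) (tfst Y)"
    "Far (Endo W) f \<cdot>\<^bsub>Base W\<^esub> tsnd X = tsnd Y \<cdot>\<^bsub>Base W\<^esub> f"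
    by (auto simp: EM_def)
  then show "tfst k \<in> Obj (EM W)" "tfst (tsnd k) \<in> Obj (EM W)"
    "tsnd (tsnd k) \<in> Arr (Base W)" "Dom (Base W) (tsnd (tsnd k)) = tfst (tfst k)"
    "Cod (Base W) (tsnd (tsnd k)) = tfst (tfst (tsnd k))"
    "Far (Endo W) (tsnd (tsnd k)) \<cdot>\<^bsub>Base W\<^esub> tsnd (tfst k) = tsnd (tfst (tsnd k)) \<cdot>\<^bsub>Base W\<^esub> tsnd (tsnd k)"
    by (simp_all add: hom_def)
qed

lemma EM_raw_idn: "X \<in> Obj (EM W) \<Longrightarrow> tsnd (tsnd (Idn (EM W) X)) = Idn (Base W) (tfst X)"
  by (simp add: EM_def)

lemma EM_raw_cmp: "k \<in> Arr (EM W) \<Longrightarrow> l \<in> Arr (EM W) \<Longrightarrow> tfst l = tfst (tsnd k) \<Longrightarrow>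
   tsnd (tsnd (l \<cdot>\<^bsub>EM W\<^esub> k)) = tsnd (tsnd l) \<cdot>\<^bsub>Base W\<^esub> tsnd (tsnd k)"
  by (simp add: EM_def partial_comp_def)

lemma fctr_EM_forget [simp]:
  assumes "comonad CAT W" shows "fctr (EM_forget W)"
  unfolding EM_forget_def
  by (rule fctrI) (use assms in \<open>simp_all add: EM_raw_obj EM_raw_arr EM_raw_idn EM_raw_cmp\<close>)

lemma EM_co_simps [simp]: "NSrc (EM_co W) = EM_forget W" "NTgt (EM_co W) = fct_comp (Endo W) (EM_forget W)"
  by (simp_all add: EM_coaction_def)

lemma ntrans_EM_co [simp]:
  assumes "comonad CAT W" shows "ntrans (EM_co W)"
proof -
  have [simp]: "Fob (EM_forget W) X = tfst X" if "X \<in> Obj (EM W)" for X using that by (simp add: EM_forget_def)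
  have [simp]: "Far (EM_forget W) k = tsnd (tsnd k)" if "k \<in> Arr (EM W)" for k using that by (simp add: EM_forget_def)
  show ?thesis
    unfolding EM_coaction_def cmor.simps
    by (rule ntransI) (use assms in \<open>simp_all add: EM_raw_obj EM_raw_arr\<close>)
qed

lemma EM_coalg:
  assumes "X \<in> Obj (EM W)"
  shows "At (Counit W) (Fob (EM_forget W) X) \<cdot>\<^bsub>Base W\<^esub> At (EM_co W) X = Idn (Base W) (Fob (EM_forget W) X)"
    "At (Comult W) (Fob (EM_forget W) X) \<cdot>\<^bsub>Base W\<^esub> At (EM_co W) X
      = Far (Endo W) (At (EM_co W) X) \<cdot>\<^bsub>Base W\<^esub> At (EM_co W) X"
  using assms by (auto simp: EM_coaction_def EM_forget_def, auto simp: EM_def coalgebras_def)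

lemma EM_map_eq:
  assumes W: "comonad CAT W" and k: "k \<in> Arr (EM W)"
  shows "Far (Endo W) (Far (EM_forget W) k) \<cdot>\<^bsub>Base W\<^esub> At (EM_co W) (Dom (EM W) k)
    = At (EM_co W) (Cod (EM W) k) \<cdot>\<^bsub>Base W\<^esub> Far (EM_forget W) k"
  using naturality[OF ntrans_EM_co[OF W], of _ "EM W" k] W k by simp

lemma EM_objI:
  assumes "A \<in> Obj (Base W)" "a \<in> Arr (Base W)" "Dom (Base W) a = A" "Cod (Base W) a = Fob (Endo W) A"
    "At (Counit W) A \<cdot>\<^bsub>Base W\<^esub> a = Idn (Base W) A"
    "At (Comult W) A \<cdot>\<^bsub>Base W\<^esub> a = Far (Endo W) a \<cdot>\<^bsub>Base W\<^esub> a"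
  shows "Tup A a \<in> Obj (EM W)"
  using assms by (auto simp: EM_def coalgebras_def hom_def)

lemma EM_obj_simps [simp]:
  "Tup A a \<in> Obj (EM W) \<Longrightarrow> Fob (EM_forget W) (Tup A a) = A"
  "Tup A a \<in> Obj (EM W) \<Longrightarrow> At (EM_co W) (Tup A a) = a"
  by (simp_all add: EM_forget_def EM_coaction_def)

lemma EM_arrI:
  assumes "X \<in> Obj (EM W)" "Y \<in> Obj (EM W)" "f \<in> Arr (Base W)" "Dom (Base W) f = Fob (EM_forget W) X"
    "Cod (Base W) f = Fob (EM_forget W) Y"
    "Far (Endo W) f \<cdot>\<^bsub>Base W\<^esub> At (EM_co W) X = At (EM_co W) Y \<cdot>\<^bsub>Base W\<^esub> f"
  shows "Tup X (Tup Y f) \<in> Arr (EM W)"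
  using assms by (simp add: EM_forget_def EM_coaction_def) (simp add: EM_def hom_def)

lemma EM_arr_simps [simp]:
  "Tup X (Tup Y f) \<in> Arr (EM W) \<Longrightarrow> Dom (EM W) (Tup X (Tup Y f)) = X"
  "Tup X (Tup Y f) \<in> Arr (EM W) \<Longrightarrow> Cod (EM W) (Tup X (Tup Y f)) = Y"
  "Tup X (Tup Y f) \<in> Arr (EM W) \<Longrightarrow> Far (EM_forget W) (Tup X (Tup Y f)) = f"
  by (simp add: EM_def, simp add: EM_def, simp add: EM_forget_def)

lemma EM_obj_eqI:
  assumes "X \<in> Obj (EM W)" "Y \<in> Obj (EM W)" "Fob (EM_forget W) X = Fob (EM_forget W) Y"
    "At (EM_co W) X = At (EM_co W) Y" shows "X = Y"
  using assms by (simp add: EM_forget_def EM_coaction_def) (auto simp: EM_def coalgebras_def)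

lemma EM_arr_eqI:
  assumes "k \<in> Arr (EM W)" "l \<in> Arr (EM W)" "Dom (EM W) k = Dom (EM W) l" "Cod (EM W) k = Cod (EM W) l"
    "Far (EM_forget W) k = Far (EM_forget W) l" shows "k = l"
  using assms by (simp add: EM_forget_def) (auto simp: EM_def)

section \<open>Lifting functors and transformations to coalgebras\<close>

definition cat_coaction where
  "cat_coaction W G \<tau> \<longleftrightarrow> fctr G \<and> Tgt G = Base W \<and> ntrans \<tau> \<and> NSrc \<tau> = G \<and> NTgt \<tau> = fct_comp (Endo W) G \<and>
    (\<forall>A\<in>Obj (Src G). At (Counit W) (Fob G A) \<cdot>\<^bsub>Base W\<^esub> At \<tau> A = Idn (Base W) (Fob G A) \<and>
      At (Comult W) (Fob G A) \<cdot>\<^bsub>Base W\<^esub> At \<tau> A = Far (Endo W) (At \<tau> A) \<cdot>\<^bsub>Base W\<^esub> At \<tau> A)"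

text \<open>For well-typed data each law equates two natural transformations with the same ends, so
  it can be tested at components. For ill-typed data both sides are false.\<close>

lemma coaction_CAT_iff:
  fixes W :: "('u scat, 'u sfct, 'u sntr) cmnd"
  assumes W: "comonad CAT W"
  shows "strict_2_category.coaction CAT W D G \<tau> \<longleftrightarrow> Src G = D \<and> cat_coaction W G \<tau>" (is "?l \<longleftrightarrow> ?r")
proof (cases "fctr G \<and> Src G = D \<and> Tgt G = Base W \<and> ntrans \<tau> \<and> NSrc \<tau> = G \<and> NTgt \<tau> = fct_comp (Endo W) G")
  case True
  then have [simp]: "fctr G" "Src G = D" "Tgt G = Base W" "ntrans \<tau>" "NSrc \<tau> = G" "NTgt \<tau> = fct_comp (Endo W) G" by auto
  have "ntvcomp (nthcomp (Counit W) (ntid G)) \<tau> = ntid G \<longleftrightarrow>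
    (\<forall>A\<in>Obj D. At (Counit W) (Fob G A) \<cdot>\<^bsub>Base W\<^esub> At \<tau> A = Idn (Base W) (Fob G A))" (is "?L \<longleftrightarrow> ?R")
  proof
    assume L: ?L
    show ?R
    proof
      fix A assume "A \<in> Obj D"
      then show "At (Counit W) (Fob G A) \<cdot>\<^bsub>Base W\<^esub> At \<tau> A = Idn (Base W) (Fob G A)"
        using arg_cong[OF L, of "\<lambda>t. At t A"] W by simp
    qed
  next
    assume R: ?R then show ?L using W by (intro ntr_eqI) auto
  qed
  moreover have "ntvcomp (nthcomp (Comult W) (ntid G)) \<tau> = ntvcomp (nthcomp (ntid (Endo W)) \<tau>) \<tau> \<longleftrightarrow>
    (\<forall>A\<in>Obj D. At (Comult W) (Fob G A) \<cdot>\<^bsub>Base W\<^esub> At \<tau> A = Far (Endo W) (At \<tau> A) \<cdot>\<^bsub>Base W\<^esub> At \<tau> A)" (is "?L \<longleftrightarrow> ?R")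
  proof
    assume L: ?L
    show ?R
    proof
      fix A assume "A \<in> Obj D"
      then show "At (Comult W) (Fob G A) \<cdot>\<^bsub>Base W\<^esub> At \<tau> A = Far (Endo W) (At \<tau> A) \<cdot>\<^bsub>Base W\<^esub> At \<tau> A"
        using arg_cong[OF L, of "\<lambda>t. At t A"] W by simp
    qed
  next
    assume R: ?R then show ?L using W by (intro ntr_eqI) auto
  qed
  ultimately show ?thesis using W by (auto simp: CAT.coaction_def cat_coaction_def hom_def)
next
  case False
  then show ?thesis using W by (auto simp: CAT.coaction_def cat_coaction_def hom_def)
qed

definition EM_lift where
  "EM_lift W G \<tau> = \<lparr>Src = Src G, Tgt = EM W, Fob = (\<lambda>A\<in>Obj (Src G). Tup (Fob G A) (At \<tau> A)),
     Far = (\<lambda>f\<in>Arr (Src G). Tup (Tup (Fob G (Dom (Src G) f)) (At \<tau> (Dom (Src G) f)))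
       (Tup (Tup (Fob G (Cod (Src G) f)) (At \<tau> (Cod (Src G) f))) (Far G f)))\<rparr>"

lemma EM_lift_simps [simp]: "Src (EM_lift W G \<tau>) = Src G" "Tgt (EM_lift W G \<tau>) = EM W"
  by (simp_all add: EM_lift_def)

lemma EM_lift_obj:
  assumes "comonad CAT W" "cat_coaction W G \<tau>" "A \<in> Obj (Src G)"
  shows "Tup (Fob G A) (At \<tau> A) \<in> Obj (EM W)"
  by (rule EM_objI) (use assms in \<open>simp_all add: cat_coaction_def\<close>)

lemma EM_lift_arr:
  assumes "comonad CAT W" "cat_coaction W G \<tau>" "f \<in> Arr (Src G)"
  shows "Tup (Tup (Fob G (Dom (Src G) f)) (At \<tau> (Dom (Src G) f)))
       (Tup (Tup (Fob G (Cod (Src G) f)) (At \<tau> (Cod (Src G) f))) (Far G f)) \<in> Arr (EM W)"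
proof -
  have h: "fctr G" "Tgt G = Base W" "ntrans \<tau>" "NSrc \<tau> = G" "NTgt \<tau> = fct_comp (Endo W) G"
    using assms by (auto simp: cat_coaction_def)
  note [simp] = EM_lift_obj[OF assms(1,2)]
  show ?thesis by (rule EM_arrI) (use assms h naturality[OF h(3), of _ _ f] in simp_all)
qed

lemma fctr_EM_lift [simp]:
  assumes "comonad CAT W" "cat_coaction W G \<tau>"
  shows "fctr (EM_lift W G \<tau>)"
proof -
  have h: "fctr G" "Tgt G = Base W" using assms by (auto simp: cat_coaction_def)
  note [simp] = EM_lift_obj[OF assms] EM_lift_arr[OF assms]
  \<comment> \<open>The tagged image of a composite, with its ends in the form that
    \<open>simp\<close> reaches; \<open>EM_arr_eqI\<close> asks for its membership in this
    form.\<close>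
  have cc: "Tup (Tup (Fob G (Dom (Src G) f)) (At \<tau> (Dom (Src G) f)))
       (Tup (Tup (Fob G (Cod (Src G) g)) (At \<tau> (Cod (Src G) g))) (Far G (g \<cdot>\<^bsub>Src G\<^esub> f))) \<in> Arr (EM W)"
       if "f \<in> Arr (Src G)" "g \<in> Arr (Src G)" "Dom (Src G) g = Cod (Src G) f" for f g
       using EM_lift_arr[OF assms, of "g \<cdot>\<^bsub>Src G\<^esub> f"] that h by simp
  have ci: "Tup (Tup (Fob G A) (At \<tau> A)) (Tup (Tup (Fob G A) (At \<tau> A)) (Idn (Base W) (Fob G A))) \<in> Arr (EM W)"
       if "A \<in> Obj (Src G)" for A
       using EM_lift_arr[OF assms, of "Idn (Src G) A"] that h by simp
  show ?thesis unfolding EM_lift_def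
  proof (rule fctrI)
    fix f g assume fg: "f \<in> Arr (Src G)" "g \<in> Arr (Src G)" "Dom (Src G) g = Cod (Src G) f"
    show "Tup (Tup (Fob G (Dom (Src G) (g \<cdot>\<^bsub>Src G\<^esub> f))) (At \<tau> (Dom (Src G) (g \<cdot>\<^bsub>Src G\<^esub> f))))
       (Tup (Tup (Fob G (Cod (Src G) (g \<cdot>\<^bsub>Src G\<^esub> f))) (At \<tau> (Cod (Src G) (g \<cdot>\<^bsub>Src G\<^esub> f)))) (Far G (g \<cdot>\<^bsub>Src G\<^esub> f))) =
      Tup (Tup (Fob G (Dom (Src G) g)) (At \<tau> (Dom (Src G) g)))
       (Tup (Tup (Fob G (Cod (Src G) g)) (At \<tau> (Cod (Src G) g))) (Far G g)) \<cdot>\<^bsub>EM W\<^esub>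
      Tup (Tup (Fob G (Dom (Src G) f)) (At \<tau> (Dom (Src G) f)))
       (Tup (Tup (Fob G (Cod (Src G) f)) (At \<tau> (Cod (Src G) f))) (Far G f))"
      by (rule EM_arr_eqI[of _ W]) (use assms(1) h cc[OF fg] EM_lift_arr[OF assms fg(2)] fg in simp_all)
  next
    fix A assume A: "A \<in> Obj (Src G)"
    show "Tup (Tup (Fob G (Dom (Src G) (Idn (Src G) A))) (At \<tau> (Dom (Src G) (Idn (Src G) A))))
       (Tup (Tup (Fob G (Cod (Src G) (Idn (Src G) A))) (At \<tau> (Cod (Src G) (Idn (Src G) A)))) (Far G (Idn (Src G) A))) =
      Idn (EM W) (Tup (Fob G A) (At \<tau> A))"
      by (rule EM_arr_eqI[of _ W]) (use assms(1) h ci[OF A] A in simp_all)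
  qed (use assms h in simp_all)
qed

lemma EM_lift_U [simp]:
  assumes "comonad CAT W" "cat_coaction W G \<tau>"
  shows "A \<in> Obj (Src G) \<Longrightarrow> Fob (EM_forget W) (Fob (EM_lift W G \<tau>) A) = Fob G A"
    "A \<in> Obj (Src G) \<Longrightarrow> At (EM_co W) (Fob (EM_lift W G \<tau>) A) = At \<tau> A"
    "f \<in> Arr (Src G) \<Longrightarrow> Far (EM_forget W) (Far (EM_lift W G \<tau>) f) = Far G f"
  using EM_lift_obj[OF assms] EM_lift_arr[OF assms] by (simp_all add: EM_lift_def)

lemma EM_lift_unique:
  assumes "comonad CAT W" "cat_coaction W G \<tau>" "fctr H" "Src H = Src G" "Tgt H = EM W"
    "\<And>A. A \<in> Obj (Src G) \<Longrightarrow> Fob (EM_forget W) (Fob H A) = Fob G A"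
    "\<And>A. A \<in> Obj (Src G) \<Longrightarrow> At (EM_co W) (Fob H A) = At \<tau> A"
    "\<And>f. f \<in> Arr (Src G) \<Longrightarrow> Far (EM_forget W) (Far H f) = Far G f"
  shows "H = EM_lift W G \<tau>"
proof -
  have *: "Fob H A = Fob (EM_lift W G \<tau>) A" if "A \<in> Obj (Src G)" for A
    by (rule EM_obj_eqI[of _ W]) (use that assms in simp_all)
  have [simp]: "category (Src G)" using assms by (auto simp: cat_coaction_def)
  show ?thesis
  proof (rule fct_eqI)
    fix f assume f: "f \<in> Arr (Src (EM_lift W G \<tau>))"
    show "Far H f = Far (EM_lift W G \<tau>) f"
      by (rule EM_arr_eqI[of _ W]) (use f assms * in simp_all)
  qed (use assms * in simp_all)
qed

definition EM_lift2 where
  "EM_lift2 G H \<theta> = \<lparr>NSrc = G, NTgt = H, At = (\<lambda>A\<in>Obj (Src G). Tup (Fob G A) (Tup (Fob H A) (At \<theta> A)))\<rparr>"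

lemma EM_lift2_simps [simp]: "NSrc (EM_lift2 G H \<theta>) = G" "NTgt (EM_lift2 G H \<theta>) = H"
  by (simp_all add: EM_lift2_def)

definition cat_coalg_map where
  "cat_coalg_map W G H \<theta> \<longleftrightarrow> fctr G \<and> fctr H \<and> Src H = Src G \<and> Tgt G = EM W \<and> Tgt H = EM W \<and>
     ntrans \<theta> \<and> NSrc \<theta> = fct_comp (EM_forget W) G \<and> NTgt \<theta> = fct_comp (EM_forget W) H \<and>
     (\<forall>A\<in>Obj (Src G). Far (Endo W) (At \<theta> A) \<cdot>\<^bsub>Base W\<^esub> At (EM_co W) (Fob G A)
       = At (EM_co W) (Fob H A) \<cdot>\<^bsub>Base W\<^esub> At \<theta> A)"

lemma EM_lift2:
  assumes "comonad CAT W" "cat_coalg_map W G H \<theta>"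
  shows "ntrans (EM_lift2 G H \<theta>)"
    and "A \<in> Obj (Src G) \<Longrightarrow> Far (EM_forget W) (At (EM_lift2 G H \<theta>) A) = At \<theta> A"
proof -
  have h: "fctr G" "fctr H" "Src H = Src G" "Tgt G = EM W" "Tgt H = EM W" "ntrans \<theta>"
     "NSrc \<theta> = fct_comp (EM_forget W) G" "NTgt \<theta> = fct_comp (EM_forget W) H"
    using assms by (auto simp: cat_coalg_map_def)
  have a: "Tup (Fob G A) (Tup (Fob H A) (At \<theta> A)) \<in> Arr (EM W)" if "A \<in> Obj (Src G)" for A
    by (rule EM_arrI) (use that assms in \<open>simp_all add: cat_coalg_map_def\<close>)
  then show "A \<in> Obj (Src G) \<Longrightarrow> Far (EM_forget W) (At (EM_lift2 G H \<theta>) A) = At \<theta> A"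
    by (simp add: EM_lift2_def)
  show "ntrans (EM_lift2 G H \<theta>)"
    unfolding EM_lift2_def
  proof (rule ntransI)
    fix f assume f: "f \<in> Arr (Src G)"
    note a1 = a[of "Dom (Src G) f"] a[of "Cod (Src G) f"]
    show "Tup (Fob G (Cod (Src G) f)) (Tup (Fob H (Cod (Src G) f)) (At \<theta> (Cod (Src G) f))) \<cdot>\<^bsub>Tgt G\<^esub> Far G f =
         Far H f \<cdot>\<^bsub>Tgt G\<^esub> Tup (Fob G (Dom (Src G) f)) (Tup (Fob H (Dom (Src G) f)) (At \<theta> (Dom (Src G) f)))"
      by (rule EM_arr_eqI[of _ W]) (use f a1 assms(1) h naturality[OF h(6), of _ _ f] in simp_all)
  qed (use assms h a in simp_all)
qed

lemma EM_lift2_unique: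
  assumes "comonad CAT W" "cat_coalg_map W G H \<theta>" "ntrans \<phi>" "NSrc \<phi> = G" "NTgt \<phi> = H"
    "\<And>A. A \<in> Obj (Src G) \<Longrightarrow> Far (EM_forget W) (At \<phi> A) = At \<theta> A"
  shows "\<phi> = EM_lift2 G H \<theta>"
proof (rule ntr_eqI)
  fix A assume A: "A \<in> Obj (Src (NSrc (EM_lift2 G H \<theta>)))"
  have h: "fctr G" "fctr H" "Src H = Src G" "Tgt G = EM W" "Tgt H = EM W"
    using assms by (auto simp: cat_coalg_map_def)
  show "At \<phi> A = At (EM_lift2 G H \<theta>) A"
    by (rule EM_arr_eqI[of _ W]) (use A assms h EM_lift2[OF assms(1,2)] in simp_all)
qed (use assms EM_lift2[OF assms(1,2)] in simp_all)

text \<open>A lift is forced to send an object to the pair of its value and the component of the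
  coaction, and an arrow to its tagged image. The tags make an arrow of \<open>EM W\<close> remember
  its two coalgebras, so the uniqueness is an equality of functors.\<close>

theorem universal_EM:
  fixes W :: "('a univ scat, 'a univ sfct, 'a univ sntr) cmnd"
  assumes W: "comonad CAT W"
  shows "universal_coaction CAT W (EM W) (EM_forget W) (EM_co W)"
proof (intro universal_coaction.intro universal_coaction_axioms.intro)
  show "CAT.coaction W (EM W) (EM_forget W) (EM_co W)"
    unfolding coaction_CAT_iff[OF W] using W EM_coalg by (auto simp: cat_coaction_def)
next
  fix D G \<tau> assume "CAT.coaction W D G \<tau>"
  then have c: "cat_coaction W G \<tau>" "Src G = D" unfolding coaction_CAT_iff[OF W] by auto
  then have h: "fctr G" "Tgt G = Base W" "ntrans \<tau>" "NSrc \<tau> = G" "NTgt \<tau> = fct_comp (Endo W) G"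
    by (auto simp: cat_coaction_def)
  show "\<exists>!H. H \<in> hom (One CAT) D (EM W) \<and> EM_forget W \<cdot>\<^bsub>One CAT\<^esub> H = G \<and> EM_co W \<star>\<^bsub>CAT\<^esub> Idn (Two CAT) H = \<tau>"
  proof (rule ex1I[of _ "EM_lift W G \<tau>"])
    have "fct_comp (EM_forget W) (EM_lift W G \<tau>) = G"
      by (rule fct_eqI) (use W c h in simp_all)
    moreover have "nthcomp (EM_co W) (ntid (EM_lift W G \<tau>)) = \<tau>"
      by (rule ntr_eqI) (use W c h calculation in simp_all)
    ultimately show "EM_lift W G \<tau> \<in> hom (One CAT) D (EM W) \<and> EM_forget W \<cdot>\<^bsub>One CAT\<^esub> EM_lift W G \<tau> = G \<and>
      EM_co W \<star>\<^bsub>CAT\<^esub> Idn (Two CAT) (EM_lift W G \<tau>) = \<tau>"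
      using W c h by (simp add: hom_def)
  next
    fix H assume H: "H \<in> hom (One CAT) D (EM W) \<and> EM_forget W \<cdot>\<^bsub>One CAT\<^esub> H = G \<and> EM_co W \<star>\<^bsub>CAT\<^esub> Idn (Two CAT) H = \<tau>"
    then have H': "fctr H" "Src H = D" "Tgt H = EM W" by (auto simp: hom_def)
    then have e: "fct_comp (EM_forget W) H = G" "nthcomp (EM_co W) (ntid H) = \<tau>"
      using H W by simp_all
    show "H = EM_lift W G \<tau>"
    proof (rule EM_lift_unique)
      fix A assume A: "A \<in> Obj (Src G)"
      show "Fob (EM_forget W) (Fob H A) = Fob G A" using A H' c by (simp flip: e(1))
      show "At (EM_co W) (Fob H A) = At \<tau> A" using W A H' c by (simp flip: e(2))
    next
      fix f assume A: "f \<in> Arr (Src G)"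
      show "Far (EM_forget W) (Far H f) = Far G f" using A H' c by (simp flip: e(1))
    qed (use W c H' in simp_all)
  qed
next
  fix H D H' \<theta> assume hyp: "H \<in> hom (One CAT) D (EM W)" "H' \<in> hom (One CAT) D (EM W)"
    "\<theta> \<in> hom (Two CAT) (EM_forget W \<cdot>\<^bsub>One CAT\<^esub> H) (EM_forget W \<cdot>\<^bsub>One CAT\<^esub> H')"
    "CAT.coalg_map W (EM_co W \<star>\<^bsub>CAT\<^esub> Idn (Two CAT) H) (EM_co W \<star>\<^bsub>CAT\<^esub> Idn (Two CAT) H') \<theta>"
  then have h: "fctr H" "Src H = D" "Tgt H = EM W" "fctr H'" "Src H' = D" "Tgt H' = EM W" by (auto simp: hom_def)
  then have t: "ntrans \<theta>" "NSrc \<theta> = fct_comp (EM_forget W) H" "NTgt \<theta> = fct_comp (EM_forget W) H'"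
    using hyp W by (auto simp: hom_def)
  have eq: "ntvcomp (nthcomp (ntid (Endo W)) \<theta>) (nthcomp (EM_co W) (ntid H)) = ntvcomp (nthcomp (EM_co W) (ntid H')) \<theta>"
    using hyp(4) W h t by (simp add: CAT.coalg_map_def)
  have m: "cat_coalg_map W H H' \<theta>"
    unfolding cat_coalg_map_def
  proof (intro conjI ballI)
    fix A assume "A \<in> Obj (Src H)"
    then show "Far (Endo W) (At \<theta> A) \<cdot>\<^bsub>Base W\<^esub> At (EM_co W) (Fob H A) = At (EM_co W) (Fob H' A) \<cdot>\<^bsub>Base W\<^esub> At \<theta> A"
      using arg_cong[OF eq, of "\<lambda>t. At t A"] W h t by simp
  qed (use h t in auto)
  note l = EM_lift2[OF W m]
  show "\<exists>!\<phi>. \<phi> \<in> hom (Two CAT) H H' \<and> Idn (Two CAT) (EM_forget W) \<star>\<^bsub>CAT\<^esub> \<phi> = \<theta>"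
  proof (rule ex1I[of _ "EM_lift2 H H' \<theta>"])
    have "nthcomp (ntid (EM_forget W)) (EM_lift2 H H' \<theta>) = \<theta>"
      by (rule ntr_eqI) (use W h t l in simp_all)
    then show "EM_lift2 H H' \<theta> \<in> hom (Two CAT) H H' \<and> Idn (Two CAT) (EM_forget W) \<star>\<^bsub>CAT\<^esub> EM_lift2 H H' \<theta> = \<theta>"
      using l W h by (simp add: hom_def)
  next
    fix \<phi> assume p: "\<phi> \<in> hom (Two CAT) H H' \<and> Idn (Two CAT) (EM_forget W) \<star>\<^bsub>CAT\<^esub> \<phi> = \<theta>"
    then have p': "ntrans \<phi>" "NSrc \<phi> = H" "NTgt \<phi> = H'" by (auto simp: hom_def)
    then have e: "nthcomp (ntid (EM_forget W)) \<phi> = \<theta>" using p W h by simp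
    show "\<phi> = EM_lift2 H H' \<theta>"
    proof (rule EM_lift2_unique[OF W m p'])
      fix A assume "A \<in> Obj (Src H)"
      then show "Far (EM_forget W) (At \<phi> A) = At \<theta> A" using W h p' by (simp flip: e)
    qed
  qed
qed (use W in \<open>simp_all add: strict_2_category_CAT\<close>)

lemma EM_choice_eq: "EM_choice W = coalg_obj_of CAT W (EM W) (EM_forget W) (EM_co W)"
  by (simp add: EM_choice_def coalg_obj_of_def Let_def EM_coaction_def)

text \<open>A morphism of comonads whose 2-cell is an identity. Substitution along a coalgebra map
  and the projection from terms to types are of this kind, because the indexed structure of natural
  models is strict.\<close>

definition strict_comonad_map where
  "strict_comonad_map W V G \<longleftrightarrow> fctr G \<and> Src G = Base W \<and> Tgt G = Base V \<and>
    fct_comp G (Endo W) = fct_comp (Endo V) G \<and>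
    (\<forall>A\<in>Obj (Base W). Far G (At (Counit W) A) = At (Counit V) (Fob G A)) \<and>
    (\<forall>A\<in>Obj (Base W). Far G (At (Comult W) A) = At (Comult V) (Fob G A))"

text \<open>The image of a coalgebra with structure map \<open>a\<close> has structure map
  \<open>G a\<close>, whose codomain is right because \<open>G\<close> commutes with the
  endofunctors on the nose.\<close>

definition EM_map where
  "EM_map W V G = EM_lift V (fct_comp G (EM_forget W))
     \<lparr>NSrc = fct_comp G (EM_forget W), NTgt = fct_comp (Endo V) (fct_comp G (EM_forget W)),
      At = (\<lambda>X\<in>Obj (EM W). Far G (At (EM_co W) X))\<rparr>"

lemma strict_comonad_map_pointwise:
  assumes G: "strict_comonad_map W V G"
  shows "A \<in> Obj (Base W) \<Longrightarrow> comonad CAT W \<Longrightarrow> Fob G (Fob (Endo W) A) = Fob (Endo V) (Fob G A)"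
    "f \<in> Arr (Base W) \<Longrightarrow> comonad CAT W \<Longrightarrow> Far G (Far (Endo W) f) = Far (Endo V) (Far G f)"
proof -
  have e: "fct_comp G (Endo W) = fct_comp (Endo V) G" and h: "Src G = Base W" using G by (auto simp: strict_comonad_map_def)
  show "A \<in> Obj (Base W) \<Longrightarrow> comonad CAT W \<Longrightarrow> Fob G (Fob (Endo W) A) = Fob (Endo V) (Fob G A)"
    using arg_cong[OF e, of "\<lambda>t. Fob t A"] h by simp
  show "f \<in> Arr (Base W) \<Longrightarrow> comonad CAT W \<Longrightarrow> Far G (Far (Endo W) f) = Far (Endo V) (Far G f)"
    using arg_cong[OF e, of "\<lambda>t. Far t f"] h by simp
qed

lemma EM_map_coaction:
  assumes W: "comonad CAT W" and V: "comonad CAT V" and G: "strict_comonad_map W V G"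
  shows "cat_coaction V (fct_comp G (EM_forget W))
    \<lparr>NSrc = fct_comp G (EM_forget W), NTgt = fct_comp (Endo V) (fct_comp G (EM_forget W)),
      At = (\<lambda>X\<in>Obj (EM W). Far G (At (EM_co W) X))\<rparr>"
proof -
  have g: "fctr G" "Src G = Base W" "Tgt G = Base V"
    "\<And>A. A\<in>Obj (Base W) \<Longrightarrow> At (Counit V) (Fob G A) = Far G (At (Counit W) A)"
    "\<And>A. A\<in>Obj (Base W) \<Longrightarrow> At (Comult V) (Fob G A) = Far G (At (Comult W) A)"
    using G by (auto simp: strict_comonad_map_def)
  note p = strict_comonad_map_pointwise[OF G _ W]
  show ?thesis
    unfolding cat_coaction_def
  proof (intro conjI ballI)
    show "ntrans \<lparr>NSrc = fct_comp G (EM_forget W), NTgt = fct_comp (Endo V) (fct_comp G (EM_forget W)),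
      At = (\<lambda>X\<in>Obj (EM W). Far G (At (EM_co W) X))\<rparr>"
    proof (rule ntransI)
      fix f assume "f \<in> Arr (Src (fct_comp G (EM_forget W)))"
      then have f: "f \<in> Arr (EM W)" by simp
      show "Far G (At (EM_co W) (Cod (Src (fct_comp G (EM_forget W))) f)) \<cdot>\<^bsub>Tgt (fct_comp G (EM_forget W))\<^esub> Far (fct_comp G (EM_forget W)) f =
         Far (fct_comp (Endo V) (fct_comp G (EM_forget W))) f \<cdot>\<^bsub>Tgt (fct_comp G (EM_forget W))\<^esub> Far G (At (EM_co W) (Dom (Src (fct_comp G (EM_forget W))) f))"
        using f W V g arg_cong[OF EM_map_eq[OF W f], of "Far G"] by (simp add: p)
    qed (use W V g p in simp_all)
  next
    fix X assume "X \<in> Obj (Src (fct_comp G (EM_forget W)))"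
    then have X: "X \<in> Obj (EM W)" by simp
    show "At (Counit V) (Fob (fct_comp G (EM_forget W)) X) \<cdot>\<^bsub>Base V\<^esub>
         At \<lparr>NSrc = fct_comp G (EM_forget W), NTgt = fct_comp (Endo V) (fct_comp G (EM_forget W)),
              At = \<lambda>X\<in>Obj (EM W). Far G (At (EM_co W) X)\<rparr> X = Idn (Base V) (Fob (fct_comp G (EM_forget W)) X)"
      using X W V g arg_cong[OF EM_coalg(1)[OF X], of "Far G"] by (simp add: p)
    show "At (Comult V) (Fob (fct_comp G (EM_forget W)) X) \<cdot>\<^bsub>Base V\<^esub>
         At \<lparr>NSrc = fct_comp G (EM_forget W), NTgt = fct_comp (Endo V) (fct_comp G (EM_forget W)),
              At = \<lambda>X\<in>Obj (EM W). Far G (At (EM_co W) X)\<rparr> X =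
         Far (Endo V) (At \<lparr>NSrc = fct_comp G (EM_forget W), NTgt = fct_comp (Endo V) (fct_comp G (EM_forget W)),
              At = \<lambda>X\<in>Obj (EM W). Far G (At (EM_co W) X)\<rparr> X) \<cdot>\<^bsub>Base V\<^esub>
         At \<lparr>NSrc = fct_comp G (EM_forget W), NTgt = fct_comp (Endo V) (fct_comp G (EM_forget W)),
              At = \<lambda>X\<in>Obj (EM W). Far G (At (EM_co W) X)\<rparr> X"
      using X W V g arg_cong[OF EM_coalg(2)[OF X], of "Far G"] by (simp add: p)
  qed (use W V g in simp_all)
qed

lemma EM_map_simps [simp]:
  assumes "strict_comonad_map W V G"
  shows "Src (EM_map W V G) = EM W" "Tgt (EM_map W V G) = EM V"
    "comonad CAT W \<Longrightarrow> comonad CAT V \<Longrightarrow> fctr (EM_map W V G)"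
    "comonad CAT W \<Longrightarrow> comonad CAT V \<Longrightarrow> X \<in> Obj (EM W) \<Longrightarrow> Fob (EM_forget V) (Fob (EM_map W V G) X) = Fob G (Fob (EM_forget W) X)"
    "comonad CAT W \<Longrightarrow> comonad CAT V \<Longrightarrow> X \<in> Obj (EM W) \<Longrightarrow> At (EM_co V) (Fob (EM_map W V G) X) = Far G (At (EM_co W) X)"
    "comonad CAT W \<Longrightarrow> comonad CAT V \<Longrightarrow> k \<in> Arr (EM W) \<Longrightarrow> Far (EM_forget V) (Far (EM_map W V G) k) = Far G (Far (EM_forget W) k)"
  using EM_map_coaction[of W V G] assms by (simp_all add: EM_map_def)

text \<open>The forgetful functor and the coaction are jointly injective on functors into
  \<open>EM V\<close>. This gives equations between composites of lifts, which are not themselves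
  written as a single \<open>EM_lift\<close>.\<close>

lemma EM_functor_eqI:
  assumes V: "comonad CAT V" and "fctr F" "fctr G" "Src F = Src G" "Tgt F = EM V" "Tgt G = EM V"
    and o: "\<And>A. A \<in> Obj (Src G) \<Longrightarrow> Fob (EM_forget V) (Fob F A) = Fob (EM_forget V) (Fob G A)"
      "\<And>A. A \<in> Obj (Src G) \<Longrightarrow> At (EM_co V) (Fob F A) = At (EM_co V) (Fob G A)"
      "\<And>f. f \<in> Arr (Src G) \<Longrightarrow> Far (EM_forget V) (Far F f) = Far (EM_forget V) (Far G f)"
  shows "F = G"
proof -
  have *: "Fob F A = Fob G A" if "A \<in> Obj (Src G)" for A
    by (rule EM_obj_eqI[of _ V]) (use that assms in simp_all)
  show ?thesis
  proof (rule fct_eqI)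
    fix f assume f: "f \<in> Arr (Src G)"
    show "Far F f = Far G f"
      by (rule EM_arr_eqI[of _ V]) (use f assms * in simp_all)
  qed (use assms * in simp_all)
qed

lemma EM_map_id: "comonad CAT W \<Longrightarrow> strict_comonad_map W W (fct_id (Base W)) \<and> EM_map W W (fct_id (Base W)) = fct_id (EM W)"
proof -
  assume W: "comonad CAT W"
  have s: "strict_comonad_map W W (fct_id (Base W))" using W by (simp add: strict_comonad_map_def)
  moreover have "EM_map W W (fct_id (Base W)) = fct_id (EM W)"
    by (rule EM_functor_eqI[OF W]) (use W s in simp_all)
  ultimately show ?thesis by simp
qed

lemma EM_map_comp:
  assumes W: "comonad CAT W" and V: "comonad CAT V" and U: "comonad CAT U"
    and G: "strict_comonad_map W V G" and H: "strict_comonad_map V U H"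
  shows "strict_comonad_map W U (fct_comp H G) \<and> EM_map W U (fct_comp H G) = fct_comp (EM_map V U H) (EM_map W V G)"
proof -
  have g: "fctr G" "Src G = Base W" "Tgt G = Base V" "fctr H" "Src H = Base V" "Tgt H = Base U"
    using G H by (auto simp: strict_comonad_map_def)
  have "fct_comp (fct_comp H G) (Endo W) = fct_comp (Endo U) (fct_comp H G)"
    by (rule fct_eqI) (use W V U g strict_comonad_map_pointwise[OF G _ W] strict_comonad_map_pointwise[OF H _ V] in simp_all)
  then have s: "strict_comonad_map W U (fct_comp H G)" using W V U G H g unfolding strict_comonad_map_def by simp
  have "EM_map W U (fct_comp H G) = fct_comp (EM_map V U H) (EM_map W V G)"
    by (rule EM_functor_eqI[OF U]) (use W V U G H s g in simp_all)
  with s show ?thesis by simp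
qed

section \<open>Discrete opfibrations between categories of coalgebras\<close>

lemma opfibD:
  assumes "discrete_opfibration P" "e \<in> Obj (Src P)" "f \<in> Arr (Tgt P)" "Dom (Tgt P) f = Fob P e"
  shows "\<exists>!g. g \<in> Arr (Src P) \<and> Dom (Src P) g = e \<and> Far P g = f"
  using assms by (auto simp: discrete_opfibration_def)

lemma opfib_inj:
  assumes "discrete_opfibration P" "g \<in> Arr (Src P)" "h \<in> Arr (Src P)" "Dom (Src P) g = Dom (Src P) h" "Far P g = Far P h"
  shows "g = h"
proof -
  have f: "fctr P" using assms by (auto simp: discrete_opfibration_def)
  then show ?thesis using opfibD[OF assms(1), of "Dom (Src P) h" "Far P h"] assms by auto
qed

lemma opfib_id:
  assumes P: "discrete_opfibration P" "g \<in> Arr (Src P)" "Src P = S" "Dom S g = e" "Far P g = Idn (Tgt P) B"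
    "B = Fob P e"
  shows "g = Idn S e"
proof -
  have f: "fctr P" using assms by (auto simp: discrete_opfibration_def)
  then have "category S" using P by auto
  then have e: "e \<in> Obj S" using P by auto
  show ?thesis by (rule opfib_inj[OF P(1)]) (use f P e \<open>category S\<close> in simp_all)
qed

text \<open>To lift \<open>k\<close>, lift first its underlying arrow and then, from the codomain
  just obtained, the structure map of the codomain of \<open>k\<close>. The square and the coalgebra
  laws hold because both sides start at the same object and have equal images under
  \<open>G\<close>, where they are the square and the laws of the given data.\<close>

lemma EM_map_opfib:
  assumes W: "comonad CAT W" and V: "comonad CAT V" and G: "strict_comonad_map W V G" and op: "discrete_opfibration G"
  shows "discrete_opfibration (EM_map W V G)"
  unfolding discrete_opfibration_def EM_map_simps[OF G]
proof (intro conjI ballI impI)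
  have g: "fctr G" "Src G = Base W" "Tgt G = Base V"
    "\<And>A. A\<in>Obj (Base W) \<Longrightarrow> At (Counit V) (Fob G A) = Far G (At (Counit W) A)"
    "\<And>A. A\<in>Obj (Base W) \<Longrightarrow> At (Comult V) (Fob G A) = Far G (At (Comult W) A)"
    using G by (auto simp: strict_comonad_map_def)
  note p = strict_comonad_map_pointwise[OF G _ W]
  fix X k assume X: "X \<in> Obj (EM W)" and k: "k \<in> Arr (EM V)" and d: "Dom (EM V) k = Fob (EM_map W V G) X"
  let ?B = "Base W" and ?E = "Endo W" and ?t = "Fob (EM_forget W) X" and ?s = "At (EM_co W) X"
  let ?f = "Far (EM_forget V) k" and ?b = "At (EM_co V) (Cod (EM V) k)"
  have df: "Dom (Base V) ?f = Fob G ?t" using k d V W X G by simp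
  obtain f' where f': "f' \<in> Arr ?B" "Dom ?B f' = ?t" "Far G f' = ?f"
    using opfibD[OF op, of ?t ?f] df k V W X g by auto
  let ?t' = "Cod ?B f'"
  have Gt': "Fob G ?t' = Fob (EM_forget V) (Cod (EM V) k)"
    using fct_simps(4)[OF g(1,3), of f'] g f' k V by simp
  obtain b' where b': "b' \<in> Arr ?B" "Dom ?B b' = ?t'" "Far G b' = ?b"
    using opfibD[OF op, of ?t' ?b] Gt' f' k V W X g by auto
  have sq: "Far (Endo V) ?f \<cdot>\<^bsub>Base V\<^esub> Far G ?s = ?b \<cdot>\<^bsub>Base V\<^esub> ?f"
    using EM_map_eq[OF V k] d W V G X by simp
  have sq': "Far ?E f' \<cdot>\<^bsub>?B\<^esub> ?s = b' \<cdot>\<^bsub>?B\<^esub> f'"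
    by (rule opfib_inj[OF op]) (use f' b' X W V g p sq in simp_all)
  \<comment> \<open>The lift prescribes only the domain of \<open>b'\<close>. That it ends at the
    endofunctor applied to \<open>?t'\<close> is read off the square.\<close>
  have c': "Cod ?B b' = Fob ?E ?t'"
    using arg_cong[OF sq', of "Cod ?B"] f' b' X W by simp
  have Y: "Tup ?t' b' \<in> Obj (EM W)"
  proof (rule EM_objI)
    note l = EM_coalg[OF category.cod_closed[OF category_EM[OF V] k]]
    show "At (Counit W) ?t' \<cdot>\<^bsub>?B\<^esub> b' = Idn ?B ?t'"
      by (rule opfib_id[OF op]) (use f' b' c' X k W V g l Gt' in \<open>simp_all flip: g(4)\<close>)
    show "At (Comult W) ?t' \<cdot>\<^bsub>?B\<^esub> b' = Far ?E b' \<cdot>\<^bsub>?B\<^esub> b'"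
      by (rule opfib_inj[OF op]) (use f' b' c' X k W V g l Gt' p in \<open>simp_all flip: g(5)\<close>)
  qed (use f' b' c' W in simp_all)
  have GY: "Fob (EM_map W V G) (Tup ?t' b') = Cod (EM V) k"
    by (rule EM_obj_eqI[of _ V]) (use Y W V G k Gt' b' in simp_all)
  have K: "Tup X (Tup (Tup ?t' b') f') \<in> Arr (EM W)"
    by (rule EM_arrI) (use X Y f' b' W sq' in simp_all)
  show "\<exists>!l. l \<in> Arr (EM W) \<and> Dom (EM W) l = X \<and> Far (EM_map W V G) l = k"
  proof (rule ex1I[of _ "Tup X (Tup (Tup ?t' b') f')"])
    have "Far (EM_map W V G) (Tup X (Tup (Tup ?t' b') f')) = k"
      by (rule EM_arr_eqI[of _ V]) (use K G W V k d GY f' in simp_all)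
    then show "Tup X (Tup (Tup ?t' b') f') \<in> Arr (EM W) \<and> Dom (EM W) (Tup X (Tup (Tup ?t' b') f')) = X \<and>
       Far (EM_map W V G) (Tup X (Tup (Tup ?t' b') f')) = k" using K by simp
  next
    fix l assume l: "l \<in> Arr (EM W) \<and> Dom (EM W) l = X \<and> Far (EM_map W V G) l = k"
    then have l': "l \<in> Arr (EM W)" "Dom (EM W) l = X" "Far (EM_map W V G) l = k" by auto
    have 1: "Far (EM_forget W) l = f'"
      by (rule opfib_inj[OF op]) (use l' f' W V G g EM_map_simps(6)[OF G W V l'(1)] in simp_all)
    have 2: "Fob (EM_forget W) (Cod (EM W) l) = ?t'"
      using l' W by (simp flip: 1)
    have 3: "Fob (EM_map W V G) (Cod (EM W) l) = Cod (EM V) k" using l' W V G by (simp flip: l'(3))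
    have 4: "At (EM_co W) (Cod (EM W) l) = b'"
      by (rule opfib_inj[OF op]) (use l' 2 b' W V G g f' EM_map_simps(5)[OF G W V, of "Cod (EM W) l"] 3 in simp_all)
    have "Cod (EM W) l = Tup ?t' b'"
      by (rule EM_obj_eqI[of _ W]) (use l' Y W 2 4 in simp_all)
    note 5 = this
    show "l = Tup X (Tup (Tup ?t' b') f')"
      by (rule EM_arr_eqI[of _ W]) (use l' K 1 5 in simp_all)
  qed
qed (use assms in simp_all)

section \<open>Types and terms as indexed categories\<close>

declare pre_natural_model.tp(2,3) [simp] pre_natural_model.tm(2,3) [simp] pre_natural_model.pr [simp]
  pre_natural_model.pr_opfib [simp]

lemma pre_nm_simps [simp]:
  assumes "pre_natural_model M"
  shows "category (UCat M)" "fctr (Tp M)" "fctr (Tm M)" "display_category M"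
  using assms pre_natural_model.dcat display_category.ucat pre_natural_model.tp(1) pre_natural_model.tm(1)
  by blast+

lemma nm_pre [simp]: "natural_model M \<Longrightarrow> pre_natural_model M"
  by (simp add: natural_model_def)

lemma pre_nm_mor_simps [simp]:
  assumes "pre_nm_mor m"
  shows "pre_natural_model (MSrc m)" "pre_natural_model (MTgt m)" "fctr (MFun m)"
    "Src (MFun m) = UCat (MSrc m)" "Tgt (MFun m) = UCat (MTgt m)"
    "ntrans (MTp m)" "NSrc (MTp m) = Tp (MSrc m)" "NTgt (MTp m) = fct_comp (Tp (MTgt m)) (fct_op (MFun m))"
    "ntrans (MTm m)" "NSrc (MTm m) = Tm (MSrc m)" "NTgt (MTm m) = fct_comp (Tm (MTgt m)) (fct_op (MFun m))"
  using assms by (simp_all add: pre_nm_mor_def display_functor_def)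

lemma nm_mor_simps [simp]:
  assumes "nm_mor m"
  shows "pre_nm_mor m" "natural_model (MSrc m)" "natural_model (MTgt m)"
  using assms by (simp_all add: nm_mor_def nm_mor_axioms_def)

lemma nm_mor2_simps [simp]:
  assumes "nm_mor2 \<theta>"
  shows "nm_mor (M2Src \<theta>)" "nm_mor (M2Tgt \<theta>)" "MSrc (M2Tgt \<theta>) = MSrc (M2Src \<theta>)"
    "MTgt (M2Tgt \<theta>) = MTgt (M2Src \<theta>)" "ntrans (M2Nt \<theta>)" "NSrc (M2Nt \<theta>) = MFun (M2Src \<theta>)"
    "NTgt (M2Nt \<theta>) = MFun (M2Tgt \<theta>)"
  using assms by (simp_all add: nm_mor2_def)

lemma naturality_image:
  assumes "fctr F" "Src F = D" "Tgt F = E" "ntrans \<alpha>" "Tgt (NSrc \<alpha>) = D" "Src (NSrc \<alpha>) = C"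
    "f \<in> Arr C" "Dom C f = A" "Cod C f = B"
  shows "Far F (Far (NTgt \<alpha>) f) \<cdot>\<^bsub>E\<^esub> Far F (At \<alpha> A) = Far F (At \<alpha> B) \<cdot>\<^bsub>E\<^esub> Far F (Far (NSrc \<alpha>) f)"
proof -
  have "category C" using assms by auto
  then have "A \<in> Obj C" "B \<in> Obj C" using assms(7-9) by auto
  then show ?thesis using arg_cong[OF naturality[OF assms(4-9)], of "Far F"] assms by simp
qed

lemma icat_simps [simp]:
  "fctr T \<Longrightarrow> Tgt T = One CAT \<Longrightarrow> \<Gamma> \<in> Obj (Src T) \<Longrightarrow> category (Fob T \<Gamma>)"
  "fctr T \<Longrightarrow> Tgt T = One CAT \<Longrightarrow> u \<in> Arr (Src T) \<Longrightarrow> fctr (Far T u)"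
  "fctr T \<Longrightarrow> Tgt T = One CAT \<Longrightarrow> u \<in> Arr (Src T) \<Longrightarrow> Src (Far T u) = Fob T (Dom (Src T) u)"
  "fctr T \<Longrightarrow> Tgt T = One CAT \<Longrightarrow> u \<in> Arr (Src T) \<Longrightarrow> Tgt (Far T u) = Fob T (Cod (Src T) u)"
proof -
  assume T: "fctr T" "Tgt T = One CAT"
  show "\<Gamma> \<in> Obj (Src T) \<Longrightarrow> category (Fob T \<Gamma>)" using fct_simps(1)[OF T, of \<Gamma>] by simp
  assume u: "u \<in> Arr (Src T)"
  show "fctr (Far T u)" using fct_simps(2)[OF T u] by simp
  then show "Src (Far T u) = Fob T (Dom (Src T) u)" "Tgt (Far T u) = Fob T (Cod (Src T) u)"
    using fct_simps(3,4)[OF T u] by simp_all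
qed

lemma icat_idn [simp]:
  "fctr T \<Longrightarrow> Tgt T = One CAT \<Longrightarrow> Src T = opcat C \<Longrightarrow> \<Gamma> \<in> Obj C \<Longrightarrow> Far T (Idn C \<Gamma>) = fct_id (Fob T \<Gamma>)"
  using fctr.pres_idn[of T \<Gamma>] by simp

lemma icat_cmp [simp]:
  assumes "fctr T" "Tgt T = One CAT" "Src T = opcat C" "u \<in> Arr C" "v \<in> Arr C" "Dom C v = Cod C u"
  shows "Far T (v \<cdot>\<^bsub>C\<^esub> u) = fct_comp (Far T u) (Far T v)"
  using fctr.pres_cmp[of T v u] assms by simp

lemma ifct_simps [simp]:
  "ntrans m \<Longrightarrow> Tgt (NSrc m) = One CAT \<Longrightarrow> \<Gamma> \<in> Obj (Src (NSrc m)) \<Longrightarrow> fctr (At m \<Gamma>)"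
  "ntrans m \<Longrightarrow> Tgt (NSrc m) = One CAT \<Longrightarrow> \<Gamma> \<in> Obj (Src (NSrc m)) \<Longrightarrow> Src (At m \<Gamma>) = Fob (NSrc m) \<Gamma>"
  "ntrans m \<Longrightarrow> Tgt (NSrc m) = One CAT \<Longrightarrow> \<Gamma> \<in> Obj (Src (NSrc m)) \<Longrightarrow> Tgt (At m \<Gamma>) = Fob (NTgt m) \<Gamma>"
proof -
  assume T: "ntrans m" "Tgt (NSrc m) = One CAT" and G: "\<Gamma> \<in> Obj (Src (NSrc m))"
  show "fctr (At m \<Gamma>)" using ntr_simps(3)[OF T G] by simp
  then show "Src (At m \<Gamma>) = Fob (NSrc m) \<Gamma>" "Tgt (At m \<Gamma>) = Fob (NTgt m) \<Gamma>"
    using ntr_simps(4,5)[OF T G] by simp_all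
qed

lemma ifct_natural:
  assumes "ntrans m" "Tgt (NSrc m) = One CAT" "Src (NSrc m) = opcat C" "NSrc m = T" "u \<in> Arr C" "Dom C u = \<Delta>" "Cod C u = \<Gamma>"
  shows "fct_comp (At m \<Delta>) (Far T u) = fct_comp (Far (NTgt m) u) (At m \<Gamma>)"
proof -
  have "category (opcat C)" using assms fctr.src_cat[of "NSrc m"] ntrans.nsrc[of m] by metis
  \<comment> \<open>Only \<open>opcat C\<close> is known to be a category; applying
    \<open>opcat\<close> twice gives back \<open>C\<close>.\<close>
  then have "category C" using category_opcat[of "opcat C"] by (simp add: opcat_def)
  moreover from this have "\<Gamma> \<in> Obj C" "\<Delta> \<in> Obj C" using assms(5-7) by auto
  moreover have "fctr T" using assms ntrans.nsrc[of m] by blast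
  ultimately show ?thesis using ntrans.natural[of m u] assms by simp
qed

lemma ifctI:
  assumes "fctr T" "fctr S" "Src T = opcat C" "category C" "Src S = opcat C" "Tgt T = One CAT" "Tgt S = One CAT"
    "\<And>\<Gamma>. \<Gamma> \<in> Obj C \<Longrightarrow> fctr (m \<Gamma>)" "\<And>\<Gamma>. \<Gamma> \<in> Obj C \<Longrightarrow> Src (m \<Gamma>) = Fob T \<Gamma>"
    "\<And>\<Gamma>. \<Gamma> \<in> Obj C \<Longrightarrow> Tgt (m \<Gamma>) = Fob S \<Gamma>"
    "\<And>u A. u \<in> Arr C \<Longrightarrow> A \<in> Obj (Fob T (Cod C u)) \<Longrightarrow>
      Fob (m (Dom C u)) (Fob (Far T u) A) = Fob (Far S u) (Fob (m (Cod C u)) A)"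
    "\<And>u f. u \<in> Arr C \<Longrightarrow> f \<in> Arr (Fob T (Cod C u)) \<Longrightarrow>
      Far (m (Dom C u)) (Far (Far T u) f) = Far (Far S u) (Far (m (Cod C u)) f)"
    "X = Obj C"
  shows "ntrans \<lparr>NSrc = T, NTgt = S, At = restrict m X\<rparr>"
proof (rule ntransI)
  fix u assume u: "u \<in> Arr (Src T)"
  have "fct_comp (m (Dom C u)) (Far T u) = fct_comp (Far S u) (m (Cod C u))"
    by (rule fct_eqI) (use assms u in simp_all)
  then show "m (Cod (Src T) u) \<cdot>\<^bsub>Tgt T\<^esub> Far T u = Far S u \<cdot>\<^bsub>Tgt T\<^esub> m (Dom (Src T) u)"
    using assms u by simp
qed (use assms in simp_all)

lemma Pr_simps [simp]:
  assumes M: "pre_natural_model M"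
  shows "u \<in> Arr (UCat M) \<Longrightarrow> Dom (UCat M) u = \<Delta> \<Longrightarrow> t \<in> Obj (Fob (Tm M) (Cod (UCat M) u)) \<Longrightarrow>
      Fob (At (Pr M) \<Delta>) (Fob (Far (Tm M) u) t) = Fob (Far (Tp M) u) (Fob (At (Pr M) (Cod (UCat M) u)) t)"
    "u \<in> Arr (UCat M) \<Longrightarrow> Dom (UCat M) u = \<Delta> \<Longrightarrow> f \<in> Arr (Fob (Tm M) (Cod (UCat M) u)) \<Longrightarrow>
      Far (At (Pr M) \<Delta>) (Far (Far (Tm M) u) f) = Far (Far (Tp M) u) (Far (At (Pr M) (Cod (UCat M) u)) f)"
proof -
  assume u: "u \<in> Arr (UCat M)" "Dom (UCat M) u = \<Delta>"
  have e: "fct_comp (At (Pr M) \<Delta>) (Far (Tm M) u) = fct_comp (Far (Tp M) u) (At (Pr M) (Cod (UCat M) u))"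
    using ifct_natural[of "Pr M" "UCat M" "Tm M" u \<Delta>] M u by simp
  show "t \<in> Obj (Fob (Tm M) (Cod (UCat M) u)) \<Longrightarrow>
      Fob (At (Pr M) \<Delta>) (Fob (Far (Tm M) u) t) = Fob (Far (Tp M) u) (Fob (At (Pr M) (Cod (UCat M) u)) t)"
    using arg_cong[OF e, of "\<lambda>F. Fob F t"] M u by simp
  show "f \<in> Arr (Fob (Tm M) (Cod (UCat M) u)) \<Longrightarrow>
      Far (At (Pr M) \<Delta>) (Far (Far (Tm M) u) f) = Far (Far (Tp M) u) (Far (At (Pr M) (Cod (UCat M) u)) f)"
    using arg_cong[OF e, of "\<lambda>F. Far F f"] M u by simp
qed

lemma commutes_simps [simp]:
  assumes m: "pre_nm_mor m" and N: "MTgt m = N" and \<Gamma>: "\<Gamma> \<in> Obj (UCat (MSrc m))" "Fob (MFun m) \<Gamma> = \<Gamma>'"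
  shows "t \<in> Obj (Fob (Tm (MSrc m)) \<Gamma>) \<Longrightarrow>
      Fob (At (Pr N) \<Gamma>') (Fob (At (MTm m) \<Gamma>) t) = Fob (At (MTp m) \<Gamma>) (Fob (At (Pr (MSrc m)) \<Gamma>) t)"
    "f \<in> Arr (Fob (Tm (MSrc m)) \<Gamma>) \<Longrightarrow>
      Far (At (Pr N) \<Gamma>') (Far (At (MTm m) \<Gamma>) f) = Far (At (MTp m) \<Gamma>) (Far (At (Pr (MSrc m)) \<Gamma>) f)"
proof -
  have e: "fct_comp (At (Pr N) \<Gamma>') (At (MTm m) \<Gamma>) = fct_comp (At (MTp m) \<Gamma>) (At (Pr (MSrc m)) \<Gamma>)"
    using pre_nm_mor.commutes[OF m \<Gamma>(1)] N \<Gamma> by simp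
  show "t \<in> Obj (Fob (Tm (MSrc m)) \<Gamma>) \<Longrightarrow>
      Fob (At (Pr N) \<Gamma>') (Fob (At (MTm m) \<Gamma>) t) = Fob (At (MTp m) \<Gamma>) (Fob (At (Pr (MSrc m)) \<Gamma>) t)"
    using arg_cong[OF e, of "\<lambda>F. Fob F t"] m \<Gamma> by simp
  show "f \<in> Arr (Fob (Tm (MSrc m)) \<Gamma>) \<Longrightarrow>
      Far (At (Pr N) \<Gamma>') (Far (At (MTm m) \<Gamma>) f) = Far (At (MTp m) \<Gamma>) (Far (At (Pr (MSrc m)) \<Gamma>) f)"
    using arg_cong[OF e, of "\<lambda>F. Far F f"] m \<Gamma> by simp
qed

lemma nmor_rec_simps [simp]:
  "MSrc (nmor_id M) = M" "MTgt (nmor_id M) = M" "MFun (nmor_id M) = fct_id (UCat M)"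
  "MSrc (nmor_comp n m) = MSrc m" "MTgt (nmor_comp n m) = MTgt n" "MFun (nmor_comp n m) = fct_comp (MFun n) (MFun m)"
  by (simp_all add: nmor_id_def nmor_comp_def)

lemma nmor2_rec_simps [simp]:
  "M2Src (nmor2_id m) = m" "M2Tgt (nmor2_id m) = m" "M2Nt (nmor2_id m) = ntid (MFun m)"
  "M2Src (nmor2_vcomp \<phi> \<theta>) = M2Src \<theta>" "M2Tgt (nmor2_vcomp \<phi> \<theta>) = M2Tgt \<phi>" "M2Nt (nmor2_vcomp \<phi> \<theta>) = ntvcomp (M2Nt \<phi>) (M2Nt \<theta>)"
  "M2Src (nmor2_hcomp \<phi> \<theta>) = nmor_comp (M2Src \<phi>) (M2Src \<theta>)" "M2Tgt (nmor2_hcomp \<phi> \<theta>) = nmor_comp (M2Tgt \<phi>) (M2Tgt \<theta>)"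
  "M2Nt (nmor2_hcomp \<phi> \<theta>) = nthcomp (M2Nt \<phi>) (M2Nt \<theta>)"
  by (simp_all add: nmor2_id_def nmor2_vcomp_def nmor2_hcomp_def)

text \<open>The indexed structure that types and terms have in common: \<open>T\<close>, \<open>mT\<close>, \<open>m2T\<close> stand for
  \<open>Tp\<close>, \<open>MTp\<close>, \<open>M2Tp\<close> or for \<open>Tm\<close>, \<open>MTm\<close>, \<open>M2Tm\<close>.\<close>

locale selector =
  fixes T :: "'u nm \<Rightarrow> 'u icat" and mT :: "'u nmor \<Rightarrow> 'u ifct" and m2T :: "'u nmor2 \<Rightarrow> 'u \<Rightarrow> 'u sntr"
  assumes T [simp]: "pre_natural_model M \<Longrightarrow> fctr (T M)" "pre_natural_model M \<Longrightarrow> Src (T M) = opcat (UCat M)"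
      "pre_natural_model M \<Longrightarrow> Tgt (T M) = One CAT"
    and mT [simp]: "pre_nm_mor m \<Longrightarrow> ntrans (mT m)" "pre_nm_mor m \<Longrightarrow> NSrc (mT m) = T (MSrc m)"
      "pre_nm_mor m \<Longrightarrow> NTgt (mT m) = fct_comp (T (MTgt m)) (fct_op (MFun m))"
    and m2T: "nm_mor2 \<theta> \<Longrightarrow> indexed_ntrans (T (MSrc (M2Src \<theta>))) (T (MTgt (M2Src \<theta>))) (M2Nt \<theta>)
      (mT (M2Src \<theta>)) (mT (M2Tgt \<theta>)) (m2T \<theta>)"
    and mT_id [simp]: "mT (nmor_id M) = ntid (T M)"
    and mT_comp: "mT (nmor_comp n m) = \<lparr>NSrc = T (MSrc m), NTgt = fct_comp (T (MTgt n)) (fct_op (fct_comp (MFun n) (MFun m))),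
       At = (\<lambda>\<Gamma>\<in>Obj (UCat (MSrc m)). fct_comp (At (mT n) (Fob (MFun m) \<Gamma>)) (At (mT m) \<Gamma>))\<rparr>"
    and m2T_id: "m2T (nmor2_id m) = (\<lambda>\<Gamma>\<in>Obj (UCat (MSrc m)). ntid (At (mT m) \<Gamma>))"
    and m2T_vcomp: "m2T (nmor2_vcomp \<phi> \<theta>) = indexed_vcomp T mT m2T \<phi> \<theta>"
    and m2T_hcomp: "m2T (nmor2_hcomp \<phi> \<theta>) = indexed_hcomp T mT m2T \<phi> \<theta>"
begin

lemma mT_natural [simp]:
  assumes m: "pre_nm_mor m" and M: "MSrc m = M" and u: "u \<in> Arr (UCat M)" "Dom (UCat M) u = \<Delta>"
  shows "A \<in> Obj (Fob (T M) (Cod (UCat M) u)) \<Longrightarrow>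
     Fob (At (mT m) \<Delta>) (Fob (Far (T M) u) A) = Fob (Far (T (MTgt m)) (Far (MFun m) u)) (Fob (At (mT m) (Cod (UCat M) u)) A)"
   "f \<in> Arr (Fob (T M) (Cod (UCat M) u)) \<Longrightarrow>
     Far (At (mT m) \<Delta>) (Far (Far (T M) u) f) = Far (Far (T (MTgt m)) (Far (MFun m) u)) (Far (At (mT m) (Cod (UCat M) u)) f)"
proof -
  have [simp]: "pre_natural_model M" using m M by auto
  have e: "fct_comp (At (mT m) \<Delta>) (Far (T M) u) = fct_comp (Far (NTgt (mT m)) u) (At (mT m) (Cod (UCat M) u))"
    using ifct_natural[of "mT m" "UCat M" "T M" u \<Delta>] m M u by simp
  show "A \<in> Obj (Fob (T M) (Cod (UCat M) u)) \<Longrightarrow>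
     Fob (At (mT m) \<Delta>) (Fob (Far (T M) u) A) = Fob (Far (T (MTgt m)) (Far (MFun m) u)) (Fob (At (mT m) (Cod (UCat M) u)) A)"
    using arg_cong[OF e, of "\<lambda>F. Fob F A"] m M u by simp
  show "f \<in> Arr (Fob (T M) (Cod (UCat M) u)) \<Longrightarrow>
     Far (At (mT m) \<Delta>) (Far (Far (T M) u) f) = Far (Far (T (MTgt m)) (Far (MFun m) u)) (Far (At (mT m) (Cod (UCat M) u)) f)"
    using arg_cong[OF e, of "\<lambda>F. Far F f"] m M u by simp
qed

lemma mT_comp_simps [simp]:
  "NSrc (mT (nmor_comp n m)) = T (MSrc m)"
  "NTgt (mT (nmor_comp n m)) = fct_comp (T (MTgt n)) (fct_op (fct_comp (MFun n) (MFun m)))"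
  "\<Gamma> \<in> Obj (UCat (MSrc m)) \<Longrightarrow> At (mT (nmor_comp n m)) \<Gamma> = fct_comp (At (mT n) (Fob (MFun m) \<Gamma>)) (At (mT m) \<Gamma>)"
  by (simp_all add: mT_comp)

lemma ntrans_mT_comp:
  assumes "pre_nm_mor m" "pre_nm_mor n" "MSrc n = MTgt m"
  shows "ntrans (mT (nmor_comp n m))"
  unfolding mT_comp
  by (rule ifctI[where C = "UCat (MSrc m)"]) (use assms in \<open>simp_all\<close>)

lemma m2T_simps [simp]:
  assumes "nm_mor2 \<theta>" "\<Gamma> \<in> Obj (UCat (MSrc (M2Src \<theta>)))"
  shows "ntrans (m2T \<theta> \<Gamma>)" "NSrc (m2T \<theta> \<Gamma>) = At (mT (M2Src \<theta>)) \<Gamma>"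
    "NTgt (m2T \<theta> \<Gamma>) = fct_comp (Far (T (MTgt (M2Src \<theta>))) (At (M2Nt \<theta>) \<Gamma>)) (At (mT (M2Tgt \<theta>)) \<Gamma>)"
  using indexed_ntrans.components[OF m2T[OF assms(1)], of \<Gamma>] assms by simp_all

lemma m2T_indexed [simp]:
  assumes "nm_mor2 \<theta>" "MSrc (M2Src \<theta>) = M" "u \<in> Arr (UCat M)" "Dom (UCat M) u = \<Delta>" "A \<in> Obj (Fob (T M) (Cod (UCat M) u))"
  shows "At (m2T \<theta> \<Delta>) (Fob (Far (T M) u) A)
    = Far (Far (T (MTgt (M2Src \<theta>))) (Far (MFun (M2Src \<theta>)) u)) (At (m2T \<theta> (Cod (UCat M) u)) A)"
  using indexed_ntrans.indexed[OF m2T[OF assms(1)], of u A] assms by simp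

lemma m2T_eqI:
  assumes "nm_mor2 \<theta>" "nm_mor2 \<phi>" "M2Src \<theta> = M2Src \<phi>" "M2Tgt \<theta> = M2Tgt \<phi>" "M2Nt \<theta> = M2Nt \<phi>"
    "\<And>\<Gamma> A. \<Gamma> \<in> Obj (UCat (MSrc (M2Src \<phi>))) \<Longrightarrow> A \<in> Obj (Fob (T (MSrc (M2Src \<phi>))) \<Gamma>) \<Longrightarrow>
       At (m2T \<theta> \<Gamma>) A = At (m2T \<phi> \<Gamma>) A"
  shows "m2T \<theta> = m2T \<phi>"
proof (rule extensionalityI)
  show "m2T \<theta> \<in> extensional (Obj (UCat (MSrc (M2Src \<phi>))))" "m2T \<phi> \<in> extensional (Obj (UCat (MSrc (M2Src \<phi>))))"
    using indexed_ntrans.tau_ext[OF m2T[OF assms(1)]] indexed_ntrans.tau_ext[OF m2T[OF assms(2)]] assms(1-4) by simp_all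
  fix \<Gamma> assume "\<Gamma> \<in> Obj (UCat (MSrc (M2Src \<phi>)))"
  then show "m2T \<theta> \<Gamma> = m2T \<phi> \<Gamma>"
    by (intro ntr_eqI) (use assms in simp_all)
qed

lemma m2T_id_At [simp]:
  "pre_nm_mor m \<Longrightarrow> \<Gamma> \<in> Obj (UCat (MSrc m)) \<Longrightarrow> A \<in> Obj (Fob (T (MSrc m)) \<Gamma>) \<Longrightarrow>
   At (m2T (nmor2_id m) \<Gamma>) A = Idn (Fob (T (MTgt m)) (Fob (MFun m) \<Gamma>)) (Fob (At (mT m) \<Gamma>) A)"
  by (simp add: m2T_id)

lemma m2T_vcomp_At [simp]:
  "\<Gamma> \<in> Obj (UCat (MSrc (M2Src \<theta>))) \<Longrightarrow> A \<in> Obj (Fob (T (MSrc (M2Src \<theta>))) \<Gamma>) \<Longrightarrow>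
   At (m2T (nmor2_vcomp \<phi> \<theta>) \<Gamma>) A = Far (Far (T (MTgt (M2Src \<theta>))) (At (M2Nt \<theta>) \<Gamma>)) (At (m2T \<phi> \<Gamma>) A)
           \<cdot>\<^bsub>Fob (T (MTgt (M2Src \<theta>))) (Fob (MFun (M2Src \<theta>)) \<Gamma>)\<^esub> At (m2T \<theta> \<Gamma>) A"
  by (simp add: m2T_vcomp indexed_vcomp_def Let_def)

lemma m2T_hcomp_At [simp]:
  "\<Gamma> \<in> Obj (UCat (MSrc (M2Src \<theta>))) \<Longrightarrow> A \<in> Obj (Fob (T (MSrc (M2Src \<theta>))) \<Gamma>) \<Longrightarrow>
   At (m2T (nmor2_hcomp \<phi> \<theta>) \<Gamma>) A = 
     Far (Far (T (MTgt (M2Src \<phi>))) (Far (MFun (M2Src \<phi>)) (At (M2Nt \<theta>) \<Gamma>)))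
       (At (m2T \<phi> (Fob (MFun (M2Tgt \<theta>)) \<Gamma>)) (Fob (At (mT (M2Tgt \<theta>)) \<Gamma>) A))
     \<cdot>\<^bsub>Fob (T (MTgt (M2Src \<phi>))) (Fob (MFun (M2Src \<phi>)) (Fob (MFun (M2Src \<theta>)) \<Gamma>))\<^esub>
           Far (At (mT (M2Src \<phi>)) (Fob (MFun (M2Src \<theta>)) \<Gamma>)) (At (m2T \<theta> \<Gamma>) A)"
  by (simp add: m2T_hcomp indexed_hcomp_def Let_def)

text \<open>Strict functoriality of substitution: a commuting square of contexts yields equal
  iterated substitutions. This is how naturality in the base enters computations in the
  fibres.\<close>

lemma sub_square:
  assumes "pre_natural_model N" "a \<cdot>\<^bsub>UCat N\<^esub> b = c \<cdot>\<^bsub>UCat N\<^esub> d"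
    "a \<in> Arr (UCat N)" "b \<in> Arr (UCat N)" "c \<in> Arr (UCat N)" "d \<in> Arr (UCat N)"
    "Dom (UCat N) a = Cod (UCat N) b" "Dom (UCat N) c = Cod (UCat N) d"
  shows "A \<in> Obj (Fob (T N) (Cod (UCat N) a)) \<Longrightarrow> Fob (Far (T N) b) (Fob (Far (T N) a) A) = Fob (Far (T N) d) (Fob (Far (T N) c) A)"
    "f \<in> Arr (Fob (T N) (Cod (UCat N) a)) \<Longrightarrow> Far (Far (T N) b) (Far (Far (T N) a) f) = Far (Far (T N) d) (Far (Far (T N) c) f)"
proof -
  have "category (UCat N)" using assms by simp
  then have c: "Cod (UCat N) a = Cod (UCat N) c"
    using arg_cong[OF assms(2), of "Cod (UCat N)"] assms(1,3-8) by simp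
  have e: "fct_comp (Far (T N) b) (Far (T N) a) = fct_comp (Far (T N) d) (Far (T N) c)"
    using arg_cong[OF assms(2), of "Far (T N)"] assms(1,3-8) by simp
  show "A \<in> Obj (Fob (T N) (Cod (UCat N) a)) \<Longrightarrow> Fob (Far (T N) b) (Fob (Far (T N) a) A) = Fob (Far (T N) d) (Fob (Far (T N) c) A)"
    using arg_cong[OF e, of "\<lambda>F. Fob F A"] assms c by simp
  show "f \<in> Arr (Fob (T N) (Cod (UCat N) a)) \<Longrightarrow> Far (Far (T N) b) (Far (Far (T N) a) f) = Far (Far (T N) d) (Far (Far (T N) c) f)"
    using arg_cong[OF e, of "\<lambda>F. Far F f"] assms c by simp
qed

lemma indexed_id:
  assumes m: "nm_mor m"
  shows "indexed_ntrans (T (MSrc m)) (T (MTgt m)) (ntid (MFun m)) (mT m) (mT m) (m2T (nmor2_id m))"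
  unfolding m2T_id
  by (rule indexed_ntrans.intro) (use m in simp_all)

text \<open>Naturality in a fibre is naturality of \<open>\<phi>\<close>, substituted along the base
  component of \<open>\<theta>\<close>, pasted to naturality of \<open>\<theta>\<close>.
  Compatibility with substitution comes from the base naturality square of \<open>\<theta>\<close>,
  through which the two ways of substituting in \<open>\<phi>\<close> agree.\<close>

lemma indexed_v:
  assumes t: "nm_mor2 \<theta>" and p: "nm_mor2 \<phi>" and c: "M2Src \<phi> = M2Tgt \<theta>"
  shows "indexed_ntrans (T (MSrc (M2Src \<theta>))) (T (MTgt (M2Src \<theta>))) (ntvcomp (M2Nt \<phi>) (M2Nt \<theta>))
      (mT (M2Src \<theta>)) (mT (M2Tgt \<phi>)) (m2T (nmor2_vcomp \<phi> \<theta>))"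
proof (rule indexed_ntrans.intro)
  let ?M = "MSrc (M2Src \<theta>)" let ?N = "MTgt (M2Src \<theta>)" let ?C = "UCat ?M" let ?D = "UCat ?N"
  have s [simp]: "MSrc (M2Tgt \<phi>) = ?M" "MTgt (M2Tgt \<phi>) = ?N" using t p c by simp_all
  note [simp] = t p c
  fix \<Gamma> assume "\<Gamma> \<in> Obj (Src (NSrc (ntvcomp (M2Nt \<phi>) (M2Nt \<theta>))))"
  then have G: "\<Gamma> \<in> Obj ?C" by simp
  let ?K = "Fob (T ?N) (Fob (MFun (M2Src \<theta>)) \<Gamma>)"
  have "ntrans \<lparr>NSrc = At (mT (M2Src \<theta>)) \<Gamma>,
         NTgt = fct_comp (Far (T ?N) (At (ntvcomp (M2Nt \<phi>) (M2Nt \<theta>)) \<Gamma>)) (At (mT (M2Tgt \<phi>)) \<Gamma>),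
         At = (\<lambda>A\<in>Obj (Fob (T ?M) \<Gamma>). Far (Far (T ?N) (At (M2Nt \<theta>) \<Gamma>)) (At (m2T \<phi> \<Gamma>) A) \<cdot>\<^bsub>?K\<^esub> At (m2T \<theta> \<Gamma>) A)\<rparr>"
  proof (rule ntransI)
    fix f assume "f \<in> Arr (Src (At (mT (M2Src \<theta>)) \<Gamma>))"
    then have f: "f \<in> Arr (Fob (T ?M) \<Gamma>)" using G by simp
    have 1: "Far (Far (T ?N) (At (M2Nt \<theta>) \<Gamma>)) (Far (Far (T ?N) (At (M2Nt \<phi>) \<Gamma>)) (Far (At (mT (M2Tgt \<phi>)) \<Gamma>) f)) \<cdot>\<^bsub>?K\<^esub> 
        Far (Far (T ?N) (At (M2Nt \<theta>) \<Gamma>)) (At (m2T \<phi> \<Gamma>) (Dom (Fob (T ?M) \<Gamma>) f))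
      = Far (Far (T ?N) (At (M2Nt \<theta>) \<Gamma>)) (At (m2T \<phi> \<Gamma>) (Cod (Fob (T ?M) \<Gamma>) f)) \<cdot>\<^bsub>?K\<^esub>
         Far (Far (T ?N) (At (M2Nt \<theta>) \<Gamma>)) (Far (At (mT (M2Tgt \<theta>)) \<Gamma>) f)"
      using naturality_image[of "Far (T ?N) (At (M2Nt \<theta>) \<Gamma>)" _ _ "m2T \<phi> \<Gamma>" _ f] f G by simp
    have 2: "Far (Far (T ?N) (At (M2Nt \<theta>) \<Gamma>)) (Far (At (mT (M2Tgt \<theta>)) \<Gamma>) f) \<cdot>\<^bsub>?K\<^esub> At (m2T \<theta> \<Gamma>) (Dom (Fob (T ?M) \<Gamma>) f)
      = At (m2T \<theta> \<Gamma>) (Cod (Fob (T ?M) \<Gamma>) f) \<cdot>\<^bsub>?K\<^esub> Far (At (mT (M2Src \<theta>)) \<Gamma>) f"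
      using naturality[of "m2T \<theta> \<Gamma>" _ _ f] f G by simp
    have 3: "Far (Far (T ?N) (At (M2Nt \<theta>) \<Gamma>)) (Far (Far (T ?N) (At (M2Nt \<phi>) \<Gamma>)) (Far (At (mT (M2Tgt \<phi>)) \<Gamma>) f)) \<cdot>\<^bsub>?K\<^esub> 
        (Far (Far (T ?N) (At (M2Nt \<theta>) \<Gamma>)) (At (m2T \<phi> \<Gamma>) (Dom (Fob (T ?M) \<Gamma>) f)) \<cdot>\<^bsub>?K\<^esub> At (m2T \<theta> \<Gamma>) (Dom (Fob (T ?M) \<Gamma>) f))
      = Far (Far (T ?N) (At (M2Nt \<theta>) \<Gamma>)) (At (m2T \<phi> \<Gamma>) (Cod (Fob (T ?M) \<Gamma>) f)) \<cdot>\<^bsub>?K\<^esub>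
         (Far (Far (T ?N) (At (M2Nt \<theta>) \<Gamma>)) (Far (At (mT (M2Tgt \<theta>)) \<Gamma>) f) \<cdot>\<^bsub>?K\<^esub> At (m2T \<theta> \<Gamma>) (Dom (Fob (T ?M) \<Gamma>) f))"
      by (rule cmp_cong_left[OF _ 1]) (use f G in simp_all)
    show "(Far (Far (T ?N) (At (M2Nt \<theta>) \<Gamma>)) (At (m2T \<phi> \<Gamma>) (Cod (Src (At (mT (M2Src \<theta>)) \<Gamma>)) f)) \<cdot>\<^bsub>?K\<^esub> At (m2T \<theta> \<Gamma>) (Cod (Src (At (mT (M2Src \<theta>)) \<Gamma>)) f))
        \<cdot>\<^bsub>Tgt (At (mT (M2Src \<theta>)) \<Gamma>)\<^esub> Far (At (mT (M2Src \<theta>)) \<Gamma>) f =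
      Far (fct_comp (Far (T ?N) (At (ntvcomp (M2Nt \<phi>) (M2Nt \<theta>)) \<Gamma>)) (At (mT (M2Tgt \<phi>)) \<Gamma>)) f \<cdot>\<^bsub>Tgt (At (mT (M2Src \<theta>)) \<Gamma>)\<^esub> 
        (Far (Far (T ?N) (At (M2Nt \<theta>) \<Gamma>)) (At (m2T \<phi> \<Gamma>) (Dom (Src (At (mT (M2Src \<theta>)) \<Gamma>)) f)) \<cdot>\<^bsub>?K\<^esub> At (m2T \<theta> \<Gamma>) (Dom (Src (At (mT (M2Src \<theta>)) \<Gamma>)) f))"
      using f G 3 by (simp add: 2)
  qed (use G in simp_all)
  then show "ntrans (m2T (nmor2_vcomp \<phi> \<theta>) \<Gamma>) \<and> NSrc (m2T (nmor2_vcomp \<phi> \<theta>) \<Gamma>) = At (mT (M2Src \<theta>)) \<Gamma> \<and>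
      NTgt (m2T (nmor2_vcomp \<phi> \<theta>) \<Gamma>) = fct_comp (Far (T ?N) (At (ntvcomp (M2Nt \<phi>) (M2Nt \<theta>)) \<Gamma>)) (At (mT (M2Tgt \<phi>)) \<Gamma>)"
    using G by (simp add: m2T_vcomp indexed_vcomp_def Let_def)
next
  let ?M = "MSrc (M2Src \<theta>)" let ?N = "MTgt (M2Src \<theta>)" let ?C = "UCat ?M" let ?D = "UCat ?N"
  note [simp] = t p c
  fix u A assume "u \<in> Arr (Src (NSrc (ntvcomp (M2Nt \<phi>) (M2Nt \<theta>))))"
     and "A \<in> Obj (Fob (T ?M) (Cod (Src (NSrc (ntvcomp (M2Nt \<phi>) (M2Nt \<theta>)))) u))"
  then have u: "u \<in> Arr ?C" and A: "A \<in> Obj (Fob (T ?M) (Cod ?C u))" by simp_all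
  have s [simp]: "MSrc (M2Tgt \<phi>) = ?M" "MTgt (M2Tgt \<phi>) = ?N" using t p c by simp_all
  have "At (M2Nt \<theta>) (Cod ?C u) \<cdot>\<^bsub>?D\<^esub> Far (MFun (M2Src \<theta>)) u = Far (MFun (M2Tgt \<theta>)) u \<cdot>\<^bsub>?D\<^esub> At (M2Nt \<theta>) (Dom ?C u)"
    using naturality[of "M2Nt \<theta>" _ _ u] u by simp
  from sub_square[OF _ this, of "At (m2T \<phi> (Cod ?C u)) A"]
  show "At (m2T (nmor2_vcomp \<phi> \<theta>) (Dom (Src (NSrc (ntvcomp (M2Nt \<phi>) (M2Nt \<theta>)))) u)) (Fob (Far (T ?M) u) A)
    = Far (Far (T ?N) (Far (NSrc (ntvcomp (M2Nt \<phi>) (M2Nt \<theta>))) u)) (At (m2T (nmor2_vcomp \<phi> \<theta>) (Cod (Src (NSrc (ntvcomp (M2Nt \<phi>) (M2Nt \<theta>)))) u)) A)"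
    using u A by simp
next
  show "m2T (nmor2_vcomp \<phi> \<theta>) \<in> extensional (Obj (Src (NSrc (ntvcomp (M2Nt \<phi>) (M2Nt \<theta>)))))"
    using t by (simp add: m2T_vcomp indexed_vcomp_def Let_def)
qed

text \<open>The pattern is that of the vertical case, with the components of \<open>\<theta>\<close>
  first carried over by the source 1-cell of \<open>\<phi>\<close>; hence the base square is the
  image of the naturality square of \<open>\<theta>\<close>.\<close>

lemma indexed_h:
  assumes t: "nm_mor2 \<theta>" and p: "nm_mor2 \<phi>" and c: "MSrc (M2Src \<phi>) = MTgt (M2Src \<theta>)"
  shows "indexed_ntrans (T (MSrc (M2Src \<theta>))) (T (MTgt (M2Src \<phi>))) (nthcomp (M2Nt \<phi>) (M2Nt \<theta>))
      (mT (nmor_comp (M2Src \<phi>) (M2Src \<theta>))) (mT (nmor_comp (M2Tgt \<phi>) (M2Tgt \<theta>))) (m2T (nmor2_hcomp \<phi> \<theta>))"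
proof (rule indexed_ntrans.intro)
  let ?F = "M2Src \<theta>" let ?G = "M2Tgt \<theta>" let ?H = "M2Src \<phi>" let ?L = "M2Tgt \<phi>"
  let ?M = "MSrc ?F" let ?N = "MTgt ?F" let ?P = "MTgt ?H" let ?C = "UCat ?M" let ?D = "UCat ?N"
  note [simp] = t p c
  fix \<Gamma> assume "\<Gamma> \<in> Obj (Src (NSrc (nthcomp (M2Nt \<phi>) (M2Nt \<theta>))))"
  then have G: "\<Gamma> \<in> Obj ?C" by simp
  let ?K = "Fob (T ?P) (Fob (MFun ?H) (Fob (MFun ?F) \<Gamma>))"
  let ?S = "fct_comp (At (mT ?H) (Fob (MFun ?F) \<Gamma>)) (At (mT ?F) \<Gamma>)"
  let ?R = "fct_comp (Far (T ?P) (At (nthcomp (M2Nt \<phi>) (M2Nt \<theta>)) \<Gamma>))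
           (fct_comp (At (mT ?L) (Fob (MFun ?G) \<Gamma>)) (At (mT ?G) \<Gamma>))"
  let ?h = "Far (MFun ?H) (At (M2Nt \<theta>) \<Gamma>)"
  let ?a = "\<lambda>A. Far (Far (T ?P) ?h) (At (m2T \<phi> (Fob (MFun ?G) \<Gamma>)) (Fob (At (mT ?G) \<Gamma>) A))
     \<cdot>\<^bsub>?K\<^esub> Far (At (mT ?H) (Fob (MFun ?F) \<Gamma>)) (At (m2T \<theta> \<Gamma>) A)"
  have [simp]: "Fob (MFun ?G) \<Gamma> \<in> Obj ?D" "Fob (MFun ?F) \<Gamma> \<in> Obj ?D" using G by simp_all
  have "ntrans \<lparr>NSrc = ?S, NTgt = ?R, At = restrict ?a (Obj (Fob (T ?M) \<Gamma>))\<rparr>"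
  proof (rule ntransI)
    fix f assume "f \<in> Arr (Src ?S)"
    then have f: "f \<in> Arr (Fob (T ?M) \<Gamma>)" using G by simp
    let ?d = "Dom (Fob (T ?M) \<Gamma>) f" and ?c = "Cod (Fob (T ?M) \<Gamma>) f"
    have 1: "Far (Far (T ?P) ?h) (Far (Far (T ?P) (At (M2Nt \<phi>) (Fob (MFun ?G) \<Gamma>))) (Far (At (mT ?L) (Fob (MFun ?G) \<Gamma>)) (Far (At (mT ?G) \<Gamma>) f)))
        \<cdot>\<^bsub>?K\<^esub> Far (Far (T ?P) ?h) (At (m2T \<phi> (Fob (MFun ?G) \<Gamma>)) (Fob (At (mT ?G) \<Gamma>) ?d))
      = Far (Far (T ?P) ?h) (At (m2T \<phi> (Fob (MFun ?G) \<Gamma>)) (Fob (At (mT ?G) \<Gamma>) ?c)) \<cdot>\<^bsub>?K\<^esub>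
         Far (Far (T ?P) ?h) (Far (At (mT ?H) (Fob (MFun ?G) \<Gamma>)) (Far (At (mT ?G) \<Gamma>) f))"
      using naturality_image[of "Far (T ?P) ?h" _ _ "m2T \<phi> (Fob (MFun ?G) \<Gamma>)" _ "Far (At (mT ?G) \<Gamma>) f"] f G by simp
    have 2: "Far (Far (T ?P) ?h) (Far (At (mT ?H) (Fob (MFun ?G) \<Gamma>)) (Far (At (mT ?G) \<Gamma>) f))
        \<cdot>\<^bsub>?K\<^esub> Far (At (mT ?H) (Fob (MFun ?F) \<Gamma>)) (At (m2T \<theta> \<Gamma>) ?d)
      = Far (At (mT ?H) (Fob (MFun ?F) \<Gamma>)) (At (m2T \<theta> \<Gamma>) ?c) \<cdot>\<^bsub>?K\<^esub> Far (At (mT ?H) (Fob (MFun ?F) \<Gamma>)) (Far (At (mT ?F) \<Gamma>) f)"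
      using naturality_image[of "At (mT ?H) (Fob (MFun ?F) \<Gamma>)" _ _ "m2T \<theta> \<Gamma>" _ f] f G by simp
    have 3: "Far (Far (T ?P) ?h) (Far (Far (T ?P) (At (M2Nt \<phi>) (Fob (MFun ?G) \<Gamma>))) (Far (At (mT ?L) (Fob (MFun ?G) \<Gamma>)) (Far (At (mT ?G) \<Gamma>) f)))
        \<cdot>\<^bsub>?K\<^esub> (Far (Far (T ?P) ?h) (At (m2T \<phi> (Fob (MFun ?G) \<Gamma>)) (Fob (At (mT ?G) \<Gamma>) ?d)) \<cdot>\<^bsub>?K\<^esub> Far (At (mT ?H) (Fob (MFun ?F) \<Gamma>)) (At (m2T \<theta> \<Gamma>) ?d))
      = Far (Far (T ?P) ?h) (At (m2T \<phi> (Fob (MFun ?G) \<Gamma>)) (Fob (At (mT ?G) \<Gamma>) ?c)) \<cdot>\<^bsub>?K\<^esub>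
         (Far (Far (T ?P) ?h) (Far (At (mT ?H) (Fob (MFun ?G) \<Gamma>)) (Far (At (mT ?G) \<Gamma>) f)) \<cdot>\<^bsub>?K\<^esub> Far (At (mT ?H) (Fob (MFun ?F) \<Gamma>)) (At (m2T \<theta> \<Gamma>) ?d))"
      by (rule cmp_cong_left[OF _ 1]) (use f G in simp_all)
    show "?a (Cod (Src ?S) f) \<cdot>\<^bsub>Tgt ?S\<^esub> Far ?S f = Far ?R f \<cdot>\<^bsub>Tgt ?S\<^esub> ?a (Dom (Src ?S) f)"
      using f G 3 by (simp add: 2)
  qed (use G in simp_all)
  then show "ntrans (m2T (nmor2_hcomp \<phi> \<theta>) \<Gamma>) \<and> NSrc (m2T (nmor2_hcomp \<phi> \<theta>) \<Gamma>) = At (mT (nmor_comp ?H ?F)) \<Gamma> \<and>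
      NTgt (m2T (nmor2_hcomp \<phi> \<theta>) \<Gamma>) = fct_comp (Far (T ?P) (At (nthcomp (M2Nt \<phi>) (M2Nt \<theta>)) \<Gamma>)) (At (mT (nmor_comp ?L ?G)) \<Gamma>)"
    using G by (simp add: m2T_hcomp indexed_hcomp_def Let_def)
next
  let ?F = "M2Src \<theta>" let ?G = "M2Tgt \<theta>" let ?H = "M2Src \<phi>" let ?L = "M2Tgt \<phi>"
  let ?M = "MSrc ?F" let ?N = "MTgt ?F" let ?P = "MTgt ?H" let ?C = "UCat ?M" let ?D = "UCat ?N"
  note [simp] = t p c
  fix u A assume "u \<in> Arr (Src (NSrc (nthcomp (M2Nt \<phi>) (M2Nt \<theta>))))"
     and "A \<in> Obj (Fob (T ?M) (Cod (Src (NSrc (nthcomp (M2Nt \<phi>) (M2Nt \<theta>)))) u))"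
  then have u: "u \<in> Arr ?C" and A: "A \<in> Obj (Fob (T ?M) (Cod ?C u))" by simp_all
  have "Far (MFun ?H) (At (M2Nt \<theta>) (Cod ?C u)) \<cdot>\<^bsub>UCat ?P\<^esub> Far (MFun ?H) (Far (MFun ?F) u)
     = Far (MFun ?H) (Far (MFun ?G) u) \<cdot>\<^bsub>UCat ?P\<^esub> Far (MFun ?H) (At (M2Nt \<theta>) (Dom ?C u))"
    using naturality_image[of "MFun ?H" _ _ "M2Nt \<theta>" _ u] u by simp
  from sub_square[OF _ this, of "At (m2T \<phi> (Fob (MFun ?G) (Cod ?C u))) (Fob (At (mT ?G) (Cod ?C u)) A)"]
  show "At (m2T (nmor2_hcomp \<phi> \<theta>) (Dom (Src (NSrc (nthcomp (M2Nt \<phi>) (M2Nt \<theta>)))) u)) (Fob (Far (T ?M) u) A)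
    = Far (Far (T ?P) (Far (NSrc (nthcomp (M2Nt \<phi>) (M2Nt \<theta>))) u)) (At (m2T (nmor2_hcomp \<phi> \<theta>) (Cod (Src (NSrc (nthcomp (M2Nt \<phi>) (M2Nt \<theta>)))) u)) A)"
    using u A by simp
next
  show "m2T (nmor2_hcomp \<phi> \<theta>) \<in> extensional (Obj (Src (NSrc (nthcomp (M2Nt \<phi>) (M2Nt \<theta>)))))"
    using t by (simp add: m2T_hcomp indexed_hcomp_def Let_def)
qed

end

interpretation Tp: selector Tp MTp M2Tp
proof (rule selector.intro)
  fix \<theta> :: "'u nmor2" assume "nm_mor2 \<theta>"
  then show "indexed_ntrans (Tp (MSrc (M2Src \<theta>))) (Tp (MTgt (M2Src \<theta>))) (M2Nt \<theta>) (MTp (M2Src \<theta>)) (MTp (M2Tgt \<theta>)) (M2Tp \<theta>)"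
    by (rule nm_mor2.m2tp)
qed (simp_all, simp_all only: nmor_id_def nmor_comp_def nmor2_id_def nmor2_vcomp_def nmor2_hcomp_def nmor.simps nmor2.simps)

interpretation Tm: selector Tm MTm M2Tm
proof (rule selector.intro)
  fix \<theta> :: "'u nmor2" assume "nm_mor2 \<theta>"
  then show "indexed_ntrans (Tm (MSrc (M2Src \<theta>))) (Tm (MTgt (M2Src \<theta>))) (M2Nt \<theta>) (MTm (M2Src \<theta>)) (MTm (M2Tgt \<theta>)) (M2Tm \<theta>)"
    by (rule nm_mor2.m2tm)
qed (simp_all, simp_all only: nmor_id_def nmor_comp_def nmor2_id_def nmor2_vcomp_def nmor2_hcomp_def nmor.simps nmor2.simps)

section \<open>The 2-category of natural models\<close>

lemma isoI:
  "f \<in> Arr C \<Longrightarrow> g \<in> Arr C \<Longrightarrow> Dom C g = Cod C f \<Longrightarrow> Cod C g = Dom C f \<Longrightarrow>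
   g \<cdot>\<^bsub>C\<^esub> f = Idn C (Dom C f) \<Longrightarrow> f \<cdot>\<^bsub>C\<^esub> g = Idn C (Cod C f) \<Longrightarrow> iso C f"
  unfolding iso_def hom_def by blast

lemma isoE:
  assumes "iso C f"
  obtains g where "f \<in> Arr C" "g \<in> Arr C" "Dom C g = Cod C f" "Cod C g = Dom C f"
   "g \<cdot>\<^bsub>C\<^esub> f = Idn C (Dom C f)" "f \<cdot>\<^bsub>C\<^esub> g = Idn C (Cod C f)" "iso C g"
proof -
  from assms obtain g where g: "f \<in> Arr C" "g \<in> Arr C" "Dom C g = Cod C f" "Cod C g = Dom C f"
   "g \<cdot>\<^bsub>C\<^esub> f = Idn C (Dom C f)" "f \<cdot>\<^bsub>C\<^esub> g = Idn C (Cod C f)" by (auto simp: iso_def hom_def)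
  moreover from g have "iso C g" by (intro isoI[of _ _ f]) simp_all
  ultimately show thesis using that by blast
qed

lemma cmp_cancel_left:
  assumes "category C" "g \<in> Arr C" "f \<in> Arr C" "x \<in> Arr C" "Dom C g = Cod C f" "Dom C f = Cod C x"
    "g \<cdot>\<^bsub>C\<^esub> f = Idn C B" "Cod C x = B"
  shows "g \<cdot>\<^bsub>C\<^esub> (f \<cdot>\<^bsub>C\<^esub> x) = x"
  using assms by (simp flip: category.assoc)

lemma disp_arr [simp]: "pre_natural_model M \<Longrightarrow> p \<in> Disp M \<Longrightarrow> p \<in> Arr (UCat M)"
  using display_category.disp_arr[of M] by auto

lemma Pj_simps [simp]:
  assumes "pre_natural_model M" "\<Gamma> \<in> Obj (UCat M)" "A \<in> Obj (Fob (Tp M) \<Gamma>)"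
  shows "Pj M \<Gamma> A \<in> Disp M" "Cod (UCat M) (Pj M \<Gamma> A) = \<Gamma>"
    "Vr M \<Gamma> A \<in> Obj (Fob (Tm M) (Dom (UCat M) (Pj M \<Gamma> A)))"
    "Fob (At (Pr M) (Dom (UCat M) (Pj M \<Gamma> A))) (Vr M \<Gamma> A) = Fob (Far (Tp M) (Pj M \<Gamma> A)) A"
  using pre_natural_model.pj[OF assms] pre_natural_model.vr[OF assms] by (simp_all add: ctx_ext_def)

text \<open>\<open>is_ext M A \<pi> v\<close>: the arrow \<open>\<pi>\<close> and the term \<open>v\<close> represent the terms of type \<open>A\<close>,
  as the chosen \<open>p\<^sub>A\<close> and \<open>v\<^sub>A\<close> do.\<close>

definition is_ext :: "'u nm \<Rightarrow> 'u \<Rightarrow> 'u \<Rightarrow> 'u \<Rightarrow> bool" where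
  "is_ext M A \<pi> v \<longleftrightarrow> \<pi> \<in> Arr (UCat M) \<and> A \<in> Obj (Fob (Tp M) (Cod (UCat M) \<pi>)) \<and>
     v \<in> Obj (Fob (Tm M) (Dom (UCat M) \<pi>)) \<and> Fob (At (Pr M) (Dom (UCat M) \<pi>)) v = Fob (Far (Tp M) \<pi>) A \<and>
     (\<forall>u t. u \<in> Arr (UCat M) \<and> Cod (UCat M) u = Cod (UCat M) \<pi> \<and> t \<in> Obj (Fob (Tm M) (Dom (UCat M) u)) \<and>
        Fob (At (Pr M) (Dom (UCat M) u)) t = Fob (Far (Tp M) u) A \<longrightarrow>
        (\<exists>!w. w \<in> Arr (UCat M) \<and> Dom (UCat M) w = Dom (UCat M) u \<and> Cod (UCat M) w = Dom (UCat M) \<pi> \<and>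
           \<pi> \<cdot>\<^bsub>UCat M\<^esub> w = u \<and> Fob (Far (Tm M) w) v = t))"

lemma is_extD:
  assumes "is_ext M A \<pi> v"
  shows "\<pi> \<in> Arr (UCat M)" "A \<in> Obj (Fob (Tp M) (Cod (UCat M) \<pi>))" "v \<in> Obj (Fob (Tm M) (Dom (UCat M) \<pi>))"
    "Fob (At (Pr M) (Dom (UCat M) \<pi>)) v = Fob (Far (Tp M) \<pi>) A"
  using assms by (simp_all add: is_ext_def)

lemma is_ext_ex1:
  assumes "is_ext M A \<pi> v" "u \<in> Arr (UCat M)" "Cod (UCat M) u = Cod (UCat M) \<pi>" "t \<in> Obj (Fob (Tm M) (Dom (UCat M) u))"
        "Fob (At (Pr M) (Dom (UCat M) u)) t = Fob (Far (Tp M) u) A"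
  shows "\<exists>!w. w \<in> Arr (UCat M) \<and> Dom (UCat M) w = Dom (UCat M) u \<and> Cod (UCat M) w = Dom (UCat M) \<pi> \<and>
           \<pi> \<cdot>\<^bsub>UCat M\<^esub> w = u \<and> Fob (Far (Tm M) w) v = t"
  using assms by (simp add: is_ext_def)

lemma is_ext_obtain:
  assumes "is_ext M A \<pi> v" "u \<in> Arr (UCat M)" "Cod (UCat M) u = Cod (UCat M) \<pi>" "t \<in> Obj (Fob (Tm M) (Dom (UCat M) u))"
        "Fob (At (Pr M) (Dom (UCat M) u)) t = Fob (Far (Tp M) u) A"
  obtains w where "w \<in> Arr (UCat M)" "Dom (UCat M) w = Dom (UCat M) u" "Cod (UCat M) w = Dom (UCat M) \<pi>"
           "\<pi> \<cdot>\<^bsub>UCat M\<^esub> w = u" "Fob (Far (Tm M) w) v = t"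
  using is_ext_ex1[OF assms] by blast

lemma is_ext_unique:
  assumes M: "pre_natural_model M" and e: "is_ext M A \<pi> v"
    and w: "w \<in> Arr (UCat M)" "w' \<in> Arr (UCat M)" "Dom (UCat M) w = Dom (UCat M) w'"
      "Cod (UCat M) w = Dom (UCat M) \<pi>" "Cod (UCat M) w' = Dom (UCat M) \<pi>"
      "\<pi> \<cdot>\<^bsub>UCat M\<^esub> w = \<pi> \<cdot>\<^bsub>UCat M\<^esub> w'" "Fob (Far (Tm M) w) v = Fob (Far (Tm M) w') v"
  shows "w = w'"
proof -
  note [simp] = is_extD[OF e]
  have "\<exists>!x. x \<in> Arr (UCat M) \<and> Dom (UCat M) x = Dom (UCat M) (\<pi> \<cdot>\<^bsub>UCat M\<^esub> w') \<and> Cod (UCat M) x = Dom (UCat M) \<pi> \<and>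
           \<pi> \<cdot>\<^bsub>UCat M\<^esub> x = \<pi> \<cdot>\<^bsub>UCat M\<^esub> w' \<and> Fob (Far (Tm M) x) v = Fob (Far (Tm M) w') v"
    by (rule is_ext_ex1[OF e]) (use M w in simp_all)
  moreover have "Dom (UCat M) (\<pi> \<cdot>\<^bsub>UCat M\<^esub> w') = Dom (UCat M) w'" using M w by simp
  ultimately show ?thesis using w by auto
qed

lemma is_ext_chosen:
  assumes "pre_natural_model M" "\<Gamma> \<in> Obj (UCat M)" "A \<in> Obj (Fob (Tp M) \<Gamma>)"
  shows "is_ext M A (Pj M \<Gamma> A) (Vr M \<Gamma> A)"
proof -
  { fix u t assume *: "u \<in> Arr (UCat M)" "Cod (UCat M) u = \<Gamma>" "t \<in> Obj (Fob (Tm M) (Dom (UCat M) u))"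
       "Fob (At (Pr M) (Dom (UCat M) u)) t = Fob (Far (Tp M) u) A"
    have "\<exists>!w. w \<in> hom (UCat M) (Dom (UCat M) u) (ctx_ext M \<Gamma> A) \<and> Pj M \<Gamma> A \<cdot>\<^bsub>UCat M\<^esub> w = u \<and> Fob (Far (Tm M) w) (Vr M \<Gamma> A) = t"
      by (rule pre_natural_model.representable[OF assms]) (use * in \<open>simp_all add: hom_def\<close>)
    then have "\<exists>!w. w \<in> Arr (UCat M) \<and> Dom (UCat M) w = Dom (UCat M) u \<and> Cod (UCat M) w = Dom (UCat M) (Pj M \<Gamma> A) \<and>
           Pj M \<Gamma> A \<cdot>\<^bsub>UCat M\<^esub> w = u \<and> Fob (Far (Tm M) w) (Vr M \<Gamma> A) = t"
      by (simp add: hom_def ctx_ext_def) }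
  then show ?thesis using assms by (simp add: is_ext_def)
qed

lemma is_ext_iso:
  assumes M: "pre_natural_model M" and e: "is_ext M A \<pi> v" and i: "iso (UCat M) i" "Cod (UCat M) i = Dom (UCat M) \<pi>"
  shows "is_ext M A (\<pi> \<cdot>\<^bsub>UCat M\<^esub> i) (Fob (Far (Tm M) i) v)"
proof -
  let ?C = "UCat M"
  from i(1) obtain j where ij: "i \<in> Arr ?C" "j \<in> Arr ?C" "Dom ?C j = Cod ?C i" "Cod ?C j = Dom ?C i"
    "j \<cdot>\<^bsub>?C\<^esub> i = Idn ?C (Dom ?C i)" "i \<cdot>\<^bsub>?C\<^esub> j = Idn ?C (Cod ?C i)" by (rule isoE)
  note [simp] = is_extD[OF e] ij(1-4) M i(2)
  have vj: "Fob (Far (Tm M) j) (Fob (Far (Tm M) i) v) = v"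
    using arg_cong[OF ij(6), of "\<lambda>x. Fob (Far (Tm M) x) v"] by simp
  show ?thesis unfolding is_ext_def
  proof (intro conjI allI impI)
    fix u t assume "u \<in> Arr ?C \<and> Cod ?C u = Cod ?C (\<pi> \<cdot>\<^bsub>?C\<^esub> i) \<and> t \<in> Obj (Fob (Tm M) (Dom ?C u)) \<and>
       Fob (At (Pr M) (Dom ?C u)) t = Fob (Far (Tp M) u) A"
    then have u: "u \<in> Arr ?C" "Cod ?C u = Cod ?C \<pi>" "t \<in> Obj (Fob (Tm M) (Dom ?C u))"
       "Fob (At (Pr M) (Dom ?C u)) t = Fob (Far (Tp M) u) A" by simp_all
    from is_ext_obtain[OF e u] obtain w where w: "w \<in> Arr ?C" "Dom ?C w = Dom ?C u" "Cod ?C w = Dom ?C \<pi>"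
      "\<pi> \<cdot>\<^bsub>?C\<^esub> w = u" "Fob (Far (Tm M) w) v = t" by blast
    have iw: "i \<cdot>\<^bsub>?C\<^esub> (j \<cdot>\<^bsub>?C\<^esub> w) = w" by (rule cmp_cancel_left[OF _ _ _ _ _ _ ij(6)]) (use w in simp_all)
    show "\<exists>!w. w \<in> Arr ?C \<and> Dom ?C w = Dom ?C u \<and> Cod ?C w = Dom ?C (\<pi> \<cdot>\<^bsub>?C\<^esub> i) \<and>
         (\<pi> \<cdot>\<^bsub>?C\<^esub> i) \<cdot>\<^bsub>?C\<^esub> w = u \<and> Fob (Far (Tm M) w) (Fob (Far (Tm M) i) v) = t"
    proof (rule ex1I[of _ "j \<cdot>\<^bsub>?C\<^esub> w"])
      show "j \<cdot>\<^bsub>?C\<^esub> w \<in> Arr ?C \<and> Dom ?C (j \<cdot>\<^bsub>?C\<^esub> w) = Dom ?C u \<and> Cod ?C (j \<cdot>\<^bsub>?C\<^esub> w) = Dom ?C (\<pi> \<cdot>\<^bsub>?C\<^esub> i) \<and>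
         (\<pi> \<cdot>\<^bsub>?C\<^esub> i) \<cdot>\<^bsub>?C\<^esub> (j \<cdot>\<^bsub>?C\<^esub> w) = u \<and> Fob (Far (Tm M) (j \<cdot>\<^bsub>?C\<^esub> w)) (Fob (Far (Tm M) i) v) = t"
        using w iw vj by simp
    next
      fix x assume "x \<in> Arr ?C \<and> Dom ?C x = Dom ?C u \<and> Cod ?C x = Dom ?C (\<pi> \<cdot>\<^bsub>?C\<^esub> i) \<and>
         (\<pi> \<cdot>\<^bsub>?C\<^esub> i) \<cdot>\<^bsub>?C\<^esub> x = u \<and> Fob (Far (Tm M) x) (Fob (Far (Tm M) i) v) = t"
      then have x: "x \<in> Arr ?C" "Dom ?C x = Dom ?C u" "Cod ?C x = Dom ?C i" "(\<pi> \<cdot>\<^bsub>?C\<^esub> i) \<cdot>\<^bsub>?C\<^esub> x = u"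
        "Fob (Far (Tm M) x) (Fob (Far (Tm M) i) v) = t" by simp_all
      have x4: "\<pi> \<cdot>\<^bsub>?C\<^esub> (i \<cdot>\<^bsub>?C\<^esub> x) = u" using x(1-4) by simp
      have "i \<cdot>\<^bsub>?C\<^esub> x = w"
        by (rule is_ext_unique[OF M e]) (use x(1-3,5) w x4 in simp_all)
      then show "x = j \<cdot>\<^bsub>?C\<^esub> w" using cmp_cancel_left[OF _ _ _ _ _ _ ij(5), of x] x(1-3) by simp
    qed
  qed simp_all
qed

lemma is_ext_compare:
  assumes M: "pre_natural_model M" and e: "is_ext M A \<pi> v" and e': "is_ext M A \<pi>' v'" and c: "Cod (UCat M) \<pi> = Cod (UCat M) \<pi>'"
  obtains i where "iso (UCat M) i" "Dom (UCat M) i = Dom (UCat M) \<pi>'" "Cod (UCat M) i = Dom (UCat M) \<pi>"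
    "\<pi> \<cdot>\<^bsub>UCat M\<^esub> i = \<pi>'" "Fob (Far (Tm M) i) v = v'"
proof -
  let ?C = "UCat M"
  note [simp] = is_extD[OF e] is_extD[OF e'] M
  note c' = c[symmetric]
  obtain i where i: "i \<in> Arr ?C" "Dom ?C i = Dom ?C \<pi>'" "Cod ?C i = Dom ?C \<pi>" "\<pi> \<cdot>\<^bsub>?C\<^esub> i = \<pi>'" "Fob (Far (Tm M) i) v = v'"
    by (rule is_ext_obtain[OF e, of \<pi>' v']) (use c in simp_all)
  obtain j where j: "j \<in> Arr ?C" "Dom ?C j = Dom ?C \<pi>" "Cod ?C j = Dom ?C \<pi>'" "\<pi>' \<cdot>\<^bsub>?C\<^esub> j = \<pi>" "Fob (Far (Tm M) j) v' = v"
    by (rule is_ext_obtain[OF e', of \<pi> v]) (use c in simp_all)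
  have pij: "\<pi> \<cdot>\<^bsub>?C\<^esub> (i \<cdot>\<^bsub>?C\<^esub> j) = \<pi>" using category.assoc[of ?C j i \<pi>] i j by simp
  have pji: "\<pi>' \<cdot>\<^bsub>?C\<^esub> (j \<cdot>\<^bsub>?C\<^esub> i) = \<pi>'" using category.assoc[of ?C i j \<pi>'] i j by simp
  have 1: "i \<cdot>\<^bsub>?C\<^esub> j = Idn ?C (Dom ?C \<pi>)"
    by (rule is_ext_unique[OF M e]) (use i j pij in simp_all)
  have 2: "j \<cdot>\<^bsub>?C\<^esub> i = Idn ?C (Dom ?C \<pi>')"
    by (rule is_ext_unique[OF M e']) (use i j pji in simp_all)
  have "iso ?C i" by (rule isoI[of _ _ j]) (use i j 1 2 in simp_all)
  then show thesis using that i by blast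
qed

text \<open>The canonical map compares the image of the chosen extension with the chosen extension
  of the image. By uniqueness of representing objects it is invertible exactly when the image
  represents as well, which removes the choice in the target from the definition of a
  morphism.\<close>

lemma canonical_iff:
  assumes m: "pre_nm_mor m" and G: "\<Gamma> \<in> Obj (UCat (MSrc m))" and A: "A \<in> Obj (Fob (Tp (MSrc m)) \<Gamma>)"
  shows "iso (UCat (MTgt m)) (canonical_map m \<Gamma> A) \<longleftrightarrow>
    is_ext (MTgt m) (Fob (At (MTp m) \<Gamma>) A) (Far (MFun m) (Pj (MSrc m) \<Gamma> A))
      (Fob (At (MTm m) (Dom (UCat (MSrc m)) (Pj (MSrc m) \<Gamma> A))) (Vr (MSrc m) \<Gamma> A))" (is "_ \<longleftrightarrow> is_ext ?N ?A ?\<pi> ?v")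
proof -
  let ?C = "UCat (MTgt m)" let ?h = "canonical_map m \<Gamma> A"
  let ?p = "Pj ?N (Fob (MFun m) \<Gamma>) ?A" let ?x = "Vr ?N (Fob (MFun m) \<Gamma>) ?A"
  note [simp] = m G A
  have e: "is_ext ?N ?A ?p ?x" by (rule is_ext_chosen) simp_all
  have "\<exists>!w. w \<in> Arr ?C \<and> Dom ?C w = Dom ?C ?\<pi> \<and> Cod ?C w = Dom ?C ?p \<and> ?p \<cdot>\<^bsub>?C\<^esub> w = ?\<pi> \<and> Fob (Far (Tm ?N) w) ?x = ?v"
    by (rule is_ext_ex1[OF e]) simp_all
  then have "\<exists>!w. w \<in> hom ?C (Fob (MFun m) (ctx_ext (MSrc m) \<Gamma> A)) (ctx_ext ?N (Fob (MFun m) \<Gamma>) ?A) \<and> ?p \<cdot>\<^bsub>?C\<^esub> w = ?\<pi> \<and> Fob (Far (Tm ?N) w) ?x = ?v"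
    by (simp add: hom_def ctx_ext_def)
  from theI'[OF this] have h: "?h \<in> Arr ?C" "Dom ?C ?h = Dom ?C ?\<pi>" "Cod ?C ?h = Dom ?C ?p" "?p \<cdot>\<^bsub>?C\<^esub> ?h = ?\<pi>"
      "Fob (Far (Tm ?N) ?h) ?x = ?v"
    unfolding canonical_map_def Let_def ctx_ext_def by (auto simp: hom_def)
  show ?thesis
  proof
    assume i: "iso ?C ?h"
    show "is_ext ?N ?A ?\<pi> ?v" using is_ext_iso[OF _ e i h(3)] h(4,5) by simp
  next
    assume e': "is_ext ?N ?A ?\<pi> ?v"
    have c: "Cod ?C ?p = Cod ?C ?\<pi>" by simp
    obtain i where i: "iso ?C i" "Dom ?C i = Dom ?C ?\<pi>" "Cod ?C i = Dom ?C ?p" "?p \<cdot>\<^bsub>?C\<^esub> i = ?\<pi>" "Fob (Far (Tm ?N) i) ?x = ?v"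
      by (rule is_ext_compare[OF _ e e' c]) simp_all
    have "?h = i" by (rule is_ext_unique[OF _ e]) (use h i in \<open>simp_all add: iso_def\<close>)
    then show "iso ?C ?h" using i by simp
  qed
qed

lemma iso_Far:
  assumes F: "fctr F" "Tgt F = D" and i: "iso (Src F) i" shows "iso D (Far F i)"
proof -
  from i obtain j where j: "i \<in> Arr (Src F)" "j \<in> Arr (Src F)" "Dom (Src F) j = Cod (Src F) i" "Cod (Src F) j = Dom (Src F) i"
    "j \<cdot>\<^bsub>Src F\<^esub> i = Idn (Src F) (Dom (Src F) i)" "i \<cdot>\<^bsub>Src F\<^esub> j = Idn (Src F) (Cod (Src F) i)" by (rule isoE)
  have c: "category (Src F)" using F by simp
  have "Far F j \<cdot>\<^bsub>D\<^esub> Far F i = Idn D (Fob F (Dom (Src F) i))" "Far F i \<cdot>\<^bsub>D\<^esub> Far F j = Idn D (Fob F (Cod (Src F) i))"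
    using F j(1-4) c arg_cong[OF j(5), of "Far F"] arg_cong[OF j(6), of "Far F"] by simp_all
  then show ?thesis by (intro isoI[of _ _ "Far F j"]) (use F j(1-4) in simp_all)
qed

text \<open>Any extension is isomorphic to the chosen one, for which the claim is the invertibility
  of the canonical map. Functors preserve the isomorphism, and \<open>is_ext\<close> is invariant
  under it.\<close>

lemma is_ext_preserved:
  assumes m: "nm_mor m" and e: "is_ext (MSrc m) A \<pi> v"
  shows "is_ext (MTgt m) (Fob (At (MTp m) (Cod (UCat (MSrc m)) \<pi>)) A) (Far (MFun m) \<pi>)
      (Fob (At (MTm m) (Dom (UCat (MSrc m)) \<pi>)) v)"
proof -
  let ?M = "MSrc m" let ?C = "UCat ?M" let ?\<Gamma> = "Cod ?C \<pi>" let ?p = "Pj ?M ?\<Gamma> A" let ?x = "Vr ?M ?\<Gamma> A"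
  note [simp] = m is_extD[OF e]
  have e': "is_ext ?M A ?p ?x" by (rule is_ext_chosen) simp_all
  have c: "Cod ?C ?p = Cod ?C \<pi>" by simp
  obtain i where i: "iso ?C i" "Dom ?C i = Dom ?C \<pi>" "Cod ?C i = Dom ?C ?p" "?p \<cdot>\<^bsub>?C\<^esub> i = \<pi>" "Fob (Far (Tm ?M) i) ?x = v"
    by (rule is_ext_compare[OF _ e' e c]) simp_all
  have [simp]: "i \<in> Arr ?C" using i by (simp add: iso_def)
  have 1: "is_ext (MTgt m) (Fob (At (MTp m) ?\<Gamma>) A) (Far (MFun m) ?p) (Fob (At (MTm m) (Dom ?C ?p)) ?x)"
    by (subst canonical_iff[symmetric]) (use nm_mor.canonical_iso[OF m] in simp_all)
  have 2: "iso (UCat (MTgt m)) (Far (MFun m) i)" by (rule iso_Far) (use i in simp_all)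
  have 3: "Far (MFun m) ?p \<cdot>\<^bsub>UCat (MTgt m)\<^esub> Far (MFun m) i = Far (MFun m) \<pi>"
    using arg_cong[OF i(4), of "Far (MFun m)"] i(2,3) by simp
  have 4: "Fob (Far (Tm (MTgt m)) (Far (MFun m) i)) (Fob (At (MTm m) (Dom ?C ?p)) ?x) = Fob (At (MTm m) (Dom ?C \<pi>)) v"
    using Tm.mT_natural(1)[of m ?M i "Dom ?C \<pi>" ?x] i by simp
  show ?thesis using is_ext_iso[OF _ 1 2] i(3) 3 4 by simp
qed

lemma display_functor_comp:
  assumes F: "display_functor D E F" and G: "display_functor E H G" and D: "Disp D \<subseteq> Arr (UCat D)"
  shows "display_functor D H (fct_comp G F)"
proof -
  have *: "pullback (UCat D) p f p' q \<Longrightarrow> p \<in> Arr (UCat D) \<and> f \<in> Arr (UCat D) \<and> p' \<in> Arr (UCat D) \<and> q \<in> Arr (UCat D)" for p f p' q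
    by (simp add: pullback_def)
  have [simp]: "fctr F" "Src F = UCat D" "Tgt F = UCat E" "fctr G" "Src G = UCat E" "Tgt G = UCat H"
    using F G by (auto simp: display_functor_def)
  have 1: "Far F ` Disp D \<subseteq> Disp E" "Far G ` Disp E \<subseteq> Disp H"
    "\<And>p f p' q. p \<in> Disp D \<Longrightarrow> pullback (UCat D) p f p' q \<Longrightarrow> pullback (UCat E) (Far F p) (Far F f) (Far F p') (Far F q)"
    "\<And>p f p' q. p \<in> Disp E \<Longrightarrow> pullback (UCat E) p f p' q \<Longrightarrow> pullback (UCat H) (Far G p) (Far G f) (Far G p') (Far G q)"
    using F G by (auto simp: display_functor_def)
  have 2: "pullback (UCat H) (Far (fct_comp G F) p) (Far (fct_comp G F) f) (Far (fct_comp G F) p') (Far (fct_comp G F) q)"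
    if "p \<in> Disp D" "pullback (UCat D) p f p' q" for p f p' q
  proof -
    have "Far F p \<in> Disp E" using 1(1) that by auto
    from 1(4)[OF this 1(3)[OF that]] show ?thesis using *[OF that(2)] by simp
  qed
  show ?thesis unfolding display_functor_def
  proof (intro conjI)
    show "Far (fct_comp G F) ` Disp D \<subseteq> Disp H"
    proof (rule image_subsetI)
      fix x assume "x \<in> Disp D"
      then have "x \<in> Arr (UCat D)" "Far F x \<in> Disp E" using 1(1) D by auto
      then show "Far (fct_comp G F) x \<in> Disp H" using 1(2) by auto
    qed
  qed (use 2 in simp_all)
qed

section \<open>Identities and composites of morphisms and 2-morphisms\<close>

lemma nm_mor_id: assumes M: "natural_model M" shows "nm_mor (nmor_id M)"
proof -
  note [simp] = M
  have d: "display_functor M M (fct_id (UCat M))"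
    unfolding display_functor_def
  proof (intro conjI ballI allI impI)
    show "Far (fct_id (UCat M)) ` Disp M \<subseteq> Disp M" by auto
    fix p f p' q assume pb: "pullback (UCat M) p f p' q"
    then have "p \<in> Arr (UCat M)" "f \<in> Arr (UCat M)" "p' \<in> Arr (UCat M)" "q \<in> Arr (UCat M)" by (auto simp: pullback_def)
    with pb show "pullback (UCat M) (Far (fct_id (UCat M)) p) (Far (fct_id (UCat M)) f) (Far (fct_id (UCat M)) p') (Far (fct_id (UCat M)) q)"
      by simp
  qed simp_all
  have p: "pre_nm_mor (nmor_id M)"
    by (rule pre_nm_mor.intro) (use d in \<open>simp_all\<close>)
  show ?thesis
    by (intro nm_mor.intro nm_mor_axioms.intro p; (subst canonical_iff[OF p])?) (simp_all add: is_ext_chosen)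
qed

text \<open>In terms of \<open>is_ext\<close>, closure under composition is preservation applied
  twice, whereas a direct proof would have to factor the canonical map of the composite.\<close>

lemma nm_mor_comp:
  assumes m: "nm_mor m" and n: "nm_mor n" and c: "MSrc n = MTgt m"
  shows "nm_mor (nmor_comp n m)"
proof -
  note [simp] = m n c
  have p: "pre_nm_mor (nmor_comp n m)"
  proof (rule pre_nm_mor.intro)
    show "display_functor (MSrc (nmor_comp n m)) (MTgt (nmor_comp n m)) (MFun (nmor_comp n m))"
      using display_functor_comp[of "MSrc m" "MTgt m" "MFun m" "MTgt n" "MFun n"] pre_nm_mor.mfun[of m] pre_nm_mor.mfun[of n]
      by (simp add: display_category.disp_arr)
    fix \<Gamma> assume G: "\<Gamma> \<in> Obj (UCat (MSrc (nmor_comp n m)))"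
    show "fct_comp (At (Pr (MTgt (nmor_comp n m))) (Fob (MFun (nmor_comp n m)) \<Gamma>)) (At (MTm (nmor_comp n m)) \<Gamma>)
      = fct_comp (At (MTp (nmor_comp n m)) \<Gamma>) (At (Pr (MSrc (nmor_comp n m))) \<Gamma>)"
      by (rule fct_eqI) (use G in simp_all)
  qed (simp_all add: Tp.ntrans_mT_comp Tm.ntrans_mT_comp)
  show ?thesis
  proof (intro nm_mor.intro nm_mor_axioms.intro p)
    fix \<Gamma> A assume "\<Gamma> \<in> Obj (UCat (MSrc (nmor_comp n m)))" "A \<in> Obj (Fob (Tp (MSrc (nmor_comp n m))) \<Gamma>)"
    then have GA: "\<Gamma> \<in> Obj (UCat (MSrc m))" "A \<in> Obj (Fob (Tp (MSrc m)) \<Gamma>)" by simp_all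
    have "is_ext (MSrc m) A (Pj (MSrc m) \<Gamma> A) (Vr (MSrc m) \<Gamma> A)" by (rule is_ext_chosen) (use GA in simp_all)
    from is_ext_preserved[OF n, unfolded c, OF is_ext_preserved[OF m this]]
    show "iso (UCat (MTgt (nmor_comp n m))) (canonical_map (nmor_comp n m) \<Gamma> A)"
      by (subst canonical_iff[OF p]) (use GA in simp_all)
  qed simp_all
qed

lemma m2compat_simp [simp]:
  assumes "nm_mor2 \<theta>" "MTgt (M2Src \<theta>) = N" "\<Gamma> \<in> Obj (UCat (MSrc (M2Src \<theta>)))" "Fob (MFun (M2Src \<theta>)) \<Gamma> = \<Gamma>'"
   "t \<in> Obj (Fob (Tm (MSrc (M2Src \<theta>))) \<Gamma>)"
  shows "Far (At (Pr N) \<Gamma>') (At (M2Tm \<theta> \<Gamma>) t) = At (M2Tp \<theta> \<Gamma>) (Fob (At (Pr (MSrc (M2Src \<theta>))) \<Gamma>) t)"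
  using nm_mor2.m2compat[OF assms(1,3,5)] assms by simp

lemma nm_mor2_id: assumes m: "nm_mor m" shows "nm_mor2 (nmor2_id m)"
  by (rule nm_mor2.intro) (use m Tp.indexed_id[OF m] Tm.indexed_id[OF m] in simp_all)

lemma nm_mor2_vcomp:
  assumes t: "nm_mor2 \<theta>" and p: "nm_mor2 \<phi>" and c: "M2Src \<phi> = M2Tgt \<theta>"
  shows "nm_mor2 (nmor2_vcomp \<phi> \<theta>)"
proof -
  have s: "MSrc (M2Tgt \<phi>) = MSrc (M2Src \<theta>)" "MTgt (M2Tgt \<phi>) = MTgt (M2Src \<theta>)" using t p c by simp_all
  show ?thesis
    by (rule nm_mor2.intro) (use t p c s Tp.indexed_v[OF t p c] Tm.indexed_v[OF t p c] in simp_all)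
qed

lemma nm_mor2_hcomp:
  assumes t: "nm_mor2 \<theta>" and p: "nm_mor2 \<phi>" and c: "MSrc (M2Src \<phi>) = MTgt (M2Src \<theta>)"
  shows "nm_mor2 (nmor2_hcomp \<phi> \<theta>)"
  by (rule nm_mor2.intro) (use t p c Tp.indexed_h[OF t p c] Tm.indexed_h[OF t p c] in \<open>simp_all add: nm_mor_comp\<close>)

lemma nm_mor_eqI:
  fixes m n :: "'u nmor"
  assumes "nm_mor m" "nm_mor n" "MSrc m = MSrc n" "MTgt m = MTgt n" "MFun m = MFun n"
    "\<And>\<Gamma>. \<Gamma> \<in> Obj (UCat (MSrc n)) \<Longrightarrow> At (MTp m) \<Gamma> = At (MTp n) \<Gamma>"
    "\<And>\<Gamma>. \<Gamma> \<in> Obj (UCat (MSrc n)) \<Longrightarrow> At (MTm m) \<Gamma> = At (MTm n) \<Gamma>"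
  shows "m = n"
proof -
  have "MTp m = MTp n" by (rule ntr_eqI) (use assms in simp_all)
  moreover have "MTm m = MTm n" by (rule ntr_eqI) (use assms in simp_all)
  ultimately show ?thesis using assms by simp
qed

lemma nm_mor2_eqI:
  fixes \<theta> \<phi> :: "'u nmor2"
  assumes "nm_mor2 \<theta>" "nm_mor2 \<phi>" "M2Src \<theta> = M2Src \<phi>" "M2Tgt \<theta> = M2Tgt \<phi>" "M2Nt \<theta> = M2Nt \<phi>"
    "\<And>\<Gamma> A. \<Gamma> \<in> Obj (UCat (MSrc (M2Src \<phi>))) \<Longrightarrow> A \<in> Obj (Fob (Tp (MSrc (M2Src \<phi>))) \<Gamma>) \<Longrightarrow>
       At (M2Tp \<theta> \<Gamma>) A = At (M2Tp \<phi> \<Gamma>) A"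
    "\<And>\<Gamma> A. \<Gamma> \<in> Obj (UCat (MSrc (M2Src \<phi>))) \<Longrightarrow> A \<in> Obj (Fob (Tm (MSrc (M2Src \<phi>))) \<Gamma>) \<Longrightarrow>
       At (M2Tm \<theta> \<Gamma>) A = At (M2Tm \<phi> \<Gamma>) A"
  shows "\<theta> = \<phi>"
  using Tp.m2T_eqI[of \<theta> \<phi>] Tm.m2T_eqI[of \<theta> \<phi>] assms by simp

lemma nmor_laws:
  "nm_mor m \<Longrightarrow> MTgt m = M \<Longrightarrow> nmor_comp (nmor_id M) m = m"
  "nm_mor m \<Longrightarrow> MSrc m = M \<Longrightarrow> nmor_comp m (nmor_id M) = m"
  "nm_mor m \<Longrightarrow> nm_mor n \<Longrightarrow> nm_mor l \<Longrightarrow> MSrc n = MTgt m \<Longrightarrow> MSrc l = MTgt n \<Longrightarrow>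
    nmor_comp (nmor_comp l n) m = nmor_comp l (nmor_comp n m)"
  by (rule nm_mor_eqI; (auto simp: nm_mor_comp nm_mor_id)[1])+

lemma nmor2_vlaws:
  "nm_mor2 \<theta> \<Longrightarrow> M2Tgt \<theta> = m \<Longrightarrow> nmor2_vcomp (nmor2_id m) \<theta> = \<theta>"
  "nm_mor2 \<theta> \<Longrightarrow> M2Src \<theta> = m \<Longrightarrow> nmor2_vcomp \<theta> (nmor2_id m) = \<theta>"
  "nm_mor2 \<theta> \<Longrightarrow> nm_mor2 \<phi> \<Longrightarrow> nm_mor2 \<psi> \<Longrightarrow> M2Src \<phi> = M2Tgt \<theta> \<Longrightarrow> M2Src \<psi> = M2Tgt \<phi> \<Longrightarrow>
    nmor2_vcomp (nmor2_vcomp \<psi> \<phi>) \<theta> = nmor2_vcomp \<psi> (nmor2_vcomp \<phi> \<theta>)"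
proof -
  assume t: "nm_mor2 \<theta>"
  show "M2Tgt \<theta> = m \<Longrightarrow> nmor2_vcomp (nmor2_id m) \<theta> = \<theta>"
    using t by (intro nm_mor2_eqI) (auto simp: nm_mor2_vcomp nm_mor2_id)
  show "M2Src \<theta> = m \<Longrightarrow> nmor2_vcomp \<theta> (nmor2_id m) = \<theta>"
    using t by (intro nm_mor2_eqI) (auto simp: nm_mor2_vcomp nm_mor2_id)
  assume p: "nm_mor2 \<phi>" "nm_mor2 \<psi>" "M2Src \<phi> = M2Tgt \<theta>" "M2Src \<psi> = M2Tgt \<phi>"
  have s: "MSrc (M2Tgt \<phi>) = MSrc (M2Src \<theta>)" "MTgt (M2Tgt \<phi>) = MTgt (M2Src \<theta>)" using t p nm_mor2_simps(3,4)[of \<phi>] by simp_all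
  show "nmor2_vcomp (nmor2_vcomp \<psi> \<phi>) \<theta> = nmor2_vcomp \<psi> (nmor2_vcomp \<phi> \<theta>)"
    by (rule nm_mor2_eqI) (use t p s in \<open>simp_all add: nm_mor2_vcomp\<close>)
qed

lemma nmor2_hlaws:
  "nm_mor2 \<theta> \<Longrightarrow> MTgt (M2Src \<theta>) = M \<Longrightarrow> nmor2_hcomp (nmor2_id (nmor_id M)) \<theta> = \<theta>"
  "nm_mor2 \<theta> \<Longrightarrow> MSrc (M2Src \<theta>) = M \<Longrightarrow> nmor2_hcomp \<theta> (nmor2_id (nmor_id M)) = \<theta>"
  "nm_mor2 \<theta> \<Longrightarrow> nm_mor2 \<phi> \<Longrightarrow> nm_mor2 \<psi> \<Longrightarrow> MSrc (M2Src \<phi>) = MTgt (M2Src \<theta>) \<Longrightarrow> MSrc (M2Src \<psi>) = MTgt (M2Src \<phi>) \<Longrightarrow>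
    nmor2_hcomp (nmor2_hcomp \<psi> \<phi>) \<theta> = nmor2_hcomp \<psi> (nmor2_hcomp \<phi> \<theta>)"
  "nm_mor m \<Longrightarrow> nm_mor n \<Longrightarrow> MSrc n = MTgt m \<Longrightarrow> nmor2_hcomp (nmor2_id n) (nmor2_id m) = nmor2_id (nmor_comp n m)"
proof -
  show "nm_mor m \<Longrightarrow> nm_mor n \<Longrightarrow> MSrc n = MTgt m \<Longrightarrow> nmor2_hcomp (nmor2_id n) (nmor2_id m) = nmor2_id (nmor_comp n m)"
    by (rule nm_mor2_eqI) (simp_all add: nm_mor2_hcomp nm_mor2_id nm_mor_comp)
  assume t: "nm_mor2 \<theta>"
  show "nmor2_hcomp (nmor2_id (nmor_id M)) \<theta> = \<theta>" if "MTgt (M2Src \<theta>) = M"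
  proof -
    have M: "natural_model M" using t that by auto
    show ?thesis
      by (rule nm_mor2_eqI) (use t that M in \<open>simp_all add: nm_mor2_hcomp nm_mor2_id nm_mor_id nmor_laws\<close>)
  qed
  show "nmor2_hcomp \<theta> (nmor2_id (nmor_id M)) = \<theta>" if "MSrc (M2Src \<theta>) = M"
  proof -
    have M: "natural_model M" using t that by auto
    show ?thesis
      by (rule nm_mor2_eqI) (use t that M in \<open>simp_all add: nm_mor2_hcomp nm_mor2_id nm_mor_id nmor_laws\<close>)
  qed
  assume p: "nm_mor2 \<phi>" "nm_mor2 \<psi>" "MSrc (M2Src \<phi>) = MTgt (M2Src \<theta>)" "MSrc (M2Src \<psi>) = MTgt (M2Src \<phi>)"
  show "nmor2_hcomp (nmor2_hcomp \<psi> \<phi>) \<theta> = nmor2_hcomp \<psi> (nmor2_hcomp \<phi> \<theta>)"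
    by (rule nm_mor2_eqI) (use t p in \<open>simp_all add: nm_mor2_hcomp nmor_laws\<close>)
qed

text \<open>Two facts are combined: naturality of \<open>\<phi>\<close> in the base at the component
  of \<open>\<theta>'\<close> identifies the two substitutions in front of the component of
  \<open>\<phi>'\<close> (\<open>x1\<close>), and naturality of \<open>\<phi>\<close> in the fibre
  at the component of \<open>\<theta>'\<close> exchanges the middle factors
  (\<open>x2\<close>).\<close>

lemma (in selector) interchange_At:
  assumes h: "nm_mor2 \<theta>" "nm_mor2 \<theta>'" "nm_mor2 \<phi>" "nm_mor2 \<phi>'" "M2Src \<theta>' = M2Tgt \<theta>" "M2Src \<phi>' = M2Tgt \<phi>"
      "MSrc (M2Src \<phi>) = MTgt (M2Src \<theta>)" "nm_mor2 (nmor2_vcomp \<phi>' \<phi>)" "nm_mor2 (nmor2_vcomp \<theta>' \<theta>)"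
      "nm_mor2 (nmor2_hcomp \<phi> \<theta>)" "nm_mor2 (nmor2_hcomp \<phi>' \<theta>')"
    and G: "\<Gamma> \<in> Obj (UCat (MSrc (M2Src \<theta>)))" and A: "A \<in> Obj (Fob (T (MSrc (M2Src \<theta>))) \<Gamma>)"
  shows "At (m2T (nmor2_hcomp (nmor2_vcomp \<phi>' \<phi>) (nmor2_vcomp \<theta>' \<theta>)) \<Gamma>) A
    = At (m2T (nmor2_vcomp (nmor2_hcomp \<phi>' \<theta>') (nmor2_hcomp \<phi> \<theta>)) \<Gamma>) A"
proof -
  let ?F = "M2Src \<theta>" let ?G = "M2Tgt \<theta>" let ?G' = "M2Tgt \<theta>'" let ?H = "M2Src \<phi>" let ?L = "M2Tgt \<phi>" let ?L' = "M2Tgt \<phi>'"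
  let ?M = "MSrc ?F" let ?N = "MTgt ?F" let ?P = "MTgt ?H"
  have s: "MSrc ?G' = ?M" "MTgt ?G' = ?N" "MSrc ?L' = ?N" "MTgt ?L' = ?P"
    using h nm_mor2_simps(3,4)[of \<theta>'] nm_mor2_simps(3,4)[of \<phi>'] by simp_all
  note [simp] = h s G A
  let ?h = "Far (MFun ?H) (At (M2Nt \<theta>) \<Gamma>)" let ?h' = "Far (MFun ?H) (At (M2Nt \<theta>') \<Gamma>)"
  let ?K = "Fob (T ?P) (Fob (MFun ?H) (Fob (MFun ?F) \<Gamma>))"
  have [simp]: "Fob (MFun ?G) \<Gamma> \<in> Obj (UCat ?N)" "Fob (MFun ?G') \<Gamma> \<in> Obj (UCat ?N)" "Fob (MFun ?F) \<Gamma> \<in> Obj (UCat ?N)"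
    by (simp_all add: fct_simps)
  have sq: "At (M2Nt \<phi>) (Fob (MFun ?G') \<Gamma>) \<cdot>\<^bsub>UCat ?P\<^esub> ?h'
     = Far (MFun ?L) (At (M2Nt \<theta>') \<Gamma>) \<cdot>\<^bsub>UCat ?P\<^esub> At (M2Nt \<phi>) (Fob (MFun ?G) \<Gamma>)"
    using naturality[of "M2Nt \<phi>" _ _ "At (M2Nt \<theta>') \<Gamma>"] by simp
  have x1: "Far (Far (T ?P) ?h') (Far (Far (T ?P) (At (M2Nt \<phi>) (Fob (MFun ?G') \<Gamma>))) y)
    = Far (Far (T ?P) (At (M2Nt \<phi>) (Fob (MFun ?G) \<Gamma>))) (Far (Far (T ?P) (Far (MFun ?L) (At (M2Nt \<theta>') \<Gamma>))) y)"
    if "y \<in> Arr (Fob (T ?P) (Fob (MFun ?L) (Fob (MFun ?G') \<Gamma>)))" for y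
    using sub_square(2)[OF _ sq, of y] that by simp
  have x1': "Fob (Far (T ?P) ?h') (Fob (Far (T ?P) (At (M2Nt \<phi>) (Fob (MFun ?G') \<Gamma>))) y)
    = Fob (Far (T ?P) (At (M2Nt \<phi>) (Fob (MFun ?G) \<Gamma>))) (Fob (Far (T ?P) (Far (MFun ?L) (At (M2Nt \<theta>') \<Gamma>))) y)"
    if "y \<in> Obj (Fob (T ?P) (Fob (MFun ?L) (Fob (MFun ?G') \<Gamma>)))" for y
    using sub_square(1)[OF _ sq, of y] that by simp
  have x2: "Far (Far (T ?P) ?h) (Far (Far (T ?P) (At (M2Nt \<phi>) (Fob (MFun ?G) \<Gamma>))) (Far (At (mT ?L) (Fob (MFun ?G) \<Gamma>)) (At (m2T \<theta>' \<Gamma>) A)))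
      \<cdot>\<^bsub>?K\<^esub> Far (Far (T ?P) ?h) (At (m2T \<phi> (Fob (MFun ?G) \<Gamma>)) (Fob (At (mT ?G) \<Gamma>) A))
    = Far (Far (T ?P) ?h) (Far (Far (T ?P) ?h') (At (m2T \<phi> (Fob (MFun ?G') \<Gamma>)) (Fob (At (mT ?G') \<Gamma>) A)))
      \<cdot>\<^bsub>?K\<^esub> Far (Far (T ?P) ?h) (Far (At (mT ?H) (Fob (MFun ?G) \<Gamma>)) (At (m2T \<theta>' \<Gamma>) A))"
    using naturality_image[of "Far (T ?P) ?h" _ _ "m2T \<phi> (Fob (MFun ?G) \<Gamma>)" _ "At (m2T \<theta>' \<Gamma>) A"] by simp
  have x3: "Far (Far (T ?P) ?h) (Far (Far (T ?P) (At (M2Nt \<phi>) (Fob (MFun ?G) \<Gamma>))) (Far (At (mT ?L) (Fob (MFun ?G) \<Gamma>)) (At (m2T \<theta>' \<Gamma>) A)))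
      \<cdot>\<^bsub>?K\<^esub> (Far (Far (T ?P) ?h) (At (m2T \<phi> (Fob (MFun ?G) \<Gamma>)) (Fob (At (mT ?G) \<Gamma>) A)) \<cdot>\<^bsub>?K\<^esub> z)
    = Far (Far (T ?P) ?h) (Far (Far (T ?P) ?h') (At (m2T \<phi> (Fob (MFun ?G') \<Gamma>)) (Fob (At (mT ?G') \<Gamma>) A)))
      \<cdot>\<^bsub>?K\<^esub> (Far (Far (T ?P) ?h) (Far (At (mT ?H) (Fob (MFun ?G) \<Gamma>)) (At (m2T \<theta>' \<Gamma>) A)) \<cdot>\<^bsub>?K\<^esub> z)"
      if "z \<in> Arr ?K" "Cod ?K z = Fob (At (mT ?H) (Fob (MFun ?F) \<Gamma>)) (Fob (Far (T ?N) (At (M2Nt \<theta>) \<Gamma>)) (Fob (At (mT ?G) \<Gamma>) A))" for z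
    by (rule cmp_cong_left[OF _ x2]) (use that in simp_all)
  show ?thesis by (simp add: x1 x1' x3)
qed

lemma nmor2_interchange:
  assumes h: "nm_mor2 \<theta>" "nm_mor2 \<theta>'" "nm_mor2 \<phi>" "nm_mor2 \<phi>'" "M2Src \<theta>' = M2Tgt \<theta>" "M2Src \<phi>' = M2Tgt \<phi>"
      "MSrc (M2Src \<phi>) = MTgt (M2Src \<theta>)"
  shows "nmor2_hcomp (nmor2_vcomp \<phi>' \<phi>) (nmor2_vcomp \<theta>' \<theta>) = nmor2_vcomp (nmor2_hcomp \<phi>' \<theta>') (nmor2_hcomp \<phi> \<theta>)"
proof -
  have c: "nm_mor2 (nmor2_vcomp \<phi>' \<phi>)" "nm_mor2 (nmor2_vcomp \<theta>' \<theta>)" "nm_mor2 (nmor2_hcomp \<phi> \<theta>)" "nm_mor2 (nmor2_hcomp \<phi>' \<theta>')"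
    using h by (simp_all add: nm_mor2_vcomp nm_mor2_hcomp)
  show ?thesis
  proof (rule nm_mor2_eqI)
    fix \<Gamma> A
    assume "\<Gamma> \<in> Obj (UCat (MSrc (M2Src (nmor2_vcomp (nmor2_hcomp \<phi>' \<theta>') (nmor2_hcomp \<phi> \<theta>)))))"
    then have G: "\<Gamma> \<in> Obj (UCat (MSrc (M2Src \<theta>)))" by simp
    show "A \<in> Obj (Fob (Tp (MSrc (M2Src (nmor2_vcomp (nmor2_hcomp \<phi>' \<theta>') (nmor2_hcomp \<phi> \<theta>))))) \<Gamma>) \<Longrightarrow>
       At (M2Tp (nmor2_hcomp (nmor2_vcomp \<phi>' \<phi>) (nmor2_vcomp \<theta>' \<theta>)) \<Gamma>) A
      = At (M2Tp (nmor2_vcomp (nmor2_hcomp \<phi>' \<theta>') (nmor2_hcomp \<phi> \<theta>)) \<Gamma>) A"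
      by (rule Tp.interchange_At[OF h c G]) simp
    show "A \<in> Obj (Fob (Tm (MSrc (M2Src (nmor2_vcomp (nmor2_hcomp \<phi>' \<theta>') (nmor2_hcomp \<phi> \<theta>))))) \<Gamma>) \<Longrightarrow>
       At (M2Tm (nmor2_hcomp (nmor2_vcomp \<phi>' \<phi>) (nmor2_vcomp \<theta>' \<theta>)) \<Gamma>) A
      = At (M2Tm (nmor2_vcomp (nmor2_hcomp \<phi>' \<theta>') (nmor2_hcomp \<phi> \<theta>)) \<Gamma>) A"
      by (rule Tm.interchange_At[OF h c G]) simp
  qed (use h c in \<open>simp_all add: nm_mor2_vcomp nm_mor2_hcomp nt_interchange\<close>)
qed

lemma NM_simps [simp]:
  "Obj (One NM) = {C. natural_model C}" "Arr (One NM) = {F. nm_mor F}"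
  "nm_mor F \<Longrightarrow> Dom (One NM) F = MSrc F" "nm_mor F \<Longrightarrow> Cod (One NM) F = MTgt F"
  "natural_model C \<Longrightarrow> Idn (One NM) C = nmor_id C"
  "nm_mor F \<Longrightarrow> nm_mor G \<Longrightarrow> MSrc G = MTgt F \<Longrightarrow> G \<cdot>\<^bsub>One NM\<^esub> F = nmor_comp G F"
  "Obj (Two NM) = {F. nm_mor F}" "Arr (Two NM) = {\<alpha>. nm_mor2 \<alpha>}"
  "nm_mor2 \<alpha> \<Longrightarrow> Dom (Two NM) \<alpha> = M2Src \<alpha>" "nm_mor2 \<alpha> \<Longrightarrow> Cod (Two NM) \<alpha> = M2Tgt \<alpha>"
  "nm_mor F \<Longrightarrow> Idn (Two NM) F = nmor2_id F"
  "nm_mor2 \<alpha> \<Longrightarrow> nm_mor2 \<beta> \<Longrightarrow> M2Src \<beta> = M2Tgt \<alpha> \<Longrightarrow> \<beta> \<cdot>\<^bsub>Two NM\<^esub> \<alpha> = nmor2_vcomp \<beta> \<alpha>"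
  "nm_mor2 \<alpha> \<Longrightarrow> nm_mor2 \<beta> \<Longrightarrow> MSrc (M2Src \<beta>) = MTgt (M2Src \<alpha>) \<Longrightarrow> \<beta> \<star>\<^bsub>NM\<^esub> \<alpha> = nmor2_hcomp \<beta> \<alpha>"
  by (simp_all add: NM_def partial_comp_def)

lemmas [simp] = nm_mor_id nm_mor_comp nm_mor2_id nm_mor2_vcomp nm_mor2_hcomp

lemma category_one_NM: "category (One NM)"
  unfolding NM_def two_cat.simps by (rule category_mkcat) (simp_all add: nmor_laws)

lemma category_two_NM: "category (Two NM)"
  unfolding NM_def two_cat.simps by (rule category_mkcat) (simp_all add: nmor2_vlaws)

lemma horizontal_NM: "horizontal NM = mkcat {C. natural_model C} {\<alpha>. nm_mor2 \<alpha>} (MSrc \<circ> M2Src) (MTgt \<circ> M2Src)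
    (\<lambda>C. nmor2_id (nmor_id C)) nmor2_hcomp"
  by (simp add: horizontal_def mkcat_def NM_def comp_def cong: restrict_cong)

lemma category_hor_NM: "category (horizontal NM)"
  unfolding horizontal_NM by (rule category_mkcat) (simp_all add: nmor2_hlaws)

lemma strict_2_category_NM: "strict_2_category NM"
  by (intro strict_2_category.intro)
    (simp_all add: category_one_NM category_two_NM category_hor_NM nmor2_interchange nmor2_hlaws(4))

lemma strict_2_functor_forget: "strict_2_functor NM CAT NM_forget"
  by (intro strict_2_functor.intro) (simp_all add: NM_forget_def hom_def)

interpretation NM: strict_2_category NM by (rule strict_2_category_NM)

section \<open>Recognising natural models\<close>

text \<open>The unit makes \<open>F\<close> faithful and the counit makes the quasi-inverse
  \<open>G\<close> faithful. Fullness of \<open>F\<close> then follows: a candidate is built from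
  \<open>Far G g\<close>, and faithfulness of \<open>G\<close> shows that it is mapped to
  \<open>g\<close>.\<close>

lemma equiv_ff:
  assumes "cat_equivalence F" "A \<in> Obj (Src F)" "B \<in> Obj (Src F)" "g \<in> Arr (Tgt F)" "Dom (Tgt F) g = Fob F A" "Cod (Tgt F) g = Fob F B"
  shows "\<exists>!f. f \<in> Arr (Src F) \<and> Dom (Src F) f = A \<and> Cod (Src F) f = B \<and> Far F f = g"
proof -
  let ?S = "Src F" let ?T = "Tgt F"
  from assms(1) obtain G \<eta> \<epsilon> where G: "fctr F" "fctr G" "Src G = ?T" "Tgt G = ?S"
    and \<eta>: "ntrans \<eta>" "NSrc \<eta> = fct_id ?S" "NTgt \<eta> = fct_comp G F" "\<And>A. A \<in> Obj ?S \<Longrightarrow> iso ?S (At \<eta> A)"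
    and \<epsilon>: "ntrans \<epsilon>" "NSrc \<epsilon> = fct_comp F G" "NTgt \<epsilon> = fct_id ?T" "\<And>A. A \<in> Obj ?T \<Longrightarrow> iso ?T (At \<epsilon> A)"
    by (auto simp: cat_equivalence_def nat_iso_def)
  note [simp] = G \<eta>(1-3) \<epsilon>(1-3) assms(2,3)
  have inj: "f = f'" if f: "f \<in> Arr ?S" "f' \<in> Arr ?S" "Dom ?S f = Dom ?S f'" "Cod ?S f = Cod ?S f'" "Far F f = Far F f'" for f f'
  proof -
    obtain j where j: "j \<in> Arr ?S" "Dom ?S j = Fob G (Fob F (Cod ?S f))" "Cod ?S j = Cod ?S f" "j \<cdot>\<^bsub>?S\<^esub> At \<eta> (Cod ?S f) = Idn ?S (Cod ?S f)"
      using isoE[OF \<eta>(4)[of "Cod ?S f"]] f(1) by (metis \<eta>(1,2,3) fct_comp_simps(3) fct_id_simps(1,2,3) ntr_simps(4,5) G(1) category.cod_closed fctr.src_cat)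
    have n: "At \<eta> (Cod ?S f) \<cdot>\<^bsub>?S\<^esub> f = At \<eta> (Cod ?S f) \<cdot>\<^bsub>?S\<^esub> f'"
      using naturality[OF \<eta>(1), of ?S ?S f] naturality[OF \<eta>(1), of ?S ?S f'] f by simp
    have "f = j \<cdot>\<^bsub>?S\<^esub> (At \<eta> (Cod ?S f) \<cdot>\<^bsub>?S\<^esub> f)" by (rule cmp_cancel_left[OF _ _ _ _ _ _ j(4), symmetric]) (use f j in simp_all)
    also have "\<dots> = j \<cdot>\<^bsub>?S\<^esub> (At \<eta> (Cod ?S f) \<cdot>\<^bsub>?S\<^esub> f')" using n by simp
    also have "\<dots> = f'" by (rule cmp_cancel_left[OF _ _ _ _ _ _ j(4)]) (use f j in simp_all)
    finally show ?thesis .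
  qed
  have injG: "h = h'" if h: "h \<in> Arr ?T" "h' \<in> Arr ?T" "Dom ?T h = Dom ?T h'" "Cod ?T h = Cod ?T h'" "Far G h = Far G h'" for h h'
  proof -
    obtain j where j: "j \<in> Arr ?T" "Cod ?T j = Fob F (Fob G (Dom ?T h))" "Dom ?T j = Dom ?T h" "At \<epsilon> (Dom ?T h) \<cdot>\<^bsub>?T\<^esub> j = Idn ?T (Dom ?T h)"
      using isoE[OF \<epsilon>(4)[of "Dom ?T h"]] h(1) by (metis \<epsilon>(1,2,3) fct_comp_simps(1,2,3) fct_id_simps(3) ntr_simps(4,5) G category.dom_closed fctr.tgt_cat)
    have n: "h \<cdot>\<^bsub>?T\<^esub> At \<epsilon> (Dom ?T h) = h' \<cdot>\<^bsub>?T\<^esub> At \<epsilon> (Dom ?T h)"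
      using naturality[OF \<epsilon>(1), of ?T ?T h] naturality[OF \<epsilon>(1), of ?T ?T h'] h by simp
    have "h = (h \<cdot>\<^bsub>?T\<^esub> At \<epsilon> (Dom ?T h)) \<cdot>\<^bsub>?T\<^esub> j" using h j by simp
    also have "\<dots> = (h' \<cdot>\<^bsub>?T\<^esub> At \<epsilon> (Dom ?T h)) \<cdot>\<^bsub>?T\<^esub> j" using n by simp
    also have "\<dots> = h'" using h j by simp
    finally show ?thesis .
  qed
  obtain j where j: "j \<in> Arr ?S" "Dom ?S j = Fob G (Fob F B)" "Cod ?S j = B" "At \<eta> B \<cdot>\<^bsub>?S\<^esub> j = Idn ?S (Fob G (Fob F B))"
    using isoE[OF \<eta>(4)[of B]] by (metis \<eta>(1,2,3) fct_comp_simps(3) fct_id_simps(1,2,3) ntr_simps(4,5) assms(3))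
  \<comment> \<open>The only possible preimage: naturality of \<open>\<eta>\<close> forces
    \<open>At \<eta> B\<close> after it to be \<open>Far G g\<close> after
    \<open>At \<eta> A\<close>, and \<open>j\<close> inverts \<open>At \<eta> B\<close>.\<close>
  let ?f = "j \<cdot>\<^bsub>?S\<^esub> (Far G g \<cdot>\<^bsub>?S\<^esub> At \<eta> A)"
  have f0: "?f \<in> Arr ?S" "Dom ?S ?f = A" "Cod ?S ?f = B" using assms(4-6) j by simp_all
  have e0: "At \<eta> B \<cdot>\<^bsub>?S\<^esub> ?f = Far G g \<cdot>\<^bsub>?S\<^esub> At \<eta> A"
    by (rule cmp_cancel_left[OF _ _ _ _ _ _ j(4)]) (use assms(4-6) j(1-3) in simp_all)
  obtain f where f: "f \<in> Arr ?S" "Dom ?S f = A" "Cod ?S f = B" and e2: "At \<eta> B \<cdot>\<^bsub>?S\<^esub> f = Far G g \<cdot>\<^bsub>?S\<^esub> At \<eta> A"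
    using f0 e0 by blast
  have e1: "At \<eta> B \<cdot>\<^bsub>?S\<^esub> f = Far G (Far F f) \<cdot>\<^bsub>?S\<^esub> At \<eta> A"
    using naturality[OF \<eta>(1), of ?S ?S f A B] f by simp
  obtain i where i: "i \<in> Arr ?S" "Dom ?S i = Fob G (Fob F A)" "Cod ?S i = A" "At \<eta> A \<cdot>\<^bsub>?S\<^esub> i = Idn ?S (Fob G (Fob F A))"
    using isoE[OF \<eta>(4)[of A]] by (metis \<eta>(1,2,3) fct_comp_simps(3) fct_id_simps(1,2,3) ntr_simps(4,5) assms(2))
  have "Far G (Far F f) = (Far G (Far F f) \<cdot>\<^bsub>?S\<^esub> At \<eta> A) \<cdot>\<^bsub>?S\<^esub> i" using f i by simp
  also have "\<dots> = (Far G g \<cdot>\<^bsub>?S\<^esub> At \<eta> A) \<cdot>\<^bsub>?S\<^esub> i" using e1 e2 by simp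
  also have "\<dots> = Far G g" using i assms(4-6) by simp
  finally have "Far G (Far F f) = Far G g" .
  then have "Far F f = g" by (rule injG[rotated -1]) (use f assms(4-6) in simp_all)
  note Fg = this
  show ?thesis
  proof (rule ex1I[of _ f])
    show "f \<in> Arr ?S \<and> Dom ?S f = A \<and> Cod ?S f = B \<and> Far F f = g" using f Fg by simp
    fix x assume "x \<in> Arr ?S \<and> Dom ?S x = A \<and> Cod ?S x = B \<and> Far F x = g"
    then show "x = f" by (intro inj) (use f Fg in simp_all)
  qed
qed

lemma equiv_es:
  assumes "cat_equivalence F" "X \<in> Obj (Tgt F)"
  obtains A i where "A \<in> Obj (Src F)" "iso (Tgt F) i" "Dom (Tgt F) i = Fob F A" "Cod (Tgt F) i = X"
proof -
  let ?S = "Src F" let ?T = "Tgt F"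
  from assms(1) obtain G \<epsilon> where G: "fctr F" "fctr G" "Src G = ?T" "Tgt G = ?S"
    and \<epsilon>: "ntrans \<epsilon>" "NSrc \<epsilon> = fct_comp F G" "NTgt \<epsilon> = fct_id ?T" "\<And>A. A \<in> Obj ?T \<Longrightarrow> iso ?T (At \<epsilon> A)"
    by (auto simp: cat_equivalence_def nat_iso_def)
  show thesis by (rule that[of "Fob G X" "At \<epsilon> X"]) (use G \<epsilon> assms(2) in simp_all)
qed

text \<open>The quasi-inverse is chosen on objects by essential surjectivity; on arrows it is the
  unique lift of the conjugate by the chosen isomorphisms. All laws are tested after
  \<open>F\<close>, which is faithful.\<close>

lemma cat_equivalenceI:
  fixes F :: "('o,'a,'p,'b) fct"
  assumes F: "fctr F"
    and ff: "\<And>A B g. A \<in> Obj (Src F) \<Longrightarrow> B \<in> Obj (Src F) \<Longrightarrow> g \<in> Arr (Tgt F) \<Longrightarrow> Dom (Tgt F) g = Fob F A \<Longrightarrow>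
      Cod (Tgt F) g = Fob F B \<Longrightarrow> \<exists>!f. f \<in> Arr (Src F) \<and> Dom (Src F) f = A \<and> Cod (Src F) f = B \<and> Far F f = g"
    and es: "\<And>X. X \<in> Obj (Tgt F) \<Longrightarrow> \<exists>A i. A \<in> Obj (Src F) \<and> iso (Tgt F) i \<and> Dom (Tgt F) i = Fob F A \<and> Cod (Tgt F) i = X"
  shows "cat_equivalence F"
proof -
  let ?S = "Src F" let ?T = "Tgt F"
  define lift where "lift A B g = (THE f. f \<in> Arr ?S \<and> Dom ?S f = A \<and> Cod ?S f = B \<and> Far F f = g)" for A B g
  have lift: "lift A B g \<in> Arr ?S" "Dom ?S (lift A B g) = A" "Cod ?S (lift A B g) = B" "Far F (lift A B g) = g"
    if "A \<in> Obj ?S" "B \<in> Obj ?S" "g \<in> Arr ?T" "Dom ?T g = Fob F A" "Cod ?T g = Fob F B" for A B g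
    using theI'[OF ff[OF that]] by (auto simp: lift_def)
  have inj: "f = f'" if f: "f \<in> Arr ?S" "f' \<in> Arr ?S" "Dom ?S f = Dom ?S f'" "Cod ?S f = Cod ?S f'" "Far F f = Far F f'" for f f'
  proof -
    have "\<exists>!x. x \<in> Arr ?S \<and> Dom ?S x = Dom ?S f \<and> Cod ?S x = Cod ?S f \<and> Far F x = Far F f"
      by (rule ff) (use F f(1) in simp_all)
    then show ?thesis using f by auto
  qed
  \<comment> \<open>The axiom of choice enters here: for every object a preimage \<open>g X\<close>,
    together with an isomorphism \<open>e X\<close> from its image. The inverses \<open>d X\<close>
    are chosen next.\<close>
  obtain g e where ge: "\<And>X. X \<in> Obj ?T \<Longrightarrow> g X \<in> Obj ?S \<and> iso ?T (e X) \<and> Dom ?T (e X) = Fob F (g X) \<and> Cod ?T (e X) = X"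
    using es by metis
  have "\<forall>X. \<exists>d. X \<in> Obj ?T \<longrightarrow> d \<in> Arr ?T \<and> Dom ?T d = X \<and> Cod ?T d = Fob F (g X) \<and> d \<cdot>\<^bsub>?T\<^esub> e X = Idn ?T (Fob F (g X)) \<and> e X \<cdot>\<^bsub>?T\<^esub> d = Idn ?T X"
    using ge isoE by metis
  then obtain d where d: "\<And>X. X \<in> Obj ?T \<Longrightarrow> d X \<in> Arr ?T \<and> Dom ?T (d X) = X \<and> Cod ?T (d X) = Fob F (g X) \<and>
      d X \<cdot>\<^bsub>?T\<^esub> e X = Idn ?T (Fob F (g X)) \<and> e X \<cdot>\<^bsub>?T\<^esub> d X = Idn ?T X" by metis
  have ea: "e X \<in> Arr ?T" if "X \<in> Obj ?T" for X using ge[OF that] by (simp add: iso_def)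
  note [simp] = F ge ea d
  have de [simp]: "d X \<cdot>\<^bsub>?T\<^esub> (e X \<cdot>\<^bsub>?T\<^esub> x) = x" if "x \<in> Arr ?T" "X \<in> Obj ?T" "Cod ?T x = Fob F (g X)" for x X
    by (rule cmp_cancel_left) (use that in simp_all)
  have ed [simp]: "e X \<cdot>\<^bsub>?T\<^esub> (d X \<cdot>\<^bsub>?T\<^esub> x) = x" if "x \<in> Arr ?T" "X \<in> Obj ?T" "Cod ?T x = X" for x X
    by (rule cmp_cancel_left) (use that in simp_all)
  define G where "G = \<lparr>Src = ?T, Tgt = ?S, Fob = restrict g (Obj ?T),
     Far = (\<lambda>h\<in>Arr ?T. lift (g (Dom ?T h)) (g (Cod ?T h)) (d (Cod ?T h) \<cdot>\<^bsub>?T\<^esub> (h \<cdot>\<^bsub>?T\<^esub> e (Dom ?T h))))\<rparr>"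
  have l [simp]: "lift (g (Dom ?T h)) (g (Cod ?T h)) (d (Cod ?T h) \<cdot>\<^bsub>?T\<^esub> (h \<cdot>\<^bsub>?T\<^esub> e (Dom ?T h))) \<in> Arr ?S"
     "Dom ?S (lift (g (Dom ?T h)) (g (Cod ?T h)) (d (Cod ?T h) \<cdot>\<^bsub>?T\<^esub> (h \<cdot>\<^bsub>?T\<^esub> e (Dom ?T h)))) = g (Dom ?T h)"
     "Cod ?S (lift (g (Dom ?T h)) (g (Cod ?T h)) (d (Cod ?T h) \<cdot>\<^bsub>?T\<^esub> (h \<cdot>\<^bsub>?T\<^esub> e (Dom ?T h)))) = g (Cod ?T h)"
     "Far F (lift (g (Dom ?T h)) (g (Cod ?T h)) (d (Cod ?T h) \<cdot>\<^bsub>?T\<^esub> (h \<cdot>\<^bsub>?T\<^esub> e (Dom ?T h)))) = d (Cod ?T h) \<cdot>\<^bsub>?T\<^esub> (h \<cdot>\<^bsub>?T\<^esub> e (Dom ?T h))"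
    if "h \<in> Arr ?T" for h
    using lift[of "g (Dom ?T h)" "g (Cod ?T h)" "d (Cod ?T h) \<cdot>\<^bsub>?T\<^esub> (h \<cdot>\<^bsub>?T\<^esub> e (Dom ?T h))"] that by simp_all
  have G: "fctr G" "Src G = ?T" "Tgt G = ?S" and Go: "\<And>X. X \<in> Obj ?T \<Longrightarrow> Fob G X = g X"
    and Ga: "\<And>h. h \<in> Arr ?T \<Longrightarrow> Far F (Far G h) = d (Cod ?T h) \<cdot>\<^bsub>?T\<^esub> (h \<cdot>\<^bsub>?T\<^esub> e (Dom ?T h))"
  proof -
    show "fctr G" unfolding G_def
    proof (rule fctrI)
      fix X assume X: "X \<in> Obj ?T"
      show "lift (g (Dom ?T (Idn ?T X))) (g (Cod ?T (Idn ?T X))) (d (Cod ?T (Idn ?T X)) \<cdot>\<^bsub>?T\<^esub> (Idn ?T X \<cdot>\<^bsub>?T\<^esub> e (Dom ?T (Idn ?T X)))) = Idn ?S (g X)"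
        by (rule inj, use l[of "Idn ?T X"] X in simp_all)
    next
      fix h k assume h: "h \<in> Arr ?T" "k \<in> Arr ?T" "Dom ?T k = Cod ?T h"
      note l' = l[of "k \<cdot>\<^bsub>?T\<^esub> h"] l[of h] l[of k]
      show "lift (g (Dom ?T (k \<cdot>\<^bsub>?T\<^esub> h))) (g (Cod ?T (k \<cdot>\<^bsub>?T\<^esub> h))) (d (Cod ?T (k \<cdot>\<^bsub>?T\<^esub> h)) \<cdot>\<^bsub>?T\<^esub> (k \<cdot>\<^bsub>?T\<^esub> h) \<cdot>\<^bsub>?T\<^esub> e (Dom ?T (k \<cdot>\<^bsub>?T\<^esub> h)))
        = lift (g (Dom ?T k)) (g (Cod ?T k)) (d (Cod ?T k) \<cdot>\<^bsub>?T\<^esub> k \<cdot>\<^bsub>?T\<^esub> e (Dom ?T k)) \<cdot>\<^bsub>?S\<^esub>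
          lift (g (Dom ?T h)) (g (Cod ?T h)) (d (Cod ?T h) \<cdot>\<^bsub>?T\<^esub> h \<cdot>\<^bsub>?T\<^esub> e (Dom ?T h))"
        by (rule inj) (use h l' in simp_all)
    qed simp_all
  qed (simp_all add: G_def)
  note [simp] = G Go Ga
  define \<epsilon> where "\<epsilon> = \<lparr>NSrc = fct_comp F G, NTgt = fct_id ?T, At = restrict e (Obj ?T)\<rparr>"
  have \<epsilon>: "ntrans \<epsilon>" unfolding \<epsilon>_def by (rule ntransI) simp_all
  define \<eta> where "\<eta> = \<lparr>NSrc = fct_id ?S, NTgt = fct_comp G F, At = (\<lambda>A\<in>Obj ?S. lift A (g (Fob F A)) (d (Fob F A)))\<rparr>"
  have \<eta>l: "lift A (g (Fob F A)) (d (Fob F A)) \<in> Arr ?S" "Dom ?S (lift A (g (Fob F A)) (d (Fob F A))) = A"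
     "Cod ?S (lift A (g (Fob F A)) (d (Fob F A))) = g (Fob F A)" "Far F (lift A (g (Fob F A)) (d (Fob F A))) = d (Fob F A)" if "A \<in> Obj ?S" for A
    using lift[of A "g (Fob F A)" "d (Fob F A)"] that by simp_all
  have \<eta>: "ntrans \<eta>" unfolding \<eta>_def
  proof (rule ntransI)
    fix f assume "f \<in> Arr (Src (fct_id ?S))"
    then have f: "f \<in> Arr ?S" by simp
    show "lift (Cod (Src (fct_id ?S)) f) (g (Fob F (Cod (Src (fct_id ?S)) f))) (d (Fob F (Cod (Src (fct_id ?S)) f))) \<cdot>\<^bsub>Tgt (fct_id ?S)\<^esub> Far (fct_id ?S) f =
         Far (fct_comp G F) f \<cdot>\<^bsub>Tgt (fct_id ?S)\<^esub> lift (Dom (Src (fct_id ?S)) f) (g (Fob F (Dom (Src (fct_id ?S)) f))) (d (Fob F (Dom (Src (fct_id ?S)) f)))"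
      by (rule inj) (use f \<eta>l in simp_all)
  qed (use \<eta>l in simp_all)
  have \<eta>i: "iso ?S (At \<eta> A)" if A: "A \<in> Obj ?S" for A
  proof -
    let ?j = "lift (g (Fob F A)) A (e (Fob F A))"
    have j: "?j \<in> Arr ?S" "Dom ?S ?j = g (Fob F A)" "Cod ?S ?j = A" "Far F ?j = e (Fob F A)"
      using lift[of "g (Fob F A)" A "e (Fob F A)"] A by simp_all
    have "iso ?S (lift A (g (Fob F A)) (d (Fob F A)))"
    proof (rule isoI[of _ _ ?j])
      show "?j \<cdot>\<^bsub>?S\<^esub> lift A (g (Fob F A)) (d (Fob F A)) = Idn ?S (Dom ?S (lift A (g (Fob F A)) (d (Fob F A))))"
        by (rule inj) (use j \<eta>l A in simp_all)
      show "lift A (g (Fob F A)) (d (Fob F A)) \<cdot>\<^bsub>?S\<^esub> ?j = Idn ?S (Cod ?S (lift A (g (Fob F A)) (d (Fob F A))))"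
        by (rule inj) (use j \<eta>l A in simp_all)
    qed (use j \<eta>l A in simp_all)
    then show ?thesis using A by (simp add: \<eta>_def)
  qed
  have "nat_iso (fct_id ?S) (fct_comp G F) \<eta>" using \<eta> \<eta>i by (simp add: nat_iso_def) (simp add: \<eta>_def)
  moreover have "nat_iso (fct_comp F G) (fct_id ?T) \<epsilon>" using \<epsilon> by (simp add: nat_iso_def) (simp add: \<epsilon>_def)
  ultimately show ?thesis unfolding cat_equivalence_def using F G by blast
qed

text \<open>The covariant action of arrows of types on terms that a discrete opfibration encodes.
  With it, statements about lifts become equations between terms.\<close>

definition push where "push M \<Gamma> t f = Cod (Fob (Tm M) \<Gamma>) (oplift (At (Pr M) \<Gamma>) t f)"

lemma oplift:
  assumes "discrete_opfibration P" "e \<in> Obj (Src P)" "f \<in> Arr (Tgt P)" "Dom (Tgt P) f = Fob P e"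
  shows "oplift P e f \<in> Arr (Src P)" "Dom (Src P) (oplift P e f) = e" "Far P (oplift P e f) = f"
  using theI'[OF opfibD[OF assms]] by (simp_all add: oplift_def)

lemma oplift_eq:
  assumes "discrete_opfibration P" "g \<in> Arr (Src P)"
  shows "oplift P (Dom (Src P) g) (Far P g) = g"
proof -
  have f: "fctr P" using assms by (auto simp: discrete_opfibration_def)
  show ?thesis by (rule opfib_inj[OF assms(1)]) (use f oplift[OF assms(1)] assms in simp_all)
qed

lemma push_eq:
  assumes "pre_natural_model M" "\<Gamma> \<in> Obj (UCat M)" "g \<in> Arr (Fob (Tm M) \<Gamma>)" "Dom (Fob (Tm M) \<Gamma>) g = t" "Far (At (Pr M) \<Gamma>) g = f"
  shows "push M \<Gamma> t f = Cod (Fob (Tm M) \<Gamma>) g"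
  using oplift_eq[of "At (Pr M) \<Gamma>" g] assms by (auto simp: push_def)

lemma push:
  assumes "pre_natural_model M" "\<Gamma> \<in> Obj (UCat M)" "t \<in> Obj (Fob (Tm M) \<Gamma>)" "f \<in> Arr (Fob (Tp M) \<Gamma>)" "Dom (Fob (Tp M) \<Gamma>) f = Fob (At (Pr M) \<Gamma>) t"
  obtains g where "g \<in> Arr (Fob (Tm M) \<Gamma>)" "Dom (Fob (Tm M) \<Gamma>) g = t" "Far (At (Pr M) \<Gamma>) g = f" "Cod (Fob (Tm M) \<Gamma>) g = push M \<Gamma> t f"
  using oplift[of "At (Pr M) \<Gamma>" t f] assms by (auto simp: push_def)

lemma push_closed:
  assumes "pre_natural_model M" "\<Gamma> \<in> Obj (UCat M)" "t \<in> Obj (Fob (Tm M) \<Gamma>)" "f \<in> Arr (Fob (Tp M) \<Gamma>)" "Dom (Fob (Tp M) \<Gamma>) f = Fob (At (Pr M) \<Gamma>) t"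
  shows "push M \<Gamma> t f \<in> Obj (Fob (Tm M) \<Gamma>)" "Fob (At (Pr M) \<Gamma>) (push M \<Gamma> t f) = Cod (Fob (Tp M) \<Gamma>) f"
proof -
  obtain g where g: "g \<in> Arr (Fob (Tm M) \<Gamma>)" "Dom (Fob (Tm M) \<Gamma>) g = t" "Far (At (Pr M) \<Gamma>) g = f" "Cod (Fob (Tm M) \<Gamma>) g = push M \<Gamma> t f"
    using push[OF assms] by blast
  have c: "Cod (Fob (Tm M) \<Gamma>) g \<in> Obj (Fob (Tm M) \<Gamma>)" using g(1) assms by simp
  then show "push M \<Gamma> t f \<in> Obj (Fob (Tm M) \<Gamma>)" using g by simp
  have "Fob (At (Pr M) \<Gamma>) (Cod (Fob (Tm M) \<Gamma>) g) = Cod (Fob (Tp M) \<Gamma>) (Far (At (Pr M) \<Gamma>) g)" using g(1) assms by simp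
  then show "Fob (At (Pr M) \<Gamma>) (push M \<Gamma> t f) = Cod (Fob (Tp M) \<Gamma>) f" using g by simp
qed

text \<open>Substitution sends the lift of \<open>f\<close> to an arrow of terms with the required
  domain over the substituted \<open>f\<close>, and by uniqueness of lifts this is the lift
  there.\<close>

lemma push_sub:
  assumes M: "pre_natural_model M" and u: "u \<in> Arr (UCat M)" "Dom (UCat M) u = \<Delta>" "Cod (UCat M) u = \<Gamma>" and t: "t \<in> Obj (Fob (Tm M) \<Gamma>)" "f \<in> Arr (Fob (Tp M) \<Gamma>)" "Dom (Fob (Tp M) \<Gamma>) f = Fob (At (Pr M) \<Gamma>) t"
  shows "push M \<Delta> (Fob (Far (Tm M) u) t) (Far (Far (Tp M) u) f) = Fob (Far (Tm M) u) (push M \<Gamma> t f)"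
proof -
  have G: "\<Gamma> \<in> Obj (UCat M)" "\<Delta> \<in> Obj (UCat M)" using M u by auto
  obtain g where g: "g \<in> Arr (Fob (Tm M) \<Gamma>)" "Dom (Fob (Tm M) \<Gamma>) g = t" "Far (At (Pr M) \<Gamma>) g = f" "Cod (Fob (Tm M) \<Gamma>) g = push M \<Gamma> t f"
    using push[OF M G(1) t] by blast
  have "push M \<Delta> (Fob (Far (Tm M) u) t) (Far (Far (Tp M) u) f) = Cod (Fob (Tm M) \<Delta>) (Far (Far (Tm M) u) g)"
    by (rule push_eq) (use M G u g in simp_all)
  then show ?thesis using g u M by simp
qed

lemma push_comp:
  assumes M: "pre_natural_model M" and G: "\<Gamma> \<in> Obj (UCat M)" and t: "t \<in> Obj (Fob (Tm M) \<Gamma>)" "f \<in> Arr (Fob (Tp M) \<Gamma>)" "Dom (Fob (Tp M) \<Gamma>) f = Fob (At (Pr M) \<Gamma>) t"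
    and h: "h \<in> Arr (Fob (Tp M) \<Gamma>)" "Dom (Fob (Tp M) \<Gamma>) h = Cod (Fob (Tp M) \<Gamma>) f"
  shows "push M \<Gamma> t (h \<cdot>\<^bsub>Fob (Tp M) \<Gamma>\<^esub> f) = push M \<Gamma> (push M \<Gamma> t f) h"
proof -
  obtain g where g: "g \<in> Arr (Fob (Tm M) \<Gamma>)" "Dom (Fob (Tm M) \<Gamma>) g = t" "Far (At (Pr M) \<Gamma>) g = f" "Cod (Fob (Tm M) \<Gamma>) g = push M \<Gamma> t f"
    using push[OF M G t] by blast
  obtain k where k: "k \<in> Arr (Fob (Tm M) \<Gamma>)" "Dom (Fob (Tm M) \<Gamma>) k = push M \<Gamma> t f" "Far (At (Pr M) \<Gamma>) k = h" "Cod (Fob (Tm M) \<Gamma>) k = push M \<Gamma> (push M \<Gamma> t f) h"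
    using push[OF M G push_closed(1)[OF M G t] h(1)] push_closed(2)[OF M G t] h by auto
  have "push M \<Gamma> t (h \<cdot>\<^bsub>Fob (Tp M) \<Gamma>\<^esub> f) = Cod (Fob (Tm M) \<Gamma>) (k \<cdot>\<^bsub>Fob (Tm M) \<Gamma>\<^esub> g)"
    by (rule push_eq) (use M G g k in simp_all)
  then show ?thesis using M G g k by simp
qed

lemma push_idn:
  assumes M: "pre_natural_model M" and G: "\<Gamma> \<in> Obj (UCat M)" and t: "t \<in> Obj (Fob (Tm M) \<Gamma>)" "Fob (At (Pr M) \<Gamma>) t = A"
  shows "push M \<Gamma> t (Idn (Fob (Tp M) \<Gamma>) A) = t"
  using push_eq[OF M G, of "Idn (Fob (Tm M) \<Gamma>) t"] M G t by simp

text \<open>The clause with \<open>oplift\<close> in \<open>ext_map\<close> is a pushforward. So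
  \<open>ext_map M \<Gamma> f\<close> is the arrow into the extension by \<open>B\<close> that
  classifies the generic term of \<open>A\<close> pushed along \<open>f\<close>, and existence is
  representability.\<close>

lemma ext_map:
  assumes M: "pre_natural_model M" and G: "\<Gamma> \<in> Obj (UCat M)" and f: "f \<in> Arr (Fob (Tp M) \<Gamma>)" "Dom (Fob (Tp M) \<Gamma>) f = A" "Cod (Fob (Tp M) \<Gamma>) f = B"
  shows "ext_map M \<Gamma> f \<in> Arr (UCat M)" "Dom (UCat M) (ext_map M \<Gamma> f) = Dom (UCat M) (Pj M \<Gamma> A)" "Cod (UCat M) (ext_map M \<Gamma> f) = Dom (UCat M) (Pj M \<Gamma> B)"
    "Pj M \<Gamma> B \<cdot>\<^bsub>UCat M\<^esub> ext_map M \<Gamma> f = Pj M \<Gamma> A"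
    "Fob (Far (Tm M) (ext_map M \<Gamma> f)) (Vr M \<Gamma> B) = push M (Dom (UCat M) (Pj M \<Gamma> A)) (Vr M \<Gamma> A) (Far (Far (Tp M) (Pj M \<Gamma> A)) f)" (is "_ = ?t")
proof -
  have AB: "A \<in> Obj (Fob (Tp M) \<Gamma>)" "B \<in> Obj (Fob (Tp M) \<Gamma>)" using f M G by auto
  note [simp] = M G f AB
  let ?p = "Pj M \<Gamma> A" let ?E = "Dom (UCat M) ?p"
  have pc: "?t \<in> Obj (Fob (Tm M) ?E)" "Fob (At (Pr M) ?E) ?t = Fob (Far (Tp M) ?p) B"
    using push_closed[of M ?E "Vr M \<Gamma> A" "Far (Far (Tp M) ?p) f"] by simp_all
  have "\<exists>!w. w \<in> Arr (UCat M) \<and> Dom (UCat M) w = ?E \<and> Cod (UCat M) w = Dom (UCat M) (Pj M \<Gamma> B) \<and>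
           Pj M \<Gamma> B \<cdot>\<^bsub>UCat M\<^esub> w = ?p \<and> Fob (Far (Tm M) w) (Vr M \<Gamma> B) = ?t"
    by (rule is_ext_ex1[OF is_ext_chosen]) (use pc in simp_all)
  then have "\<exists>!w. w \<in> hom (UCat M) (ctx_ext M \<Gamma> A) (ctx_ext M \<Gamma> B) \<and>
           Pj M \<Gamma> B \<cdot>\<^bsub>UCat M\<^esub> w = ?p \<and> Fob (Far (Tm M) w) (Vr M \<Gamma> B) = ?t"
    by (simp add: hom_def ctx_ext_def)
  from theI'[OF this]
  show "ext_map M \<Gamma> f \<in> Arr (UCat M)" "Dom (UCat M) (ext_map M \<Gamma> f) = Dom (UCat M) (Pj M \<Gamma> A)" "Cod (UCat M) (ext_map M \<Gamma> f) = Dom (UCat M) (Pj M \<Gamma> B)"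
    "Pj M \<Gamma> B \<cdot>\<^bsub>UCat M\<^esub> ext_map M \<Gamma> f = Pj M \<Gamma> A"
    "Fob (Far (Tm M) (ext_map M \<Gamma> f)) (Vr M \<Gamma> B) = ?t"
    unfolding ext_map_def Let_def f push_def ctx_ext_def by (simp_all add: hom_def)
qed

lemma ext_map_eq:
  assumes M: "pre_natural_model M" and G: "\<Gamma> \<in> Obj (UCat M)" and f: "f \<in> Arr (Fob (Tp M) \<Gamma>)" "Dom (Fob (Tp M) \<Gamma>) f = A" "Cod (Fob (Tp M) \<Gamma>) f = B"
    and h: "h \<in> Arr (UCat M)" "Dom (UCat M) h = Dom (UCat M) (Pj M \<Gamma> A)" "Cod (UCat M) h = Dom (UCat M) (Pj M \<Gamma> B)"
    "Pj M \<Gamma> B \<cdot>\<^bsub>UCat M\<^esub> h = Pj M \<Gamma> A"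
    "Fob (Far (Tm M) h) (Vr M \<Gamma> B) = push M (Dom (UCat M) (Pj M \<Gamma> A)) (Vr M \<Gamma> A) (Far (Far (Tp M) (Pj M \<Gamma> A)) f)"
  shows "ext_map M \<Gamma> f = h"
proof -
  have AB: "A \<in> Obj (Fob (Tp M) \<Gamma>)" "B \<in> Obj (Fob (Tp M) \<Gamma>)" using f M G by auto
  show ?thesis by (rule is_ext_unique[OF M is_ext_chosen[OF M G AB(2)]]) (use ext_map[OF M G f] h in simp_all)
qed

lemma slice_simps:
  "Obj (slice C B) = {p \<in> Arr C. Cod C p = B}"
  "Arr (slice C B) = {(p, q, h). p \<in> Arr C \<and> Cod C p = B \<and> q \<in> Arr C \<and> Cod C q = B \<and>
        h \<in> hom C (Dom C p) (Dom C q) \<and> q \<cdot>\<^bsub>C\<^esub> h = p}"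
  "k \<in> Arr (slice C B) \<Longrightarrow> Dom (slice C B) k = fst k" "k \<in> Arr (slice C B) \<Longrightarrow> Cod (slice C B) k = fst (snd k)"
  "p \<in> Arr C \<Longrightarrow> Cod C p = B \<Longrightarrow> Idn (slice C B) p = (p, p, Idn C (Dom C p))"
  "k \<in> Arr (slice C B) \<Longrightarrow> l \<in> Arr (slice C B) \<Longrightarrow> fst l = fst (snd k) \<Longrightarrow> l \<cdot>\<^bsub>slice C B\<^esub> k = (fst k, fst (snd l), snd (snd l) \<cdot>\<^bsub>C\<^esub> snd (snd k))"
  by (auto simp: slice_def partial_comp_def split: prod.splits)

lemma category_slice [simp]:
  fixes C :: "('a, 'b) cat"
  assumes C: "category C" shows "category (slice C B)"
  unfolding slice_def
proof (rule category_mkcat)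
  let ?A = "{(p, q, h). p \<in> Arr C \<and> Cod C p = B \<and> q \<in> Arr C \<and> Cod C q = B \<and> h \<in> hom C (Dom C p) (Dom C q) \<and> q \<cdot>\<^bsub>C\<^esub> h = p}"
  fix f g assume "f \<in> ?A" "g \<in> ?A" "fst g = (fst \<circ> snd) f"
  then obtain p q r h k where fg: "f = (p, q, h)" "g = (q, r, k)" "p \<in> Arr C" "q \<in> Arr C" "r \<in> Arr C" "Cod C p = B" "Cod C q = B" "Cod C r = B"
    "h \<in> Arr C" "k \<in> Arr C" "Dom C h = Dom C p" "Cod C h = Dom C q" "Dom C k = Dom C q" "Cod C k = Dom C r" "q \<cdot>\<^bsub>C\<^esub> h = p" "r \<cdot>\<^bsub>C\<^esub> k = q"
    by (cases f; cases g) (simp add: hom_def)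
  have "r \<cdot>\<^bsub>C\<^esub> (k \<cdot>\<^bsub>C\<^esub> h) = p" using category.assoc[of C h k r] C fg by simp
  then show "(case g of (q', r, k) \<Rightarrow> \<lambda>(p, q, h). (p, r, k \<cdot>\<^bsub>C\<^esub> h)) f \<in> ?A"
    using C fg(1-14) by (simp add: hom_def)
  fix l assume "l \<in> ?A" "g \<in> ?A" "f \<in> ?A" "fst g = (fst \<circ> snd) f" "fst l = (fst \<circ> snd) g"
  then show "(case (case l of (q', r, k) \<Rightarrow> \<lambda>(p, q, h). (p, r, k \<cdot>\<^bsub>C\<^esub> h)) g of (q', r, k) \<Rightarrow> \<lambda>(p, q, h). (p, r, k \<cdot>\<^bsub>C\<^esub> h)) f
    = (case l of (q', r, k) \<Rightarrow> \<lambda>(p, q, h). (p, r, k \<cdot>\<^bsub>C\<^esub> h)) ((case g of (q', r, k) \<Rightarrow> \<lambda>(p, q, h). (p, r, k \<cdot>\<^bsub>C\<^esub> h)) f)"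
    using C by (cases f; cases g; cases l) (simp add: hom_def)
next
  fix p assume "p \<in> {p \<in> Arr C. Cod C p = B}"
  then show "(p, p, Idn C (Dom C p)) \<in> {(p, q, h). p \<in> Arr C \<and> Cod C p = B \<and> q \<in> Arr C \<and> Cod C q = B \<and> h \<in> hom C (Dom C p) (Dom C q) \<and> q \<cdot>\<^bsub>C\<^esub> h = p}"
    using C by (simp add: hom_def)
next
  fix f assume f: "f \<in> {(p, q, h). p \<in> Arr C \<and> Cod C p = B \<and> q \<in> Arr C \<and> Cod C q = B \<and> h \<in> hom C (Dom C p) (Dom C q) \<and> q \<cdot>\<^bsub>C\<^esub> h = p}"
  obtain p q h where f': "f = (p, q, h)" by (cases f)
  show "fst f \<in> {p \<in> Arr C. Cod C p = B}" using f unfolding f' by simp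
  show "(fst \<circ> snd) f \<in> {p \<in> Arr C. Cod C p = B}" using f unfolding f' by simp
  show "(case ((fst \<circ> snd) f, (fst \<circ> snd) f, Idn C (Dom C ((fst \<circ> snd) f))) of (q', r, k) \<Rightarrow> \<lambda>(p, q, h). (p, r, k \<cdot>\<^bsub>C\<^esub> h)) f = f"
    using f C unfolding f' by (simp add: hom_def)
  show "(case f of (q', r, k) \<Rightarrow> \<lambda>(p, q, h). (p, r, k \<cdot>\<^bsub>C\<^esub> h)) (fst f, fst f, Idn C (Dom C (fst f))) = f"
    using f C unfolding f' by (simp add: hom_def)
next
  fix f g :: "'b \<times> 'b \<times> 'b"
  show "fst ((case g of (q', r, k) \<Rightarrow> \<lambda>(p, q, h). (p, r, k \<cdot>\<^bsub>C\<^esub> h)) f) = fst f"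
    "(fst \<circ> snd) ((case g of (q', r, k) \<Rightarrow> \<lambda>(p, q, h). (p, r, k \<cdot>\<^bsub>C\<^esub> h)) f) = (fst \<circ> snd) g"
    by (cases f; cases g; simp)+
qed simp_all

lemma disp_over_simps:
  assumes "pre_natural_model M"
  shows "p \<in> Obj (disp_over M \<Gamma>) \<longleftrightarrow> p \<in> Disp M \<and> Cod (UCat M) p = \<Gamma>"
    "(p, q, h) \<in> Arr (disp_over M \<Gamma>) \<longleftrightarrow> p \<in> Disp M \<and> q \<in> Disp M \<and> Cod (UCat M) p = \<Gamma> \<and> Cod (UCat M) q = \<Gamma> \<and>
       h \<in> Arr (UCat M) \<and> Dom (UCat M) h = Dom (UCat M) p \<and> Cod (UCat M) h = Dom (UCat M) q \<and> q \<cdot>\<^bsub>UCat M\<^esub> h = p"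
    "k \<in> Arr (disp_over M \<Gamma>) \<Longrightarrow> Dom (disp_over M \<Gamma>) k = fst k"
    "k \<in> Arr (disp_over M \<Gamma>) \<Longrightarrow> Cod (disp_over M \<Gamma>) k = fst (snd k)"
    "p \<in> Obj (disp_over M \<Gamma>) \<Longrightarrow> Idn (disp_over M \<Gamma>) p = (p, p, Idn (UCat M) (Dom (UCat M) p))"
    "k \<in> Arr (disp_over M \<Gamma>) \<Longrightarrow> l \<in> Arr (disp_over M \<Gamma>) \<Longrightarrow> fst l = fst (snd k) \<Longrightarrow>
       l \<cdot>\<^bsub>disp_over M \<Gamma>\<^esub> k = (fst k, fst (snd l), snd (snd l) \<cdot>\<^bsub>UCat M\<^esub> snd (snd k))"
proof -
  note [simp] = assms
  let ?S = "slice (UCat M) \<Gamma>"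
  have A: "k \<in> Arr (disp_over M \<Gamma>) \<longleftrightarrow> k \<in> Arr ?S \<and> fst k \<in> Disp M \<and> fst (snd k) \<in> Disp M" for k
    by (simp add: disp_over_def slice_simps(3,4) cong: conj_cong)
  show "p \<in> Obj (disp_over M \<Gamma>) \<longleftrightarrow> p \<in> Disp M \<and> Cod (UCat M) p = \<Gamma>" for p
    using disp_arr[OF assms, of p] by (auto simp: disp_over_def slice_simps(1))
  show "(p, q, h) \<in> Arr (disp_over M \<Gamma>) \<longleftrightarrow> p \<in> Disp M \<and> q \<in> Disp M \<and> Cod (UCat M) p = \<Gamma> \<and> Cod (UCat M) q = \<Gamma> \<and>
       h \<in> Arr (UCat M) \<and> Dom (UCat M) h = Dom (UCat M) p \<and> Cod (UCat M) h = Dom (UCat M) q \<and> q \<cdot>\<^bsub>UCat M\<^esub> h = p"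
    unfolding A slice_simps(2) hom_def using disp_arr[OF assms, of p] disp_arr[OF assms, of q]
    by (cases "p \<in> Disp M"; cases "q \<in> Disp M"; simp)
  show "Dom (disp_over M \<Gamma>) k = fst k" "Cod (disp_over M \<Gamma>) k = fst (snd k)" if "k \<in> Arr (disp_over M \<Gamma>)" for k
    using that unfolding A by (simp_all add: disp_over_def slice_simps(3,4))
  show "Idn (disp_over M \<Gamma>) p = (p, p, Idn (UCat M) (Dom (UCat M) p))" if "p \<in> Obj (disp_over M \<Gamma>)"
    using that by (simp add: disp_over_def slice_simps(1,5))
  show "l \<cdot>\<^bsub>disp_over M \<Gamma>\<^esub> k = (fst k, fst (snd l), snd (snd l) \<cdot>\<^bsub>UCat M\<^esub> snd (snd k))"
    if "k \<in> Arr (disp_over M \<Gamma>)" "l \<in> Arr (disp_over M \<Gamma>)" "fst l = fst (snd k)"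
    using that unfolding A by (simp add: disp_over_def slice_simps(3,4,6))
qed

text \<open>The inverse of an invertible \<open>h\<close> over the base lies over the base
  automatically: cancel \<open>h\<close> in the triangle of \<open>(p, q, h)\<close>.\<close>

lemma iso_disp_over:
  assumes M: "pre_natural_model M"
  shows "iso (disp_over M \<Gamma>) (p, q, h) \<longleftrightarrow> (p, q, h) \<in> Arr (disp_over M \<Gamma>) \<and> iso (UCat M) h"
proof (cases "(p, q, h) \<in> Arr (disp_over M \<Gamma>)")
  case a: True
  let ?C = "UCat M" let ?D = "disp_over M \<Gamma>"
  have b: "p \<in> Disp M" "q \<in> Disp M" "Cod ?C p = \<Gamma>" "Cod ?C q = \<Gamma>"
       "h \<in> Arr ?C" "Dom ?C h = Dom ?C p" "Cod ?C h = Dom ?C q" "q \<cdot>\<^bsub>?C\<^esub> h = p"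
    using a by (simp_all add: disp_over_simps(2)[OF M])
  have c: "p \<in> Arr ?C" "q \<in> Arr ?C" using b(1,2) M by simp_all
  have pq: "p \<in> Obj ?D" "q \<in> Obj ?D" using b by (simp_all add: disp_over_simps(1)[OF M])
  show ?thesis
  proof
    assume "iso ?D (p, q, h)"
    then obtain k where k: "k \<in> Arr ?D" "Dom ?D k = Cod ?D (p, q, h)" "Cod ?D k = Dom ?D (p, q, h)"
       "k \<cdot>\<^bsub>?D\<^esub> (p,q,h) = Idn ?D (Dom ?D (p, q, h))" "(p,q,h) \<cdot>\<^bsub>?D\<^esub> k = Idn ?D (Cod ?D (p, q, h))"
      by (rule isoE)
    then have k': "fst k = q" "fst (snd k) = p" using a by (simp_all add: disp_over_simps(3,4)[OF M])
    then obtain j where j: "k = (q, p, j)" by (cases k) auto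
    have j': "j \<in> Arr ?C" "Dom ?C j = Dom ?C q" "Cod ?C j = Dom ?C p"
      using k(1) unfolding j by (simp_all add: disp_over_simps(2)[OF M])
    have "j \<cdot>\<^bsub>?C\<^esub> h = Idn ?C (Dom ?C p)" "h \<cdot>\<^bsub>?C\<^esub> j = Idn ?C (Dom ?C q)"
      using k(4,5) a k(1) pq unfolding j by (simp_all add: disp_over_simps(3-6)[OF M])
    then have "iso ?C h" using b(5-7) j' by (intro isoI[of _ _ j]) simp_all
    with a show "(p, q, h) \<in> Arr ?D \<and> iso ?C h" by simp
  next
    assume "(p, q, h) \<in> Arr ?D \<and> iso ?C h"
    then have "iso ?C h" by simp
    then obtain j where j: "j \<in> Arr ?C" "Dom ?C j = Dom ?C q" "Cod ?C j = Dom ?C p"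
      "j \<cdot>\<^bsub>?C\<^esub> h = Idn ?C (Dom ?C p)" "h \<cdot>\<^bsub>?C\<^esub> j = Idn ?C (Dom ?C q)"
      by (rule isoE) (simp add: b(6,7))
    have "p \<cdot>\<^bsub>?C\<^esub> j = (q \<cdot>\<^bsub>?C\<^esub> h) \<cdot>\<^bsub>?C\<^esub> j" by (simp only: b(8))
    also have "\<dots> = q" using j b(5-7) c M by simp
    finally have "(q, p, j) \<in> Arr ?D" using b j by (simp add: disp_over_simps(2)[OF M])
    then show "iso ?D (p, q, h)"
      by (intro isoI[of _ _ "(q, p, j)"]) (use a j pq in \<open>simp_all add: disp_over_simps(3-6)[OF M]\<close>)
  qed
next
  case False
  then show ?thesis by (simp add: iso_def)
qed

lemma comprehension_simps [simp]: "Src (comprehension M \<Gamma>) = Fob (Tp M) \<Gamma>" "Tgt (comprehension M \<Gamma>) = disp_over M \<Gamma>"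
  "A \<in> Obj (Fob (Tp M) \<Gamma>) \<Longrightarrow> Fob (comprehension M \<Gamma>) A = Pj M \<Gamma> A"
  "f \<in> Arr (Fob (Tp M) \<Gamma>) \<Longrightarrow> Far (comprehension M \<Gamma>) f = (Pj M \<Gamma> (Dom (Fob (Tp M) \<Gamma>) f), Pj M \<Gamma> (Cod (Fob (Tp M) \<Gamma>) f), ext_map M \<Gamma> f)"
  by (simp_all add: comprehension_def)

text \<open>An arrow into an extension is determined by its projection and by the term it
  classifies, so functoriality reduces to \<open>push_idn\<close> and
  \<open>push_comp\<close>.\<close>

lemma fctr_comprehension:
  assumes M: "pre_natural_model M" and G: "\<Gamma> \<in> Obj (UCat M)"
  shows "fctr (comprehension M \<Gamma>)"
proof -
  note [simp] = M G
  have a: "(Pj M \<Gamma> (Dom (Fob (Tp M) \<Gamma>) f), Pj M \<Gamma> (Cod (Fob (Tp M) \<Gamma>) f), ext_map M \<Gamma> f) \<in> Arr (disp_over M \<Gamma>)" if f: "f \<in> Arr (Fob (Tp M) \<Gamma>)" for f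
    using ext_map[OF M G f] f by (simp add: disp_over_simps[OF M])
  have o: "Pj M \<Gamma> A \<in> Obj (disp_over M \<Gamma>)" if "A \<in> Obj (Fob (Tp M) \<Gamma>)" for A
    using that by (simp add: disp_over_simps[OF M])
  have i: "ext_map M \<Gamma> (Idn (Fob (Tp M) \<Gamma>) A) = Idn (UCat M) (Dom (UCat M) (Pj M \<Gamma> A))" if "A \<in> Obj (Fob (Tp M) \<Gamma>)" for A
    by (rule ext_map_eq[OF M G, of _ A A]) (use that in \<open>simp_all add: push_idn\<close>)
  have c: "ext_map M \<Gamma> (g \<cdot>\<^bsub>Fob (Tp M) \<Gamma>\<^esub> f) = ext_map M \<Gamma> g \<cdot>\<^bsub>UCat M\<^esub> ext_map M \<Gamma> f"
    if f: "f \<in> Arr (Fob (Tp M) \<Gamma>)" and g: "g \<in> Arr (Fob (Tp M) \<Gamma>)" "Dom (Fob (Tp M) \<Gamma>) g = Cod (Fob (Tp M) \<Gamma>) f" for f g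
  proof -
    let ?A = "Dom (Fob (Tp M) \<Gamma>) f" let ?B = "Cod (Fob (Tp M) \<Gamma>) f" let ?D = "Cod (Fob (Tp M) \<Gamma>) g"
    note ef = ext_map[OF M G f refl refl] and eg = ext_map[OF M G g(1,2) refl]
    let ?p = "Pj M \<Gamma> ?A" let ?q = "Pj M \<Gamma> ?B" let ?r = "Pj M \<Gamma> ?D" let ?v = "Vr M \<Gamma> ?A" let ?x = "Vr M \<Gamma> ?B"
    have sq: "Far (Far (Tp M) (ext_map M \<Gamma> f)) (Far (Far (Tp M) ?q) g) = Far (Far (Tp M) ?p) g"
      using arg_cong[OF ef(4), of "\<lambda>u. Far (Far (Tp M) u) g"] f g ef(1-3) by simp
    \<comment> \<open>The substitution is moved inside the pushforward, where it turns the generic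
      term of \<open>?B\<close> into that of \<open>?A\<close> pushed along \<open>f\<close>; the
      two pushforwards then merge.\<close>
    have "Fob (Far (Tm M) (ext_map M \<Gamma> f)) (push M (Dom (UCat M) ?q) ?x (Far (Far (Tp M) ?q) g))
      = push M (Dom (UCat M) ?p) (Fob (Far (Tm M) (ext_map M \<Gamma> f)) ?x) (Far (Far (Tp M) (ext_map M \<Gamma> f)) (Far (Far (Tp M) ?q) g))"
      by (rule push_sub[symmetric]) (use f g ef(1-3) in simp_all)
    also have "\<dots> = push M (Dom (UCat M) ?p) (push M (Dom (UCat M) ?p) ?v (Far (Far (Tp M) ?p) f)) (Far (Far (Tp M) ?p) g)"
      by (simp add: sq ef(5))
    also have "\<dots> = push M (Dom (UCat M) ?p) ?v (Far (Far (Tp M) ?p) (g \<cdot>\<^bsub>Fob (Tp M) \<Gamma>\<^esub> f))"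
      using push_comp[of M "Dom (UCat M) ?p" ?v "Far (Far (Tp M) ?p) f" "Far (Far (Tp M) ?p) g"] f g by simp
    finally have e: "Fob (Far (Tm M) (ext_map M \<Gamma> f)) (push M (Dom (UCat M) ?q) ?x (Far (Far (Tp M) ?q) g)) = \<dots>" .
    have r: "?r \<cdot>\<^bsub>UCat M\<^esub> (ext_map M \<Gamma> g \<cdot>\<^bsub>UCat M\<^esub> ext_map M \<Gamma> f) = ?p"
      using category.assoc[of "UCat M" "ext_map M \<Gamma> f" "ext_map M \<Gamma> g" ?r] f g ef(1-4) eg(1-4) by simp
    show ?thesis
      by (rule ext_map_eq[OF M G, of _ ?A ?D]) (use f g ef eg r e in simp_all)
  qed
  show ?thesis
    unfolding comprehension_def
  proof (rule fctrI)
    fix f g assume fg: "f \<in> Arr (Fob (Tp M) \<Gamma>)" "g \<in> Arr (Fob (Tp M) \<Gamma>)" "Dom (Fob (Tp M) \<Gamma>) g = Cod (Fob (Tp M) \<Gamma>) f"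
    then show "(Pj M \<Gamma> (Dom (Fob (Tp M) \<Gamma>) (g \<cdot>\<^bsub>Fob (Tp M) \<Gamma>\<^esub> f)), Pj M \<Gamma> (Cod (Fob (Tp M) \<Gamma>) (g \<cdot>\<^bsub>Fob (Tp M) \<Gamma>\<^esub> f)), ext_map M \<Gamma> (g \<cdot>\<^bsub>Fob (Tp M) \<Gamma>\<^esub> f))
      = (Pj M \<Gamma> (Dom (Fob (Tp M) \<Gamma>) g), Pj M \<Gamma> (Cod (Fob (Tp M) \<Gamma>) g), ext_map M \<Gamma> g) \<cdot>\<^bsub>disp_over M \<Gamma>\<^esub>
        (Pj M \<Gamma> (Dom (Fob (Tp M) \<Gamma>) f), Pj M \<Gamma> (Cod (Fob (Tp M) \<Gamma>) f), ext_map M \<Gamma> f)"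
      using a[OF fg(1)] a[OF fg(2)] by (simp add: disp_over_simps(6)[OF M] c)
  next
    show "category (disp_over M \<Gamma>)" unfolding disp_over_def by simp
  qed (use a o in \<open>simp_all add: disp_over_simps(3-5)[OF M] i\<close>)
qed

text \<open>By representability, arrows over \<open>\<Gamma>\<close> from the extension by
  \<open>A\<close> to that by \<open>B\<close> are terms of type \<open>B\<close> over the extension
  by \<open>A\<close>. Full faithfulness of comprehension therefore says that pushing the generic
  term is a bijection from arrows \<open>A\<close> to \<open>B\<close> onto such terms; essential
  surjectivity says that every display is an extension.\<close>

lemma natural_modelI:
  assumes M: "pre_natural_model M"
    and ff: "\<And>\<Gamma> A B t. \<Gamma> \<in> Obj (UCat M) \<Longrightarrow> A \<in> Obj (Fob (Tp M) \<Gamma>) \<Longrightarrow> B \<in> Obj (Fob (Tp M) \<Gamma>) \<Longrightarrow>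
      t \<in> Obj (Fob (Tm M) (Dom (UCat M) (Pj M \<Gamma> A))) \<Longrightarrow>
      Fob (At (Pr M) (Dom (UCat M) (Pj M \<Gamma> A))) t = Fob (Far (Tp M) (Pj M \<Gamma> A)) B \<Longrightarrow>
      \<exists>!f. f \<in> Arr (Fob (Tp M) \<Gamma>) \<and> Dom (Fob (Tp M) \<Gamma>) f = A \<and> Cod (Fob (Tp M) \<Gamma>) f = B \<and>
        push M (Dom (UCat M) (Pj M \<Gamma> A)) (Vr M \<Gamma> A) (Far (Far (Tp M) (Pj M \<Gamma> A)) f) = t"
    and es: "\<And>p. p \<in> Disp M \<Longrightarrow> \<exists>A v. is_ext M A p v"
  shows "natural_model M"
proof (intro natural_model.intro natural_model_axioms.intro M)
  fix \<Gamma> assume G: "\<Gamma> \<in> Obj (UCat M)"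
  note [simp] = M G
  show "cat_equivalence (comprehension M \<Gamma>)"
  proof (rule cat_equivalenceI[OF fctr_comprehension[OF M G]]; unfold comprehension_simps(1,2))
    fix A B g assume A: "A \<in> Obj (Fob (Tp M) \<Gamma>)" and B: "B \<in> Obj (Fob (Tp M) \<Gamma>)" and g: "g \<in> Arr (disp_over M \<Gamma>)"
      "Dom (disp_over M \<Gamma>) g = Fob (comprehension M \<Gamma>) A" "Cod (disp_over M \<Gamma>) g = Fob (comprehension M \<Gamma>) B"
    let ?p = "Pj M \<Gamma> A" let ?q = "Pj M \<Gamma> B"
    obtain h where h: "g = (?p, ?q, h)" using g A B by (cases g) (simp add: disp_over_simps(3,4)[OF M])
    then have h': "h \<in> Arr (UCat M)" "Dom (UCat M) h = Dom (UCat M) ?p" "Cod (UCat M) h = Dom (UCat M) ?q" "?q \<cdot>\<^bsub>UCat M\<^esub> h = ?p"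
      using g by (simp_all add: disp_over_simps(2)[OF M])
    let ?t = "Fob (Far (Tm M) h) (Vr M \<Gamma> B)"
    have "\<exists>!f. f \<in> Arr (Fob (Tp M) \<Gamma>) \<and> Dom (Fob (Tp M) \<Gamma>) f = A \<and> Cod (Fob (Tp M) \<Gamma>) f = B \<and>
        push M (Dom (UCat M) ?p) (Vr M \<Gamma> A) (Far (Far (Tp M) ?p) f) = ?t"
    proof (rule ff[OF G A B])
      show "Fob (At (Pr M) (Dom (UCat M) ?p)) ?t = Fob (Far (Tp M) ?p) B"
        using arg_cong[OF h'(4), of "\<lambda>u. Fob (Far (Tp M) u) B"] h'(1-3) A B by simp
    qed (use h' A B in simp_all)
    moreover have "push M (Dom (UCat M) ?p) (Vr M \<Gamma> A) (Far (Far (Tp M) ?p) f) = ?t \<longleftrightarrow> Far (comprehension M \<Gamma>) f = g"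
      if f: "f \<in> Arr (Fob (Tp M) \<Gamma>)" "Dom (Fob (Tp M) \<Gamma>) f = A" "Cod (Fob (Tp M) \<Gamma>) f = B" for f
      using ext_map_eq[OF M G f h'] ext_map(5)[OF M G f] f h by auto
    ultimately show "\<exists>!f. f \<in> Arr (Fob (Tp M) \<Gamma>) \<and> Dom (Fob (Tp M) \<Gamma>) f = A \<and> Cod (Fob (Tp M) \<Gamma>) f = B \<and> Far (comprehension M \<Gamma>) f = g"
      by metis
  next
    fix p assume "p \<in> Obj (disp_over M \<Gamma>)"
    then have p: "p \<in> Disp M" "Cod (UCat M) p = \<Gamma>" by (simp_all add: disp_over_simps(1)[OF M])
    obtain A v where e: "is_ext M A p v" using es[OF p(1)] by blast
    have A: "A \<in> Obj (Fob (Tp M) \<Gamma>)" using is_extD(2)[OF e] p by simp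
    have c: "Cod (UCat M) p = Cod (UCat M) (Pj M \<Gamma> A)" using p A by simp
    obtain i where i: "iso (UCat M) i" "Dom (UCat M) i = Dom (UCat M) (Pj M \<Gamma> A)" "Cod (UCat M) i = Dom (UCat M) p" "p \<cdot>\<^bsub>UCat M\<^esub> i = Pj M \<Gamma> A"
      by (rule is_ext_compare[OF M e is_ext_chosen[OF M G A] c])
    then have a: "(Pj M \<Gamma> A, p, i) \<in> Arr (disp_over M \<Gamma>)" using p A by (simp add: disp_over_simps[OF M] iso_def)
    then have "iso (disp_over M \<Gamma>) (Pj M \<Gamma> A, p, i)" using i by (simp add: iso_disp_over[OF M])
    then show "\<exists>A i. A \<in> Obj (Fob (Tp M) \<Gamma>) \<and> iso (disp_over M \<Gamma>) i \<and> Dom (disp_over M \<Gamma>) i = Fob (comprehension M \<Gamma>) A \<and> Cod (disp_over M \<Gamma>) i = p"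
      using A a by (intro exI[of _ A] exI[of _ "(Pj M \<Gamma> A, p, i)"]) (simp add: disp_over_simps(3,4)[OF M])
  qed
qed

text \<open>The converse reading: the arrow \<open>h\<close> classified by \<open>t\<close> is an
  arrow of displays, and its unique preimage under comprehension is the arrow of types
  sought.\<close>

lemma natural_model_ff_chosen:
  assumes M: "natural_model M" and G: "\<Gamma> \<in> Obj (UCat M)" and A: "A \<in> Obj (Fob (Tp M) \<Gamma>)" and B: "B \<in> Obj (Fob (Tp M) \<Gamma>)"
    and t: "t \<in> Obj (Fob (Tm M) (Dom (UCat M) (Pj M \<Gamma> A)))" "Fob (At (Pr M) (Dom (UCat M) (Pj M \<Gamma> A))) t = Fob (Far (Tp M) (Pj M \<Gamma> A)) B"
  shows "\<exists>!f. f \<in> Arr (Fob (Tp M) \<Gamma>) \<and> Dom (Fob (Tp M) \<Gamma>) f = A \<and> Cod (Fob (Tp M) \<Gamma>) f = B \<and>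
        push M (Dom (UCat M) (Pj M \<Gamma> A)) (Vr M \<Gamma> A) (Far (Far (Tp M) (Pj M \<Gamma> A)) f) = t"
proof -
  note [simp] = M G A B
  have M': "pre_natural_model M" by simp
  let ?p = "Pj M \<Gamma> A" let ?q = "Pj M \<Gamma> B"
  obtain h where h: "h \<in> Arr (UCat M)" "Dom (UCat M) h = Dom (UCat M) ?p" "Cod (UCat M) h = Dom (UCat M) ?q" "?q \<cdot>\<^bsub>UCat M\<^esub> h = ?p"
     "Fob (Far (Tm M) h) (Vr M \<Gamma> B) = t"
    by (rule is_ext_obtain[OF is_ext_chosen[OF M' G B], of ?p t]) (use t in simp_all)
  have a: "(?p, ?q, h) \<in> Arr (disp_over M \<Gamma>)" using h by (simp add: disp_over_simps[OF M'])
  have "\<exists>!f. f \<in> Arr (Fob (Tp M) \<Gamma>) \<and> Dom (Fob (Tp M) \<Gamma>) f = A \<and> Cod (Fob (Tp M) \<Gamma>) f = B \<and> Far (comprehension M \<Gamma>) f = (?p, ?q, h)"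
    using equiv_ff[OF natural_model.comprehension_equiv[OF M G], of A B "(?p,?q,h)"] a by (simp add: disp_over_simps(3,4)[OF M'])
  moreover have "push M (Dom (UCat M) ?p) (Vr M \<Gamma> A) (Far (Far (Tp M) ?p) f) = t \<longleftrightarrow> Far (comprehension M \<Gamma>) f = (?p, ?q, h)"
    if f: "f \<in> Arr (Fob (Tp M) \<Gamma>)" "Dom (Fob (Tp M) \<Gamma>) f = A" "Cod (Fob (Tp M) \<Gamma>) f = B" for f
    using ext_map_eq[OF M' G f h(1-4)] ext_map(5)[OF M' G f] f h(5) by auto
  ultimately show ?thesis by metis
qed

lemma natural_model_es:
  assumes M: "natural_model M" and p: "p \<in> Disp M"
  obtains A v where "is_ext M A p v"
proof -
  note [simp] = M
  have M': "pre_natural_model M" by simp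
  let ?\<Gamma> = "Cod (UCat M) p"
  have G: "?\<Gamma> \<in> Obj (UCat M)" using p by simp
  have o: "p \<in> Obj (Tgt (comprehension M ?\<Gamma>))" using p by (simp add: disp_over_simps[OF M'])
  obtain A i where A: "A \<in> Obj (Fob (Tp M) ?\<Gamma>)" and i: "iso (disp_over M ?\<Gamma>) i" "Dom (disp_over M ?\<Gamma>) i = Pj M ?\<Gamma> A" "Cod (disp_over M ?\<Gamma>) i = p"
    by (rule equiv_es[OF natural_model.comprehension_equiv[OF M G] o]) (unfold comprehension_simps(1,2), simp)
  have ia: "i \<in> Arr (disp_over M ?\<Gamma>)" using i by (simp add: iso_def)
  obtain h where h: "i = (Pj M ?\<Gamma> A, p, h)" using i(2,3) ia by (cases i) (simp add: disp_over_simps(3,4)[OF M'])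
  have h': "h \<in> Arr (UCat M)" "Dom (UCat M) h = Dom (UCat M) (Pj M ?\<Gamma> A)" "Cod (UCat M) h = Dom (UCat M) p" "p \<cdot>\<^bsub>UCat M\<^esub> h = Pj M ?\<Gamma> A" "iso (UCat M) h"
    using i(1) ia unfolding h by (simp_all add: iso_disp_over[OF M'] disp_over_simps[OF M'])
  obtain j where j: "j \<in> Arr (UCat M)" "Dom (UCat M) j = Dom (UCat M) p" "Cod (UCat M) j = Dom (UCat M) (Pj M ?\<Gamma> A)"
    "h \<cdot>\<^bsub>UCat M\<^esub> j = Idn (UCat M) (Dom (UCat M) p)" "iso (UCat M) j"
    using h'(5) by (rule isoE) (use h' in simp)
  have "Pj M ?\<Gamma> A \<cdot>\<^bsub>UCat M\<^esub> j = p" unfolding h'(4)[symmetric] using h'(1-3) j p by simp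
  then show thesis using is_ext_iso[OF M' is_ext_chosen[OF M' G A] j(5,3)] that by simp
qed

text \<open>Extensions arising as images or lifts are not the chosen ones. The comparison
  isomorphism \<open>i\<close> transports the chosen case: substitution along it is a bijection on
  terms and commutes with \<open>push\<close>.\<close>

lemma natural_model_ff:
  assumes M: "natural_model M" and e: "is_ext M A \<pi> v" and E: "Dom (UCat M) \<pi> = E" "Cod (UCat M) \<pi> = \<Gamma>" and B: "B \<in> Obj (Fob (Tp M) \<Gamma>)"
    and t: "t \<in> Obj (Fob (Tm M) E)" "Fob (At (Pr M) E) t = Fob (Far (Tp M) \<pi>) B"
  shows "\<exists>!f. f \<in> Arr (Fob (Tp M) \<Gamma>) \<and> Dom (Fob (Tp M) \<Gamma>) f = A \<and> Cod (Fob (Tp M) \<Gamma>) f = B \<and>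
        push M E v (Far (Far (Tp M) \<pi>) f) = t"
proof -
  note [simp] = M B is_extD[OF e]
  have M': "pre_natural_model M" by simp
  have G: "\<Gamma> \<in> Obj (UCat M)" "E \<in> Obj (UCat M)" and A: "A \<in> Obj (Fob (Tp M) \<Gamma>)" and v: "v \<in> Obj (Fob (Tm M) E)"
    using E category.cod_closed[of "UCat M" \<pi>] category.dom_closed[of "UCat M" \<pi>] is_extD[OF e] by auto
  note [simp] = E G A v
  let ?p = "Pj M \<Gamma> A" let ?x = "Vr M \<Gamma> A" let ?E = "Dom (UCat M) ?p"
  obtain i where i: "iso (UCat M) i" "Dom (UCat M) i = E" "Cod (UCat M) i = ?E" "?p \<cdot>\<^bsub>UCat M\<^esub> i = \<pi>" "Fob (Far (Tm M) i) ?x = v"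
    using is_ext_compare[OF M' is_ext_chosen[OF M' G(1) A] e] E A by auto
  obtain j where j: "i \<in> Arr (UCat M)" "j \<in> Arr (UCat M)" "Dom (UCat M) j = ?E" "Cod (UCat M) j = E"
    "j \<cdot>\<^bsub>UCat M\<^esub> i = Idn (UCat M) E" "i \<cdot>\<^bsub>UCat M\<^esub> j = Idn (UCat M) ?E"
    using i(1) by (rule isoE) (use i in simp)
  have pj: "\<pi> \<cdot>\<^bsub>UCat M\<^esub> j = ?p" unfolding i(4)[symmetric] using i(2,3) j by simp
  have inv: "Fob (Far (Tm M) i) (Fob (Far (Tm M) j) s) = s" if "s \<in> Obj (Fob (Tm M) E)" for s
    using arg_cong[OF j(5), of "\<lambda>u. Fob (Far (Tm M) u) s"] that i(2,3) j(1-4) by simp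
  have inv': "Fob (Far (Tm M) j) (Fob (Far (Tm M) i) s) = s" if "s \<in> Obj (Fob (Tm M) ?E)" for s
    using arg_cong[OF j(6), of "\<lambda>u. Fob (Far (Tm M) u) s"] that i(2,3) j(1-4) by simp
  let ?t = "Fob (Far (Tm M) j) t"
  have "\<exists>!f. f \<in> Arr (Fob (Tp M) \<Gamma>) \<and> Dom (Fob (Tp M) \<Gamma>) f = A \<and> Cod (Fob (Tp M) \<Gamma>) f = B \<and>
        push M ?E ?x (Far (Far (Tp M) ?p) f) = ?t"
  proof (rule natural_model_ff_chosen[OF M G(1) A B])
    show "Fob (At (Pr M) ?E) ?t = Fob (Far (Tp M) ?p) B"
      using arg_cong[OF pj, of "\<lambda>u. Fob (Far (Tp M) u) B"] j(1-4) t by simp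
  qed (use j t in simp_all)
  moreover have "push M E v (Far (Far (Tp M) \<pi>) f) = t \<longleftrightarrow> push M ?E ?x (Far (Far (Tp M) ?p) f) = ?t"
    if f: "f \<in> Arr (Fob (Tp M) \<Gamma>)" "Dom (Fob (Tp M) \<Gamma>) f = A" "Cod (Fob (Tp M) \<Gamma>) f = B" for f
  proof -
    have "Far (Far (Tp M) i) (Far (Far (Tp M) ?p) f) = Far (Far (Tp M) \<pi>) f"
      using arg_cong[OF i(4), of "\<lambda>u. Far (Far (Tp M) u) f"] f i(2,3) j(1) by simp
    then have 1: "push M E v (Far (Far (Tp M) \<pi>) f) = Fob (Far (Tm M) i) (push M ?E ?x (Far (Far (Tp M) ?p) f))"
      using push_sub[OF M' j(1) i(2,3), of ?x "Far (Far (Tp M) ?p) f"] f i(5) by simp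
    have 2: "push M ?E ?x (Far (Far (Tp M) ?p) f) \<in> Obj (Fob (Tm M) ?E)"
      by (rule push_closed) (use f in simp_all)
    show ?thesis unfolding 1 using inv[OF t(1)] inv'[OF 2] by metis
  qed
  ultimately show ?thesis by metis
qed

section \<open>Comonads on the fibres over coalgebras\<close>

lemma comonad_map:
  assumes K: "strict_2_category K" and L: "strict_2_category L" and \<Phi>: "strict_2_functor K L \<Phi>" and W: "comonad K W"
  shows "comonad L (map_comonad \<Phi> W)"
proof -
  interpret K: strict_2_category K by fact
  interpret L: strict_2_category L by fact
  interpret F: strict_2_functor K L \<Phi> by fact
  note [simp] = K.comonad_simps[OF W]
  have e: "F1 \<Phi> (Endo W) \<in> Arr (One L)" "Dom (One L) (F1 \<Phi> (Endo W)) = F0 \<Phi> (Base W)" "Cod (One L) (F1 \<Phi> (Endo W)) = F0 \<Phi> (Base W)"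
    using F.f1[of "Endo W"] by (auto simp: hom_def)
  have e': "F2 \<Phi> (Idn (Two K) (Endo W)) = Idn (Two L) (F1 \<Phi> (Endo W))" using F.f2_idn[of "Endo W"] by simp
  have c: "F2 \<Phi> (Counit W) \<in> Arr (Two L)" "Dom (Two L) (F2 \<Phi> (Counit W)) = F1 \<Phi> (Endo W)" "Cod (Two L) (F2 \<Phi> (Counit W)) = Idn (One L) (F0 \<Phi> (Base W))"
    using F.f2[of "Counit W"] F.f1_idn[of "Base W"] by (auto simp: hom_def)
  have d: "F2 \<Phi> (Comult W) \<in> Arr (Two L)" "Dom (Two L) (F2 \<Phi> (Comult W)) = F1 \<Phi> (Endo W)" "Cod (Two L) (F2 \<Phi> (Comult W)) = F1 \<Phi> (Endo W) \<cdot>\<^bsub>One L\<^esub> F1 \<Phi> (Endo W)"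
    using F.f2[of "Comult W"] F.f1_cmp[of "Endo W" "Endo W"] by (auto simp: hom_def)
  let ?E = "Idn (Two K) (Endo W)"
  have s: "F2 \<Phi> (Counit W \<star>\<^bsub>K\<^esub> ?E) = F2 \<Phi> (Counit W) \<star>\<^bsub>L\<^esub> F2 \<Phi> ?E" "F2 \<Phi> (?E \<star>\<^bsub>K\<^esub> Counit W) = F2 \<Phi> ?E \<star>\<^bsub>L\<^esub> F2 \<Phi> (Counit W)"
    "F2 \<Phi> (Comult W \<star>\<^bsub>K\<^esub> ?E) = F2 \<Phi> (Comult W) \<star>\<^bsub>L\<^esub> F2 \<Phi> ?E" "F2 \<Phi> (?E \<star>\<^bsub>K\<^esub> Comult W) = F2 \<Phi> ?E \<star>\<^bsub>L\<^esub> F2 \<Phi> (Comult W)"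
    by (rule F.f2_hcmp; simp)+
  have v: "F2 \<Phi> ((Counit W \<star>\<^bsub>K\<^esub> ?E) \<cdot>\<^bsub>Two K\<^esub> Comult W) = F2 \<Phi> (Counit W \<star>\<^bsub>K\<^esub> ?E) \<cdot>\<^bsub>Two L\<^esub> F2 \<Phi> (Comult W)"
    "F2 \<Phi> ((?E \<star>\<^bsub>K\<^esub> Counit W) \<cdot>\<^bsub>Two K\<^esub> Comult W) = F2 \<Phi> (?E \<star>\<^bsub>K\<^esub> Counit W) \<cdot>\<^bsub>Two L\<^esub> F2 \<Phi> (Comult W)"
    "F2 \<Phi> ((Comult W \<star>\<^bsub>K\<^esub> ?E) \<cdot>\<^bsub>Two K\<^esub> Comult W) = F2 \<Phi> (Comult W \<star>\<^bsub>K\<^esub> ?E) \<cdot>\<^bsub>Two L\<^esub> F2 \<Phi> (Comult W)"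
    "F2 \<Phi> ((?E \<star>\<^bsub>K\<^esub> Comult W) \<cdot>\<^bsub>Two K\<^esub> Comult W) = F2 \<Phi> (?E \<star>\<^bsub>K\<^esub> Comult W) \<cdot>\<^bsub>Two L\<^esub> F2 \<Phi> (Comult W)"
    by (rule F.f2_cmp; simp)+
  note l = comonad.counit_left[OF W] comonad.counit_right[OF W] comonad.coassoc[OF W]
  show ?thesis
    using e e' c d s v l[unfolded rwhisker_def lwhisker_def]
    by (intro comonad.intro) (simp_all add: map_comonad_def hom_def rwhisker_def lwhisker_def F.f0)
qed

text \<open>The coalgebra laws for \<open>s\<close> are equations between arrows out of
  \<open>t\<close>. Their images under \<open>G\<close> are the laws of \<open>X\<close>, and a
  discrete opfibration reflects equality of arrows with a common domain.\<close>

lemma opfib_coalg: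
  assumes W: "comonad CAT W" and V: "comonad CAT V" and G: "strict_comonad_map W V G" and op: "discrete_opfibration G"
    and X: "X \<in> Obj (EM V)" and t: "t \<in> Obj (Base W)" "Fob G t = Fob (EM_forget V) X"
    and s: "s \<in> Arr (Base W)" "Dom (Base W) s = t" "Cod (Base W) s = Fob (Endo W) t" "Far G s = At (EM_co V) X"
  shows "Tup t s \<in> Obj (EM W)" "Fob (EM_map W V G) (Tup t s) = X"
proof -
  have g: "fctr G" "Src G = Base W" "Tgt G = Base V"
    "\<And>A. A\<in>Obj (Base W) \<Longrightarrow> Far G (At (Counit W) A) = At (Counit V) (Fob G A)"
    "\<And>A. A\<in>Obj (Base W) \<Longrightarrow> Far G (At (Comult W) A) = At (Comult V) (Fob G A)"
    using G by (auto simp: strict_comonad_map_def)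
  note p = strict_comonad_map_pointwise[OF G _ W]
  note l = EM_coalg[OF X]
  show o: "Tup t s \<in> Obj (EM W)"
  proof (rule EM_objI)
    show "At (Counit W) t \<cdot>\<^bsub>Base W\<^esub> s = Idn (Base W) t"
      by (rule opfib_id[OF op]) (use t s X W V g l in simp_all)
    show "At (Comult W) t \<cdot>\<^bsub>Base W\<^esub> s = Far (Endo W) s \<cdot>\<^bsub>Base W\<^esub> s"
      by (rule opfib_inj[OF op]) (use t s X W V g l p in simp_all)
  qed (use t s W in simp_all)
  show "Fob (EM_map W V G) (Tup t s) = X"
    by (rule EM_obj_eqI[of _ V]) (use W V G o X s t in simp_all)
qed

text \<open>The structure maps of \<open>X\<close> and \<open>Y\<close> start at the same object and
  lie over the same arrow, so they coincide. Equality of term coalgebras can thus be tested on the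
  term and on the type coalgebra below it.\<close>

lemma opfib_coalg_inj:
  assumes W: "comonad CAT W" and V: "comonad CAT V" and G: "strict_comonad_map W V G" and op: "discrete_opfibration G"
    and X: "X \<in> Obj (EM W)" "Y \<in> Obj (EM W)" "Fob (EM_forget W) X = Fob (EM_forget W) Y" "Fob (EM_map W V G) X = Fob (EM_map W V G) Y"
  shows "X = Y"
proof -
  have g: "fctr G" "Src G = Base W" "Tgt G = Base V" using G by (auto simp: strict_comonad_map_def)
  have "At (EM_co W) X = At (EM_co W) Y"
    by (rule opfib_inj[OF op]) (use W V G X g EM_map_simps(5)[OF G W V X(1)] EM_map_simps(5)[OF G W V X(2)] in simp_all)
  then show ?thesis by (intro EM_obj_eqI[OF X(1-3)])
qed

section \<open>Pullbacks and their uniqueness\<close>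

lemma pullbackD:
  assumes "pullback C p f p' q"
  shows "p \<in> Arr C" "f \<in> Arr C" "p' \<in> Arr C" "q \<in> Arr C" "Cod C f = Cod C p" "Cod C p' = Dom C f" "Cod C q = Dom C p" "Dom C q = Dom C p'"
    "p \<cdot>\<^bsub>C\<^esub> q = f \<cdot>\<^bsub>C\<^esub> p'"
  using assms by (simp_all add: pullback_def)

lemma pullback_ex1:
  assumes "pullback C p f p' q" "a \<in> Arr C" "b \<in> Arr C" "Cod C a = Dom C f" "Cod C b = Dom C p" "Dom C a = Dom C b" "p \<cdot>\<^bsub>C\<^esub> b = f \<cdot>\<^bsub>C\<^esub> a"
  shows "\<exists>!w. w \<in> Arr C \<and> Dom C w = Dom C a \<and> Cod C w = Dom C p' \<and> p' \<cdot>\<^bsub>C\<^esub> w = a \<and> q \<cdot>\<^bsub>C\<^esub> w = b"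
proof -
  have "\<exists>!w. w \<in> hom C (Dom C a) (Dom C p') \<and> p' \<cdot>\<^bsub>C\<^esub> w = a \<and> q \<cdot>\<^bsub>C\<^esub> w = b"
    using assms unfolding pullback_def by blast
  then show ?thesis by (simp add: hom_def)
qed

lemma pullback_obtain:
  assumes "pullback C p f p' q" "a \<in> Arr C" "b \<in> Arr C" "Cod C a = Dom C f" "Cod C b = Dom C p" "Dom C a = Dom C b" "p \<cdot>\<^bsub>C\<^esub> b = f \<cdot>\<^bsub>C\<^esub> a"
  obtains w where "w \<in> Arr C" "Dom C w = Dom C a" "Cod C w = Dom C p'" "p' \<cdot>\<^bsub>C\<^esub> w = a" "q \<cdot>\<^bsub>C\<^esub> w = b"
  using pullback_ex1[OF assms] by blast

lemma pullback_unique: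
  assumes C: "category C" and pb: "pullback C p f p' q"
    and w: "w \<in> Arr C" "w' \<in> Arr C" "Dom C w = Dom C w'" "Cod C w = Dom C p'" "Cod C w' = Dom C p'"
      "p' \<cdot>\<^bsub>C\<^esub> w = p' \<cdot>\<^bsub>C\<^esub> w'" "q \<cdot>\<^bsub>C\<^esub> w = q \<cdot>\<^bsub>C\<^esub> w'"
  shows "w = w'"
proof -
  note d = pullbackD[OF pb]
  have e: "p \<cdot>\<^bsub>C\<^esub> (q \<cdot>\<^bsub>C\<^esub> w') = f \<cdot>\<^bsub>C\<^esub> (p' \<cdot>\<^bsub>C\<^esub> w')"
    by (rule cmp_cong_left[OF C d(9)]) (use d(1-8) w(1-5) in simp_all)
  have "\<exists>!x. x \<in> Arr C \<and> Dom C x = Dom C (p' \<cdot>\<^bsub>C\<^esub> w') \<and> Cod C x = Dom C p' \<and> p' \<cdot>\<^bsub>C\<^esub> x = p' \<cdot>\<^bsub>C\<^esub> w' \<and> q \<cdot>\<^bsub>C\<^esub> x = q \<cdot>\<^bsub>C\<^esub> w'"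
    by (rule pullback_ex1[OF pb]) (use C d(1-8) w(1-5) e in simp_all)
  moreover have "Dom C (p' \<cdot>\<^bsub>C\<^esub> w') = Dom C w'" using C d(1-8) w(1-5) by simp
  ultimately show ?thesis using w by auto
qed

lemma pullbackI:
  assumes "p \<in> Arr C" "f \<in> Arr C" "p' \<in> Arr C" "q \<in> Arr C" "Cod C f = Cod C p" "Cod C p' = Dom C f" "Cod C q = Dom C p" "Dom C q = Dom C p'"
    "p \<cdot>\<^bsub>C\<^esub> q = f \<cdot>\<^bsub>C\<^esub> p'"
    and ex: "\<And>a b. a \<in> Arr C \<Longrightarrow> b \<in> Arr C \<Longrightarrow> Cod C a = Dom C f \<Longrightarrow> Cod C b = Dom C p \<Longrightarrow> Dom C a = Dom C b \<Longrightarrow> p \<cdot>\<^bsub>C\<^esub> b = f \<cdot>\<^bsub>C\<^esub> a \<Longrightarrow>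
      \<exists>w. w \<in> Arr C \<and> Dom C w = Dom C a \<and> Cod C w = Dom C p' \<and> p' \<cdot>\<^bsub>C\<^esub> w = a \<and> q \<cdot>\<^bsub>C\<^esub> w = b"
    and un: "\<And>w w'. w \<in> Arr C \<Longrightarrow> w' \<in> Arr C \<Longrightarrow> Dom C w = Dom C w' \<Longrightarrow> Cod C w = Dom C p' \<Longrightarrow> Cod C w' = Dom C p' \<Longrightarrow>
      p' \<cdot>\<^bsub>C\<^esub> w = p' \<cdot>\<^bsub>C\<^esub> w' \<Longrightarrow> q \<cdot>\<^bsub>C\<^esub> w = q \<cdot>\<^bsub>C\<^esub> w' \<Longrightarrow> w = w'"
  shows "pullback C p f p' q"
proof -
  have "\<exists>!w. w \<in> hom C (Dom C a) (Dom C p') \<and> p' \<cdot>\<^bsub>C\<^esub> w = a \<and> q \<cdot>\<^bsub>C\<^esub> w = b"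
    if "a \<in> Arr C" "b \<in> Arr C" "Cod C a = Dom C f" "Cod C b = Dom C p" "Dom C a = Dom C b" "p \<cdot>\<^bsub>C\<^esub> b = f \<cdot>\<^bsub>C\<^esub> a" for a b
  proof -
    from ex[OF that] obtain w where w: "w \<in> Arr C" "Dom C w = Dom C a" "Cod C w = Dom C p'" "p' \<cdot>\<^bsub>C\<^esub> w = a" "q \<cdot>\<^bsub>C\<^esub> w = b" by blast
    show ?thesis
    proof (rule ex1I[of _ w])
      show "w \<in> hom C (Dom C a) (Dom C p') \<and> p' \<cdot>\<^bsub>C\<^esub> w = a \<and> q \<cdot>\<^bsub>C\<^esub> w = b" using w by (simp add: hom_def)
      fix x assume "x \<in> hom C (Dom C a) (Dom C p') \<and> p' \<cdot>\<^bsub>C\<^esub> x = a \<and> q \<cdot>\<^bsub>C\<^esub> x = b"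
      then have x: "x \<in> Arr C" "Dom C x = Dom C a" "Cod C x = Dom C p'" "p' \<cdot>\<^bsub>C\<^esub> x = a" "q \<cdot>\<^bsub>C\<^esub> x = b"
        by (simp_all add: hom_def)
      show "x = w" by (rule un) (simp_all add: w x)
    qed
  qed
  then show ?thesis using assms(1-9) by (simp add: pullback_def)
qed

lemma pullback_iso:
  assumes C: "category C" and pb: "pullback C p f p' q" and i: "iso C i" "Cod C i = Dom C p'"
  shows "pullback C p f (p' \<cdot>\<^bsub>C\<^esub> i) (q \<cdot>\<^bsub>C\<^esub> i)"
proof -
  note d = pullbackD[OF pb]
  from i(1) obtain j where j: "i \<in> Arr C" "j \<in> Arr C" "Dom C j = Cod C i" "Cod C j = Dom C i" "j \<cdot>\<^bsub>C\<^esub> i = Idn C (Dom C i)" "i \<cdot>\<^bsub>C\<^esub> j = Idn C (Cod C i)"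
    by (rule isoE)
  have e: "p \<cdot>\<^bsub>C\<^esub> (q \<cdot>\<^bsub>C\<^esub> i) = f \<cdot>\<^bsub>C\<^esub> (p' \<cdot>\<^bsub>C\<^esub> i)"
    by (rule cmp_cong_left[OF C d(9)]) (use d(1-8) i(2) j(1) in simp_all)
  show ?thesis
  proof (rule pullbackI)
    fix a b assume ab: "a \<in> Arr C" "b \<in> Arr C" "Cod C a = Dom C f" "Cod C b = Dom C p" "Dom C a = Dom C b" "p \<cdot>\<^bsub>C\<^esub> b = f \<cdot>\<^bsub>C\<^esub> a"
    obtain w where w: "w \<in> Arr C" "Dom C w = Dom C a" "Cod C w = Dom C p'" "p' \<cdot>\<^bsub>C\<^esub> w = a" "q \<cdot>\<^bsub>C\<^esub> w = b"
      by (rule pullback_obtain[OF pb ab])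
    have "i \<cdot>\<^bsub>C\<^esub> (j \<cdot>\<^bsub>C\<^esub> w) = w" by (rule cmp_cancel_left[OF C _ _ _ _ _ j(6)]) (use j(1-4) w i in simp_all)
    then show "\<exists>w. w \<in> Arr C \<and> Dom C w = Dom C a \<and> Cod C w = Dom C (p' \<cdot>\<^bsub>C\<^esub> i) \<and> (p' \<cdot>\<^bsub>C\<^esub> i) \<cdot>\<^bsub>C\<^esub> w = a \<and> (q \<cdot>\<^bsub>C\<^esub> i) \<cdot>\<^bsub>C\<^esub> w = b"
      by (intro exI[of _ "j \<cdot>\<^bsub>C\<^esub> w"]) (use C d(1-8) j(1-4) w i(2) in simp)
  next
    fix w w' assume w: "w \<in> Arr C" "w' \<in> Arr C" "Dom C w = Dom C w'" "Cod C w = Dom C (p' \<cdot>\<^bsub>C\<^esub> i)" "Cod C w' = Dom C (p' \<cdot>\<^bsub>C\<^esub> i)"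
      "(p' \<cdot>\<^bsub>C\<^esub> i) \<cdot>\<^bsub>C\<^esub> w = (p' \<cdot>\<^bsub>C\<^esub> i) \<cdot>\<^bsub>C\<^esub> w'" "(q \<cdot>\<^bsub>C\<^esub> i) \<cdot>\<^bsub>C\<^esub> w = (q \<cdot>\<^bsub>C\<^esub> i) \<cdot>\<^bsub>C\<^esub> w'"
    have w': "Cod C w = Dom C i" "Cod C w' = Dom C i" using w(4,5) C d(1-8) j(1) i(2) by simp_all
    have 1: "i \<cdot>\<^bsub>C\<^esub> w = i \<cdot>\<^bsub>C\<^esub> w'"
      by (rule pullback_unique[OF C pb]) (use C d(1-8) j(1) i(2) w(1-3,6-7) w' in simp_all)
    have "w = j \<cdot>\<^bsub>C\<^esub> (i \<cdot>\<^bsub>C\<^esub> w)" by (rule cmp_cancel_left[OF C _ _ _ _ _ j(5), symmetric]) (use j(1-4) w w' in simp_all)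
    also have "\<dots> = w'" unfolding 1 by (rule cmp_cancel_left[OF C _ _ _ _ _ j(5)]) (use j(1-4) w w' in simp_all)
    finally show "w = w'" .
  qed (use C d j(1) i(2) e in simp_all)
qed

lemma pullback_compare:
  assumes C: "category C" and pb: "pullback C p f p' q" and pb': "pullback C p f p1 q1"
  obtains i where "iso C i" "Dom C i = Dom C p1" "Cod C i = Dom C p'" "p' \<cdot>\<^bsub>C\<^esub> i = p1" "q \<cdot>\<^bsub>C\<^esub> i = q1"
proof -
  note d = pullbackD[OF pb] and d' = pullbackD[OF pb']
  obtain i where i: "i \<in> Arr C" "Dom C i = Dom C p1" "Cod C i = Dom C p'" "p' \<cdot>\<^bsub>C\<^esub> i = p1" "q \<cdot>\<^bsub>C\<^esub> i = q1"
    by (rule pullback_obtain[OF pb, of p1 q1]) (use d d' in simp_all)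
  obtain j where j: "j \<in> Arr C" "Dom C j = Dom C p'" "Cod C j = Dom C p1" "p1 \<cdot>\<^bsub>C\<^esub> j = p'" "q1 \<cdot>\<^bsub>C\<^esub> j = q"
    by (rule pullback_obtain[OF pb', of p' q]) (use d d' in simp_all)
  have a: "p' \<cdot>\<^bsub>C\<^esub> (i \<cdot>\<^bsub>C\<^esub> j) = p'" "q \<cdot>\<^bsub>C\<^esub> (i \<cdot>\<^bsub>C\<^esub> j) = q" "p1 \<cdot>\<^bsub>C\<^esub> (j \<cdot>\<^bsub>C\<^esub> i) = p1" "q1 \<cdot>\<^bsub>C\<^esub> (j \<cdot>\<^bsub>C\<^esub> i) = q1"
    using category.assoc[OF C, of j i p'] category.assoc[OF C, of j i q] category.assoc[OF C, of i j p1] category.assoc[OF C, of i j q1]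
      d(1-8) d'(1-8) i j by simp_all
  have 1: "i \<cdot>\<^bsub>C\<^esub> j = Idn C (Dom C p')" by (rule pullback_unique[OF C pb]) (use C d(1-8) i j a in simp_all)
  have 2: "j \<cdot>\<^bsub>C\<^esub> i = Idn C (Dom C p1)" by (rule pullback_unique[OF C pb']) (use C d'(1-8) i j a in simp_all)
  have "iso C i" by (rule isoI[of _ _ j]) (use i j 1 2 in simp_all)
  then show thesis using that i by blast
qed

section \<open>A comonad on a natural model, in the base and in the fibres\<close>

locale nm_comonad =
  fixes W :: "('a univ nm, 'a univ nmor, 'a univ nmor2) cmnd"
  assumes W: "comonad NM W"
begin

abbreviation "M \<equiv> Base W"
abbreviation "B \<equiv> Endo W"
abbreviation "C \<equiv> UCat M"
abbreviation "F \<equiv> MFun B"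
abbreviation "W0 \<equiv> map_comonad NM_forget W"
abbreviation "E \<equiv> EM W0"
abbreviation "U \<equiv> EM_forget W0"
abbreviation "co \<equiv> EM_co W0"
abbreviation "cu \<equiv> M2Nt (Counit W)"
abbreviation "cm \<equiv> M2Nt (Comult W)"

lemma W_simps [simp]:
  "natural_model M" "nm_mor B" "MSrc B = M" "MTgt B = M"
  "nm_mor2 (Counit W)" "M2Src (Counit W) = B" "M2Tgt (Counit W) = nmor_id M"
  "nm_mor2 (Comult W)" "M2Src (Comult W) = B" "M2Tgt (Comult W) = nmor_comp B B"
  using NM.comonad_simps[OF W] by auto

lemma W_laws:
  "nmor2_vcomp (nmor2_hcomp (Counit W) (nmor2_id B)) (Comult W) = nmor2_id B"
  "nmor2_vcomp (nmor2_hcomp (nmor2_id B) (Counit W)) (Comult W) = nmor2_id B"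
  "nmor2_vcomp (nmor2_hcomp (Comult W) (nmor2_id B)) (Comult W) = nmor2_vcomp (nmor2_hcomp (nmor2_id B) (Comult W)) (Comult W)"
  using comonad.counit_left[OF W] comonad.counit_right[OF W] comonad.coassoc[OF W]
  by (simp_all add: rwhisker_def lwhisker_def nmor_laws)

lemma W0 [simp]: "comonad CAT W0"
  by (rule comonad_map[OF strict_2_category_NM strict_2_category_CAT strict_2_functor_forget W])

lemma W0_simps [simp]: "Base W0 = C" "Endo W0 = F" "Counit W0 = cu" "Comult W0 = cm"
  by (simp_all add: map_comonad_def NM_forget_def)

lemma E_coalg:
  assumes "X \<in> Obj E"
  shows "At cu (Fob U X) \<cdot>\<^bsub>C\<^esub> At co X = Idn C (Fob U X)" "At cm (Fob U X) \<cdot>\<^bsub>C\<^esub> At co X = Far F (At co X) \<cdot>\<^bsub>C\<^esub> At co X"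
  using EM_coalg[OF assms] by simp_all

lemma E_map: "k \<in> Arr E \<Longrightarrow> Far F (Far U k) \<cdot>\<^bsub>C\<^esub> At co (Dom E k) = At co (Cod E k) \<cdot>\<^bsub>C\<^esub> Far U k"
  using EM_map_eq[of W0 k] by simp

end

locale selector_comonad = selector T mT m2T + nm_comonad W
  for T :: "'a univ nm \<Rightarrow> 'a univ icat" and mT :: "'a univ nmor \<Rightarrow> 'a univ ifct" and m2T :: "'a univ nmor2 \<Rightarrow> 'a univ \<Rightarrow> 'a univ sntr"
    and W :: "('a univ nm, 'a univ nmor, 'a univ nmor2) cmnd"
begin

text \<open>The three comonad laws at a type or term \<open>A\<close> over \<open>\<Gamma>\<close>.
  They are equations over \<open>Fob F \<Gamma>\<close>: components that live over
  \<open>Fob F (Fob F \<Gamma>)\<close> are brought back along the base comultiplication.\<close>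

lemma W_pointwise:
  assumes "\<Gamma> \<in> Obj C" "A \<in> Obj (Fob (T M) \<Gamma>)"
  shows "Far (Far (T M) (At cm \<Gamma>)) (At (m2T (Counit W) (Fob F \<Gamma>)) (Fob (At (mT B) \<Gamma>) A)) \<cdot>\<^bsub>Fob (T M) (Fob F \<Gamma>)\<^esub> At (m2T (Comult W) \<Gamma>) A
      = Idn (Fob (T M) (Fob F \<Gamma>)) (Fob (At (mT B) \<Gamma>) A)"
    "Far (Far (T M) (At cm \<Gamma>)) (Far (At (mT B) (Fob F \<Gamma>)) (At (m2T (Counit W) \<Gamma>) A)) \<cdot>\<^bsub>Fob (T M) (Fob F \<Gamma>)\<^esub> At (m2T (Comult W) \<Gamma>) A
      = Idn (Fob (T M) (Fob F \<Gamma>)) (Fob (At (mT B) \<Gamma>) A)"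
    "Far (Far (T M) (At cm \<Gamma>)) (At (m2T (Comult W) (Fob F \<Gamma>)) (Fob (At (mT B) \<Gamma>) A)) \<cdot>\<^bsub>Fob (T M) (Fob F \<Gamma>)\<^esub> At (m2T (Comult W) \<Gamma>) A
      = Far (Far (T M) (At cm \<Gamma>)) (Far (At (mT B) (Fob F \<Gamma>)) (At (m2T (Comult W) \<Gamma>) A)) \<cdot>\<^bsub>Fob (T M) (Fob F \<Gamma>)\<^esub> At (m2T (Comult W) \<Gamma>) A"
  using arg_cong[OF W_laws(1), of "\<lambda>t. At (m2T t \<Gamma>) A"] arg_cong[OF W_laws(2), of "\<lambda>t. At (m2T t \<Gamma>) A"]
    arg_cong[OF W_laws(3), of "\<lambda>t. At (m2T t \<Gamma>) A"] assms by simp_all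

lemma sub_counit:
  assumes X: "X \<in> Obj E"
  shows "A \<in> Obj (Fob (T M) (Fob U X)) \<Longrightarrow> Fob (Far (T M) (At co X)) (Fob (Far (T M) (At cu (Fob U X))) A) = A"
    "f \<in> Arr (Fob (T M) (Fob U X)) \<Longrightarrow> Far (Far (T M) (At co X)) (Far (Far (T M) (At cu (Fob U X))) f) = f"
  using arg_cong[OF E_coalg(1)[OF X], of "\<lambda>u. Fob (Far (T M) u) A"] arg_cong[OF E_coalg(1)[OF X], of "\<lambda>u. Far (Far (T M) u) f"] X by simp_all

lemma sub_comult:
  assumes X: "X \<in> Obj E"
  shows "A \<in> Obj (Fob (T M) (Fob F (Fob F (Fob U X)))) \<Longrightarrow> Fob (Far (T M) (At co X)) (Fob (Far (T M) (At cm (Fob U X))) A)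
      = Fob (Far (T M) (At co X)) (Fob (Far (T M) (Far F (At co X))) A)"
    "f \<in> Arr (Fob (T M) (Fob F (Fob F (Fob U X)))) \<Longrightarrow> Far (Far (T M) (At co X)) (Far (Far (T M) (At cm (Fob U X))) f)
      = Far (Far (T M) (At co X)) (Far (Far (T M) (Far F (At co X))) f)"
  using sub_square(1)[OF _ E_coalg(2)[OF X], of A] sub_square(2)[OF _ E_coalg(2)[OF X], of f] X by simp_all

lemma sub_map:
  assumes k: "k \<in> Arr E"
  shows "A \<in> Obj (Fob (T M) (Fob F (Fob U (Cod E k)))) \<Longrightarrow> Fob (Far (T M) (Far U k)) (Fob (Far (T M) (At co (Cod E k))) A)
      = Fob (Far (T M) (At co (Dom E k))) (Fob (Far (T M) (Far F (Far U k))) A)"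
    "f \<in> Arr (Fob (T M) (Fob F (Fob U (Cod E k)))) \<Longrightarrow> Far (Far (T M) (Far U k)) (Far (Far (T M) (At co (Cod E k))) f)
      = Far (Far (T M) (At co (Dom E k))) (Far (Far (T M) (Far F (Far U k))) f)"
  using sub_square(1)[OF _ E_map[OF k, symmetric], of A] sub_square(2)[OF _ E_map[OF k, symmetric], of f] k by simp_all

definition fib_endo where
  "fib_endo X = fct_comp (Far (T M) (At co X)) (At (mT B) (Fob U X))"

text \<open>A coalgebra \<open>(\<Gamma>, \<gamma>)\<close> of the base comonad makes \<open>A \<mapsto> (\<box>A)[\<gamma>]\<close> a comonad on the fibre over \<open>\<Gamma>\<close>.\<close>

definition fib_comonad where
  "fib_comonad X = \<lparr>Base = Fob (T M) (Fob U X), Endo = fib_endo X,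
     Counit = \<lparr>NSrc = fib_endo X, NTgt = fct_id (Fob (T M) (Fob U X)),
       At = (\<lambda>A\<in>Obj (Fob (T M) (Fob U X)). Far (Far (T M) (At co X)) (At (m2T (Counit W) (Fob U X)) A))\<rparr>,
     Comult = \<lparr>NSrc = fib_endo X, NTgt = fct_comp (fib_endo X) (fib_endo X),
       At = (\<lambda>A\<in>Obj (Fob (T M) (Fob U X)). Far (Far (T M) (At co X)) (At (m2T (Comult W) (Fob U X)) A))\<rparr>\<rparr>"

lemma fib_endo_simps [simp]:
  assumes X: "X \<in> Obj E"
  shows "fctr (fib_endo X)" "Src (fib_endo X) = Fob (T M) (Fob U X)" "Tgt (fib_endo X) = Fob (T M) (Fob U X)"
    "A \<in> Obj (Fob (T M) (Fob U X)) \<Longrightarrow> Fob (fib_endo X) A = Fob (Far (T M) (At co X)) (Fob (At (mT B) (Fob U X)) A)"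
    "f \<in> Arr (Fob (T M) (Fob U X)) \<Longrightarrow> Far (fib_endo X) f = Far (Far (T M) (At co X)) (Far (At (mT B) (Fob U X)) f)"
  using X by (simp_all add: fib_endo_def)

lemma fib_comonad_simps [simp]:
  "Base (fib_comonad X) = Fob (T M) (Fob U X)" "Endo (fib_comonad X) = fib_endo X"
  "A \<in> Obj (Fob (T M) (Fob U X)) \<Longrightarrow> At (Counit (fib_comonad X)) A = Far (Far (T M) (At co X)) (At (m2T (Counit W) (Fob U X)) A)"
  "A \<in> Obj (Fob (T M) (Fob U X)) \<Longrightarrow> At (Comult (fib_comonad X)) A = Far (Far (T M) (At co X)) (At (m2T (Comult W) (Fob U X)) A)"
  by (simp_all add: fib_comonad_def)

text \<open>The laws are those of \<open>W_pointwise\<close>, substituted along the coaction of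
  \<open>X\<close>. The counit law of the coaction removes the substitution along the base counit,
  and its coassociativity replaces the base comultiplication by the image of the coaction, which is
  the substitution that iterating \<open>fib_endo\<close> produces.\<close>

lemma comonad_fib [simp]:
  assumes X: "X \<in> Obj E" shows "comonad CAT (fib_comonad X)"
  unfolding fib_comonad_def
proof (rule comonad_CAT_I)
  let ?\<Gamma> = "Fob U X" let ?g = "At co X" let ?K = "Fob (T M) ?\<Gamma>"
  note [simp] = X
  have G [simp]: "?\<Gamma> \<in> Obj C" "Fob F ?\<Gamma> \<in> Obj C" by simp_all
  show "ntrans \<lparr>NSrc = fib_endo X, NTgt = fct_id ?K, At = (\<lambda>A\<in>Obj ?K. Far (Far (T M) ?g) (At (m2T (Counit W) ?\<Gamma>) A))\<rparr>"
  proof (rule ntransI)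
    fix f assume "f \<in> Arr (Src (fib_endo X))"
    then have f: "f \<in> Arr ?K" by simp
    show "Far (Far (T M) ?g) (At (m2T (Counit W) ?\<Gamma>) (Cod (Src (fib_endo X)) f)) \<cdot>\<^bsub>Tgt (fib_endo X)\<^esub> Far (fib_endo X) f =
         Far (fct_id ?K) f \<cdot>\<^bsub>Tgt (fib_endo X)\<^esub> Far (Far (T M) ?g) (At (m2T (Counit W) ?\<Gamma>) (Dom (Src (fib_endo X)) f))"
      using naturality_image[of "Far (T M) ?g" "Fob (T M) (Fob F ?\<Gamma>)" ?K "m2T (Counit W) ?\<Gamma>" ?K f "Dom ?K f" "Cod ?K f"] f by (simp add: sub_counit)
  qed (simp_all add: sub_counit)
  show "ntrans \<lparr>NSrc = fib_endo X, NTgt = fct_comp (fib_endo X) (fib_endo X), At = (\<lambda>A\<in>Obj ?K. Far (Far (T M) ?g) (At (m2T (Comult W) ?\<Gamma>) A))\<rparr>"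
  proof (rule ntransI)
    fix f assume "f \<in> Arr (Src (fib_endo X))"
    then have f: "f \<in> Arr ?K" by simp
    show "Far (Far (T M) ?g) (At (m2T (Comult W) ?\<Gamma>) (Cod (Src (fib_endo X)) f)) \<cdot>\<^bsub>Tgt (fib_endo X)\<^esub> Far (fib_endo X) f =
         Far (fct_comp (fib_endo X) (fib_endo X)) f \<cdot>\<^bsub>Tgt (fib_endo X)\<^esub> Far (Far (T M) ?g) (At (m2T (Comult W) ?\<Gamma>) (Dom (Src (fib_endo X)) f))"
      using naturality_image[of "Far (T M) ?g" "Fob (T M) (Fob F ?\<Gamma>)" ?K "m2T (Comult W) ?\<Gamma>" ?K f "Dom ?K f" "Cod ?K f"] f by (simp add: sub_comult)
  qed (simp_all add: sub_comult)
  fix A assume A: "A \<in> Obj ?K"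
  note l = W_pointwise[OF G(1) A, THEN arg_cong[of _ _ "Far (Far (T M) ?g)"]]
  show "At \<lparr>NSrc = fib_endo X, NTgt = fct_id ?K, At = (\<lambda>A\<in>Obj ?K. Far (Far (T M) ?g) (At (m2T (Counit W) ?\<Gamma>) A))\<rparr> (Fob (fib_endo X) A) \<cdot>\<^bsub>?K\<^esub>
         At \<lparr>NSrc = fib_endo X, NTgt = fct_comp (fib_endo X) (fib_endo X), At = (\<lambda>A\<in>Obj ?K. Far (Far (T M) ?g) (At (m2T (Comult W) ?\<Gamma>) A))\<rparr> A =
         Idn ?K (Fob (fib_endo X) A)"
    using l(1) A by (simp add: sub_comult)
  show "Far (fib_endo X) (At \<lparr>NSrc = fib_endo X, NTgt = fct_id ?K, At = (\<lambda>A\<in>Obj ?K. Far (Far (T M) ?g) (At (m2T (Counit W) ?\<Gamma>) A))\<rparr> A) \<cdot>\<^bsub>?K\<^esub>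
         At \<lparr>NSrc = fib_endo X, NTgt = fct_comp (fib_endo X) (fib_endo X), At = (\<lambda>A\<in>Obj ?K. Far (Far (T M) ?g) (At (m2T (Comult W) ?\<Gamma>) A))\<rparr> A =
         Idn ?K (Fob (fib_endo X) A)"
    using l(2) A by (simp add: sub_comult)
  show "At \<lparr>NSrc = fib_endo X, NTgt = fct_comp (fib_endo X) (fib_endo X), At = (\<lambda>A\<in>Obj ?K. Far (Far (T M) ?g) (At (m2T (Comult W) ?\<Gamma>) A))\<rparr> (Fob (fib_endo X) A) \<cdot>\<^bsub>?K\<^esub>
         At \<lparr>NSrc = fib_endo X, NTgt = fct_comp (fib_endo X) (fib_endo X), At = (\<lambda>A\<in>Obj ?K. Far (Far (T M) ?g) (At (m2T (Comult W) ?\<Gamma>) A))\<rparr> A =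
        Far (fib_endo X) (At \<lparr>NSrc = fib_endo X, NTgt = fct_comp (fib_endo X) (fib_endo X), At = (\<lambda>A\<in>Obj ?K. Far (Far (T M) ?g) (At (m2T (Comult W) ?\<Gamma>) A))\<rparr> A) \<cdot>\<^bsub>?K\<^esub>
         At \<lparr>NSrc = fib_endo X, NTgt = fct_comp (fib_endo X) (fib_endo X), At = (\<lambda>A\<in>Obj ?K. Far (Far (T M) ?g) (At (m2T (Comult W) ?\<Gamma>) A))\<rparr> A"
    using l(3) A by (simp add: sub_comult)
qed (use X in simp_all)

text \<open>Substituting along \<open>Far U k\<close> after applying \<open>fib_endo Y\<close> means
  substituting along the composite of the coaction with \<open>Far U k\<close>. The square of the
  coalgebra map \<open>k\<close> and strict naturality of the comonad turn this into
  \<open>fib_endo X\<close> of the substituted object.\<close>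

lemma sub_comonad_map [simp]:
  assumes k: "k \<in> Arr E" "Cod E k = Y" "Dom E k = X"
  shows "strict_comonad_map (fib_comonad Y) (fib_comonad X) (Far (T M) (Far U k))"
proof -
  have XY: "X \<in> Obj E" "Y \<in> Obj E" using category.dom_closed[of E k] category.cod_closed[of E k] k by auto
  note s = sub_map[OF k(1), unfolded k(2,3)]
  have "fct_comp (Far (T M) (Far U k)) (fib_endo Y) = fct_comp (fib_endo X) (Far (T M) (Far U k))"
    by (rule fct_eqI) (use k XY in \<open>simp_all add: s\<close>)
  then show ?thesis unfolding strict_comonad_map_def using k XY by (simp add: s)
qed

definition emT where
  "emT = \<lparr>Src = opcat E, Tgt = One CAT, Fob = (\<lambda>X\<in>Obj E. EM (fib_comonad X)),
     Far = (\<lambda>k\<in>Arr E. EM_map (fib_comonad (Cod E k)) (fib_comonad (Dom E k)) (Far (T M) (Far U k)))\<rparr>"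

lemma emT_simps [simp]: "Src emT = opcat E" "Tgt emT = One CAT" "X \<in> Obj E \<Longrightarrow> Fob emT X = EM (fib_comonad X)"
  "k \<in> Arr E \<Longrightarrow> Far emT k = EM_map (fib_comonad (Cod E k)) (fib_comonad (Dom E k)) (Far (T M) (Far U k))"
  by (simp_all add: emT_def)

lemma fctr_emT [simp]: "fctr emT"
proof -
  have "fctr \<lparr>Src = opcat E, Tgt = One CAT, Fob = restrict (\<lambda>X. EM (fib_comonad X)) (Obj (opcat E)),
     Far = restrict (\<lambda>k. EM_map (fib_comonad (Cod E k)) (fib_comonad (Dom E k)) (Far (T M) (Far U k))) (Arr (opcat E))\<rparr>"
  proof (rule fctrI)
    fix X assume "X \<in> Obj (opcat E)"
    then have X: "X \<in> Obj E" by simp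
    have "Far (T M) (Far U (Idn E X)) = fct_id (Base (fib_comonad X))" using X by simp
    then show "EM_map (fib_comonad (Cod E (Idn (opcat E) X))) (fib_comonad (Dom E (Idn (opcat E) X))) (Far (T M) (Far U (Idn (opcat E) X))) =
         Idn (One CAT) (EM (fib_comonad X))"
      using X EM_map_id[OF comonad_fib[OF X]] by simp
  next
    fix f g assume "f \<in> Arr (opcat E)" "g \<in> Arr (opcat E)" "Dom (opcat E) g = Cod (opcat E) f"
    then have fg: "f \<in> Arr E" "g \<in> Arr E" "Cod E g = Dom E f" by simp_all
    have e: "Far (T M) (Far U (f \<cdot>\<^bsub>E\<^esub> g)) = fct_comp (Far (T M) (Far U g)) (Far (T M) (Far U f))" using fg by simp
    have "EM_map (fib_comonad (Cod E f)) (fib_comonad (Dom E g)) (fct_comp (Far (T M) (Far U g)) (Far (T M) (Far U f)))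
      = fct_comp (EM_map (fib_comonad (Cod E g)) (fib_comonad (Dom E g)) (Far (T M) (Far U g))) (EM_map (fib_comonad (Cod E f)) (fib_comonad (Dom E f)) (Far (T M) (Far U f)))"
      using EM_map_comp[of "fib_comonad (Cod E f)" "fib_comonad (Dom E f)" "fib_comonad (Dom E g)" "Far (T M) (Far U f)" "Far (T M) (Far U g)"] fg by simp
    then show "EM_map (fib_comonad (Cod E (g \<cdot>\<^bsub>opcat E\<^esub> f))) (fib_comonad (Dom E (g \<cdot>\<^bsub>opcat E\<^esub> f))) (Far (T M) (Far U (g \<cdot>\<^bsub>opcat E\<^esub> f))) =
       EM_map (fib_comonad (Cod E g)) (fib_comonad (Dom E g)) (Far (T M) (Far U g)) \<cdot>\<^bsub>One CAT\<^esub>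
       EM_map (fib_comonad (Cod E f)) (fib_comonad (Dom E f)) (Far (T M) (Far U f))"
      using fg e by simp
  qed simp_all
  then show ?thesis by (simp add: emT_def)
qed

definition forgetT where
  "forgetT = \<lparr>NSrc = emT, NTgt = fct_comp (T M) (fct_op U), At = (\<lambda>X\<in>Obj E. EM_forget (fib_comonad X))\<rparr>"

lemma forgetT_simps [simp]: "NSrc forgetT = emT" "NTgt forgetT = fct_comp (T M) (fct_op U)"
  "X \<in> Obj E \<Longrightarrow> At forgetT X = EM_forget (fib_comonad X)"
  by (simp_all add: forgetT_def)

lemma ntrans_forgetT [simp]: "ntrans forgetT"
  unfolding forgetT_def
  by (rule ifctI[where C = E]) simp_all

definition coT where "coT = (\<lambda>X\<in>Obj E. EM_co (fib_comonad X))"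

lemma coT_simps [simp]: "X \<in> Obj E \<Longrightarrow> coT X = EM_co (fib_comonad X)" "coT \<in> extensional (Obj E)"
  by (simp_all add: coT_def)

end

section \<open>Term coalgebras over type coalgebras, and extensions of coalgebras\<close>

context nm_comonad
begin

sublocale tp: selector_comonad Tp MTp M2Tp W
  by (intro selector_comonad.intro Tp.selector_axioms nm_comonad_axioms)
sublocale tm: selector_comonad Tm MTm M2Tm W
  by (intro selector_comonad.intro Tm.selector_axioms nm_comonad_axioms)

abbreviation "FTp X \<equiv> tp.fib_comonad X"
abbreviation "FTm X \<equiv> tm.fib_comonad X"
abbreviation "UTp X \<equiv> EM_forget (FTp X)"
abbreviation "UTm X \<equiv> EM_forget (FTm X)"
abbreviation "PrX X \<equiv> EM_map (FTm X) (FTp X) (At (Pr M) (Fob U X))"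

lemma Pr_comonad_map [simp]:
  assumes X: "X \<in> Obj E" "Fob U X = \<Gamma>"
  shows "strict_comonad_map (FTm X) (FTp X) (At (Pr M) \<Gamma>)"
proof -
  have "fct_comp (At (Pr M) (Fob U X)) (tm.fib_endo X) = fct_comp (tp.fib_endo X) (At (Pr M) (Fob U X))"
    by (rule fct_eqI) (use X(1) in simp_all)
  then show ?thesis unfolding strict_comonad_map_def X(2)[symmetric] using X(1) by simp
qed

lemma PrX_opfib: "X \<in> Obj E \<Longrightarrow> discrete_opfibration (PrX X)"
  by (rule EM_map_opfib) simp_all

definition emPr where
  "emPr = \<lparr>NSrc = tm.emT, NTgt = tp.emT, At = (\<lambda>X\<in>Obj E. PrX X)\<rparr>"

lemma emPr_simps [simp]: "NSrc emPr = tm.emT" "NTgt emPr = tp.emT" "X \<in> Obj E \<Longrightarrow> At emPr X = PrX X"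
  by (simp_all add: emPr_def)

lemma PrX_natural:
  assumes k: "k \<in> Arr E"
  shows "z \<in> Obj (EM (FTm (Cod E k))) \<Longrightarrow> Fob (PrX (Dom E k)) (Fob (Far tm.emT k) z) = Fob (Far tp.emT k) (Fob (PrX (Cod E k)) z)"
    "f \<in> Arr (EM (FTm (Cod E k))) \<Longrightarrow> Far (PrX (Dom E k)) (Far (Far tm.emT k) f) = Far (Far tp.emT k) (Far (PrX (Cod E k)) f)"
proof -
  have o: "Dom E k \<in> Obj E" "Cod E k \<in> Obj E" using k by simp_all
  have "fct_comp (PrX (Dom E k)) (Far tm.emT k) = fct_comp (Far tp.emT k) (PrX (Cod E k))"
    by (rule EM_functor_eqI[of "FTp (Dom E k)"]) (use k o in simp_all)
  from arg_cong[OF this, of "\<lambda>G. Fob G z"] arg_cong[OF this, of "\<lambda>G. Far G f"]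
  show "z \<in> Obj (EM (FTm (Cod E k))) \<Longrightarrow> Fob (PrX (Dom E k)) (Fob (Far tm.emT k) z) = Fob (Far tp.emT k) (Fob (PrX (Cod E k)) z)"
    "f \<in> Arr (EM (FTm (Cod E k))) \<Longrightarrow> Far (PrX (Dom E k)) (Far (Far tm.emT k) f) = Far (Far tp.emT k) (Far (PrX (Cod E k)) f)"
    using k o by simp_all
qed

lemma ntrans_emPr [simp]: "ntrans emPr"
  unfolding emPr_def
  by (rule ifctI[where C = E]; (rule PrX_natural)?) (simp_all)

text \<open>A map \<open>s\<close> covering the coaction of \<open>X\<close> satisfies the counit
  law after composition with \<open>f\<close>, and coassociativity after composition with
  \<open>Far F (Far F f)\<close>. For a projection \<open>f\<close> it remains to test a second
  component: the generic term in case of an extension, the other leg in case of a pullback.\<close>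

lemma structure_map:
  assumes X: "X \<in> Obj E" and f: "f \<in> Arr C" "Cod C f = Fob U X" "Dom C f = D"
    and s: "s \<in> Arr C" "Dom C s = D" "Cod C s = Fob F D" "Far F f \<cdot>\<^bsub>C\<^esub> s = At co X \<cdot>\<^bsub>C\<^esub> f"
  shows "f \<cdot>\<^bsub>C\<^esub> (At cu D \<cdot>\<^bsub>C\<^esub> s) = f"
    "Far F (Far F f) \<cdot>\<^bsub>C\<^esub> (At cm D \<cdot>\<^bsub>C\<^esub> s) = Far F (Far F f) \<cdot>\<^bsub>C\<^esub> (Far F s \<cdot>\<^bsub>C\<^esub> s)"
proof -
  let ?\<Gamma> = "Fob U X" let ?g = "At co X"
  have D: "D \<in> Obj C" using category.dom_closed[of C f] f by simp
  note [simp] = X f s(1-3) D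
  have n1: "f \<cdot>\<^bsub>C\<^esub> At cu D = At cu ?\<Gamma> \<cdot>\<^bsub>C\<^esub> Far F f"
    using naturality[of cu C C f D ?\<Gamma>] by simp
  have n2: "Far F (Far F f) \<cdot>\<^bsub>C\<^esub> At cm D = At cm ?\<Gamma> \<cdot>\<^bsub>C\<^esub> Far F f"
    using naturality[of cm C C f D ?\<Gamma>] by simp
  have "f \<cdot>\<^bsub>C\<^esub> (At cu D \<cdot>\<^bsub>C\<^esub> s) = At cu ?\<Gamma> \<cdot>\<^bsub>C\<^esub> (Far F f \<cdot>\<^bsub>C\<^esub> s)" by (rule cmp_cong_left[OF _ n1]) simp_all
  also have "\<dots> = At cu ?\<Gamma> \<cdot>\<^bsub>C\<^esub> (?g \<cdot>\<^bsub>C\<^esub> f)" by (simp add: s(4))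
  also have "\<dots> = f" by (rule cmp_cancel_left[OF _ _ _ _ _ _ E_coalg(1)[OF X]]) simp_all
  finally show "f \<cdot>\<^bsub>C\<^esub> (At cu D \<cdot>\<^bsub>C\<^esub> s) = f" .
  have "Far F (Far F f) \<cdot>\<^bsub>C\<^esub> (At cm D \<cdot>\<^bsub>C\<^esub> s) = At cm ?\<Gamma> \<cdot>\<^bsub>C\<^esub> (Far F f \<cdot>\<^bsub>C\<^esub> s)" by (rule cmp_cong_left[OF _ n2]) simp_all
  also have "\<dots> = At cm ?\<Gamma> \<cdot>\<^bsub>C\<^esub> (?g \<cdot>\<^bsub>C\<^esub> f)" by (simp add: s(4))
  also have "\<dots> = Far F ?g \<cdot>\<^bsub>C\<^esub> (?g \<cdot>\<^bsub>C\<^esub> f)" by (rule cmp_cong_left[OF _ E_coalg(2)[OF X]]) simp_all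
  also have "\<dots> = Far F ?g \<cdot>\<^bsub>C\<^esub> (Far F f \<cdot>\<^bsub>C\<^esub> s)" by (simp add: s(4))
  also have "\<dots> = Far F (Far F f) \<cdot>\<^bsub>C\<^esub> (Far F s \<cdot>\<^bsub>C\<^esub> s)"
    by (rule cmp_cong_left) (use arg_cong[OF s(4), of "Far F"] in simp_all)
  finally show "Far F (Far F f) \<cdot>\<^bsub>C\<^esub> (At cm D \<cdot>\<^bsub>C\<^esub> s) = Far F (Far F f) \<cdot>\<^bsub>C\<^esub> (Far F s \<cdot>\<^bsub>C\<^esub> s)" .
qed

text \<open>The companion of \<open>structure_map\<close> for the term component. Hypothesis
  \<open>p\<close> couples the structure map \<open>a\<close> of a type with the map
  \<open>s\<close> on the extension. The conclusions translate both sides of each coalgebra law of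
  \<open>a\<close> into terms substituted along the corresponding composites of \<open>s\<close>, so
  that laws can be passed between \<open>a\<close> and \<open>s\<close> in either direction.\<close>

lemma push_structure:
  assumes X: "X \<in> Obj E" and \<pi>: "\<pi> \<in> Arr C" "Cod C \<pi> = Fob U X" "Dom C \<pi> = D"
    and s: "s \<in> Arr C" "Dom C s = D" "Cod C s = Fob F D" "Far F \<pi> \<cdot>\<^bsub>C\<^esub> s = At co X \<cdot>\<^bsub>C\<^esub> \<pi>"
    and v: "v \<in> Obj (Fob (Tm M) D)" "Fob (At (Pr M) D) v = Fob (Far (Tp M) \<pi>) A" and A: "A \<in> Obj (Fob (Tp M) (Fob U X))"
    and a: "a \<in> Arr (Fob (Tp M) (Fob U X))" "Dom (Fob (Tp M) (Fob U X)) a = A" "Cod (Fob (Tp M) (Fob U X)) a = Fob (tp.fib_endo X) A"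
    and p: "push M D v (Far (Far (Tp M) \<pi>) a) = Fob (Far (Tm M) s) (Fob (At (MTm B) D) v)"
  shows "push M D v (Far (Far (Tp M) \<pi>) (At (Counit (FTp X)) A \<cdot>\<^bsub>Fob (Tp M) (Fob U X)\<^esub> a)) = Fob (Far (Tm M) s) (Fob (Far (Tm M) (At cu D)) v)"
    "push M D v (Far (Far (Tp M) \<pi>) (At (Comult (FTp X)) A \<cdot>\<^bsub>Fob (Tp M) (Fob U X)\<^esub> a)) =
       Fob (Far (Tm M) s) (Fob (Far (Tm M) (At cm D)) (Fob (At (MTm B) (Fob F D)) (Fob (At (MTm B) D) v)))"
    "push M D v (Far (Far (Tp M) \<pi>) (Far (tp.fib_endo X) a \<cdot>\<^bsub>Fob (Tp M) (Fob U X)\<^esub> a)) =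
       Fob (Far (Tm M) s) (Fob (Far (Tm M) (Far F s)) (Fob (At (MTm B) (Fob F D)) (Fob (At (MTm B) D) v)))"
proof -
  have G: "D \<in> Obj C" "Fob F D \<in> Obj C" "Fob U X \<in> Obj C" "Fob F (Fob U X) \<in> Obj C" "Fob F (Fob F D) \<in> Obj C"
    using category.dom_closed[of C \<pi>] \<pi> X by auto
  note [simp] = X \<pi> s(1-3) v A a G
  have MM: "pre_natural_model M" by simp
  have sq: "y \<in> Obj (Fob (Tp M) (Fob F (Fob U X))) \<Longrightarrow> Fob (Far (Tp M) \<pi>) (Fob (Far (Tp M) (At co X)) y) = Fob (Far (Tp M) s) (Fob (Far (Tp M) (Far F \<pi>)) y)"
    "f \<in> Arr (Fob (Tp M) (Fob F (Fob U X))) \<Longrightarrow> Far (Far (Tp M) \<pi>) (Far (Far (Tp M) (At co X)) f) = Far (Far (Tp M) s) (Far (Far (Tp M) (Far F \<pi>)) f)" for y f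
    using Tp.sub_square(1)[OF _ s(4)[symmetric], of y] Tp.sub_square(2)[OF _ s(4)[symmetric], of f] by simp_all
  \<comment> \<open>The lift of the substituted \<open>a\<close> at \<open>v\<close>. By
    \<open>p\<close> it ends at the fibrewise endofunctor applied to \<open>v\<close>, so composing
    it with counit, comultiplication or its own image gives lifts of the composites in question, and
    \<open>push_eq\<close> reads off their codomains.\<close>
  obtain \<sigma> where \<sigma>: "\<sigma> \<in> Arr (Fob (Tm M) D)" "Dom (Fob (Tm M) D) \<sigma> = v" "Far (At (Pr M) D) \<sigma> = Far (Far (Tp M) \<pi>) a"
     "Cod (Fob (Tm M) D) \<sigma> = Fob (Far (Tm M) s) (Fob (At (MTm B) D) v)"
    by (rule push[of M D v "Far (Far (Tp M) \<pi>) a"]) (use p in simp_all)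
  note [simp] = \<sigma>
  have "push M D v (Far (Far (Tp M) \<pi>) (At (Counit (FTp X)) A \<cdot>\<^bsub>Fob (Tp M) (Fob U X)\<^esub> a))
    = Cod (Fob (Tm M) D) (Far (Far (Tm M) s) (At (M2Tm (Counit W) D) v) \<cdot>\<^bsub>Fob (Tm M) D\<^esub> \<sigma>)"
    by (rule push_eq[OF MM G(1)]) (simp_all add: sq tp.sub_counit)
  then show "push M D v (Far (Far (Tp M) \<pi>) (At (Counit (FTp X)) A \<cdot>\<^bsub>Fob (Tp M) (Fob U X)\<^esub> a)) = Fob (Far (Tm M) s) (Fob (Far (Tm M) (At cu D)) v)"
    by simp
  have "push M D v (Far (Far (Tp M) \<pi>) (At (Comult (FTp X)) A \<cdot>\<^bsub>Fob (Tp M) (Fob U X)\<^esub> a))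
    = Cod (Fob (Tm M) D) (Far (Far (Tm M) s) (At (M2Tm (Comult W) D) v) \<cdot>\<^bsub>Fob (Tm M) D\<^esub> \<sigma>)"
    by (rule push_eq[OF MM G(1)]) (simp_all add: sq)
  then show "push M D v (Far (Far (Tp M) \<pi>) (At (Comult (FTp X)) A \<cdot>\<^bsub>Fob (Tp M) (Fob U X)\<^esub> a)) =
       Fob (Far (Tm M) s) (Fob (Far (Tm M) (At cm D)) (Fob (At (MTm B) (Fob F D)) (Fob (At (MTm B) D) v)))" by simp
  have "push M D v (Far (Far (Tp M) \<pi>) (Far (tp.fib_endo X) a \<cdot>\<^bsub>Fob (Tp M) (Fob U X)\<^esub> a))
    = Cod (Fob (Tm M) D) (Far (Far (Tm M) s) (Far (At (MTm B) D) \<sigma>) \<cdot>\<^bsub>Fob (Tm M) D\<^esub> \<sigma>)"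
    by (rule push_eq[OF MM G(1)]) (simp_all add: sq)
  then show "push M D v (Far (Far (Tp M) \<pi>) (Far (tp.fib_endo X) a \<cdot>\<^bsub>Fob (Tp M) (Fob U X)\<^esub> a)) =
       Fob (Far (Tm M) s) (Fob (Far (Tm M) (Far F s)) (Fob (At (MTm B) (Fob F D)) (Fob (At (MTm B) D) v)))" by simp
qed

text \<open>The lift \<open>\<sigma>\<close> of the substituted structure map of \<open>Bt\<close>
  is the candidate structure map of \<open>v\<close>. The third assumption on \<open>v\<close> makes
  its codomain right, and discreteness supplies the coalgebra laws.\<close>

lemma term_lift:
  assumes k: "k \<in> Arr E" and Bt: "Bt \<in> Obj (EM (FTp (Cod E k)))"
    and v: "v \<in> Obj (Fob (Tm M) (Fob U (Dom E k)))" "Fob (At (Pr M) (Fob U (Dom E k))) v = Fob (Far (Tp M) (Far U k)) (Fob (UTp (Cod E k)) Bt)"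
      "push M (Fob U (Dom E k)) v (Far (Far (Tp M) (Far U k)) (At (EM_co (FTp (Cod E k))) Bt)) = Fob (Far (Tm M) (At co (Dom E k))) (Fob (At (MTm B) (Fob U (Dom E k))) v)"
  obtains z where "z \<in> Obj (EM (FTm (Dom E k)))" "Fob (UTm (Dom E k)) z = v" "Fob (PrX (Dom E k)) z = Fob (Far tp.emT k) Bt"
proof -
  let ?Y = "Dom E k" let ?X = "Cod E k" let ?D = "Fob U ?Y" let ?a = "At (EM_co (FTp ?X)) Bt"
  have XY: "?X \<in> Obj E" "?Y \<in> Obj E" using k by simp_all
  note [simp] = k Bt v(1,2) XY
  obtain \<sigma> where \<sigma>: "\<sigma> \<in> Arr (Fob (Tm M) ?D)" "Dom (Fob (Tm M) ?D) \<sigma> = v" "Far (At (Pr M) ?D) \<sigma> = Far (Far (Tp M) (Far U k)) ?a"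
     "Cod (Fob (Tm M) ?D) \<sigma> = Fob (Far (Tm M) (At co ?Y)) (Fob (At (MTm B) ?D) v)"
    by (rule push[of M ?D v "Far (Far (Tp M) (Far U k)) ?a"]) (use v(3) in simp_all)
  have "Fob (Far tp.emT k) Bt \<in> Obj (EM (FTp ?Y))" by simp
  note o = opfib_coalg[OF _ _ _ _ this, of "FTm ?Y" "At (Pr M) ?D" v \<sigma>]
  have o1: "Tup v \<sigma> \<in> Obj (EM (FTm ?Y))" by (rule o(1)) (use \<sigma> in simp_all)
  have "Fob (PrX ?Y) (Tup v \<sigma>) = Fob (Far tp.emT k) Bt" by (rule o(2)) (use \<sigma> in simp_all)
  with o1 show thesis by (intro that[of "Tup v \<sigma>"]) simp_all
qed

text \<open>The image of the extension under the comonad is again an extension, so a coaction on the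
  total object amounts to an arrow over the coaction of \<open>X\<close> together with a term. Its
  laws are checked by uniqueness of classifying arrows, with \<open>structure_map\<close> for the
  projection and \<open>push_structure\<close> for the term.\<close>

lemma ext_lift:
  assumes X: "X \<in> Obj E" and Bt: "Bt \<in> Obj (EM (FTp X))" and e: "is_ext M (Fob (UTp X) Bt) \<pi> v" "Cod C \<pi> = Fob U X"
  obtains k z where "k \<in> Arr E" "Cod E k = X" "z \<in> Obj (EM (FTm (Dom E k)))" "Fob (PrX (Dom E k)) z = Fob (Far tp.emT k) Bt"
    "Far U k = \<pi>" "Fob (UTm (Dom E k)) z = v"
proof -
  let ?D = "Dom C \<pi>" let ?A = "Fob (UTp X) Bt" let ?a = "At (EM_co (FTp X)) Bt" let ?g = "At co X" let ?\<Gamma> = "Fob U X"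
  note [simp] = X Bt e(2) is_extD(1,3,4)[OF e(1)]
  have MM: "pre_natural_model M" by simp
  have A: "?A \<in> Obj (Fob (Tp M) ?\<Gamma>)" "?a \<in> Arr (Fob (Tp M) ?\<Gamma>)" "Dom (Fob (Tp M) ?\<Gamma>) ?a = ?A" "Cod (Fob (Tp M) ?\<Gamma>) ?a = Fob (tp.fib_endo X) ?A" by simp_all
  have G: "?D \<in> Obj C" "Fob F ?D \<in> Obj C" by simp_all
  have e1: "is_ext M (Fob (At (MTp B) ?\<Gamma>) ?A) (Far F \<pi>) (Fob (At (MTm B) ?D) v)"
    using is_ext_preserved[of B ?A \<pi> v] e(1) by simp
  \<comment> \<open>Coassociativity is an equation between arrows into the twofold image, so it has
    to be tested against the extension preserved twice.\<close>
  have e2: "is_ext M (Fob (At (MTp B) (Fob F ?\<Gamma>)) (Fob (At (MTp B) ?\<Gamma>) ?A)) (Far F (Far F \<pi>)) (Fob (At (MTm B) (Fob F ?D)) (Fob (At (MTm B) ?D) v))"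
    using is_ext_preserved[of B "Fob (At (MTp B) ?\<Gamma>) ?A" "Far F \<pi>" "Fob (At (MTm B) ?D) v"] e1 by simp
  let ?t = "push M ?D v (Far (Far (Tp M) \<pi>) ?a)"
  have t: "?t \<in> Obj (Fob (Tm M) ?D)" "Fob (At (Pr M) ?D) ?t = Fob (Far (Tp M) \<pi>) (Fob (Far (Tp M) ?g) (Fob (At (MTp B) ?\<Gamma>) ?A))"
    using push_closed[OF MM G(1), of v "Far (Far (Tp M) \<pi>) ?a"] by simp_all
  \<comment> \<open>The equation for the term is the coupling of \<open>s\<close> with
    \<open>?a\<close> that \<open>push_structure\<close> assumes.\<close>
  obtain s where s: "s \<in> Arr C" "Dom C s = ?D" "Cod C s = Fob F ?D" "Far F \<pi> \<cdot>\<^bsub>C\<^esub> s = ?g \<cdot>\<^bsub>C\<^esub> \<pi>"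
    "Fob (Far (Tm M) s) (Fob (At (MTm B) ?D) v) = ?t"
    by (rule is_ext_obtain[OF e1, of "?g \<cdot>\<^bsub>C\<^esub> \<pi>" ?t]) (use t in simp_all)
  note [simp] = s(1-3)
  note S = push_structure[OF X _ e(2) refl s(1-4) _ _ A s(5)[symmetric]]
  have S1: "push M ?D v (Far (Far (Tp M) \<pi>) (At (Counit (FTp X)) ?A \<cdot>\<^bsub>Fob (Tp M) ?\<Gamma>\<^esub> ?a)) = Fob (Far (Tm M) s) (Fob (Far (Tm M) (At cu ?D)) v)"
    by (rule S(1)) simp_all
  have S2: "push M ?D v (Far (Far (Tp M) \<pi>) (At (Comult (FTp X)) ?A \<cdot>\<^bsub>Fob (Tp M) ?\<Gamma>\<^esub> ?a)) =
       Fob (Far (Tm M) s) (Fob (Far (Tm M) (At cm ?D)) (Fob (At (MTm B) (Fob F ?D)) (Fob (At (MTm B) ?D) v)))"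
    by (rule S(2)) simp_all
  have S3: "push M ?D v (Far (Far (Tp M) \<pi>) (Far (tp.fib_endo X) ?a \<cdot>\<^bsub>Fob (Tp M) ?\<Gamma>\<^esub> ?a)) =
       Fob (Far (Tm M) s) (Fob (Far (Tm M) (Far F s)) (Fob (At (MTm B) (Fob F ?D)) (Fob (At (MTm B) ?D) v)))"
    by (rule S(3)) simp_all
  have c1: "At (Counit (FTp X)) ?A \<cdot>\<^bsub>Fob (Tp M) ?\<Gamma>\<^esub> ?a = Idn (Fob (Tp M) ?\<Gamma>) ?A"
    and c2: "At (Comult (FTp X)) ?A \<cdot>\<^bsub>Fob (Tp M) ?\<Gamma>\<^esub> ?a = Far (tp.fib_endo X) ?a \<cdot>\<^bsub>Fob (Tp M) ?\<Gamma>\<^esub> ?a"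
    using EM_coalg[OF Bt] by simp_all
  note u = structure_map[OF X is_extD(1)[OF e(1)] e(2) refl s(1-4)]
  have counit: "At cu ?D \<cdot>\<^bsub>C\<^esub> s = Idn C ?D"
    by (rule is_ext_unique[OF MM e(1)]) (use S1[unfolded c1] u(1) in \<open>simp_all add: push_idn\<close>)
  have comult: "At cm ?D \<cdot>\<^bsub>C\<^esub> s = Far F s \<cdot>\<^bsub>C\<^esub> s"
    by (rule is_ext_unique[OF MM e2]) (use trans[OF sym[OF S2[unfolded c2]] S3] u(2) in simp_all)
  have Y: "Tup ?D s \<in> Obj E" by (rule EM_objI) (simp_all add: counit comult)
  have k: "Tup (Tup ?D s) (Tup X \<pi>) \<in> Arr E" by (rule EM_arrI) (use Y s(4) in simp_all)
  let ?k = "Tup (Tup ?D s) (Tup X \<pi>)"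
  have k': "Dom E ?k = Tup ?D s" "Cod E ?k = X" "Far U ?k = \<pi>" using k by simp_all
  obtain z where "z \<in> Obj (EM (FTm (Dom E ?k)))" "Fob (UTm (Dom E ?k)) z = v" "Fob (PrX (Dom E ?k)) z = Fob (Far tp.emT ?k) Bt"
    by (rule term_lift[OF k, of Bt v]) (use Y s(5) in \<open>simp_all add: k' del: EM_arr_simps\<close>)
  then show thesis using that[OF k k'(2)] k'(3) by blast
qed

text \<open>Here the coaction on the total object is given and the structure map of the type is
  sought. Full faithfulness of comprehension produces \<open>a\<close> from the coupling equation,
  and its faithfulness transfers the coalgebra laws of the coaction to \<open>a\<close>.\<close>

lemma ext_descend:
  assumes k: "k \<in> Arr E" and e: "is_ext M A (Far U k) v"
  obtains Bt z where "Bt \<in> Obj (EM (FTp (Cod E k)))" "Fob (UTp (Cod E k)) Bt = A" "z \<in> Obj (EM (FTm (Dom E k)))"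
    "Fob (PrX (Dom E k)) z = Fob (Far tp.emT k) Bt" "Fob (UTm (Dom E k)) z = v"
proof -
  let ?Y = "Dom E k" let ?X = "Cod E k" let ?D = "Fob U ?Y" let ?\<Gamma> = "Fob U ?X" let ?\<pi> = "Far U k" let ?s = "At co ?Y" let ?g = "At co ?X"
  have XY: "?X \<in> Obj E" "?Y \<in> Obj E" using k by simp_all
  have DC: "Dom C ?\<pi> = ?D" "Cod C ?\<pi> = ?\<Gamma>" using k by simp_all
  have v: "v \<in> Obj (Fob (Tm M) ?D)" "Fob (At (Pr M) ?D) v = Fob (Far (Tp M) ?\<pi>) A" and A: "A \<in> Obj (Fob (Tp M) ?\<Gamma>)"
    using is_extD[OF e] k by simp_all
  note [simp] = k v A XY
  have MM: "pre_natural_model M" by simp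
  have sq: "y \<in> Obj (Fob (Tp M) (Fob F ?\<Gamma>)) \<Longrightarrow> Fob (Far (Tp M) ?\<pi>) (Fob (Far (Tp M) ?g) y) = Fob (Far (Tp M) ?s) (Fob (Far (Tp M) (Far F ?\<pi>)) y)"
    for y using tp.sub_map(1)[OF k] by simp
  note ff = natural_model_ff[OF _ e DC]
  let ?t = "Fob (Far (Tm M) ?s) (Fob (At (MTm B) ?D) v)"
  have "\<exists>!f. f \<in> Arr (Fob (Tp M) ?\<Gamma>) \<and> Dom (Fob (Tp M) ?\<Gamma>) f = A \<and> Cod (Fob (Tp M) ?\<Gamma>) f = Fob (tp.fib_endo ?X) A \<and>
        push M ?D v (Far (Far (Tp M) ?\<pi>) f) = ?t"
    by (rule ff) (simp_all add: sq)
  then obtain a where a: "a \<in> Arr (Fob (Tp M) ?\<Gamma>)" "Dom (Fob (Tp M) ?\<Gamma>) a = A" "Cod (Fob (Tp M) ?\<Gamma>) a = Fob (tp.fib_endo ?X) A"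
     "push M ?D v (Far (Far (Tp M) ?\<pi>) a) = ?t" by blast
  have S: "push M ?D v (Far (Far (Tp M) ?\<pi>) (At (Counit (FTp ?X)) A \<cdot>\<^bsub>Fob (Tp M) ?\<Gamma>\<^esub> a)) = Fob (Far (Tm M) ?s) (Fob (Far (Tm M) (At cu ?D)) v)"
    "push M ?D v (Far (Far (Tp M) ?\<pi>) (At (Comult (FTp ?X)) A \<cdot>\<^bsub>Fob (Tp M) ?\<Gamma>\<^esub> a)) =
       Fob (Far (Tm M) ?s) (Fob (Far (Tm M) (At cm ?D)) (Fob (At (MTm B) (Fob F ?D)) (Fob (At (MTm B) ?D) v)))"
    "push M ?D v (Far (Far (Tp M) ?\<pi>) (Far (tp.fib_endo ?X) a \<cdot>\<^bsub>Fob (Tp M) ?\<Gamma>\<^esub> a)) =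
       Fob (Far (Tm M) ?s) (Fob (Far (Tm M) (Far F ?s)) (Fob (At (MTm B) (Fob F ?D)) (Fob (At (MTm B) ?D) v)))"
    by (rule push_structure[OF XY(1) _ DC(2,1), where s = ?s and v = v and A = A and a = a]; use a E_map[OF k] in simp)+
  note [simp] = a(1-3)
  \<comment> \<open>Arrows out of \<open>A\<close> with a common codomain are equal once they push
    \<open>v\<close> to the same term. The existence statement \<open>ff\<close> is used here for
    its uniqueness.\<close>
  have inj: "f = f'" if "f \<in> Arr (Fob (Tp M) ?\<Gamma>)" "f' \<in> Arr (Fob (Tp M) ?\<Gamma>)" "Dom (Fob (Tp M) ?\<Gamma>) f = A" "Dom (Fob (Tp M) ?\<Gamma>) f' = A"
    "Cod (Fob (Tp M) ?\<Gamma>) f = Cod (Fob (Tp M) ?\<Gamma>) f'" "push M ?D v (Far (Far (Tp M) ?\<pi>) f) = push M ?D v (Far (Far (Tp M) ?\<pi>) f')" for f f'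
  proof -
    have c: "Cod (Fob (Tp M) ?\<Gamma>) f' \<in> Obj (Fob (Tp M) ?\<Gamma>)" using that(2) by simp
    have pc: "push M ?D v (Far (Far (Tp M) ?\<pi>) f') \<in> Obj (Fob (Tm M) ?D)" "Fob (At (Pr M) ?D) (push M ?D v (Far (Far (Tp M) ?\<pi>) f')) = Fob (Far (Tp M) ?\<pi>) (Cod (Fob (Tp M) ?\<Gamma>) f')"
      using push_closed[OF MM _ v(1), of "Far (Far (Tp M) ?\<pi>) f'"] that(2,4) by simp_all
    have "\<exists>!x. x \<in> Arr (Fob (Tp M) ?\<Gamma>) \<and> Dom (Fob (Tp M) ?\<Gamma>) x = A \<and> Cod (Fob (Tp M) ?\<Gamma>) x = Cod (Fob (Tp M) ?\<Gamma>) f' \<and>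
        push M ?D v (Far (Far (Tp M) ?\<pi>) x) = push M ?D v (Far (Far (Tp M) ?\<pi>) f')"
      by (rule ff) (use c pc in simp_all)
    then show ?thesis using that by auto
  qed
  have c1: "At (Counit (FTp ?X)) A \<cdot>\<^bsub>Fob (Tp M) ?\<Gamma>\<^esub> a = Idn (Fob (Tp M) ?\<Gamma>) A"
  proof (rule inj)
    have "Fob (Far (Tm M) ?s) (Fob (Far (Tm M) (At cu ?D)) v) = v" by (rule tm.sub_counit(1)) simp_all
    then show "push M ?D v (Far (Far (Tp M) ?\<pi>) (At (Counit (FTp ?X)) A \<cdot>\<^bsub>Fob (Tp M) ?\<Gamma>\<^esub> a)) = push M ?D v (Far (Far (Tp M) ?\<pi>) (Idn (Fob (Tp M) ?\<Gamma>) A))"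
      unfolding S(1) by (simp add: push_idn)
  qed (simp_all add: tp.sub_counit)
  have c2: "At (Comult (FTp ?X)) A \<cdot>\<^bsub>Fob (Tp M) ?\<Gamma>\<^esub> a = Far (tp.fib_endo ?X) a \<cdot>\<^bsub>Fob (Tp M) ?\<Gamma>\<^esub> a"
  proof (rule inj)
    show "push M ?D v (Far (Far (Tp M) ?\<pi>) (At (Comult (FTp ?X)) A \<cdot>\<^bsub>Fob (Tp M) ?\<Gamma>\<^esub> a)) = push M ?D v (Far (Far (Tp M) ?\<pi>) (Far (tp.fib_endo ?X) a \<cdot>\<^bsub>Fob (Tp M) ?\<Gamma>\<^esub> a))"
      unfolding S(2,3) by (rule tm.sub_comult(1)) simp_all
  qed (simp_all add: tp.sub_comult)
  have Bt: "Tup A a \<in> Obj (EM (FTp ?X))"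
    by (rule EM_objI) (use c1 c2 in simp_all)
  obtain z where "z \<in> Obj (EM (FTm ?Y))" "Fob (UTm ?Y) z = v" "Fob (PrX ?Y) z = Fob (Far tp.emT k) (Tup A a)"
    by (rule term_lift[OF k Bt, of v]) (use Bt a(4) in simp_all)
  then show thesis using that[OF Bt] Bt by simp
qed

text \<open>The classifying arrow \<open>w\<close> is found in \<open>M\<close>. Two things remain:
  \<open>w\<close> is a map of coalgebras, tested against the image of the extension under the
  comonad, and substitution along it yields the term coalgebra \<open>y\<close> and not only its
  carrier.\<close>

lemma ext_universal:
  assumes k: "k \<in> Arr E" and Bt: "Bt \<in> Obj (EM (FTp (Cod E k)))" and z: "z \<in> Obj (EM (FTm (Dom E k)))" "Fob (PrX (Dom E k)) z = Fob (Far tp.emT k) Bt"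
    and e: "is_ext M (Fob (UTp (Cod E k)) Bt) (Far U k) (Fob (UTm (Dom E k)) z)"
    and l: "l \<in> Arr E" "Cod E l = Cod E k" and y: "y \<in> Obj (EM (FTm (Dom E l)))" "Fob (PrX (Dom E l)) y = Fob (Far tp.emT l) Bt"
  shows "\<exists>!w. w \<in> Arr E \<and> Dom E w = Dom E l \<and> Cod E w = Dom E k \<and> k \<cdot>\<^bsub>E\<^esub> w = l \<and> Fob (Far tm.emT w) z = y"
proof -
  let ?X = "Cod E k" let ?Y = "Dom E k" let ?Z = "Dom E l"
  let ?v = "Fob (UTm ?Y) z" let ?t = "Fob (UTm ?Z) y" let ?\<sigma> = "At (EM_co (FTm ?Y)) z" let ?\<tau> = "At (EM_co (FTm ?Z)) y"
  let ?A = "Fob (UTp ?X) Bt" let ?a = "At (EM_co (FTp ?X)) Bt" let ?\<pi> = "Far U k"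
  have XY: "?X \<in> Obj E" "?Y \<in> Obj E" "?Z \<in> Obj E" using k l by simp_all
  note [simp] = k l z(1) y(1) Bt XY
  have MM: "pre_natural_model M" by simp
  have Prv: "Fob (At (Pr M) (Fob U ?Y)) ?v = Fob (Far (Tp M) ?\<pi>) ?A" "Far (At (Pr M) (Fob U ?Y)) ?\<sigma> = Far (Far (Tp M) ?\<pi>) ?a"
    using arg_cong[OF z(2), of "Fob (UTp ?Y)"] arg_cong[OF z(2), of "At (EM_co (FTp ?Y))"] by simp_all
  have Prt: "Fob (At (Pr M) (Fob U ?Z)) ?t = Fob (Far (Tp M) (Far U l)) ?A" "Far (At (Pr M) (Fob U ?Z)) ?\<tau> = Far (Far (Tp M) (Far U l)) ?a"
    using arg_cong[OF y(2), of "Fob (UTp ?Z)"] arg_cong[OF y(2), of "At (EM_co (FTp ?Z))"] by simp_all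
  have e1: "is_ext M (Fob (At (MTp B) (Fob U ?X)) ?A) (Far F ?\<pi>) (Fob (At (MTm B) (Fob U ?Y)) ?v)"
    using is_ext_preserved[of B ?A ?\<pi> ?v] e by simp
  obtain w where w: "w \<in> Arr C" "Dom C w = Fob U ?Z" "Cod C w = Fob U ?Y" "?\<pi> \<cdot>\<^bsub>C\<^esub> w = Far U l" "Fob (Far (Tm M) w) ?v = ?t"
    by (rule is_ext_obtain[OF e, of "Far U l" ?t]) (use Prt in simp_all)
  note [simp] = w(1-3)
  have aw: "Far (Far (Tp M) w) (Far (Far (Tp M) ?\<pi>) ?a) = Far (Far (Tp M) (Far U l)) ?a"
    using arg_cong[OF w(4), of "\<lambda>u. Far (Far (Tp M) u) ?a"] by simp
  \<comment> \<open>The structure map of \<open>z\<close>, substituted along \<open>w\<close>, and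
    that of \<open>y\<close> start at the same term and lie over the same arrow of types. Their
    codomains then give \<open>c3\<close>.\<close>
  have st: "Far (Far (Tm M) w) ?\<sigma> = ?\<tau>"
    by (rule opfib_inj[of "At (Pr M) (Fob U ?Z)"]) (simp_all add: Prv Prt aw w(5))
  have c1: "Far F ?\<pi> \<cdot>\<^bsub>C\<^esub> (Far F w \<cdot>\<^bsub>C\<^esub> At co ?Z) = At co ?X \<cdot>\<^bsub>C\<^esub> Far U l"
  proof -
    have "Far F ?\<pi> \<cdot>\<^bsub>C\<^esub> (Far F w \<cdot>\<^bsub>C\<^esub> At co ?Z) = Far F (?\<pi> \<cdot>\<^bsub>C\<^esub> w) \<cdot>\<^bsub>C\<^esub> At co ?Z" by simp
    also have "\<dots> = Far F (Far U l) \<cdot>\<^bsub>C\<^esub> At co ?Z" by (simp only: w(4))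
    also have "\<dots> = At co ?X \<cdot>\<^bsub>C\<^esub> Far U l" using E_map[OF l(1)] by simp
    finally show ?thesis .
  qed
  have c2: "Far F ?\<pi> \<cdot>\<^bsub>C\<^esub> (At co ?Y \<cdot>\<^bsub>C\<^esub> w) = At co ?X \<cdot>\<^bsub>C\<^esub> Far U l"
  proof -
    have "Far F ?\<pi> \<cdot>\<^bsub>C\<^esub> (At co ?Y \<cdot>\<^bsub>C\<^esub> w) = At co ?X \<cdot>\<^bsub>C\<^esub> (?\<pi> \<cdot>\<^bsub>C\<^esub> w)" by (rule cmp_cong_left[OF _ E_map[OF k]]) simp_all
    then show ?thesis by (simp add: w(4))
  qed
  have "Fob (Far (Tm M) (At co ?Z)) (Fob (Far (Tm M) (Far F w)) (Fob (At (MTm B) (Fob U ?Y)) ?v)) = Fob (Far (Tm M) (At co ?Z)) (Fob (At (MTm B) (Fob U ?Z)) ?t)"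
    using arg_cong[OF w(5), of "Fob (At (MTm B) (Fob U ?Z))"] by simp
  also have "\<dots> = Fob (Far (Tm M) w) (Fob (Far (Tm M) (At co ?Y)) (Fob (At (MTm B) (Fob U ?Y)) ?v))"
    using arg_cong[OF st, of "Cod (Fob (Tm M) (Fob U ?Z))"] by simp
  finally have c3: "Fob (Far (Tm M) (At co ?Z)) (Fob (Far (Tm M) (Far F w)) (Fob (At (MTm B) (Fob U ?Y)) ?v)) = \<dots>" .
  \<comment> \<open>Both composites land in the image of the extension; \<open>c1\<close> and
    \<open>c2\<close> compare their projections, \<open>c3\<close> the terms they classify.\<close>
  have cw: "Far F w \<cdot>\<^bsub>C\<^esub> At co ?Z = At co ?Y \<cdot>\<^bsub>C\<^esub> w"
    by (rule is_ext_unique[OF MM e1]) (simp_all add: c1 c2 c3)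
  let ?w = "Tup ?Z (Tup ?Y w)"
  have W1: "?w \<in> Arr E" by (rule EM_arrI) (simp_all add: cw)
  have W2: "Dom E ?w = ?Z" "Cod E ?w = ?Y" "Far U ?w = w" using W1 by simp_all
  have W3: "k \<cdot>\<^bsub>E\<^esub> ?w = l" by (rule EM_arr_eqI[of _ W0]) (use W1 W2 w(4) in simp_all)
  have sc: "strict_comonad_map (FTm ?Y) (FTm ?Z) (Far (Tm M) w)" using tm.sub_comonad_map[OF W1 W2(2,1)] W2(3) by simp
  \<comment> \<open>A term coalgebra is determined by its term and by the type coalgebra below it,
    so no structure maps are compared here.\<close>
  have W4: "Fob (Far tm.emT ?w) z = y"
  proof (rule opfib_coalg_inj[of "FTm ?Z" "FTp ?Z" "At (Pr M) (Fob U ?Z)"])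
    have "Fob (PrX (Dom E ?w)) (Fob (Far tm.emT ?w) z) = Fob (Far tp.emT ?w) (Fob (PrX (Cod E ?w)) z)"
      by (rule PrX_natural(1)) (use W1 W2 in simp_all)
    also have "\<dots> = Fob (Far tp.emT ?w) (Fob (Far tp.emT k) Bt)" by (simp only: W2 z(2))
    also have "\<dots> = Fob (Far tp.emT (k \<cdot>\<^bsub>E\<^esub> ?w)) Bt"
      using icat_cmp[of tp.emT E ?w k] W1 W2 by (simp del: tp.emT_simps(4))
    finally show "Fob (PrX ?Z) (Fob (Far tm.emT ?w) z) = Fob (PrX ?Z) y" by (simp only: W2 W3 y(2))
    show "Fob (UTm ?Z) (Fob (Far tm.emT ?w) z) = Fob (UTm ?Z) y" using W1 W2 w(5) sc by simp
    show "Fob (Far tm.emT ?w) z \<in> Obj (EM (FTm ?Z))" using W1 W2 sc by simp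
  qed simp_all
  show ?thesis
  proof (rule ex1I[of _ ?w])
    show "?w \<in> Arr E \<and> Dom E ?w = Dom E l \<and> Cod E ?w = Dom E k \<and> k \<cdot>\<^bsub>E\<^esub> ?w = l \<and> Fob (Far tm.emT ?w) z = y"
      using W1 W2 W3 W4 by blast
  next
    fix x assume "x \<in> Arr E \<and> Dom E x = Dom E l \<and> Cod E x = Dom E k \<and> k \<cdot>\<^bsub>E\<^esub> x = l \<and> Fob (Far tm.emT x) z = y"
    then have x: "x \<in> Arr E" "Dom E x = ?Z" "Cod E x = ?Y" "k \<cdot>\<^bsub>E\<^esub> x = l" "Fob (Far tm.emT x) z = y" by auto
    have x1: "?\<pi> \<cdot>\<^bsub>C\<^esub> Far U x = Far U l" using arg_cong[OF x(4), of "Far U"] x(1-3) by simp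
    have x2: "Fob (Far (Tm M) (Far U x)) ?v = ?t" using arg_cong[OF x(5), of "Fob (UTm ?Z)"] x(1-3) by simp
    have "Far U x = w" by (rule is_ext_unique[OF MM e]) (use x(1-3) x1 x2 w in simp_all)
    then show "x = ?w" by (intro EM_arr_eqI[OF x(1) W1]) (simp_all only: x(2,3) W2)
  qed
qed

end

section \<open>The natural model of coalgebras\<close>

context nm_comonad
begin

definition "em_disp = {k \<in> Arr E. Far U k \<in> Disp M}"

lemma em_dispI: "k \<in> Arr E \<Longrightarrow> Far U k \<in> Disp M \<Longrightarrow> k \<in> em_disp"
  by (simp add: em_disp_def)

lemma em_dispD [simp]: "k \<in> em_disp \<Longrightarrow> k \<in> Arr E" "k \<in> em_disp \<Longrightarrow> Far U k \<in> Disp M"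
  by (simp_all add: em_disp_def)

lemma F_disp: "p \<in> Disp M \<Longrightarrow> Far F p \<in> Disp M"
  and F_pullback: "p \<in> Disp M \<Longrightarrow> pullback C p f p' q \<Longrightarrow> pullback C (Far F p) (Far F f) (Far F p') (Far F q)"
  using pre_nm_mor.mfun[of B] by (auto simp: display_functor_def)

text \<open>The mediating arrow in \<open>C\<close> is a map of coalgebras because the comonad
  preserves the pullback: the two composites into its image agree on both legs, each leg being a
  coalgebra map.\<close>

lemma pullback_reflect:
  assumes k: "k \<in> em_disp" "l \<in> Arr E" "k' \<in> Arr E" "q \<in> Arr E" "Cod E l = Cod E k" "Cod E k' = Dom E l" "Cod E q = Dom E k" "Dom E q = Dom E k'"
    and pb: "pullback C (Far U k) (Far U l) (Far U k') (Far U q)"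
  shows "pullback E k l k' q"
proof -
  note [simp] = k
  note Fpb = F_pullback[OF em_dispD(2)[OF k(1)] pb]
  show ?thesis
  proof (rule pullbackI)
    show "k \<cdot>\<^bsub>E\<^esub> q = l \<cdot>\<^bsub>E\<^esub> k'"
      by (rule EM_arr_eqI[of _ W0]) (use pullbackD(9)[OF pb] in simp_all)
  next
    fix a b assume ab: "a \<in> Arr E" "b \<in> Arr E" "Cod E a = Dom E l" "Cod E b = Dom E k" "Dom E a = Dom E b" "k \<cdot>\<^bsub>E\<^esub> b = l \<cdot>\<^bsub>E\<^esub> a"
    have e: "Far U k \<cdot>\<^bsub>C\<^esub> Far U b = Far U l \<cdot>\<^bsub>C\<^esub> Far U a" using arg_cong[OF ab(6), of "Far U"] ab(1-5) by simp
    obtain w where w: "w \<in> Arr C" "Dom C w = Dom C (Far U a)" "Cod C w = Dom C (Far U k')" "Far U k' \<cdot>\<^bsub>C\<^esub> w = Far U a" "Far U q \<cdot>\<^bsub>C\<^esub> w = Far U b"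
      by (rule pullback_obtain[OF pb, of "Far U a" "Far U b"]) (use ab(1-5) e in simp_all)
    let ?s = "At co (Dom E k')" let ?z = "At co (Dom E a)"
    have w': "Dom C w = Fob U (Dom E a)" "Cod C w = Fob U (Dom E k')" using w(2,3) ab(1) by simp_all
    \<comment> \<open>One computation for both legs: \<open>g\<close> is the leg and
      \<open>h\<close> the given coalgebra map that \<open>w\<close> factors through it.\<close>
    have leg: "Far F (Far U g) \<cdot>\<^bsub>C\<^esub> (Far F w \<cdot>\<^bsub>C\<^esub> ?z) = Far F (Far U g) \<cdot>\<^bsub>C\<^esub> (?s \<cdot>\<^bsub>C\<^esub> w)"
      if g: "g \<in> Arr E" "Dom E g = Dom E k'" "Far U g \<cdot>\<^bsub>C\<^esub> w = Far U h" "h \<in> Arr E" "Dom E h = Dom E a" "Cod E h = Cod E g" for g h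
    proof -
      have "Far F (Far U g) \<cdot>\<^bsub>C\<^esub> (Far F w \<cdot>\<^bsub>C\<^esub> ?z) = Far F (Far U g \<cdot>\<^bsub>C\<^esub> w) \<cdot>\<^bsub>C\<^esub> ?z" using g(1,2,4-6) w(1) w' ab(1) by simp
      also have "\<dots> = Far F (Far U h) \<cdot>\<^bsub>C\<^esub> ?z" by (simp only: g(3))
      also have "\<dots> = At co (Cod E g) \<cdot>\<^bsub>C\<^esub> (Far U g \<cdot>\<^bsub>C\<^esub> w)" using E_map[OF g(4)] g by simp
      also have "\<dots> = Far F (Far U g) \<cdot>\<^bsub>C\<^esub> (?s \<cdot>\<^bsub>C\<^esub> w)"
        by (rule cmp_cong_left) (use E_map[OF g(1)] g(1,2) w(1) w' in simp_all)
      finally show ?thesis .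
    qed
    have cw: "Far F w \<cdot>\<^bsub>C\<^esub> ?z = ?s \<cdot>\<^bsub>C\<^esub> w"
      by (rule pullback_unique[OF _ Fpb]) (use w(1) w' ab(1-5) leg[of k' a] leg[of q b] w(4,5) in simp_all)
    have W1: "Tup (Dom E a) (Tup (Dom E k') w) \<in> Arr E" by (rule EM_arrI) (use w(1) w' ab(1) cw in simp_all)
    have W2: "k' \<cdot>\<^bsub>E\<^esub> Tup (Dom E a) (Tup (Dom E k') w) = a" by (rule EM_arr_eqI[of _ W0]) (use W1 w ab(1-5) in simp_all)
    have W3: "q \<cdot>\<^bsub>E\<^esub> Tup (Dom E a) (Tup (Dom E k') w) = b" by (rule EM_arr_eqI[of _ W0]) (use W1 w ab(1-5) in simp_all)
    show "\<exists>w. w \<in> Arr E \<and> Dom E w = Dom E a \<and> Cod E w = Dom E k' \<and> k' \<cdot>\<^bsub>E\<^esub> w = a \<and> q \<cdot>\<^bsub>E\<^esub> w = b"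
      by (rule exI[of _ "Tup (Dom E a) (Tup (Dom E k') w)"]) (use W1 W2 W3 in simp)
  next
    fix w w' assume w: "w \<in> Arr E" "w' \<in> Arr E" "Dom E w = Dom E w'" "Cod E w = Dom E k'" "Cod E w' = Dom E k'" "k' \<cdot>\<^bsub>E\<^esub> w = k' \<cdot>\<^bsub>E\<^esub> w'" "q \<cdot>\<^bsub>E\<^esub> w = q \<cdot>\<^bsub>E\<^esub> w'"
    have "Far U w = Far U w'"
      by (rule pullback_unique[OF _ pb]) (use w(1-5) arg_cong[OF w(6), of "Far U"] arg_cong[OF w(7), of "Far U"] in simp_all)
    then show "w = w'" by (intro EM_arr_eqI[OF w(1,2)]) (simp_all add: w)
  qed simp_all
qed

text \<open>The two coactions at hand induce one on the pullback, because its image under the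
  comonad is a pullback. The counit law is tested on the legs, coassociativity on their twofold
  images.\<close>

lemma pullback_create:
  assumes k: "k \<in> em_disp" and l: "l \<in> Arr E" "Cod E l = Cod E k"
  obtains k' q where "k' \<in> em_disp" "pullback E k l k' q" "pullback C (Far U k) (Far U l) (Far U k') (Far U q)"
proof -
  note [simp] = k l
  let ?pb = "Pb M (Far U k) (Far U l)"
  obtain p q where p: "p \<in> Disp M" and pb: "pullback C (Far U k) (Far U l) p q"
    using display_category.pb_disp[of M "Far U k" "Far U l"] display_category.pb[of M "Far U k" "Far U l"] by simp
  note d = pullbackD[OF pb]
  let ?D = "Dom C p"
  have dd: "Cod C p = Fob U (Dom E l)" "Cod C q = Fob U (Dom E k)" using d(6,7) by simp_all
  note [simp] = d(3,4,8) dd p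
  have P: "?D \<in> Obj C" by simp
  note Fpb = F_pullback[OF em_dispD(2)[OF k] pb]
  note FFpb = F_pullback[OF F_disp[OF em_dispD(2)[OF k]] Fpb]
  have e: "Far F (Far U k) \<cdot>\<^bsub>C\<^esub> (At co (Dom E k) \<cdot>\<^bsub>C\<^esub> q) = Far F (Far U l) \<cdot>\<^bsub>C\<^esub> (At co (Dom E l) \<cdot>\<^bsub>C\<^esub> p)"
  proof -
    have "Far F (Far U k) \<cdot>\<^bsub>C\<^esub> (At co (Dom E k) \<cdot>\<^bsub>C\<^esub> q) = At co (Cod E k) \<cdot>\<^bsub>C\<^esub> (Far U k \<cdot>\<^bsub>C\<^esub> q)"
      by (rule cmp_cong_left) (use E_map[of k] in simp_all)
    also have "\<dots> = At co (Cod E l) \<cdot>\<^bsub>C\<^esub> (Far U l \<cdot>\<^bsub>C\<^esub> p)" by (simp add: d(9))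
    also have "\<dots> = Far F (Far U l) \<cdot>\<^bsub>C\<^esub> (At co (Dom E l) \<cdot>\<^bsub>C\<^esub> p)"
      by (rule cmp_cong_left) (use E_map[of l] in simp_all)
    finally show ?thesis .
  qed
  obtain s where s: "s \<in> Arr C" "Dom C s = ?D" "Cod C s = Fob F ?D" "Far F p \<cdot>\<^bsub>C\<^esub> s = At co (Dom E l) \<cdot>\<^bsub>C\<^esub> p" "Far F q \<cdot>\<^bsub>C\<^esub> s = At co (Dom E k) \<cdot>\<^bsub>C\<^esub> q"
    by (rule pullback_obtain[OF Fpb, of "At co (Dom E l) \<cdot>\<^bsub>C\<^esub> p" "At co (Dom E k) \<cdot>\<^bsub>C\<^esub> q"]) (use e in simp_all)
  note [simp] = s(1-3)
  have u1: "p \<cdot>\<^bsub>C\<^esub> (At cu ?D \<cdot>\<^bsub>C\<^esub> s) = p" "Far F (Far F p) \<cdot>\<^bsub>C\<^esub> (At cm ?D \<cdot>\<^bsub>C\<^esub> s) = Far F (Far F p) \<cdot>\<^bsub>C\<^esub> (Far F s \<cdot>\<^bsub>C\<^esub> s)"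
    by (rule structure_map[of "Dom E l"]; use s(4) in simp)+
  have u2: "q \<cdot>\<^bsub>C\<^esub> (At cu ?D \<cdot>\<^bsub>C\<^esub> s) = q" "Far F (Far F q) \<cdot>\<^bsub>C\<^esub> (At cm ?D \<cdot>\<^bsub>C\<^esub> s) = Far F (Far F q) \<cdot>\<^bsub>C\<^esub> (Far F s \<cdot>\<^bsub>C\<^esub> s)"
    by (rule structure_map[of "Dom E k"]; use s(5) in simp)+
  have counit: "At cu ?D \<cdot>\<^bsub>C\<^esub> s = Idn C ?D"
    by (rule pullback_unique[OF _ pb]) (use u1 u2 in simp_all)
  have comult: "At cm ?D \<cdot>\<^bsub>C\<^esub> s = Far F s \<cdot>\<^bsub>C\<^esub> s"
    by (rule pullback_unique[OF _ FFpb]) (use u1 u2 in simp_all)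
  have Y: "Tup ?D s \<in> Obj E" by (rule EM_objI) (simp_all add: counit comult)
  let ?k = "Tup (Tup ?D s) (Tup (Dom E l) p)" let ?q = "Tup (Tup ?D s) (Tup (Dom E k) q)"
  have K: "?k \<in> Arr E" by (rule EM_arrI) (use Y s(4) in simp_all)
  have Q: "?q \<in> Arr E" by (rule EM_arrI) (use Y s(5) in simp_all)
  have D: "?k \<in> em_disp" by (rule em_dispI) (use K in simp_all)
  have pb': "pullback C (Far U k) (Far U l) (Far U ?k) (Far U ?q)" using K Q pb by simp
  have "pullback E k l ?k ?q"
    by (rule pullback_reflect[OF _ _ _ _ _ _ _ _ pb']) (use K Q in simp_all)
  then show thesis using that D pb' by blast
qed

text \<open>Any pullback of coalgebras is isomorphic to the created one, whose underlying square is
  a pullback by construction.\<close>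

lemma pullback_forget:
  assumes k: "k \<in> em_disp" and pb: "pullback E k l k' q"
  shows "pullback C (Far U k) (Far U l) (Far U k') (Far U q)"
proof -
  note d = pullbackD[OF pb]
  obtain k1 q1 where *: "k1 \<in> em_disp" "pullback E k l k1 q1" "pullback C (Far U k) (Far U l) (Far U k1) (Far U q1)"
    by (rule pullback_create[OF k d(2,5)])
  note d1 = pullbackD[OF *(2)]
  obtain i where i: "iso E i" "Dom E i = Dom E k'" "Cod E i = Dom E k1" "k1 \<cdot>\<^bsub>E\<^esub> i = k'" "q1 \<cdot>\<^bsub>E\<^esub> i = q"
    by (rule pullback_compare[OF _ *(2) pb]) simp_all
  have ia: "i \<in> Arr E" using i(1) by (simp add: iso_def)
  have Ui: "iso C (Far U i)" by (rule iso_Far) (use i in simp_all)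
  have "pullback C (Far U k) (Far U l) (Far U k1 \<cdot>\<^bsub>C\<^esub> Far U i) (Far U q1 \<cdot>\<^bsub>C\<^esub> Far U i)"
    by (rule pullback_iso[OF _ *(3) Ui]) (use ia i(3) d1(1-8) in simp_all)
  moreover have "Far U k1 \<cdot>\<^bsub>C\<^esub> Far U i = Far U k'" "Far U q1 \<cdot>\<^bsub>C\<^esub> Far U i = Far U q"
    using arg_cong[OF i(4), of "Far U"] arg_cong[OF i(5), of "Far U"] ia i(3) d1(1-8) by simp_all
  ultimately show ?thesis by simp
qed

text \<open>Neither pullbacks nor extensions of coalgebras are determined by the chosen ones of \<open>M\<close>
  on the nose, so they are selected by \<open>SOME\<close>.\<close>

definition em_Pb where
  "em_Pb k l = (if k \<in> em_disp \<and> l \<in> Arr E \<and> Cod E l = Cod E k then (SOME r. fst r \<in> em_disp \<and> pullback E k l (fst r) (snd r)) else undefined)"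

definition em_ext where
  "em_ext X Bt = (SOME r. fst r \<in> Arr E \<and> Cod E (fst r) = X \<and> snd r \<in> Obj (EM (FTm (Dom E (fst r)))) \<and>
     Fob (PrX (Dom E (fst r))) (snd r) = Fob (Far tp.emT (fst r)) Bt \<and> Far U (fst r) = Pj M (Fob U X) (Fob (UTp X) Bt) \<and>
     Fob (UTm (Dom E (fst r))) (snd r) = Vr M (Fob U X) (Fob (UTp X) Bt))"

definition EM_nm :: "'a univ nm" where
  "EM_nm = \<lparr>UCat = E, Disp = em_disp, Pb = em_Pb, Tp = tp.emT, Tm = tm.emT, Pr = emPr,
     Pj = (\<lambda>X Bt. if X \<in> Obj E \<and> Bt \<in> Obj (EM (FTp X)) then fst (em_ext X Bt) else undefined),
     Vr = (\<lambda>X Bt. if X \<in> Obj E \<and> Bt \<in> Obj (EM (FTp X)) then snd (em_ext X Bt) else undefined)\<rparr>"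

lemma EM_nm_simps [simp]: "UCat EM_nm = E" "Disp EM_nm = em_disp" "Tp EM_nm = tp.emT" "Tm EM_nm = tm.emT" "Pr EM_nm = emPr"
  by (simp_all add: EM_nm_def)

text \<open>\<open>ext_lift\<close>, applied to the chosen extension of \<open>M\<close>, supplies
  the witness for \<open>SOME\<close>. In particular the forgetful functor takes chosen extensions
  to chosen ones strictly, although their coalgebra structure is only selected.\<close>

lemma em_PjVr:
  assumes X: "X \<in> Obj E" and Bt: "Bt \<in> Obj (EM (FTp X))"
  shows "Pj EM_nm X Bt \<in> Arr E" "Cod E (Pj EM_nm X Bt) = X" "Vr EM_nm X Bt \<in> Obj (EM (FTm (Dom E (Pj EM_nm X Bt))))"
    "Fob (PrX (Dom E (Pj EM_nm X Bt))) (Vr EM_nm X Bt) = Fob (Far tp.emT (Pj EM_nm X Bt)) Bt"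
    "Far U (Pj EM_nm X Bt) = Pj M (Fob U X) (Fob (UTp X) Bt)" "Fob (UTm (Dom E (Pj EM_nm X Bt))) (Vr EM_nm X Bt) = Vr M (Fob U X) (Fob (UTp X) Bt)"
proof -
  have "is_ext M (Fob (UTp X) Bt) (Pj M (Fob U X) (Fob (UTp X) Bt)) (Vr M (Fob U X) (Fob (UTp X) Bt))"
    by (rule is_ext_chosen) (use X Bt in simp_all)
  from ext_lift[OF X Bt this] obtain k z where kz: "k \<in> Arr E" "Cod E k = X" "z \<in> Obj (EM (FTm (Dom E k)))" "Fob (PrX (Dom E k)) z = Fob (Far tp.emT k) Bt"
    "Far U k = Pj M (Fob U X) (Fob (UTp X) Bt)" "Fob (UTm (Dom E k)) z = Vr M (Fob U X) (Fob (UTp X) Bt)"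
    using X Bt by (metis Pj_simps(2) W_simps(1) nm_pre W0 W0_simps(1) EM_forget_simps fctr_EM_forget fct_simps(1) tp.comonad_fib tp.fib_comonad_simps(1))
  have "fst (k, z) \<in> Arr E \<and> Cod E (fst (k, z)) = X \<and> snd (k, z) \<in> Obj (EM (FTm (Dom E (fst (k, z))))) \<and>
     Fob (PrX (Dom E (fst (k, z)))) (snd (k, z)) = Fob (Far tp.emT (fst (k, z))) Bt \<and> Far U (fst (k, z)) = Pj M (Fob U X) (Fob (UTp X) Bt) \<and>
     Fob (UTm (Dom E (fst (k, z)))) (snd (k, z)) = Vr M (Fob U X) (Fob (UTp X) Bt)"
    unfolding fst_conv snd_conv using kz by blast
  from someI[of "\<lambda>r. fst r \<in> Arr E \<and> Cod E (fst r) = X \<and> snd r \<in> Obj (EM (FTm (Dom E (fst r)))) \<and>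
     Fob (PrX (Dom E (fst r))) (snd r) = Fob (Far tp.emT (fst r)) Bt \<and> Far U (fst r) = Pj M (Fob U X) (Fob (UTp X) Bt) \<and>
     Fob (UTm (Dom E (fst r))) (snd r) = Vr M (Fob U X) (Fob (UTp X) Bt)", OF this, folded em_ext_def]
  have r: "fst (em_ext X Bt) \<in> Arr E \<and> Cod E (fst (em_ext X Bt)) = X \<and> snd (em_ext X Bt) \<in> Obj (EM (FTm (Dom E (fst (em_ext X Bt))))) \<and>
     Fob (PrX (Dom E (fst (em_ext X Bt)))) (snd (em_ext X Bt)) = Fob (Far tp.emT (fst (em_ext X Bt))) Bt \<and> Far U (fst (em_ext X Bt)) = Pj M (Fob U X) (Fob (UTp X) Bt) \<and>
     Fob (UTm (Dom E (fst (em_ext X Bt)))) (snd (em_ext X Bt)) = Vr M (Fob U X) (Fob (UTp X) Bt)" .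
  have eq: "Pj EM_nm X Bt = fst (em_ext X Bt)" "Vr EM_nm X Bt = snd (em_ext X Bt)" using X Bt by (simp_all add: EM_nm_def)
  show "Pj EM_nm X Bt \<in> Arr E" "Cod E (Pj EM_nm X Bt) = X" "Vr EM_nm X Bt \<in> Obj (EM (FTm (Dom E (Pj EM_nm X Bt))))"
    "Fob (PrX (Dom E (Pj EM_nm X Bt))) (Vr EM_nm X Bt) = Fob (Far tp.emT (Pj EM_nm X Bt)) Bt"
    "Far U (Pj EM_nm X Bt) = Pj M (Fob U X) (Fob (UTp X) Bt)" "Fob (UTm (Dom E (Pj EM_nm X Bt))) (Vr EM_nm X Bt) = Vr M (Fob U X) (Fob (UTp X) Bt)"
    unfolding eq using r by blast+
qed

lemma em_PjVr_ext:
  assumes X: "X \<in> Obj E" and Bt: "Bt \<in> Obj (EM (FTp X))"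
  shows "is_ext M (Fob (UTp (Cod E (Pj EM_nm X Bt))) Bt) (Far U (Pj EM_nm X Bt)) (Fob (UTm (Dom E (Pj EM_nm X Bt))) (Vr EM_nm X Bt))"
  unfolding em_PjVr(2,5,6)[OF X Bt] by (rule is_ext_chosen) (use X Bt in simp_all)

lemma display_category_EM_nm: "display_category EM_nm"
proof (rule display_category.intro)
  fix p f assume "p \<in> Disp EM_nm" "f \<in> Arr (UCat EM_nm)" "Cod (UCat EM_nm) f = Cod (UCat EM_nm) p"
  then have h: "p \<in> em_disp" "f \<in> Arr E" "Cod E f = Cod E p" by simp_all
  obtain k' q where "k' \<in> em_disp" "pullback E p f k' q" by (rule pullback_create[OF h])
  then have "fst (k', q) \<in> em_disp \<and> pullback E p f (fst (k', q)) (snd (k', q))" by simp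
  from someI[of "\<lambda>r. fst r \<in> em_disp \<and> pullback E p f (fst r) (snd r)", OF this]
  have "fst (em_Pb p f) \<in> em_disp \<and> pullback E p f (fst (em_Pb p f)) (snd (em_Pb p f))" using h by (simp add: em_Pb_def)
  then show "fst (Pb EM_nm p f) \<in> Disp EM_nm" "pullback (UCat EM_nm) p f (fst (Pb EM_nm p f)) (snd (Pb EM_nm p f))" by (simp_all add: EM_nm_def)
next
  fix p i assume "p \<in> Disp EM_nm" "iso (UCat EM_nm) i"
  then have h: "p \<in> em_disp" "iso E i" "i \<in> Arr E" by (simp_all add: iso_def)
  have Ui: "iso C (Far U i)" by (rule iso_Far) (use h in simp_all)
  have D: "display_category M" by simp
  show "Dom (UCat EM_nm) i = Cod (UCat EM_nm) p \<Longrightarrow> i \<cdot>\<^bsub>UCat EM_nm\<^esub> p \<in> Disp EM_nm"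
    using h display_category.iso_disp[OF D _ Ui, of "Far U p"] by (simp add: em_dispI)
  show "Cod (UCat EM_nm) i = Dom (UCat EM_nm) p \<Longrightarrow> p \<cdot>\<^bsub>UCat EM_nm\<^esub> i \<in> Disp EM_nm"
    using h display_category.disp_iso[OF D _ Ui, of "Far U p"] by (simp add: em_dispI)
next
  fix p f assume "\<not> (p \<in> Disp EM_nm \<and> f \<in> Arr (UCat EM_nm) \<and> Cod (UCat EM_nm) f = Cod (UCat EM_nm) p)"
  then have "\<not> (p \<in> em_disp \<and> f \<in> Arr E \<and> Cod E f = Cod E p)" by simp
  then have "em_Pb p f = undefined" unfolding em_Pb_def by (rule if_not_P)
  then show "Pb EM_nm p f = undefined" by (simp add: EM_nm_def)
qed auto

lemma pre_natural_model_EM_nm [simp]: "pre_natural_model EM_nm"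
proof (rule pre_natural_model.intro)
  fix X assume "X \<in> Obj (UCat EM_nm)"
  then have X: "X \<in> Obj E" by simp
  show "discrete_opfibration (At (Pr EM_nm) X)" using X PrX_opfib by simp
  fix Bt assume "Bt \<in> Obj (Fob (Tp EM_nm) X)"
  then have Bt: "Bt \<in> Obj (EM (FTp X))" using X by simp
  note p = em_PjVr[OF X Bt]
  show "Pj EM_nm X Bt \<in> Disp EM_nm \<and> Cod (UCat EM_nm) (Pj EM_nm X Bt) = X"
    using p(1,2,5) X Bt by (simp add: em_dispI)
  show "Vr EM_nm X Bt \<in> Obj (Fob (Tm EM_nm) (ctx_ext EM_nm X Bt)) \<and>
      Fob (At (Pr EM_nm) (ctx_ext EM_nm X Bt)) (Vr EM_nm X Bt) = Fob (Far (Tp EM_nm) (Pj EM_nm X Bt)) Bt"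
    using p(1,3,4) unfolding ctx_ext_def by (simp del: tp.emT_simps(4))
  fix u D t assume "u \<in> hom (UCat EM_nm) D X" "t \<in> Obj (Fob (Tm EM_nm) D)" "Fob (At (Pr EM_nm) D) t = Fob (Far (Tp EM_nm) u) Bt"
  then have u: "u \<in> Arr E" "Dom E u = D" "Cod E u = X" "t \<in> Obj (Fob (Tm EM_nm) D)" "Fob (At (Pr EM_nm) D) t = Fob (Far tp.emT u) Bt"
    by (simp_all add: hom_def)
  have D: "D \<in> Obj E" using u(1,2) category.dom_closed[of E u] by simp
  have "\<exists>!w. w \<in> Arr E \<and> Dom E w = Dom E u \<and> Cod E w = Dom E (Pj EM_nm X Bt) \<and> Pj EM_nm X Bt \<cdot>\<^bsub>E\<^esub> w = u \<and> Fob (Far tm.emT w) (Vr EM_nm X Bt) = t"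
    by (rule ext_universal[OF p(1) _ p(3) p(4) em_PjVr_ext[OF X Bt]]) (use u D p(2) Bt in \<open>simp_all del: tp.emT_simps(4)\<close>)
  then show "\<exists>!w. w \<in> hom (UCat EM_nm) D (ctx_ext EM_nm X Bt) \<and> Pj EM_nm X Bt \<cdot>\<^bsub>UCat EM_nm\<^esub> w = u \<and> Fob (Far (Tm EM_nm) w) (Vr EM_nm X Bt) = t"
    using u(2) by (simp add: hom_def ctx_ext_def del: tm.emT_simps(4))
next
  fix X Bt assume "\<not> (X \<in> Obj (UCat EM_nm) \<and> Bt \<in> Obj (Fob (Tp EM_nm) X))"
  then show "Pj EM_nm X Bt = undefined \<and> Vr EM_nm X Bt = undefined" by (auto simp: EM_nm_def)
qed (simp_all add: display_category_EM_nm)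

text \<open>Whether coalgebra data form an extension can be decided on the underlying data in
  \<open>M\<close>. This recognises both arbitrary displays of coalgebras and images under lifted
  morphisms.\<close>

lemma is_ext_EM_nm:
  assumes k: "k \<in> Arr E" and Bt: "Bt \<in> Obj (EM (FTp (Cod E k)))" and z: "z \<in> Obj (EM (FTm (Dom E k)))" "Fob (PrX (Dom E k)) z = Fob (Far tp.emT k) Bt"
    and e: "is_ext M (Fob (UTp (Cod E k)) Bt) (Far U k) (Fob (UTm (Dom E k)) z)"
  shows "is_ext EM_nm Bt k z"
  unfolding is_ext_def
proof (intro conjI allI impI)
  fix l y assume "l \<in> Arr (UCat EM_nm) \<and> Cod (UCat EM_nm) l = Cod (UCat EM_nm) k \<and> y \<in> Obj (Fob (Tm EM_nm) (Dom (UCat EM_nm) l)) \<and>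
       Fob (At (Pr EM_nm) (Dom (UCat EM_nm) l)) y = Fob (Far (Tp EM_nm) l) Bt"
  then have l0: "l \<in> Arr E" "Cod E l = Cod E k" "y \<in> Obj (Fob tm.emT (Dom E l))" "Fob (At emPr (Dom E l)) y = Fob (Far tp.emT l) Bt"
    unfolding EM_nm_simps by blast+
  then have l: "l \<in> Arr E" "Cod E l = Cod E k" "y \<in> Obj (EM (FTm (Dom E l)))" "Fob (PrX (Dom E l)) y = Fob (Far tp.emT l) Bt"
    by simp_all
  show "\<exists>!w. w \<in> Arr (UCat EM_nm) \<and> Dom (UCat EM_nm) w = Dom (UCat EM_nm) l \<and> Cod (UCat EM_nm) w = Dom (UCat EM_nm) k \<and>
            k \<cdot>\<^bsub>UCat EM_nm\<^esub> w = l \<and> Fob (Far (Tm EM_nm) w) z = y"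
    unfolding EM_nm_simps by (rule ext_universal[OF k Bt z e l])
qed (use k Bt z in \<open>simp_all del: tp.emT_simps(4)\<close>)

text \<open>The forgetful functor on terms maps lifts to lifts, because it commutes with the
  projections to types; hence it commutes with pushforward.\<close>

lemma push_EM_nm:
  assumes Y: "Y \<in> Obj E" and z: "z \<in> Obj (EM (FTm Y))" and h: "h \<in> Arr (EM (FTp Y))" "Dom (EM (FTp Y)) h = Fob (PrX Y) z"
  shows "push EM_nm Y z h \<in> Obj (EM (FTm Y))" "Fob (PrX Y) (push EM_nm Y z h) = Cod (EM (FTp Y)) h"
    "Fob (UTm Y) (push EM_nm Y z h) = push M (Fob U Y) (Fob (UTm Y) z) (Far (UTp Y) h)"
proof -
  note [simp] = Y z h
  show "push EM_nm Y z h \<in> Obj (EM (FTm Y))" "Fob (PrX Y) (push EM_nm Y z h) = Cod (EM (FTp Y)) h"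
    using push_closed[of EM_nm Y z h] by simp_all
  obtain g where g: "g \<in> Arr (EM (FTm Y))" "Dom (EM (FTm Y)) g = z" "Far (PrX Y) g = h" "Cod (EM (FTm Y)) g = push EM_nm Y z h"
    by (rule push[of EM_nm Y z h]) simp_all
  have "push M (Fob U Y) (Fob (UTm Y) z) (Far (UTp Y) h) = Cod (Fob (Tm M) (Fob U Y)) (Far (UTm Y) g)"
    by (rule push_eq) (use g(1,2) arg_cong[OF g(3), of "Far (UTp Y)"] in simp_all)
  then show "Fob (UTm Y) (push EM_nm Y z h) = push M (Fob U Y) (Fob (UTm Y) z) (Far (UTp Y) h)" using g(1,4) by simp
qed

text \<open>Full faithfulness in \<open>M\<close> yields the underlying arrow \<open>f\<close>. It
  is a map of coalgebras by the same principle once more: the two sides of the required square push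
  \<open>?v\<close> to the same term \<open>?u\<close>, so they coincide.\<close>

lemma EM_nm_full_faithful:
  assumes k: "k \<in> Arr E" and Bt: "Bt \<in> Obj (EM (FTp (Cod E k)))" and z: "z \<in> Obj (EM (FTm (Dom E k)))" "Fob (PrX (Dom E k)) z = Fob (Far tp.emT k) Bt"
    and e: "is_ext M (Fob (UTp (Cod E k)) Bt) (Far U k) (Fob (UTm (Dom E k)) z)"
    and Bt': "Bt' \<in> Obj (EM (FTp (Cod E k)))" and t: "t \<in> Obj (EM (FTm (Dom E k)))" "Fob (PrX (Dom E k)) t = Fob (Far tp.emT k) Bt'"
  shows "\<exists>!f. f \<in> Arr (EM (FTp (Cod E k))) \<and> Dom (EM (FTp (Cod E k))) f = Bt \<and> Cod (EM (FTp (Cod E k))) f = Bt' \<and>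
     push EM_nm (Dom E k) z (Far (Far tp.emT k) f) = t"
proof -
  let ?X = "Cod E k" let ?Y = "Dom E k" let ?\<pi> = "Far U k" let ?D = "Fob U ?Y" let ?\<Gamma> = "Fob U ?X"
  let ?A = "Fob (UTp ?X) Bt" let ?a = "At (EM_co (FTp ?X)) Bt" let ?A' = "Fob (UTp ?X) Bt'" let ?a' = "At (EM_co (FTp ?X)) Bt'"
  let ?v = "Fob (UTm ?Y) z" let ?t = "Fob (UTm ?Y) t" let ?\<sigma> = "At (EM_co (FTm ?Y)) z" let ?\<tau> = "At (EM_co (FTm ?Y)) t"
  have XY: "?X \<in> Obj E" "?Y \<in> Obj E" using k by simp_all
  note [simp] = k Bt z(1) Bt' t(1) XY
  have MM: "pre_natural_model M" by simp
  have G: "?D \<in> Obj C" by simp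
  have DC: "Dom C ?\<pi> = ?D" "Cod C ?\<pi> = ?\<Gamma>" by simp_all
  have Prv: "Fob (At (Pr M) ?D) ?v = Fob (Far (Tp M) ?\<pi>) ?A" "Far (At (Pr M) ?D) ?\<sigma> = Far (Far (Tp M) ?\<pi>) ?a"
    using arg_cong[OF z(2), of "Fob (UTp ?Y)"] arg_cong[OF z(2), of "At (EM_co (FTp ?Y))"] by simp_all
  have Prt: "Fob (At (Pr M) ?D) ?t = Fob (Far (Tp M) ?\<pi>) ?A'" "Far (At (Pr M) ?D) ?\<tau> = Far (Far (Tp M) ?\<pi>) ?a'"
    using arg_cong[OF t(2), of "Fob (UTp ?Y)"] arg_cong[OF t(2), of "At (EM_co (FTp ?Y))"] by simp_all
  note [simp] = Prv Prt
  note ff = natural_model_ff[OF _ e DC]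
  note s = tp.sub_map[OF k] tm.sub_map[OF k]
  have "\<exists>!f. f \<in> Arr (Fob (Tp M) ?\<Gamma>) \<and> Dom (Fob (Tp M) ?\<Gamma>) f = ?A \<and> Cod (Fob (Tp M) ?\<Gamma>) f = ?A' \<and> push M ?D ?v (Far (Far (Tp M) ?\<pi>) f) = ?t"
    by (rule ff) simp_all
  then obtain f where f: "f \<in> Arr (Fob (Tp M) ?\<Gamma>)" "Dom (Fob (Tp M) ?\<Gamma>) f = ?A" "Cod (Fob (Tp M) ?\<Gamma>) f = ?A'" "push M ?D ?v (Far (Far (Tp M) ?\<pi>) f) = ?t"
    and f_un: "\<And>x. x \<in> Arr (Fob (Tp M) ?\<Gamma>) \<Longrightarrow> Dom (Fob (Tp M) ?\<Gamma>) x = ?A \<Longrightarrow> Cod (Fob (Tp M) ?\<Gamma>) x = ?A' \<Longrightarrow> push M ?D ?v (Far (Far (Tp M) ?\<pi>) x) = ?t \<Longrightarrow> x = f"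
    by blast
  note [simp] = f(1-3)
  obtain g where g: "g \<in> Arr (Fob (Tm M) ?D)" "Dom (Fob (Tm M) ?D) g = ?v" "Far (At (Pr M) ?D) g = Far (Far (Tp M) ?\<pi>) f" "Cod (Fob (Tm M) ?D) g = ?t"
    by (rule push[of M ?D ?v "Far (Far (Tp M) ?\<pi>) f"]) (use f(4) in simp_all)
  note [simp] = g
  let ?u = "Fob (Far (Tm M) (At co ?Y)) (Fob (At (MTm B) ?D) ?t)"
  \<comment> \<open>The lift of one side of the square is the lift \<open>g\<close> of
    \<open>f\<close> followed by the structure map of \<open>t\<close>; in the next step it is the
    structure map of \<open>z\<close> followed by the image of \<open>g\<close>. Both end at
    \<open>?u\<close>.\<close>
  have 1: "push M ?D ?v (Far (Far (Tp M) ?\<pi>) (?a' \<cdot>\<^bsub>Fob (Tp M) ?\<Gamma>\<^esub> f)) = Cod (Fob (Tm M) ?D) (?\<tau> \<cdot>\<^bsub>Fob (Tm M) ?D\<^esub> g)"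
    by (rule push_eq[OF MM G]) simp_all
  have 2: "push M ?D ?v (Far (Far (Tp M) ?\<pi>) (Far (tp.fib_endo ?X) f \<cdot>\<^bsub>Fob (Tp M) ?\<Gamma>\<^esub> ?a))
     = Cod (Fob (Tm M) ?D) (Far (Far (Tm M) (At co ?Y)) (Far (At (MTm B) ?D) g) \<cdot>\<^bsub>Fob (Tm M) ?D\<^esub> ?\<sigma>)"
    by (rule push_eq[OF MM G]) (simp_all add: s)
  have "\<exists>!x. x \<in> Arr (Fob (Tp M) ?\<Gamma>) \<and> Dom (Fob (Tp M) ?\<Gamma>) x = ?A \<and> Cod (Fob (Tp M) ?\<Gamma>) x = Fob (tp.fib_endo ?X) ?A' \<and> push M ?D ?v (Far (Far (Tp M) ?\<pi>) x) = ?u"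
    by (rule ff) (simp_all add: s)
  moreover have "?a' \<cdot>\<^bsub>Fob (Tp M) ?\<Gamma>\<^esub> f \<in> Arr (Fob (Tp M) ?\<Gamma>) \<and> Dom (Fob (Tp M) ?\<Gamma>) (?a' \<cdot>\<^bsub>Fob (Tp M) ?\<Gamma>\<^esub> f) = ?A \<and> Cod (Fob (Tp M) ?\<Gamma>) (?a' \<cdot>\<^bsub>Fob (Tp M) ?\<Gamma>\<^esub> f) = Fob (tp.fib_endo ?X) ?A' \<and>
      push M ?D ?v (Far (Far (Tp M) ?\<pi>) (?a' \<cdot>\<^bsub>Fob (Tp M) ?\<Gamma>\<^esub> f)) = ?u"
    unfolding 1 by simp
  moreover have "Far (tp.fib_endo ?X) f \<cdot>\<^bsub>Fob (Tp M) ?\<Gamma>\<^esub> ?a \<in> Arr (Fob (Tp M) ?\<Gamma>) \<and> Dom (Fob (Tp M) ?\<Gamma>) (Far (tp.fib_endo ?X) f \<cdot>\<^bsub>Fob (Tp M) ?\<Gamma>\<^esub> ?a) = ?A \<and>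
      Cod (Fob (Tp M) ?\<Gamma>) (Far (tp.fib_endo ?X) f \<cdot>\<^bsub>Fob (Tp M) ?\<Gamma>\<^esub> ?a) = Fob (tp.fib_endo ?X) ?A' \<and>
      push M ?D ?v (Far (Far (Tp M) ?\<pi>) (Far (tp.fib_endo ?X) f \<cdot>\<^bsub>Fob (Tp M) ?\<Gamma>\<^esub> ?a)) = ?u"
    unfolding 2 by simp
  ultimately have eq: "Far (tp.fib_endo ?X) f \<cdot>\<^bsub>Fob (Tp M) ?\<Gamma>\<^esub> ?a = ?a' \<cdot>\<^bsub>Fob (Tp M) ?\<Gamma>\<^esub> f" by blast
  let ?f = "Tup Bt (Tup Bt' f)"
  have F1: "?f \<in> Arr (EM (FTp ?X))" by (rule EM_arrI) (use eq in simp_all)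
  then have F2: "Dom (EM (FTp ?X)) ?f = Bt" "Cod (EM (FTp ?X)) ?f = Bt'" "Far (UTp ?X) ?f = f" by simp_all
  have UT: "Fob (UTm ?Y) (push EM_nm ?Y z (Far (Far tp.emT k) x)) = push M ?D ?v (Far (Far (Tp M) ?\<pi>) (Far (UTp ?X) x))"
    if "x \<in> Arr (EM (FTp ?X))" "Dom (EM (FTp ?X)) x = Bt" for x
    using push_EM_nm(3)[OF XY(2) z(1), of "Far (Far tp.emT k) x"] z(2) that by simp
  \<comment> \<open>Only the underlying term and the type coalgebra are compared; the structure map
    follows by discreteness.\<close>
  have F3: "push EM_nm ?Y z (Far (Far tp.emT k) ?f) = t"
  proof (rule opfib_coalg_inj[of "FTm ?Y" "FTp ?Y" "At (Pr M) ?D"])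
    show "push EM_nm ?Y z (Far (Far tp.emT k) ?f) \<in> Obj (EM (FTm ?Y))"
      by (rule push_EM_nm) (use F1 F2 z(2) in simp_all)
    show "Fob (UTm ?Y) (push EM_nm ?Y z (Far (Far tp.emT k) ?f)) = Fob (UTm ?Y) t"
      unfolding UT[OF F1 F2(1)] F2(3) f(4) ..
    have "Fob (PrX ?Y) (push EM_nm ?Y z (Far (Far tp.emT k) ?f)) = Cod (EM (FTp ?Y)) (Far (Far tp.emT k) ?f)"
      by (rule push_EM_nm) (use F1 F2 z(2) in simp_all)
    then show "Fob (PrX ?Y) (push EM_nm ?Y z (Far (Far tp.emT k) ?f)) = Fob (PrX ?Y) t" using F1 F2 t(2) by simp
  qed simp_all
  show ?thesis
  proof (rule ex1I[of _ ?f])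
    show "?f \<in> Arr (EM (FTp ?X)) \<and> Dom (EM (FTp ?X)) ?f = Bt \<and> Cod (EM (FTp ?X)) ?f = Bt' \<and> push EM_nm ?Y z (Far (Far tp.emT k) ?f) = t"
      using F1 F2 F3 by blast
  next
    fix x assume "x \<in> Arr (EM (FTp ?X)) \<and> Dom (EM (FTp ?X)) x = Bt \<and> Cod (EM (FTp ?X)) x = Bt' \<and> push EM_nm ?Y z (Far (Far tp.emT k) x) = t"
    then have x: "x \<in> Arr (EM (FTp ?X))" "Dom (EM (FTp ?X)) x = Bt" "Cod (EM (FTp ?X)) x = Bt'" "push EM_nm ?Y z (Far (Far tp.emT k) x) = t" by auto
    have "Far (UTp ?X) x = f"
      by (rule f_un) (use x UT[OF x(1,2)] in simp_all)
    then show "x = ?f" by (intro EM_arr_eqI[OF x(1) F1]) (simp_all only: x F2)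
  qed
qed

text \<open>For the second half, a display of coalgebras is an extension in \<open>M\<close> because
  \<open>M\<close> is a natural model; \<open>ext_descend\<close> equips the type with a coalgebra
  structure and \<open>is_ext_EM_nm\<close> brings the extension back to coalgebras.\<close>

theorem natural_model_EM_nm [simp]: "natural_model EM_nm"
proof (rule natural_modelI)
  fix X Bt Bt' t assume "X \<in> Obj (UCat EM_nm)" and "Bt \<in> Obj (Fob (Tp EM_nm) X)" "Bt' \<in> Obj (Fob (Tp EM_nm) X)"
    and t: "t \<in> Obj (Fob (Tm EM_nm) (Dom (UCat EM_nm) (Pj EM_nm X Bt)))"
      "Fob (At (Pr EM_nm) (Dom (UCat EM_nm) (Pj EM_nm X Bt))) t = Fob (Far (Tp EM_nm) (Pj EM_nm X Bt)) Bt'"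
  then have X: "X \<in> Obj E" and Bt: "Bt \<in> Obj (EM (FTp X))" and Bt': "Bt' \<in> Obj (EM (FTp X))" by simp_all
  note p = em_PjVr[OF X Bt]
  note ff = EM_nm_full_faithful[OF p(1) _ p(3,4) em_PjVr_ext[OF X Bt], unfolded p(2), OF Bt Bt', of t]
  have t': "t \<in> Obj (EM (FTm (Dom E (Pj EM_nm X Bt))))" "Fob (PrX (Dom E (Pj EM_nm X Bt))) t = Fob (Far tp.emT (Pj EM_nm X Bt)) Bt'"
    using t p(1) by (simp_all del: tp.emT_simps(4))
  show "\<exists>!f. f \<in> Arr (Fob (Tp EM_nm) X) \<and> Dom (Fob (Tp EM_nm) X) f = Bt \<and> Cod (Fob (Tp EM_nm) X) f = Bt' \<and>
        push EM_nm (Dom (UCat EM_nm) (Pj EM_nm X Bt)) (Vr EM_nm X Bt) (Far (Far (Tp EM_nm) (Pj EM_nm X Bt)) f) = t"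
    using ff[OF t'] X by (simp del: tp.emT_simps(4))
next
  fix k assume "k \<in> Disp EM_nm"
  then have k: "k \<in> em_disp" by simp
  obtain A v where e: "is_ext M A (Far U k) v" by (rule natural_model_es[OF W_simps(1) em_dispD(2)[OF k]])
  obtain Bt z where b: "Bt \<in> Obj (EM (FTp (Cod E k)))" "Fob (UTp (Cod E k)) Bt = A" "z \<in> Obj (EM (FTm (Dom E k)))"
    "Fob (PrX (Dom E k)) z = Fob (Far tp.emT k) Bt" "Fob (UTm (Dom E k)) z = v" by (rule ext_descend[OF em_dispD(1)[OF k] e])
  have "is_ext EM_nm Bt k z" by (rule is_ext_EM_nm[OF em_dispD(1)[OF k] b(1,3,4)]) (use b e in simp)
  then show "\<exists>A v. is_ext EM_nm A k v" by blast
qed simp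

section \<open>The universal coaction on the model of coalgebras\<close>

definition "forget = \<lparr>MSrc = EM_nm, MTgt = M, MFun = U, MTp = tp.forgetT, MTm = tm.forgetT\<rparr>"

lemma forget_simps [simp]: "MSrc forget = EM_nm" "MTgt forget = M" "MFun forget = U" "MTp forget = tp.forgetT" "MTm forget = tm.forgetT"
  by (simp_all add: forget_def)

lemma nm_mor_forget [simp]: "nm_mor forget"
proof -
  have p: "pre_nm_mor forget"
  proof (rule pre_nm_mor.intro)
    show "display_functor (MSrc forget) (MTgt forget) (MFun forget)"
      using pullback_forget by (auto simp: display_functor_def)
    fix X assume "X \<in> Obj (UCat (MSrc forget))"
    then have X: "X \<in> Obj E" by simp
    show "fct_comp (At (Pr (MTgt forget)) (Fob (MFun forget) X)) (At (MTm forget) X) = fct_comp (At (MTp forget) X) (At (Pr (MSrc forget)) X)"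
      by (rule fct_eqI) (use X in simp_all)
  qed simp_all
  show ?thesis
  proof (intro nm_mor.intro nm_mor_axioms.intro p)
    fix X Bt assume "X \<in> Obj (UCat (MSrc forget))" "Bt \<in> Obj (Fob (Tp (MSrc forget)) X)"
    then have X: "X \<in> Obj E" and Bt: "Bt \<in> Obj (EM (FTp X))" by simp_all
    show "iso (UCat (MTgt forget)) (canonical_map forget X Bt)"
      by (subst canonical_iff[OF p]) (use X Bt em_PjVr[OF X Bt] is_ext_chosen[of M "Fob U X" "Fob (UTp X) Bt"] in simp_all)
  qed simp_all
qed

definition "coact = \<lparr>M2Src = forget, M2Tgt = nmor_comp B forget, M2Nt = co, M2Tp = tp.coT, M2Tm = tm.coT\<rparr>"

lemma coact_simps [simp]: "M2Src coact = forget" "M2Tgt coact = nmor_comp B forget" "M2Nt coact = co" "M2Tp coact = tp.coT" "M2Tm coact = tm.coT"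
  by (simp_all add: coact_def)

end

context selector_comonad
begin

text \<open>The assumption on \<open>m\<close> describes the indexed functor of
  \<open>forget\<close> followed by the comonad. \<open>forget\<close> involves types and terms at
  once, so it is out of reach while only one selector is fixed.\<close>

lemma indexed_coT:
  assumes "\<And>X. X \<in> Obj E \<Longrightarrow> At m X = fct_comp (At (mT B) (Fob U X)) (EM_forget (fib_comonad X))"
  shows "indexed_ntrans emT (T M) co forgetT m coT"
proof (rule indexed_ntrans.intro)
  fix X assume "X \<in> Obj (Src (NSrc co))"
  then have X: "X \<in> Obj E" by simp
  then show "ntrans (coT X) \<and> NSrc (coT X) = At forgetT X \<and> NTgt (coT X) = fct_comp (Far (T M) (At co X)) (At m X)"
    using assms by (simp add: fib_endo_def)
qed simp_all

end

context nm_comonad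
begin

lemma nm_mor2_coact [simp]: "nm_mor2 coact"
proof (rule nm_mor2.intro)
  show "indexed_ntrans (Tp (MSrc (M2Src coact))) (Tp (MTgt (M2Src coact))) (M2Nt coact) (MTp (M2Src coact)) (MTp (M2Tgt coact)) (M2Tp coact)"
    using tp.indexed_coT by simp
  show "indexed_ntrans (Tm (MSrc (M2Src coact))) (Tm (MTgt (M2Src coact))) (M2Nt coact) (MTm (M2Src coact)) (MTm (M2Tgt coact)) (M2Tm coact)"
    using tm.indexed_coT by simp
qed simp_all

text \<open>In the base and in every fibre, both laws are the coalgebra laws of the objects
  concerned; the fibrewise comonads were formed so that the indexed composites evaluate to
  them.\<close>

lemma coaction_coact: "NM.coaction W EM_nm forget coact"
proof -
  have 1: "nmor2_vcomp (nmor2_hcomp (Counit W) (nmor2_id forget)) coact = nmor2_id forget"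
  proof (rule nm_mor2_eqI)
    show "M2Nt (nmor2_vcomp (nmor2_hcomp (Counit W) (nmor2_id forget)) coact) = M2Nt (nmor2_id forget)"
      by (rule ntr_eqI) (simp_all add: E_coalg)
    fix X Bt assume "X \<in> Obj (UCat (MSrc (M2Src (nmor2_id forget))))"
    then have X: "X \<in> Obj E" by simp
    show "Bt \<in> Obj (Fob (Tp (MSrc (M2Src (nmor2_id forget)))) X) \<Longrightarrow> At (M2Tp (nmor2_vcomp (nmor2_hcomp (Counit W) (nmor2_id forget)) coact) X) Bt = At (M2Tp (nmor2_id forget) X) Bt"
      using EM_coalg(1)[of Bt "FTp X"] X by simp
    show "Bt \<in> Obj (Fob (Tm (MSrc (M2Src (nmor2_id forget)))) X) \<Longrightarrow> At (M2Tm (nmor2_vcomp (nmor2_hcomp (Counit W) (nmor2_id forget)) coact) X) Bt = At (M2Tm (nmor2_id forget) X) Bt"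
      using EM_coalg(1)[of Bt "FTm X"] X by simp
  qed (simp_all add: nmor_laws)
  have 2: "nmor2_vcomp (nmor2_hcomp (Comult W) (nmor2_id forget)) coact = nmor2_vcomp (nmor2_hcomp (nmor2_id B) coact) coact"
  proof (rule nm_mor2_eqI)
    show "M2Nt (nmor2_vcomp (nmor2_hcomp (Comult W) (nmor2_id forget)) coact) = M2Nt (nmor2_vcomp (nmor2_hcomp (nmor2_id B) coact) coact)"
      by (rule ntr_eqI) (simp_all add: E_coalg)
    fix X Bt assume "X \<in> Obj (UCat (MSrc (M2Src (nmor2_vcomp (nmor2_hcomp (nmor2_id B) coact) coact))))"
    then have X: "X \<in> Obj E" by simp
    show "Bt \<in> Obj (Fob (Tp (MSrc (M2Src (nmor2_vcomp (nmor2_hcomp (nmor2_id B) coact) coact)))) X) \<Longrightarrow>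
        At (M2Tp (nmor2_vcomp (nmor2_hcomp (Comult W) (nmor2_id forget)) coact) X) Bt = At (M2Tp (nmor2_vcomp (nmor2_hcomp (nmor2_id B) coact) coact) X) Bt"
      using EM_coalg(2)[of Bt "FTp X"] X by simp
    show "Bt \<in> Obj (Fob (Tm (MSrc (M2Src (nmor2_vcomp (nmor2_hcomp (nmor2_id B) coact) coact)))) X) \<Longrightarrow>
        At (M2Tm (nmor2_vcomp (nmor2_hcomp (Comult W) (nmor2_id forget)) coact) X) Bt = At (M2Tm (nmor2_vcomp (nmor2_hcomp (nmor2_id B) coact) coact) X) Bt"
      using EM_coalg(2)[of Bt "FTm X"] X by simp
  qed (simp_all add: nmor_laws)
  show ?thesis using 1 2 by (simp add: NM.coaction_def hom_def)
qed

end

section \<open>The universal property\<close>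

locale nm_coaction = nm_comonad W
  for W :: "('a univ nm, 'a univ nmor, 'a univ nmor2) cmnd" +
  fixes D :: "'a univ nm" and G :: "'a univ nmor" and \<tau> :: "'a univ nmor2"
  assumes coaction: "NM.coaction W D G \<tau>"
begin

lemma G_simps [simp]: "nm_mor G" "MSrc G = D" "MTgt G = M" "nm_mor2 \<tau>" "M2Src \<tau> = G" "M2Tgt \<tau> = nmor_comp B G"
  using coaction by (auto simp: NM.coaction_def hom_def)

lemma D_nm [simp]: "natural_model D"
  using nm_mor_simps(2)[of G] by simp

lemma G_laws:
  "nmor2_vcomp (nmor2_hcomp (Counit W) (nmor2_id G)) \<tau> = nmor2_id G"
  "nmor2_vcomp (nmor2_hcomp (Comult W) (nmor2_id G)) \<tau> = nmor2_vcomp (nmor2_hcomp (nmor2_id B) \<tau>) \<tau>"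
  using coaction by (auto simp: NM.coaction_def hom_def nmor_laws)

abbreviation "L0 \<equiv> EM_lift W0 (MFun G) (M2Nt \<tau>)"

lemma base_coaction [simp]: "cat_coaction W0 (MFun G) (M2Nt \<tau>)"
  unfolding cat_coaction_def
proof (intro conjI ballI)
  fix A assume A: "A \<in> Obj (Src (MFun G))"
  show "At (Counit W0) (Fob (MFun G) A) \<cdot>\<^bsub>Base W0\<^esub> At (M2Nt \<tau>) A = Idn (Base W0) (Fob (MFun G) A)"
    using arg_cong[OF G_laws(1), of "\<lambda>t. At (M2Nt t) A"] A by simp
  show "At (Comult W0) (Fob (MFun G) A) \<cdot>\<^bsub>Base W0\<^esub> At (M2Nt \<tau>) A = Far (Endo W0) (At (M2Nt \<tau>) A) \<cdot>\<^bsub>Base W0\<^esub> At (M2Nt \<tau>) A"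
    using arg_cong[OF G_laws(2), of "\<lambda>t. At (M2Nt t) A"] A by simp
qed simp_all

lemma L0 [simp]: "fctr L0" "Src L0 = UCat D" "Tgt L0 = E"
  "\<Delta> \<in> Obj (UCat D) \<Longrightarrow> Fob U (Fob L0 \<Delta>) = Fob (MFun G) \<Delta>"
  "\<Delta> \<in> Obj (UCat D) \<Longrightarrow> At co (Fob L0 \<Delta>) = At (M2Nt \<tau>) \<Delta>"
  "u \<in> Arr (UCat D) \<Longrightarrow> Far U (Far L0 u) = Far (MFun G) u"
  by simp_all

end

text \<open>The model of coalgebras depends on types and terms together, while the lifting arguments
  are to be given once for both. The locale records what one selector sees of the model, the
  forgetful morphism and the coaction.\<close>

locale selector_em = selector_comonad T mT m2T W
  for T :: "'a univ nm \<Rightarrow> 'a univ icat" and mT :: "'a univ nmor \<Rightarrow> 'a univ ifct" and m2T :: "'a univ nmor2 \<Rightarrow> 'a univ \<Rightarrow> 'a univ sntr"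
    and W :: "('a univ nm, 'a univ nmor, 'a univ nmor2) cmnd" +
  fixes N :: "'a univ nm" and Um :: "'a univ nmor" and c :: "'a univ nmor2"
  assumes N [simp]: "natural_model N" "UCat N = E" "T N = emT"
    and Um [simp]: "nm_mor Um" "MSrc Um = N" "MTgt Um = M" "MFun Um = U" "mT Um = forgetT"
    and c [simp]: "nm_mor2 c" "M2Src c = Um" "M2Tgt c = nmor_comp B Um" "M2Nt c = co" "m2T c = coT"

locale selector_coaction = selector_em T mT m2T W N Um c + nm_coaction W D G \<tau>
  for T :: "'a univ nm \<Rightarrow> 'a univ icat" and mT :: "'a univ nmor \<Rightarrow> 'a univ ifct" and m2T :: "'a univ nmor2 \<Rightarrow> 'a univ \<Rightarrow> 'a univ sntr"
    and W :: "('a univ nm, 'a univ nmor, 'a univ nmor2) cmnd" and N Um c D G \<tau>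
begin

abbreviation "fibL \<Delta> \<equiv> fib_comonad (Fob L0 \<Delta>)"

text \<open>The base component of \<open>\<tau>\<close> is the structure map of the coalgebra
  \<open>Fob L0 \<Delta>\<close>, so its component in the fibre is typed as a coaction for the
  comonad over that coalgebra, and the coaction laws of \<open>\<tau>\<close> restrict to
  it.\<close>

lemma fib_coaction [simp]:
  assumes \<Delta>: "\<Delta> \<in> Obj (UCat D)"
  shows "cat_coaction (fibL \<Delta>) (At (mT G) \<Delta>) (m2T \<tau> \<Delta>)"
proof -
  have X: "Fob L0 \<Delta> \<in> Obj E" using \<Delta> by simp
  note [simp] = X \<Delta>
  show ?thesis
    unfolding cat_coaction_def
  proof (intro conjI ballI)
    show "NTgt (m2T \<tau> \<Delta>) = fct_comp (Endo (fibL \<Delta>)) (At (mT G) \<Delta>)" by (simp add: fib_endo_def)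
    fix A assume "A \<in> Obj (Src (At (mT G) \<Delta>))"
    then have A: "A \<in> Obj (Fob (T D) \<Delta>)" by simp
    show "At (Counit (fibL \<Delta>)) (Fob (At (mT G) \<Delta>) A) \<cdot>\<^bsub>Base (fibL \<Delta>)\<^esub> At (m2T \<tau> \<Delta>) A = Idn (Base (fibL \<Delta>)) (Fob (At (mT G) \<Delta>) A)"
      using arg_cong[OF G_laws(1), of "\<lambda>t. At (m2T t \<Delta>) A"] A by simp
    show "At (Comult (fibL \<Delta>)) (Fob (At (mT G) \<Delta>) A) \<cdot>\<^bsub>Base (fibL \<Delta>)\<^esub> At (m2T \<tau> \<Delta>) A
      = Far (Endo (fibL \<Delta>)) (At (m2T \<tau> \<Delta>) A) \<cdot>\<^bsub>Base (fibL \<Delta>)\<^esub> At (m2T \<tau> \<Delta>) A"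
      using arg_cong[OF G_laws(2), of "\<lambda>t. At (m2T t \<Delta>) A"] A by simp
  qed simp_all
qed

definition liftT where
  "liftT = \<lparr>NSrc = T D, NTgt = fct_comp emT (fct_op L0), At = (\<lambda>\<Delta>\<in>Obj (UCat D). EM_lift (fibL \<Delta>) (At (mT G) \<Delta>) (m2T \<tau> \<Delta>))\<rparr>"

lemma liftT_simps [simp]: "NSrc liftT = T D" "NTgt liftT = fct_comp emT (fct_op L0)"
  "\<Delta> \<in> Obj (UCat D) \<Longrightarrow> At liftT \<Delta> = EM_lift (fibL \<Delta>) (At (mT G) \<Delta>) (m2T \<tau> \<Delta>)"
  by (simp_all add: liftT_def)

lemma ntrans_liftT [simp]: "ntrans liftT"
proof -
  let ?m = "\<lambda>\<Delta>. EM_lift (fibL \<Delta>) (At (mT G) \<Delta>) (m2T \<tau> \<Delta>)"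
  { fix u assume u: "u \<in> Arr (UCat D)"
    have o: "Dom (UCat D) u \<in> Obj (UCat D)" "Cod (UCat D) u \<in> Obj (UCat D)" using u by simp_all
    have sc: "strict_comonad_map (fibL (Cod (UCat D) u)) (fibL (Dom (UCat D) u)) (Far (T M) (Far (MFun G) u))"
      using sub_comonad_map[of "Far L0 u"] u by simp
    \<comment> \<open>Strict naturality is an equation of functors into coalgebras; it is tested on
      carriers, where it is naturality of \<open>mT G\<close>, and on structure maps, where it says
      that \<open>\<tau>\<close> is indexed.\<close>
    have "fct_comp (?m (Dom (UCat D) u)) (Far (T D) u) = fct_comp (Far emT (Far L0 u)) (?m (Cod (UCat D) u))"
      by (rule EM_functor_eqI[of "fibL (Dom (UCat D) u)"]) (use u o sc in simp_all) }
  note e = this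
  show ?thesis unfolding liftT_def
  proof (rule ifctI[where C = "UCat D"])
    fix u A assume u: "u \<in> Arr (UCat D)" "A \<in> Obj (Fob (T D) (Cod (UCat D) u))"
    show "Fob (?m (Dom (UCat D) u)) (Fob (Far (T D) u) A) = Fob (Far (fct_comp emT (fct_op L0)) u) (Fob (?m (Cod (UCat D) u)) A)"
      using arg_cong[OF e[OF u(1)], of "\<lambda>F. Fob F A"] u by (simp del: emT_simps(4))
  next
    fix u f assume u: "u \<in> Arr (UCat D)" "f \<in> Arr (Fob (T D) (Cod (UCat D) u))"
    show "Far (?m (Dom (UCat D) u)) (Far (Far (T D) u) f) = Far (Far (fct_comp emT (fct_op L0)) u) (Far (?m (Cod (UCat D) u)) f)"
      using arg_cong[OF e[OF u(1)], of "\<lambda>F. Far F f"] u by (simp del: emT_simps(4))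
  qed simp_all
qed

text \<open>The fibre in which \<open>mT H\<close> takes values depends on the base functor, so
  uniqueness in the fibres presupposes that the base functor has been identified with
  \<open>L0\<close>.\<close>

lemma liftT_unique:
  assumes H: "nm_mor H" "MSrc H = D" "MTgt H = N" "MFun H = L0" and e: "nmor_comp Um H = G" "nmor2_hcomp c (nmor2_id H) = \<tau>"
    and \<Delta>: "\<Delta> \<in> Obj (UCat D)"
  shows "At (mT H) \<Delta> = At liftT \<Delta>"
proof -
  have X: "Fob L0 \<Delta> \<in> Obj E" using \<Delta> by simp
  have e1: "fct_comp (EM_forget (fibL \<Delta>)) (At (mT H) \<Delta>) = At (mT G) \<Delta>"
    using arg_cong[OF e(1), of "\<lambda>m. At (mT m) \<Delta>"] H \<Delta> X by simp
  have e2: "At (EM_co (fibL \<Delta>)) (Fob (At (mT H) \<Delta>) A) = At (m2T \<tau> \<Delta>) A" if "A \<in> Obj (Fob (T D) \<Delta>)" for A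
    using arg_cong[OF e(2), of "\<lambda>t. At (m2T t \<Delta>) A"] H \<Delta> X that by simp
  show ?thesis unfolding liftT_simps(3)[OF \<Delta>]
  proof (rule EM_lift_unique)
    fix A assume A: "A \<in> Obj (Src (At (mT G) \<Delta>))"
    show "Fob (EM_forget (fibL \<Delta>)) (Fob (At (mT H) \<Delta>) A) = Fob (At (mT G) \<Delta>) A"
      using arg_cong[OF e1, of "\<lambda>F. Fob F A"] H \<Delta> A by simp
    show "At (EM_co (fibL \<Delta>)) (Fob (At (mT H) \<Delta>) A) = At (m2T \<tau> \<Delta>) A"
      by (rule e2) (use A \<Delta> in simp)
  next
    fix f assume f: "f \<in> Arr (Src (At (mT G) \<Delta>))"
    show "Far (EM_forget (fibL \<Delta>)) (Far (At (mT H) \<Delta>) f) = Far (At (mT G) \<Delta>) f"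
      using arg_cong[OF e1, of "\<lambda>F. Far F f"] H \<Delta> f by simp
  qed (use H \<Delta> X in simp_all)
qed

lemma hcomp_liftT:
  assumes H: "nm_mor H" "MSrc H = D" "MTgt H = N" "MFun H = L0" "mT H = liftT" and \<Delta>: "\<Delta> \<in> Obj (UCat D)"
  shows "fct_comp (EM_forget (fibL \<Delta>)) (At liftT \<Delta>) = At (mT G) \<Delta>"
    "A \<in> Obj (Fob (T D) \<Delta>) \<Longrightarrow> At (m2T (nmor2_hcomp c (nmor2_id H)) \<Delta>) A = At (m2T \<tau> \<Delta>) A"
proof -
  have X: "Fob L0 \<Delta> \<in> Obj E" using \<Delta> by simp
  show "fct_comp (EM_forget (fibL \<Delta>)) (At liftT \<Delta>) = At (mT G) \<Delta>"
    by (rule fct_eqI) (use \<Delta> X in simp_all)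
  show "A \<in> Obj (Fob (T D) \<Delta>) \<Longrightarrow> At (m2T (nmor2_hcomp c (nmor2_id H)) \<Delta>) A = At (m2T \<tau> \<Delta>) A"
    using H \<Delta> X by simp
qed

end

section \<open>Lifting 2-cells that are coalgebra maps\<close>

locale nm_coalg_map = nm_comonad W
  for W :: "('a univ nm, 'a univ nmor, 'a univ nmor2) cmnd" +
  fixes D H H' \<theta>
  assumes H: "nm_mor H" "MSrc H = D" "MTgt H = EM_nm" and H': "nm_mor H'" "MSrc H' = D" "MTgt H' = EM_nm"
    and \<theta>: "nm_mor2 \<theta>" "M2Src \<theta> = nmor_comp forget H" "M2Tgt \<theta> = nmor_comp forget H'"
    and compat: "nmor2_vcomp (nmor2_hcomp (nmor2_id B) \<theta>) (nmor2_hcomp coact (nmor2_id H)) = nmor2_vcomp (nmor2_hcomp coact (nmor2_id H')) \<theta>"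
begin

lemmas [simp] = H H' \<theta>

lemma D_nm [simp]: "natural_model D"
  using nm_mor_simps(2)[of H] by simp

abbreviation "P0 \<equiv> EM_lift2 (MFun H) (MFun H') (M2Nt \<theta>)"

lemma base_coalg_map: "cat_coalg_map W0 (MFun H) (MFun H') (M2Nt \<theta>)"
  unfolding cat_coalg_map_def
proof (intro conjI ballI)
  fix A assume A: "A \<in> Obj (Src (MFun H))"
  show "Far (Endo W0) (At (M2Nt \<theta>) A) \<cdot>\<^bsub>Base W0\<^esub> At co (Fob (MFun H) A) = At co (Fob (MFun H') A) \<cdot>\<^bsub>Base W0\<^esub> At (M2Nt \<theta>) A"
    using arg_cong[OF compat, of "\<lambda>t. At (M2Nt t) A"] A by simp
qed simp_all

lemma P0 [simp]: "ntrans P0" "\<Delta> \<in> Obj (UCat D) \<Longrightarrow> Far U (At P0 \<Delta>) = At (M2Nt \<theta>) \<Delta>"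
  using EM_lift2[OF W0 base_coalg_map] by simp_all

end

locale selector_coalg_map = selector_em T mT m2T W "nm_comonad.EM_nm W" "nm_comonad.forget W" "nm_comonad.coact W" + nm_coalg_map W D H H' \<theta>
  for T :: "'a univ nm \<Rightarrow> 'a univ icat" and mT :: "'a univ nmor \<Rightarrow> 'a univ ifct" and m2T :: "'a univ nmor2 \<Rightarrow> 'a univ \<Rightarrow> 'a univ sntr"
    and W :: "('a univ nm, 'a univ nmor, 'a univ nmor2) cmnd" and D H H' \<theta>
begin

text \<open>The components of a 2-morphism end at values of the second morphism substituted along
  the base transformation; here that is the lifted \<open>P0\<close>.\<close>

abbreviation "tgtT \<Delta> \<equiv> fct_comp (Far emT (At P0 \<Delta>)) (At (mT H') \<Delta>)"

lemma P0_comonad_map [simp]: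
  "\<Delta> \<in> Obj (UCat D) \<Longrightarrow> strict_comonad_map (fib_comonad (Fob (MFun H') \<Delta>)) (fib_comonad (Fob (MFun H) \<Delta>)) (Far (T M) (At (M2Nt \<theta>) \<Delta>))"
  using sub_comonad_map[of "At P0 \<Delta>"] by simp

lemma fib_coalg_map:
  assumes \<Delta>: "\<Delta> \<in> Obj (UCat D)"
  shows "cat_coalg_map (fib_comonad (Fob (MFun H) \<Delta>)) (At (mT H) \<Delta>) (tgtT \<Delta>) (m2T \<theta> \<Delta>)"
  unfolding cat_coalg_map_def
proof (intro conjI ballI)
  note [simp] = \<Delta>
  have X [simp]: "Fob (MFun H) \<Delta> \<in> Obj E" "Fob (MFun H') \<Delta> \<in> Obj E" by simp_all
  have "fct_comp (Far (T M) (At (M2Nt \<theta>) \<Delta>)) (fct_comp (EM_forget (fib_comonad (Fob (MFun H') \<Delta>))) (At (mT H') \<Delta>)) = fct_comp (EM_forget (fib_comonad (Fob (MFun H) \<Delta>))) (tgtT \<Delta>)"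
    by (rule fct_eqI) simp_all
  then show "NTgt (m2T \<theta> \<Delta>) = fct_comp (EM_forget (fib_comonad (Fob (MFun H) \<Delta>))) (tgtT \<Delta>)" by simp
  fix A assume "A \<in> Obj (Src (At (mT H) \<Delta>))"
  then have A: "A \<in> Obj (Fob (T D) \<Delta>)" by simp
  show "Far (Endo (fib_comonad (Fob (MFun H) \<Delta>))) (At (m2T \<theta> \<Delta>) A) \<cdot>\<^bsub>Base (fib_comonad (Fob (MFun H) \<Delta>))\<^esub> At (EM_co (fib_comonad (Fob (MFun H) \<Delta>))) (Fob (At (mT H) \<Delta>) A) =
      At (EM_co (fib_comonad (Fob (MFun H) \<Delta>))) (Fob (tgtT \<Delta>) A) \<cdot>\<^bsub>Base (fib_comonad (Fob (MFun H) \<Delta>))\<^esub> At (m2T \<theta> \<Delta>) A"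
    using arg_cong[OF compat, of "\<lambda>t. At (m2T t \<Delta>) A"] A by simp
qed (use \<Delta> in simp_all)

definition lift2T where "lift2T = (\<lambda>\<Delta>\<in>Obj (UCat D). EM_lift2 (At (mT H) \<Delta>) (tgtT \<Delta>) (m2T \<theta> \<Delta>))"

lemma lift2T_simps [simp]:
  assumes "\<Delta> \<in> Obj (UCat D)"
  shows "ntrans (lift2T \<Delta>)" "NSrc (lift2T \<Delta>) = At (mT H) \<Delta>" "NTgt (lift2T \<Delta>) = tgtT \<Delta>"
    "A \<in> Obj (Fob (T D) \<Delta>) \<Longrightarrow> Far (EM_forget (fib_comonad (Fob (MFun H) \<Delta>))) (At (lift2T \<Delta>) A) = At (m2T \<theta> \<Delta>) A"
  using EM_lift2[OF _ fib_coalg_map[OF assms]] assms by (simp_all add: lift2T_def)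

lemma extensional_lift2T [simp]: "lift2T \<in> extensional (Obj (UCat D))"
  by (simp add: lift2T_def)

text \<open>An arrow of coalgebras is determined by its ends and its underlying arrow. On underlying
  arrows the claim is that \<open>\<theta>\<close> is indexed; the work lies in matching the
  codomains.\<close>

lemma indexed_lift2T: "indexed_ntrans (T D) emT P0 (mT H) (mT H') lift2T"
proof (rule indexed_ntrans.intro)
  fix u A assume "u \<in> Arr (Src (NSrc P0))" "A \<in> Obj (Fob (T D) (Cod (Src (NSrc P0)) u))"
  then have u: "u \<in> Arr (UCat D)" and A: "A \<in> Obj (Fob (T D) (Cod (UCat D) u))" by simp_all
  let ?\<Delta> = "Dom (UCat D) u" and ?\<Gamma> = "Cod (UCat D) u"
  note [simp] = u A
  have o [simp]: "?\<Delta> \<in> Obj (UCat D)" "?\<Gamma> \<in> Obj (UCat D)" "Fob (MFun H) ?\<Delta> \<in> Obj E" "Fob (MFun H) ?\<Gamma> \<in> Obj E" "Fob (MFun H') ?\<Delta> \<in> Obj E" "Fob (MFun H') ?\<Gamma> \<in> Obj E" by simp_all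
  have nat: "At P0 ?\<Gamma> \<cdot>\<^bsub>UCat EM_nm\<^esub> Far (MFun H) u = Far (MFun H') u \<cdot>\<^bsub>UCat EM_nm\<^esub> At P0 ?\<Delta>"
    using naturality[of P0 E "UCat D" u] by simp
  \<comment> \<open>The two codomains are substituted along the two paths of a naturality square of
    \<open>P0\<close>, which is a square of coalgebra maps.\<close>
  have cod: "Fob (Far emT (At P0 ?\<Delta>)) (Fob (Far emT (Far (MFun H') u)) (Fob (At (mT H') ?\<Gamma>) A)) = Fob (Far emT (Far (MFun H) u)) (Fob (Far emT (At P0 ?\<Gamma>)) (Fob (At (mT H') ?\<Gamma>) A))"
    using sub_square(1)[OF _ nat, of "Fob (At (mT H') ?\<Gamma>) A"] by (simp del: emT_simps(4))
  have d: "Far emT (Far (MFun H) u) = EM_map (fib_comonad (Fob (MFun H) ?\<Gamma>)) (fib_comonad (Fob (MFun H) ?\<Delta>)) (Far (T M) (Far U (Far (MFun H) u)))" by simp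
  have sc: "strict_comonad_map (fib_comonad (Fob (MFun H) ?\<Gamma>)) (fib_comonad (Fob (MFun H) ?\<Delta>)) (Far (T M) (Far U (Far (MFun H) u)))"
    using sub_comonad_map[of "Far (MFun H) u"] by simp
  have "At (lift2T ?\<Delta>) (Fob (Far (T D) u) A) = Far (Far emT (Far (MFun H) u)) (At (lift2T ?\<Gamma>) A)"
  proof (rule EM_arr_eqI[of _ "fib_comonad (Fob (MFun H) ?\<Delta>)"])
    show "Cod (EM (fib_comonad (Fob (MFun H) ?\<Delta>))) (At (lift2T ?\<Delta>) (Fob (Far (T D) u) A)) = Cod (EM (fib_comonad (Fob (MFun H) ?\<Delta>))) (Far (Far emT (Far (MFun H) u)) (At (lift2T ?\<Gamma>) A))"
      using cod by (simp del: emT_simps(4))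
    show "Far (EM_forget (fib_comonad (Fob (MFun H) ?\<Delta>))) (At (lift2T ?\<Delta>) (Fob (Far (T D) u) A)) = Far (EM_forget (fib_comonad (Fob (MFun H) ?\<Delta>))) (Far (Far emT (Far (MFun H) u)) (At (lift2T ?\<Gamma>) A))"
      unfolding d using sc by simp
  qed (simp_all del: emT_simps(4))
  then show "At (lift2T (Dom (Src (NSrc P0)) u)) (Fob (Far (T D) u) A) = Far (Far emT (Far (NSrc P0) u)) (At (lift2T (Cod (Src (NSrc P0)) u)) A)"
    by (simp del: emT_simps(4))
qed simp_all

lemma lift2T_unique:
  assumes \<psi>: "nm_mor2 \<psi>" "M2Src \<psi> = H" "M2Tgt \<psi> = H'" "M2Nt \<psi> = P0" "nmor2_hcomp (nmor2_id forget) \<psi> = \<theta>" and \<Delta>: "\<Delta> \<in> Obj (UCat D)"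
  shows "m2T \<psi> \<Delta> = lift2T \<Delta>"
proof -
  note [simp] = \<Delta>
  have X [simp]: "Fob (MFun H) \<Delta> \<in> Obj E" "Fob (MFun H') \<Delta> \<in> Obj E" by simp_all
  have "m2T \<psi> \<Delta> = EM_lift2 (At (mT H) \<Delta>) (tgtT \<Delta>) (m2T \<theta> \<Delta>)"
  proof (rule EM_lift2_unique[OF _ fib_coalg_map[OF \<Delta>]])
    fix A assume "A \<in> Obj (Src (At (mT H) \<Delta>))"
    then have A: "A \<in> Obj (Fob (T D) \<Delta>)" by simp
    show "Far (EM_forget (fib_comonad (Fob (MFun H) \<Delta>))) (At (m2T \<psi> \<Delta>) A) = At (m2T \<theta> \<Delta>) A"
      using arg_cong[OF \<psi>(5), of "\<lambda>t. At (m2T t \<Delta>) A"] \<psi>(1-4) A by simp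
  qed (use \<psi>(1-4) in \<open>simp_all del: emT_simps(4)\<close>)
  then show ?thesis by (simp add: lift2T_def)
qed

end

context nm_comonad
begin

sublocale tpe: selector_em Tp MTp M2Tp W EM_nm forget coact
  by (intro selector_em.intro selector_em_axioms.intro tp.selector_comonad_axioms) simp_all
sublocale tme: selector_em Tm MTm M2Tm W EM_nm forget coact
  by (intro selector_em.intro selector_em_axioms.intro tm.selector_comonad_axioms) simp_all

end

context nm_coaction
begin

sublocale tpc: selector_coaction Tp MTp M2Tp W EM_nm forget coact D G \<tau> ..
sublocale tmc: selector_coaction Tm MTm M2Tm W EM_nm forget coact D G \<tau> ..

definition "nm_lift = \<lparr>MSrc = D, MTgt = EM_nm, MFun = L0, MTp = tpc.liftT, MTm = tmc.liftT\<rparr>"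

lemma nm_lift_simps [simp]: "MSrc nm_lift = D" "MTgt nm_lift = EM_nm" "MFun nm_lift = L0" "MTp nm_lift = tpc.liftT" "MTm nm_lift = tmc.liftT"
  by (simp_all add: nm_lift_def)

text \<open>Displays, pullbacks and extensions of coalgebras are all recognised on underlying data,
  where the lift is \<open>G\<close>, and \<open>G\<close> preserves them.\<close>

lemma nm_mor_lift [simp]: "nm_mor nm_lift"
proof -
  have dG: "display_functor D M (MFun G)" using pre_nm_mor.mfun[of G] by simp
  have sub: "Disp D \<subseteq> Arr (UCat D)" using display_category.disp_arr[of D] by simp
  have comm: "fct_comp (PrX (Fob L0 \<Delta>)) (At tmc.liftT \<Delta>) = fct_comp (At tpc.liftT \<Delta>) (At (Pr D) \<Delta>)" if \<Delta>: "\<Delta> \<in> Obj (UCat D)" for \<Delta>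
  proof -
    have X: "Fob L0 \<Delta> \<in> Obj E" using \<Delta> by simp
    show ?thesis by (rule EM_functor_eqI[of "FTp (Fob L0 \<Delta>)"]) (use \<Delta> X in simp_all)
  qed
  have p: "pre_nm_mor nm_lift"
  proof (rule pre_nm_mor.intro)
    show "display_functor (MSrc nm_lift) (MTgt nm_lift) (MFun nm_lift)"
      unfolding display_functor_def
    proof (intro conjI ballI allI impI)
      show "Far (MFun nm_lift) ` Disp (MSrc nm_lift) \<subseteq> Disp (MTgt nm_lift)"
      proof (rule image_subsetI)
        fix p assume "p \<in> Disp (MSrc nm_lift)"
        then have "p \<in> Disp D" "p \<in> Arr (UCat D)" using sub by auto
        moreover have "Far (MFun G) p \<in> Disp M" using dG calculation by (auto simp: display_functor_def)
        ultimately show "Far (MFun nm_lift) p \<in> Disp (MTgt nm_lift)" by (simp add: em_dispI)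
      qed
      fix p f p' q assume "p \<in> Disp (MSrc nm_lift)" "pullback (UCat (MSrc nm_lift)) p f p' q"
      then have p: "p \<in> Disp D" "p \<in> Arr (UCat D)" and pb: "pullback (UCat D) p f p' q" using sub by auto
      have pbG: "pullback C (Far (MFun G) p) (Far (MFun G) f) (Far (MFun G) p') (Far (MFun G) q)" and dp: "Far (MFun G) p \<in> Disp M"
        using dG p pb by (auto simp: display_functor_def)
      note d = pullbackD(1-8)[OF pb]
      have "pullback E (Far L0 p) (Far L0 f) (Far L0 p') (Far L0 q)"
        by (rule pullback_reflect) (use d dp pbG in \<open>simp_all add: em_dispI\<close>)
      then show "pullback (UCat (MTgt nm_lift)) (Far (MFun nm_lift) p) (Far (MFun nm_lift) f) (Far (MFun nm_lift) p') (Far (MFun nm_lift) q)" by simp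
    qed simp_all
    fix \<Delta> assume "\<Delta> \<in> Obj (UCat (MSrc nm_lift))"
    then have \<Delta>: "\<Delta> \<in> Obj (UCat D)" by simp
    then show "fct_comp (At (Pr (MTgt nm_lift)) (Fob (MFun nm_lift) \<Delta>)) (At (MTm nm_lift) \<Delta>) = fct_comp (At (MTp nm_lift) \<Delta>) (At (Pr (MSrc nm_lift)) \<Delta>)"
      using comm[OF \<Delta>] by simp
  qed simp_all
  show ?thesis
  proof (intro nm_mor.intro nm_mor_axioms.intro p)
    fix \<Delta> A assume "\<Delta> \<in> Obj (UCat (MSrc nm_lift))" "A \<in> Obj (Fob (Tp (MSrc nm_lift)) \<Delta>)"
    then have \<Delta>: "\<Delta> \<in> Obj (UCat D)" and A: "A \<in> Obj (Fob (Tp D) \<Delta>)" by simp_all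
    let ?p = "Pj D \<Delta> A" and ?x = "Vr D \<Delta> A" let ?E = "Dom (UCat D) ?p"
    note [simp] = \<Delta> A
    have eD: "is_ext D A ?p ?x" by (rule is_ext_chosen) simp_all
    have e: "is_ext M (Fob (At (MTp G) \<Delta>) A) (Far (MFun G) ?p) (Fob (At (MTm G) ?E) ?x)"
      using is_ext_preserved[of G A ?p ?x] eD by simp
    have EO: "?E \<in> Obj (UCat D)" by simp
    have X: "Fob L0 \<Delta> \<in> Obj E" "Fob L0 ?E \<in> Obj E" by simp_all
    note [simp] = X
    \<comment> \<open>The lifted generic term has the lifted type, substituted along the lifted
      projection: compatibility with the projections in the fibre, followed by naturality of the
      lift on types.\<close>
    have pr: "Fob (PrX (Fob L0 ?E)) (Fob (At tmc.liftT ?E) ?x) = Fob (Far tp.emT (Far L0 ?p)) (Fob (At tpc.liftT \<Delta>) A)"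
    proof -
      have "Fob (PrX (Fob L0 ?E)) (Fob (At tmc.liftT ?E) ?x) = Fob (At tpc.liftT ?E) (Fob (Far (Tp D) ?p) A)"
        using arg_cong[OF comm[OF EO], of "\<lambda>F. Fob F ?x"] by (simp del: tpc.liftT_simps(3) tmc.liftT_simps(3) add: tmc.liftT_simps(1))
      also have "\<dots> = Fob (Far tp.emT (Far L0 ?p)) (Fob (At tpc.liftT \<Delta>) A)"
        using arg_cong[OF ifct_natural[of tpc.liftT "UCat D" "Tp D" ?p ?E \<Delta>], of "\<lambda>F. Fob F A"] by (simp del: tpc.liftT_simps(3) tp.emT_simps(4))
      finally show ?thesis .
    qed
    have "is_ext EM_nm (Fob (At tpc.liftT \<Delta>) A) (Far L0 ?p) (Fob (At tmc.liftT ?E) ?x)"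
    proof (rule is_ext_EM_nm)
      show "Fob (PrX (Dom E (Far L0 ?p))) (Fob (At tmc.liftT ?E) ?x) = Fob (Far tp.emT (Far L0 ?p)) (Fob (At tpc.liftT \<Delta>) A)"
        using pr by (simp del: tpc.liftT_simps(3) tmc.liftT_simps(3) tp.emT_simps(4))
    qed (use e in simp_all)
    then show "iso (UCat (MTgt nm_lift)) (canonical_map nm_lift \<Delta> A)"
      by (subst canonical_iff[OF p]) (simp_all del: tpc.liftT_simps(3) tmc.liftT_simps(3))
  qed simp_all
qed

lemma ex1_lift: "\<exists>!H. H \<in> hom (One NM) D EM_nm \<and> forget \<cdot>\<^bsub>One NM\<^esub> H = G \<and> coact \<star>\<^bsub>NM\<^esub> Idn (Two NM) H = \<tau>"
proof (rule ex1I[of _ nm_lift])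
  have f: "fct_comp U L0 = MFun G" by (rule fct_eqI) simp_all
  have 1: "nmor_comp forget nm_lift = G"
    by (rule nm_mor_eqI) (use f tpc.hcomp_liftT(1)[of nm_lift] tmc.hcomp_liftT(1)[of nm_lift] in simp_all)
  have 2: "nmor2_hcomp coact (nmor2_id nm_lift) = \<tau>"
  proof (rule nm_mor2_eqI)
    show "M2Nt (nmor2_hcomp coact (nmor2_id nm_lift)) = M2Nt \<tau>"
      by (rule ntr_eqI) (simp_all add: f)
    show "M2Src (nmor2_hcomp coact (nmor2_id nm_lift)) = M2Src \<tau>" using 1 by simp
    show "M2Tgt (nmor2_hcomp coact (nmor2_id nm_lift)) = M2Tgt \<tau>" using 1 by (simp add: nmor_laws)
  qed (use tpc.hcomp_liftT(2)[of nm_lift] tmc.hcomp_liftT(2)[of nm_lift] in simp_all)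
  show "nm_lift \<in> hom (One NM) D EM_nm \<and> forget \<cdot>\<^bsub>One NM\<^esub> nm_lift = G \<and> coact \<star>\<^bsub>NM\<^esub> Idn (Two NM) nm_lift = \<tau>"
    using 1 2 by (simp add: hom_def)
next
  fix H assume H: "H \<in> hom (One NM) D EM_nm \<and> forget \<cdot>\<^bsub>One NM\<^esub> H = G \<and> coact \<star>\<^bsub>NM\<^esub> Idn (Two NM) H = \<tau>"
  then have h: "nm_mor H" "MSrc H = D" "MTgt H = EM_nm" by (auto simp: hom_def)
  then have e: "nmor_comp forget H = G" "nmor2_hcomp coact (nmor2_id H) = \<tau>" using H by simp_all
  have e1: "fct_comp U (MFun H) = MFun G" using arg_cong[OF e(1), of MFun] by simp
  \<comment> \<open>The base functor is settled by the universal property in \<open>CAT\<close>; the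
    fibres over its values can be compared only afterwards.\<close>
  have F: "MFun H = L0"
  proof (rule EM_lift_unique)
    fix A assume A: "A \<in> Obj (Src (MFun G))"
    show "Fob U (Fob (MFun H) A) = Fob (MFun G) A" using arg_cong[OF e1, of "\<lambda>F. Fob F A"] h A by simp
    show "At co (Fob (MFun H) A) = At (M2Nt \<tau>) A" using arg_cong[OF e(2), of "\<lambda>t. At (M2Nt t) A"] h A by simp
  next
    fix f assume f: "f \<in> Arr (Src (MFun G))"
    show "Far U (Far (MFun H) f) = Far (MFun G) f" using arg_cong[OF e1, of "\<lambda>F. Far F f"] h f by simp
  qed (use h in simp_all)
  show "H = nm_lift"
    by (rule nm_mor_eqI)
      (use h F tpc.liftT_unique[OF h F e] tmc.liftT_unique[OF h F e] in \<open>simp_all del: tpc.liftT_simps(3) tmc.liftT_simps(3)\<close>)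
qed

end

context nm_coalg_map
begin

sublocale tpm: selector_coalg_map Tp MTp M2Tp W D H H' \<theta> ..
sublocale tmm: selector_coalg_map Tm MTm M2Tm W D H H' \<theta> ..

definition "nm_lift2 = \<lparr>M2Src = H, M2Tgt = H', M2Nt = P0, M2Tp = tpm.lift2T, M2Tm = tmm.lift2T\<rparr>"

lemma nm_lift2_simps [simp]: "M2Src nm_lift2 = H" "M2Tgt nm_lift2 = H'" "M2Nt nm_lift2 = P0" "M2Tp nm_lift2 = tpm.lift2T" "M2Tm nm_lift2 = tmm.lift2T"
  by (simp_all add: nm_lift2_def)

lemma nm_mor2_lift2 [simp]: "nm_mor2 nm_lift2"
proof (rule nm_mor2.intro)
  fix \<Delta> t assume "\<Delta> \<in> Obj (UCat (MSrc (M2Src nm_lift2)))" "t \<in> Obj (Fob (Tm (MSrc (M2Src nm_lift2))) \<Delta>)"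
  then have \<Delta>: "\<Delta> \<in> Obj (UCat D)" and t: "t \<in> Obj (Fob (Tm D) \<Delta>)" by simp_all
  note [simp] = \<Delta> t
  let ?X = "Fob (MFun H) \<Delta>" let ?X' = "Fob (MFun H') \<Delta>" let ?k = "At P0 \<Delta>"
  have X [simp]: "?X \<in> Obj E" "?X' \<in> Obj E" by simp_all
  have k [simp]: "?k \<in> Arr E" "Dom E ?k = ?X" "Cod E ?k = ?X'" by simp_all
  have c: "Fob (PrX ?X) (Fob (At (MTm H) \<Delta>) t) = Fob (At (MTp H) \<Delta>) (Fob (At (Pr D) \<Delta>) t)"
    "Fob (PrX ?X') (Fob (At (MTm H') \<Delta>) t) = Fob (At (MTp H') \<Delta>) (Fob (At (Pr D) \<Delta>) t)"
    using commutes_simps(1)[of H EM_nm \<Delta> ?X t] commutes_simps(1)[of H' EM_nm \<Delta> ?X' t] by simp_all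
  have n: "Fob (PrX ?X) (Fob (Far tm.emT ?k) (Fob (At (MTm H') \<Delta>) t)) = Fob (Far tp.emT ?k) (Fob (At (MTp H') \<Delta>) (Fob (At (Pr D) \<Delta>) t))"
    using PrX_natural(1)[OF k(1), of "Fob (At (MTm H') \<Delta>) t"] c(2) by (simp del: tm.emT_simps(4) tp.emT_simps(4))
  have U: "Far (At (Pr M) (Fob U ?X)) (At (M2Tm \<theta> \<Delta>) t) = At (M2Tp \<theta> \<Delta>) (Fob (At (Pr D) \<Delta>) t)"
    using m2compat_simp[of \<theta> M \<Delta> "Fob U ?X" t] by simp
  have "Far (PrX ?X) (At (tmm.lift2T \<Delta>) t) = At (tpm.lift2T \<Delta>) (Fob (At (Pr D) \<Delta>) t)"
    by (rule EM_arr_eqI[of _ "FTp ?X"]) (use c n U in \<open>simp_all del: tm.emT_simps(4) tp.emT_simps(4)\<close>)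
  then show "Far (At (Pr (MTgt (M2Src nm_lift2))) (Fob (MFun (M2Src nm_lift2)) \<Delta>)) (At (M2Tm nm_lift2 \<Delta>) t) = At (M2Tp nm_lift2 \<Delta>) (Fob (At (Pr (MSrc (M2Src nm_lift2))) \<Delta>) t)"
    by simp
qed (simp_all add: tpm.indexed_lift2T tmm.indexed_lift2T)

lemma ex1_lift2: "\<exists>!\<phi>. \<phi> \<in> hom (Two NM) H H' \<and> Idn (Two NM) forget \<star>\<^bsub>NM\<^esub> \<phi> = \<theta>"
proof (rule ex1I[of _ nm_lift2])
  have n: "M2Nt (nmor2_hcomp (nmor2_id forget) nm_lift2) = M2Nt \<theta>"
    by (rule ntr_eqI) simp_all
  have "nmor2_hcomp (nmor2_id forget) nm_lift2 = \<theta>"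
    by (rule nm_mor2_eqI) (use n in simp_all)
  then show "nm_lift2 \<in> hom (Two NM) H H' \<and> Idn (Two NM) forget \<star>\<^bsub>NM\<^esub> nm_lift2 = \<theta>" by (simp add: hom_def)
next
  fix \<psi> assume "\<psi> \<in> hom (Two NM) H H' \<and> Idn (Two NM) forget \<star>\<^bsub>NM\<^esub> \<psi> = \<theta>"
  then have p: "nm_mor2 \<psi>" "M2Src \<psi> = H" "M2Tgt \<psi> = H'" and e0: "Idn (Two NM) forget \<star>\<^bsub>NM\<^esub> \<psi> = \<theta>" by (auto simp: hom_def)
  then have e: "nmor2_hcomp (nmor2_id forget) \<psi> = \<theta>" by simp
  \<comment> \<open>As for 1-cells, the base transformation comes first, since the targets of the
    fibre components are substituted along it.\<close>
  have n: "M2Nt \<psi> = P0"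
  proof (rule EM_lift2_unique[OF W0 base_coalg_map])
    fix A assume A: "A \<in> Obj (Src (MFun H))"
    show "Far U (At (M2Nt \<psi>) A) = At (M2Nt \<theta>) A" using arg_cong[OF e, of "\<lambda>t. At (M2Nt t) A"] p A by simp
  qed (use p in simp_all)
  show "\<psi> = nm_lift2"
    by (rule nm_mor2_eqI) (use p n tpm.lift2T_unique[OF p n e] tmm.lift2T_unique[OF p n e] in simp_all)
qed

end

theorem (in nm_comonad) universal_EM_nm: "universal_coaction NM W EM_nm forget coact"
proof (intro universal_coaction.intro universal_coaction_axioms.intro)
  fix D G \<tau> assume c: "NM.coaction W D G \<tau>" "D \<in> Obj (One NM)"
  have "nm_coaction W D G \<tau>"
    by (intro nm_coaction.intro nm_coaction_axioms.intro nm_comonad_axioms c)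
  then show "\<exists>!H. H \<in> hom (One NM) D EM_nm \<and> forget \<cdot>\<^bsub>One NM\<^esub> H = G \<and> coact \<star>\<^bsub>NM\<^esub> Idn (Two NM) H = \<tau>"
    by (rule nm_coaction.ex1_lift)
next
  fix H D H' \<theta> assume h: "H \<in> hom (One NM) D EM_nm" "H' \<in> hom (One NM) D EM_nm"
    "\<theta> \<in> hom (Two NM) (forget \<cdot>\<^bsub>One NM\<^esub> H) (forget \<cdot>\<^bsub>One NM\<^esub> H')"
    "NM.coalg_map W (coact \<star>\<^bsub>NM\<^esub> Idn (Two NM) H) (coact \<star>\<^bsub>NM\<^esub> Idn (Two NM) H') \<theta>"
  then have a: "nm_mor H" "MSrc H = D" "MTgt H = EM_nm" "nm_mor H'" "MSrc H' = D" "MTgt H' = EM_nm" by (auto simp: hom_def)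
  then have b: "nm_mor2 \<theta>" "M2Src \<theta> = nmor_comp forget H" "M2Tgt \<theta> = nmor_comp forget H'" using h(3) by (auto simp: hom_def)
  have e: "nmor2_vcomp (nmor2_hcomp (nmor2_id B) \<theta>) (nmor2_hcomp coact (nmor2_id H)) = nmor2_vcomp (nmor2_hcomp coact (nmor2_id H')) \<theta>"
    using a b h(4) by (simp add: NM.coalg_map_def nmor_laws)
  have "nm_coalg_map W D H H' \<theta>"
    by (intro nm_coalg_map.intro nm_coalg_map_axioms.intro nm_comonad_axioms a b e)
  then show "\<exists>!\<phi>. \<phi> \<in> hom (Two NM) H H' \<and> Idn (Two NM) forget \<star>\<^bsub>NM\<^esub> \<phi> = \<theta>"
    by (rule nm_coalg_map.ex1_lift2)
qed (simp_all add: strict_2_category_NM W coaction_coact)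

theorem corollary4p4p1:
  shows "admits_coalgebras_over (NM :: ('a univ nm, 'a univ nmor, 'a univ nmor2) two_cat)
           CAT EM_choice NM_forget"
proof -
  define cK :: "('a univ nm, 'a univ nmor, 'a univ nmor2) coalg_choice"
    where "cK W = coalg_obj_of NM W (nm_comonad.EM_nm W) (nm_comonad.forget W) (nm_comonad.coact W)" for W
  have K: "universal_coaction NM W (nm_comonad.EM_nm W) (nm_comonad.forget W) (nm_comonad.coact W)"
    if "comonad NM W" for W :: "('a univ nm, 'a univ nmor, 'a univ nmor2) cmnd"
    using nm_comonad.universal_EM_nm nm_comonad.intro that by blast
  have NM: "chosen_coalgebras NM cK"
    using universal_coaction.object_of_coalgebras_coalg[OF K] by (simp add: chosen_coalgebras_def cK_def)
  have CAT: "chosen_coalgebras (CAT :: ('a univ scat, 'a univ sfct, 'a univ sntr) two_cat) EM_choice"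
    unfolding chosen_coalgebras_def EM_choice_eq
    by (intro allI impI universal_coaction.object_of_coalgebras_coalg universal_EM)
  have "preserves_coalgebras_on_the_nose NM cK CAT EM_choice NM_forget"
    unfolding preserves_coalgebras_on_the_nose_def
  proof (intro allI impI)
    fix W :: "('a univ nm, 'a univ nmor, 'a univ nmor2) cmnd" assume W: "comonad NM W"
    interpret nm_comonad W by (rule nm_comonad.intro[OF W])
    interpret L: universal_coaction CAT W0 E U co by (rule universal_EM) simp
    \<comment> \<open>Unfolding \<open>NM_forget\<close> turns \<open>EM_nm\<close>,
      \<open>forget\<close> and \<open>coact\<close> into \<open>E\<close>, \<open>U\<close> and
      \<open>co\<close>, so the assumption of \<open>preserves_coalgebras\<close> on the image is
      met by the universal coaction just interpreted.\<close>
    have "map_adj NM_forget (coalg_adj NM W (cK W)) = coalg_adj CAT W0 L.coalg"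
      using preserves_coalgebras[OF universal_EM_nm strict_2_functor_forget] L.universal_coaction_axioms
      by (simp add: cK_def NM_forget_def map_comonad_def)
    then show "adj_comonad CAT (map_adj NM_forget (coalg_adj NM W (cK W))) = W0 \<and>
        comonadic_on_the_nose CAT EM_choice (map_adj NM_forget (coalg_adj NM W (cK W)))"
      using L.adj_comonad_eq L.coalg_adjunction L.comparison_eq
      by (simp add: comonadic_on_the_nose_def EM_choice_eq L.coalg_simps(1)) (simp add: L.coalg_adj_eq)
  qed
  then show ?thesis
    unfolding admits_coalgebras_over_def admits_coalgebras_def
    using NM CAT strict_2_category_NM strict_2_category_CAT strict_2_functor_forget by (auto simp: chosen_coalgebras_def)
qed

end
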